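(* Let $n\ge 1$, $0<\beta<2$ and $1<p\le \frac{n(m-1)}{\beta}$, with $m\ge p$. Let $f:\mathbb{R}\to\mathbb{R}$ satisfy $f(0)=0$ and $$|f(u)-f(v)|\le C_0|u-v|\left(|u|^{m-1}e^{\lambda|u|^p}+|v|^{m-1}e^{\lambda|v|^p}\right)\quad\text{for all }u,v\in\mathbb{R},$$ for some constants $C_0>0$ and $\lambda>0$. Then there exists $\varepsilon>0$ such that for every $u_0\in\exp L^p(\mathbb{R}^n)$ with $\|u_0\|_{\exp L^p(\mathbb{R}^n)}\le\varepsilon$ there exists a global weak-mild solution $u\in L^\infty((0,\infty);\exp L^p(\mathbb{R}^n))$ to $$u_t+(-\Delta)^{\beta/2}u=f(u)\quad(t>0,\ x\in\mathbb{R}^n),\qquad u(0,x)=u_0(x),$$ satisfying $$\lim_{t\to0}\left\|u(t)-e^{-t(-\Delta)^{\beta/2}}u_0\right\|_{\exp L^p(\mathbb{R}^n)}=0.$$ Moreover, for $q$ as below there exists a constant $C>0$ such that $$\|u(t)\|_{L^q(\mathbb{R}^n)}\le C\,t^{-\sigma}\quad\text{for all }t>0,\qquad \sigma=\frac{1}{m-1}-\frac{n}{\beta q}>0,$$ where $q$ satisfies: - if $\beta=\frac{n(p-1)}{p}$: $\ \frac{n(m-1)}{\beta}<q<\frac{n(m-1)}{\beta}\frac{1}{(2-m)_+}$; - if $\beta<\frac{n(p-1)}{p}$: $\ \frac{n(m-1)}{\beta}<q<\frac{n(m-1)}{\beta}\frac{1}{(2-m)_+}$; - if $\beta>\frac{n(p-1)}{p}$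 and $(2-m)_+<\frac{n(p-1)}{p\beta}$: $\ \frac{(m-1)p}{p-1}<q<\frac{n(m-1)}{\beta}\frac{1}{(2-m)_+}$.
   Context: All functions are real-valued. $(\cdot)_+$ denotes the positive part, and $\frac{1}{(2-m)_+}$ is read as $+\infty$ when $m\ge 2$. The Orlicz space $\exp L^p(\mathbb{R}^n)$ is the set of $u\in L^1_{loc}(\mathbb{R}^n)$ such that $\int_{\mathbb{R}^n}\left(\exp\left(|u(x)|^p/\lambda^p\right)-1\right)dx<\infty$ for some $\lambda>0$; it is a Banach space with the Luxemburg norm $$\|u\|_{\exp L^p(\mathbb{R}^n)}=\inf\left\{\lambda>0:\ \int_{\mathbb{R}^n}\left(\exp\left(\frac{|u(x)|^p}{\lambda^p}\right)-1\right)dx\le 1\right\}.$$ The fractional heat semigroup is $e^{-t(-\Delta)^{\beta/2}}\varphi=S_\beta(t)*\varphi$ for $t>0$, where $S_\beta(x,t)=(2\pi)^{-n}\int_{\mathbb{R}^n}e^{ix\cdot\xi-t|\xi|^\beta}\,d\xi$, so that $S_\beta\ge0$ and $\int_{\mathbb{R}^n} S_\beta(x,t)\,dx=1$. Given $u_0\in\exp L^p(\mathbb{R}^n)$ and $T>0$, a weak-mild solution on $(0,T)$ is a function $u\in L^\infty((0,T);\exp L^p(\mathbb{R}^n))$ satisfying $$u(t)=e^{-t(-\Delta)^{\beta/2}}u_0+\int_0^te^{-(t-s)(-\Delta)^{\beta/2}}f(u(s))\,ds$$ in $\exp L^p(\mathbb{R}^n)$ for almost all $t\in(0,T)$, and such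 that $u(t)\to u_0$ in the weak$^*$ topology as $t\to0$, i.e. $\lim_{t\to0}\int_{\mathbb{R}^n}[u(t,x)\varphi(x)-u_0(x)\varphi(x)]\,dx=0$ for every $\varphi\in L^1(\ln L)^{1/p}(\mathbb{R}^n)$, where $$L^1(\ln L)^{1/p}(\mathbb{R}^n)=\left\{g\in L^1_{loc}(\mathbb{R}^n):\ \int_{\mathbb{R}^n}|g(x)|\ln^{1/p}(2+|g(x)|)\,dx<\infty\right\}$$ is a predual of $\exp L^p(\mathbb{R}^n)$. A global weak-mild solution is one with $(0,T)$ replaced by $(0,\infty)$. *)

theory Defs
  imports "HOL-Analysis.Analysis"
begin

text \<open>
  Elements of function spaces are represented by Lebesgue measurable functions
  on \<^typ>\<open>real ^ 'n\<close>; equality in such a space is equality almost everywhere.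
\<close>

definition L1_loc :: "(real ^ 'n \<Rightarrow> real) set" where
  "L1_loc = {u. \<forall>K. compact K \<longrightarrow> u absolutely_integrable_on K}"

definition Lq_space :: "real \<Rightarrow> (real ^ 'n \<Rightarrow> real) set" where
  "Lq_space q = {u \<in> borel_measurable lebesgue. integrable lebesgue (\<lambda>x. \<bar>u x\<bar> powr q)}"

definition Lq_norm :: "real \<Rightarrow> (real ^ 'n \<Rightarrow> real) \<Rightarrow> real" where
  "Lq_norm q u = (\<integral>x. \<bar>u x\<bar> powr q \<partial>lebesgue) powr (1 / q)"

definition exp_modular :: "real \<Rightarrow> real \<Rightarrow> (real ^ 'n \<Rightarrow> real) \<Rightarrow> ennreal" where
  "exp_modular p l u = (\<integral>\<^sup>+x. ennreal (exp (\<bar>u x\<bar> powr p / l powr p) - 1) \<partial>lebesgue)"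

definition expL :: "real \<Rightarrow> (real ^ 'n \<Rightarrow> real) set" where
  "expL p = {u \<in> L1_loc. \<exists>l>0. exp_modular p l u < \<infinity>}"

text \<open>Only meaningful on \<^term>\<open>expL p\<close>: elsewhere the infimum may be that of the empty set.\<close>

definition expL_norm :: "real \<Rightarrow> (real ^ 'n \<Rightarrow> real) \<Rightarrow> real" where
  "expL_norm p u = Inf {l. 0 < l \<and> exp_modular p l u \<le> 1}"

definition L1_lnL :: "real \<Rightarrow> (real ^ 'n \<Rightarrow> real) set" where
  "L1_lnL p = {g \<in> L1_loc.
     (\<integral>\<^sup>+x. ennreal (\<bar>g x\<bar> * ln (2 + \<bar>g x\<bar>) powr (1 / p)) \<partial>lebesgue) < \<infinity>}"

text \<open>
  The Fourier integral defining the kernel is real, the integrand being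
  conjugated by \<open>\<xi> \<mapsto> -\<xi>\<close>; the real part only changes the type.
\<close>

definition frac_heat_kernel :: "real \<Rightarrow> real \<Rightarrow> real ^ 'n \<Rightarrow> real" where
  "frac_heat_kernel \<beta> t x =
     Re (\<integral>\<xi>. exp (\<i> * complex_of_real (x \<bullet> \<xi>) - complex_of_real (t * norm \<xi> powr \<beta>)) \<partial>lebesgue)
       / (2 * pi) ^ CARD('n)"

text \<open>
  The Bochner integral is \<open>0\<close> for a non-integrable integrand, so
  the existence of the convolution is recorded separately.
\<close>

definition convolvable :: "(real ^ 'n \<Rightarrow> real) \<Rightarrow> (real ^ 'n \<Rightarrow> real) \<Rightarrow> bool" where
  "convolvable k g \<longleftrightarrow> (AE x in lebesgue. integrable lebesgue (\<lambda>y. k (x - y) * g y))"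

definition frac_heat :: "real \<Rightarrow> real \<Rightarrow> (real ^ 'n \<Rightarrow> real) \<Rightarrow> real ^ 'n \<Rightarrow> real" where
  "frac_heat \<beta> t g x = (\<integral>y. frac_heat_kernel \<beta> t (x - y) * g y \<partial>lebesgue)"

text \<open>
  Bochner measurability and the Bochner integral for functions of time with
  values in \<^term>\<open>expL p\<close>. As this space depends on the real parameter \<open>p\<close>, it is not a
  type of class \<^class>\<open>banach\<close>; the definitions follow \<^const>\<open>has_bochner_integral\<close>.
\<close>

definition expL_simple ::
  "real \<Rightarrow> real set \<Rightarrow> (real \<Rightarrow> real ^ 'n \<Rightarrow> real) \<Rightarrow> bool" where
  "expL_simple p I s \<longleftrightarrow>
     finite (s ` I) \<and> (\<forall>v. {t \<in> I. s t = v} \<in> sets lebesgue) \<and> (\<forall>t\<in>I. s t \<in> expL p)"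

definition expL_measurable ::
  "real \<Rightarrow> real set \<Rightarrow> (real \<Rightarrow> real ^ 'n \<Rightarrow> real) \<Rightarrow> bool" where
  "expL_measurable p I g \<longleftrightarrow>
     (\<exists>s. (\<forall>k. expL_simple p I (s k)) \<and>
          (AE t in lebesgue_on I. g t \<in> expL p \<and>
             (\<lambda>k. expL_norm p (\<lambda>x. g t x - s k t x)) \<longlonglongrightarrow> 0))"

definition expL_simple_integral ::
  "real set \<Rightarrow> (real \<Rightarrow> real ^ 'n \<Rightarrow> real) \<Rightarrow> real ^ 'n \<Rightarrow> real" where
  "expL_simple_integral I s x = (\<Sum>v\<in>s ` I. measure lebesgue {t \<in> I. s t = v} * v x)"

definition has_expL_integral ::
  "real \<Rightarrow> real \<Rightarrow> real \<Rightarrow> (real \<Rightarrow> real ^ 'n \<Rightarrow> real) \<Rightarrow> (real ^ 'n \<Rightarrow> real) \<Rightarrow> bool" where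
  "has_expL_integral p a b g w \<longleftrightarrow>
     expL_measurable p {a<..<b} g \<and> w \<in> expL p \<and>
     (\<exists>s. (\<forall>k. expL_simple p {a<..<b} (s k)) \<and>
          (\<lambda>k. \<integral>\<^sup>+t. ennreal (expL_norm p (\<lambda>x. g t x - s k t x)) \<partial>lebesgue_on {a<..<b})
             \<longlonglongrightarrow> 0 \<and>
          (\<lambda>k. expL_norm p (\<lambda>x. expL_simple_integral {a<..<b} (s k) x - w x)) \<longlonglongrightarrow> 0)"

definition Linf_expL ::
  "real \<Rightarrow> real set \<Rightarrow> (real \<Rightarrow> real ^ 'n \<Rightarrow> real) set" where
  "Linf_expL p I = {u. (\<forall>t\<in>I. u t \<in> expL p) \<and> expL_measurable p I u \<and>
     (\<exists>M. AE t in lebesgue_on I. expL_norm p (u t) \<le> M)}"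

text \<open>The final time \<open>T\<close> is extended real; \<open>T = \<infinity>\<close> gives global solutions.\<close>

definition weak_mild_solution ::
  "real \<Rightarrow> real \<Rightarrow> (real \<Rightarrow> real) \<Rightarrow> (real ^ 'n \<Rightarrow> real) \<Rightarrow> ereal \<Rightarrow>
   (real \<Rightarrow> real ^ 'n \<Rightarrow> real) \<Rightarrow> bool" where
  "weak_mild_solution \<beta> p f u0 T u \<longleftrightarrow>
     u \<in> Linf_expL p {t. 0 < t \<and> ereal t < T} \<and>
     (AE t in lebesgue_on {t. 0 < t \<and> ereal t < T}.
        (AE s in lebesgue_on {0<..<t}.
           convolvable (frac_heat_kernel \<beta> (t - s)) (\<lambda>x. f (u s x))) \<and>
        (\<exists>w. has_expL_integral p 0 t (\<lambda>s. frac_heat \<beta> (t - s) (\<lambda>x. f (u s x))) w \<and>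
             (AE x in lebesgue. u t x = frac_heat \<beta> t u0 x + w x))) \<and>
     (\<forall>\<phi>\<in>L1_lnL p.
        ((\<lambda>t. \<integral>x. (u t x * \<phi> x - u0 x * \<phi> x) \<partial>lebesgue) \<longlongrightarrow> 0) (at_right 0))"

abbreviation pos_part :: "real \<Rightarrow> real" where
  "pos_part x \<equiv> max x 0"

text \<open>
  In \<^typ>\<open>ereal\<close> one has \<open>1 / 0 = \<infinity>\<close>, so the upper bound is infinite for \<open>m \<ge> 2\<close>.
\<close>

definition decay_exponent :: "real \<Rightarrow> real \<Rightarrow> real \<Rightarrow> real \<Rightarrow> real \<Rightarrow> bool" where
  "decay_exponent n \<beta> p m q \<longleftrightarrow>
     (\<beta> = n * (p - 1) / p \<and>
        n * (m - 1) / \<beta> < q \<and> ereal q < ereal (n * (m - 1) / \<beta>) * (1 / ereal (pos_part (2 - m)))) \<or>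
     (\<beta> < n * (p - 1) / p \<and>
        n * (m - 1) / \<beta> < q \<and> ereal q < ereal (n * (m - 1) / \<beta>) * (1 / ereal (pos_part (2 - m)))) \<or>
     (\<beta> > n * (p - 1) / p \<and> pos_part (2 - m) < n * (p - 1) / (p * \<beta>) \<and>
        (m - 1) * p / (p - 1) < q \<and>
        ereal q < ereal (n * (m - 1) / \<beta>) * (1 / ereal (pos_part (2 - m))))"

end

theory Submission
  imports Defs "HOL-Probability.Probability" "HOL-Real_Asymp.Real_Asymp"
begin

text \<open>
  Write \<open>u = L + w\<close> with \<open>L(t) = S(t) * u0\<close>, and put \<open>\<nu> = n/\<beta>\<close>, \<open>\<alpha> = 1/(m-1)\<close>. The correction \<open>w\<close> is found by
  Picard iteration, pointwise everywhere, in the functions that satisfy \<open>\<bar>w(t,x)\<bar> \<le> W (1+t)\<^sup>-\<^sup>\<alpha>\<close> and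
  \<open>\<parallel>w(t)\<parallel>\<^sub>p \<le> W\<close>. A source term is handled through a factorisation \<open>\<bar>g\<bar> \<le> \<omega> H\<close>, where \<open>\<omega>\<close> obeys the same
  bounds as \<open>w\<close> and \<open>\<parallel>H(s)\<parallel>\<^sub>R \<le> \<eta> (1+s)\<^sup>\<delta>\<^sup>-\<^sup>1\<close> with \<open>\<delta> = \<nu>/R < 1\<close>: Hoelder's inequality against the
  probability density \<open>S(t-s) \<le> c (t-s)\<^sup>-\<^sup>\<nu>\<close> reduces the Duhamel term to the integral of
  \<open>(t-s)\<^sup>-\<^sup>\<delta> (1+s)\<^sup>\<delta>\<^sup>-\<^sup>1\<close>, which is at most \<open>B(\<delta>, 1-\<delta>)\<close> for every \<open>t\<close>. For the weight
  \<open>\<bar>u\<bar>\<^sup>m\<^sup>-\<^sup>1 exp(\<lambda>\<bar>u\<bar>\<^sup>p)\<close> the constant \<open>\<eta>\<close> is small with the data, so that the iteration contracts. The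
  \<open>L\<^sup>q\<close> decay interpolates between the \<open>L\<^sup>p\<close> bound and the pointwise decay of \<open>u\<close>.

  The kernel is nonnegative because \<open>exp(-\<bar>\<xi>\<bar>\<^sup>\<beta>)\<close> is a limit of polynomials with nonnegative coefficients in
  Gaussians, \<open>\<beta>/2\<close> being less than \<open>1\<close>.
\<close>

section \<open>The fractional heat kernel\<close>

text \<open>The obstacle is the time t = 0. Data in exp L^p may be unbounded and their heat flow
  need not be norm continuous there, so the solution itself does not fit a uniformly bounded class;
  the correction \<open>w\<close>, which starts from zero, does. The hypothesis p <= n(m-1)/\<beta>
  reads \<alpha> <= \<nu>/p: smoothing from L^p to L^infinity is at least as fast as the decay to be
  propagated, and after p powers of |u| are spent on the modular, the remaining ones still decay
  fast enough for the weight. The two time exponents then add up to -1, so the Duhamel bound is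
  scale invariant, and smallness of the data replaces smallness of time. Working with Borel
  functions and bounds at every point keeps null sets out of the iteration; Lebesgue measurable data
  enter only at the end. The Luxemburg norm is reached through two facts: the heat flow preserves a
  modular bound, and small supremum and L^p bounds together force a small norm.\<close>

lemma nn_integral_lborel_affine:
  fixes t :: "'a::euclidean_space"
  assumes [measurable]: "f \<in> borel_measurable borel" and c: "c \<noteq> 0"
  shows "(\<integral>\<^sup>+x. f x \<partial>lborel) = ennreal (\<bar>c\<bar> ^ DIM('a)) * (\<integral>\<^sup>+x. f (t + c *\<^sub>R x) \<partial>lborel)"
  by (subst lborel_affine[OF c, of t])
     (simp add: nn_integral_density nn_integral_distr nn_integral_cmult ennreal_power)

lemma integral_lborel_affine:
  fixes f :: "'a::euclidean_space \<Rightarrow> real"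
  assumes [measurable]: "f \<in> borel_measurable borel" and c: "c \<noteq> 0"
  shows "(\<integral>x. f x \<partial>lborel) = \<bar>c\<bar> ^ DIM('a) * (\<integral>x. f (t + c *\<^sub>R x) \<partial>lborel)"
  by (subst lborel_affine[OF c, of t])
     (simp add: integral_density integral_distr)

lemma nn_integral_lborel_reflect:
  fixes x :: "'a::euclidean_space"
  assumes [measurable]: "f \<in> borel_measurable borel"
  shows "(\<integral>\<^sup>+y. f (x - y) \<partial>lborel) = (\<integral>\<^sup>+y. f y \<partial>lborel)"
  using nn_integral_lborel_affine[of f "-1" x] by simp

lemma nn_integral_lborel_shift:
  fixes x :: "'a::euclidean_space"
  assumes [measurable]: "f \<in> borel_measurable borel"
  shows "(\<integral>\<^sup>+y. f (y + x) \<partial>lborel) = (\<integral>\<^sup>+y. f y \<partial>lborel)"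
  using nn_integral_lborel_affine[of f "1" x] by (simp add: add.commute)

lemma nn_integral_lborel_shift':
  fixes x :: "'a::euclidean_space"
  assumes [measurable]: "f \<in> borel_measurable borel"
  shows "(\<integral>\<^sup>+y. f (y - x) \<partial>lborel) = (\<integral>\<^sup>+y. f y \<partial>lborel)"
  using nn_integral_lborel_affine[of f "1" "-x"] by simp

text \<open>Cut space into the shells k <= |\<xi>| < k + 1. On each the integrand is at most its
  value at radius k, the volume is at most of order (k + 1)^n, and the resulting series converges
  for every \<beta> > 0.\<close>

lemma integrable_exp_norm_powr:
  fixes t \<beta> :: real
  assumes t: "0 < t" and \<beta>: "0 < \<beta>"
  shows "integrable lborel (\<lambda>\<xi>::'a::euclidean_space. exp (- (t * norm \<xi> powr \<beta>)))"
proof -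
  let ?n = "DIM('a)"
  define a where "a k = exp (- (t * real k powr \<beta>)) * (unit_ball_vol ?n * (real k + 1) ^ ?n)" for k :: nat
  have a0: "a k \<ge> 0" for k unfolding a_def by simp
  have "(\<lambda>k. exp (- (t * real k powr \<beta>)) * (real k + 1) powr real ?n) \<in> O(\<lambda>k. 1 / real k ^ 2)"
    using t \<beta> by real_asymp
  then have "summable (\<lambda>k. exp (- (t * real k powr \<beta>)) * (real k + 1) powr real ?n)"
    by (rule summable_comparison_test_bigo[rotated]) (use inverse_power_summable[of 2] in \<open>simp add: field_simps\<close>)
  from summable_mult[OF this, of "unit_ball_vol ?n"] have sa: "summable a"
    unfolding a_def by (simp add: powr_realpow add_pos_nonneg mult_ac)
  have "(\<integral>\<^sup>+\<xi>. ennreal (exp (- (t * norm \<xi> powr \<beta>))) \<partial>(lborel :: 'a measure))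
      \<le> (\<integral>\<^sup>+\<xi>. (\<Sum>k. ennreal (exp (- (t * real k powr \<beta>))) * indicator (ball 0 (real k + 1)) \<xi>) \<partial>(lborel :: 'a measure))"
  proof (rule nn_integral_mono)
    fix \<xi> :: 'a
    define k where "k = nat \<lfloor>norm \<xi>\<rfloor>"
    have k: "real k \<le> norm \<xi>" "norm \<xi> < real k + 1"
    proof -
      have "real k = of_int \<lfloor>norm \<xi>\<rfloor>" unfolding k_def by (simp add: of_nat_nat)
      then show "real k \<le> norm \<xi>" "norm \<xi> < real k + 1" by linarith+
    qed
    have "ennreal (exp (- (t * norm \<xi> powr \<beta>)))
        \<le> ennreal (exp (- (t * real k powr \<beta>))) * indicator (ball 0 (real k + 1)) \<xi>"
      using k t \<beta> by (auto intro!: ennreal_leI mult_left_mono powr_mono2)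
    also have "\<dots> \<le> (\<Sum>k. ennreal (exp (- (t * real k powr \<beta>))) * indicator (ball 0 (real k + 1)) \<xi>)"
    proof -
      have "F k \<le> (\<Sum>k. F k)" for F :: "nat \<Rightarrow> ennreal"
        using sum_le_suminf[of F "{k}"] by simp
      from this[of "\<lambda>k. ennreal (exp (- (t * real k powr \<beta>))) * indicator (ball 0 (real k + 1)) \<xi>"]
      show ?thesis .
    qed
    finally show "ennreal (exp (- (t * norm \<xi> powr \<beta>))) \<le> \<dots>" .
  qed
  also have "\<dots> = (\<Sum>k. \<integral>\<^sup>+\<xi>. ennreal (exp (- (t * real k powr \<beta>))) * indicator (ball 0 (real k + 1)) \<xi> \<partial>(lborel :: 'a measure))"
    by (rule nn_integral_suminf, intro borel_measurable_times_ennreal borel_measurable_const borel_measurable_indicator) simp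
  also have "\<dots> = (\<Sum>k. ennreal (a k))"
  proof (intro arg_cong[where f=suminf] ext)
    fix k
    have "emeasure lborel (ball 0 (real k + 1) :: 'a set) = ennreal (unit_ball_vol (real ?n) * (real k + 1) ^ ?n)"
      by (rule emeasure_ball) simp
    then show "(\<integral>\<^sup>+\<xi>. ennreal (exp (- (t * real k powr \<beta>))) * indicator (ball 0 (real k + 1)) \<xi> \<partial>(lborel :: 'a measure)) = ennreal (a k)"
      by (subst nn_integral_cmult_indicator) (simp_all only: a_def ennreal_mult'[OF exp_ge_zero] sets_lborel borel_open open_ball)
  qed
  also have "\<dots> < \<infinity>"
    unfolding infinity_ennreal_def by (subst suminf_ennreal2[OF a0 sa]) (rule ennreal_less_top)
  finally show ?thesis by (simp add: integrable_iff_bounded)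
qed

section \<open>Fourier transforms of Gaussians and functions of positive type\<close>

text \<open>Rescaling by sqrt(2 s) turns the integrand into a character times the standard normal
  density, so the value is read off from the characteristic function of the normal
  distribution.\<close>

lemma real_gauss_ft:
  fixes s x :: real assumes s: "0 < s"
  shows "(\<integral>r. cis (x * r) * of_real (exp (- (s * r\<^sup>2))) \<partial>lborel) = of_real (sqrt (pi / s) * exp (- (x\<^sup>2 / (4 * s))))"
    and "integrable lborel (\<lambda>r. cis (x * r) * of_real (exp (- (s * r\<^sup>2))))"
proof -
  let ?c = "sqrt (2 * s)"
  have c: "?c \<noteq> 0" "?c > 0" using s by auto
  have [measurable]: "cis \<in> borel_measurable borel"
    by (intro borel_measurable_continuous_onI continuous_intros)
  define h where "h r = cis ((x / ?c) * r) * complex_of_real (sqrt (2 * pi) * std_normal_density r)" for r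
  have hm: "h (0 + ?c * r) = cis (x * r) * of_real (exp (- (s * r\<^sup>2)))" for r
    using s c by (simp add: h_def std_normal_density_def power_mult_distrib)
  have int: "integrable lborel h"
    unfolding h_def
    by (rule Bochner_Integration.integrable_bound[where f="\<lambda>r. sqrt (2 * pi) * std_normal_density r"],
        use s in \<open>auto simp: norm_mult intro!: integrable_std_normal_moment[of 0, simplified]\<close>)
  show "integrable lborel (\<lambda>r. cis (x * r) * of_real (exp (- (s * r\<^sup>2))))"
    using lborel_integrable_real_affine[OF int c(1), of 0] unfolding hm by simp
  have "(\<integral>r. h r \<partial>lborel) = ?c *\<^sub>R (\<integral>r. cis (x * r) * of_real (exp (- (s * r\<^sup>2))) \<partial>lborel)"
    using lborel_integral_real_affine[OF c(1), of h 0] c unfolding hm by simp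
  moreover have "(\<integral>r. h r \<partial>lborel) = sqrt (2 * pi) * char std_normal_distribution (x / ?c)"
  proof -
    have "(\<integral>r. h r \<partial>lborel) = (\<integral>r. complex_of_real (sqrt (2 * pi)) * (std_normal_density r *\<^sub>R iexp (x / ?c * r)) \<partial>lborel)"
      by (intro Bochner_Integration.integral_cong refl)
         (simp add: h_def scaleR_conv_of_real cis_conv_exp mult_ac)
    also have "\<dots> = of_real (sqrt (2 * pi)) * (\<integral>r. std_normal_density r *\<^sub>R iexp (x / ?c * r) \<partial>lborel)"
      by (rule integral_mult_right_zero)
    also have "(\<integral>r. std_normal_density r *\<^sub>R iexp (x / ?c * r) \<partial>lborel) = char std_normal_distribution (x / ?c)"
      unfolding char_def by (rule integral_density[symmetric]) (auto simp: normal_density_nonneg)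
    finally show ?thesis .
  qed
  ultimately have "of_real ?c * (\<integral>r. cis (x * r) * of_real (exp (- (s * r\<^sup>2))) \<partial>lborel)
      = complex_of_real (sqrt (2 * pi) * exp (- (x\<^sup>2 / (4 * s))))"
    using s by (simp add: char_std_normal_distribution power_divide scaleR_conv_of_real)
  then have "(\<integral>r. cis (x * r) * of_real (exp (- (s * r\<^sup>2))) \<partial>lborel)
      = complex_of_real (sqrt (2 * pi) * exp (- (x\<^sup>2 / (4 * s)))) / of_real ?c"
    using c(1) by (subst nonzero_eq_divide_eq) (simp_all only: mult.commute of_real_eq_0_iff not_False_eq_True)
  also have "\<dots> = of_real (sqrt (2 * pi) / ?c * exp (- (x\<^sup>2 / (4 * s))))" by simp
  also have "sqrt (2 * pi) / ?c = sqrt (pi / s)"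
    using s by (simp add: real_sqrt_divide [symmetric])
  finally show "(\<integral>r. cis (x * r) * of_real (exp (- (s * r\<^sup>2))) \<partial>lborel) = of_real (sqrt (pi / s) * exp (- (x\<^sup>2 / (4 * s))))" .
qed

text \<open>Gaussian and character both factor over the coordinates, so the integral over the
  product measure behind \<open>lborel\<close> is a product of one-dimensional transforms. The
  cosine is the real part.\<close>

lemma gauss_ft:
  fixes s :: real and x :: "'a::euclidean_space" assumes s: "0 < s"
  shows "(\<integral>\<xi>. cos (x \<bullet> \<xi>) * exp (- (s * (norm \<xi>)\<^sup>2)) \<partial>lborel)
    = sqrt (pi / s) ^ DIM('a) * exp (- ((norm x)\<^sup>2 / (4 * s)))"
proof -
  let ?G = "\<lambda>b r. cis ((x \<bullet> b) * r) * complex_of_real (exp (- (s * r\<^sup>2)))"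
  interpret product_sigma_finite "\<lambda>b::'a. lborel :: real measure" ..
  have prod: "(\<Prod>b\<in>Basis. ?G b (\<xi> \<bullet> b)) = cis (x \<bullet> \<xi>) * of_real (exp (- (s * (norm \<xi>)\<^sup>2)))" for \<xi> :: 'a
  proof -
    have "(\<Prod>b\<in>Basis. ?G b (\<xi> \<bullet> b)) = exp (\<Sum>b\<in>Basis. \<i> * of_real ((x \<bullet> b) * (\<xi> \<bullet> b)) + of_real (- (s * (\<xi> \<bullet> b)\<^sup>2)))"
      by (simp add: exp_sum cis_conv_exp exp_of_real exp_add flip: of_real_minus of_real_mult of_real_power)
    also have "(\<Sum>b\<in>Basis. \<i> * of_real ((x \<bullet> b) * (\<xi> \<bullet> b)) + of_real (- (s * (\<xi> \<bullet> b)\<^sup>2)))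
       = \<i> * of_real (x \<bullet> \<xi>) + of_real (- (s * (norm \<xi>)\<^sup>2))"
      unfolding power2_norm_eq_inner euclidean_inner[of x \<xi>] euclidean_inner[of \<xi> \<xi>]
      by (simp add: sum.distrib sum_distrib_left sum_negf sum_subtractf power2_eq_square)
    finally show ?thesis by (simp add: cis_conv_exp exp_of_real exp_add flip: of_real_minus)
  qed
  have gm: "(\<lambda>\<xi>::'a. cis (x \<bullet> \<xi>) * complex_of_real (exp (- (s * (norm \<xi>)\<^sup>2)))) \<in> borel_measurable borel"
    by (intro borel_measurable_continuous_onI continuous_intros)
  have T: "(\<lambda>f. \<Sum>b\<in>Basis. f b *\<^sub>R (b :: 'a)) \<in> (\<Pi>\<^sub>M b\<in>(Basis :: 'a set). (lborel :: real measure)) \<rightarrow>\<^sub>M borel"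
    by (intro borel_measurable_sum borel_measurable_scaleR borel_measurable_const) simp
  have sum_eq: "(\<Sum>b\<in>Basis. f b *\<^sub>R b) \<bullet> c = f c" if "c \<in> Basis" for f and c :: 'a
    using that by (rule inner_sum_left_Basis)
  have "(\<integral>\<xi>. cis (x \<bullet> \<xi>) * of_real (exp (- (s * (norm \<xi>)\<^sup>2))) \<partial>lborel)
      = (\<integral>f. cis (x \<bullet> (\<Sum>b\<in>Basis. f b *\<^sub>R b)) * of_real (exp (- (s * (norm (\<Sum>b\<in>Basis. f b *\<^sub>R b :: 'a))\<^sup>2))) \<partial>Pi\<^sub>M Basis (\<lambda>b. lborel))"
    by (subst lborel_eq) (rule integral_distr[OF T gm])
  also have "\<dots> = (\<integral>f. (\<Prod>b\<in>Basis. ?G b (f b)) \<partial>Pi\<^sub>M Basis (\<lambda>b. lborel))"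
    by (intro Bochner_Integration.integral_cong refl, subst prod[symmetric]) (simp add: sum_eq)
  also have "\<dots> = (\<Prod>b\<in>Basis. \<integral>r. ?G b r \<partial>lborel)"
    by (rule product_integral_prod) (auto intro: real_gauss_ft(2)[OF s])
  also have "\<dots> = (\<Prod>b\<in>Basis. of_real (sqrt (pi / s) * exp (- ((x \<bullet> b)\<^sup>2 / (4 * s)))))"
    by (intro prod.cong refl real_gauss_ft(1)[OF s])
  also have "\<dots> = of_real (\<Prod>b\<in>Basis. sqrt (pi / s) * exp (- ((x \<bullet> b)\<^sup>2 / (4 * s))))"
    by (rule of_real_prod[symmetric])
  also have "(\<Prod>b\<in>Basis. sqrt (pi / s) * exp (- ((x \<bullet> b)\<^sup>2 / (4 * s))))
      = sqrt (pi / s) ^ DIM('a) * exp (\<Sum>b\<in>Basis. - ((x \<bullet> b)\<^sup>2 / (4 * s)))"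
    by (simp only: prod.distrib exp_sum[OF finite_Basis] prod_constant)
  also have "(\<Sum>b\<in>Basis. - ((x \<bullet> b)\<^sup>2 / (4 * s))) = - ((norm x)\<^sup>2 / (4 * s))"
    unfolding power2_norm_eq_inner euclidean_inner[of x x] by (simp only: sum_negf sum_divide_distrib power2_eq_square)
  finally have *: "(\<integral>\<xi>. cis (x \<bullet> \<xi>) * of_real (exp (- (s * (norm \<xi>)\<^sup>2))) \<partial>lborel)
      = complex_of_real (sqrt (pi / s) ^ DIM('a) * exp (- ((norm x)\<^sup>2 / (4 * s))))" .
  have int: "integrable lborel (\<lambda>\<xi>. cis (x \<bullet> \<xi>) * complex_of_real (exp (- (s * (norm \<xi>)\<^sup>2))))"
    by (rule Bochner_Integration.integrable_bound[OF integrable_exp_norm_powr[OF s, of 2]])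
       (auto simp: norm_mult powr_numeral gm)
  have "(\<integral>\<xi>. cos (x \<bullet> \<xi>) * exp (- (s * (norm \<xi>)\<^sup>2)) \<partial>lborel)
     = (\<integral>\<xi>. Re (cis (x \<bullet> \<xi>) * of_real (exp (- (s * (norm \<xi>)\<^sup>2)))) \<partial>lborel)"
    by (simp del: of_real_exp)
  also have "\<dots> = Re (\<integral>\<xi>. cis (x \<bullet> \<xi>) * of_real (exp (- (s * (norm \<xi>)\<^sup>2))) \<partial>lborel)"
    by (rule integral_Re[OF int])
  finally show ?thesis unfolding * Re_complex_of_real .
qed

text \<open>
  A function with nonnegative Fourier transform; the Gaussian factor makes the condition meaningful for
  bounded functions that are not integrable, such as constants.
\<close>

definition pos_type :: "('a::euclidean_space \<Rightarrow> real) \<Rightarrow> bool" where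
  "pos_type \<phi> \<longleftrightarrow> \<phi> \<in> borel_measurable borel \<and> (\<exists>B. \<forall>\<xi>. \<bar>\<phi> \<xi>\<bar> \<le> B) \<and>
     (\<forall>\<eta>>0. \<forall>x. 0 \<le> (\<integral>\<xi>. cos (x \<bullet> \<xi>) * exp (- (\<eta> * (norm \<xi>)\<^sup>2)) * \<phi> \<xi> \<partial>lborel))"

lemma integrable_exp_norm_sq: "0 < s \<Longrightarrow> integrable lborel (\<lambda>\<xi>::'a::euclidean_space. exp (- (s * (norm \<xi>)\<^sup>2)))"
  using integrable_exp_norm_powr[of s 2, where 'a='a] by (simp add: powr_numeral)

lemma borel_measurable_cos_inner [measurable]:
  "(\<lambda>\<xi>::'a::euclidean_space. cos (x \<bullet> \<xi>)) \<in> borel_measurable borel"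
  "(\<lambda>\<xi>::'a::euclidean_space. exp (- (s * (norm \<xi>)\<^sup>2))) \<in> borel_measurable borel"
  by (intro borel_measurable_continuous_onI continuous_intros)+

lemma integrable_gauss_mult:
  fixes \<phi> :: "'a::euclidean_space \<Rightarrow> real"
  assumes [measurable]: "\<phi> \<in> borel_measurable borel" and B: "\<And>\<xi>. \<bar>\<phi> \<xi>\<bar> \<le> B" and s: "0 < s"
  shows "integrable lborel (\<lambda>\<xi>. cos (x \<bullet> \<xi>) * exp (- (s * (norm \<xi>)\<^sup>2)) * \<phi> \<xi>)"
proof (rule Bochner_Integration.integrable_bound[where f="\<lambda>\<xi>. B * exp (- (s * (norm \<xi>)\<^sup>2))"])
  show "integrable lborel (\<lambda>\<xi>::'a. B * exp (- (s * (norm \<xi>)\<^sup>2)))"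
    by (intro integrable_mult_right integrable_exp_norm_sq s)
  show "AE \<xi> in lborel. norm (cos (x \<bullet> \<xi>) * exp (- (s * (norm \<xi>)\<^sup>2)) * \<phi> \<xi>) \<le> norm (B * exp (- (s * (norm \<xi>)\<^sup>2)))"
  proof (rule AE_I2)
    fix \<xi> :: 'a
    have "\<bar>cos (x \<bullet> \<xi>)\<bar> * exp (- (s * (norm \<xi>)\<^sup>2)) * \<bar>\<phi> \<xi>\<bar> \<le> 1 * exp (- (s * (norm \<xi>)\<^sup>2)) * \<bar>B\<bar>"
      using B[of \<xi>] by (intro mult_mono) auto
    then show "norm (cos (x \<bullet> \<xi>) * exp (- (s * (norm \<xi>)\<^sup>2)) * \<phi> \<xi>) \<le> norm (B * exp (- (s * (norm \<xi>)\<^sup>2)))"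
      by (simp add: abs_mult mult.commute)
  qed
qed simp

lemma pos_type_one: "pos_type (\<lambda>_::'a::euclidean_space. 1)"
  unfolding pos_type_def by (auto simp: gauss_ft intro!: exI[of _ 1])

text \<open>The new Gaussian is absorbed into the test Gaussian, whose parameter ranges over all
  positive numbers.\<close>

lemma pos_type_gauss:
  assumes "pos_type \<phi>" "0 \<le> s"
  shows "pos_type (\<lambda>\<xi>. exp (- (s * (norm \<xi>)\<^sup>2)) * \<phi> \<xi>)"
proof -
  obtain B where B: "\<And>\<xi>. \<bar>\<phi> \<xi>\<bar> \<le> B" and [measurable]: "\<phi> \<in> borel_measurable borel"
    using assms(1) unfolding pos_type_def by auto
  have "\<bar>exp (- (s * (norm \<xi>)\<^sup>2)) * \<phi> \<xi>\<bar> \<le> B" for \<xi>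
  proof -
    have "\<bar>exp (- (s * (norm \<xi>)\<^sup>2))\<bar> * \<bar>\<phi> \<xi>\<bar> \<le> 1 * B"
      using assms(2) B[of \<xi>] by (intro mult_mono) auto
    then show ?thesis by (simp add: abs_mult)
  qed
  moreover have "0 \<le> (\<integral>\<xi>. cos (x \<bullet> \<xi>) * exp (- (\<eta> * (norm \<xi>)\<^sup>2)) * (exp (- (s * (norm \<xi>)\<^sup>2)) * \<phi> \<xi>) \<partial>lborel)"
    if "0 < \<eta>" for \<eta> x
  proof -
    have eq: "cos (x \<bullet> \<xi>) * exp (- (\<eta> * (norm \<xi>)\<^sup>2)) * (exp (- (s * (norm \<xi>)\<^sup>2)) * \<phi> \<xi>)
       = cos (x \<bullet> \<xi>) * exp (- ((\<eta> + s) * (norm \<xi>)\<^sup>2)) * \<phi> \<xi>" for \<xi>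
      by (simp add: distrib_right exp_add[symmetric] mult_exp_exp algebra_simps)
    have "0 < \<eta> + s" using that assms(2) by simp
    then show ?thesis
      unfolding eq using assms(1) unfolding pos_type_def by blast
  qed
  ultimately show ?thesis unfolding pos_type_def by auto
qed

lemma pos_type_add:
  assumes "pos_type \<phi>" "pos_type \<psi>"
  shows "pos_type (\<lambda>\<xi>. \<phi> \<xi> + \<psi> \<xi>)"
proof -
  obtain B C where B: "\<And>\<xi>. \<bar>\<phi> \<xi>\<bar> \<le> B" and [measurable]: "\<phi> \<in> borel_measurable borel"
    and C: "\<And>\<xi>. \<bar>\<psi> \<xi>\<bar> \<le> C" and [measurable]: "\<psi> \<in> borel_measurable borel"
    using assms unfolding pos_type_def by auto
  have "\<bar>\<phi> \<xi> + \<psi> \<xi>\<bar> \<le> B + C" for \<xi>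
    using B[of \<xi>] C[of \<xi>] by linarith
  moreover have "0 \<le> (\<integral>\<xi>. cos (x \<bullet> \<xi>) * exp (- (\<eta> * (norm \<xi>)\<^sup>2)) * (\<phi> \<xi> + \<psi> \<xi>) \<partial>lborel)"
    if e: "0 < \<eta>" for \<eta> x
  proof -
    have "0 \<le> (\<integral>\<xi>. cos (x \<bullet> \<xi>) * exp (- (\<eta> * (norm \<xi>)\<^sup>2)) * \<phi> \<xi> \<partial>lborel)"
      "0 \<le> (\<integral>\<xi>. cos (x \<bullet> \<xi>) * exp (- (\<eta> * (norm \<xi>)\<^sup>2)) * \<psi> \<xi> \<partial>lborel)"
      using assms e unfolding pos_type_def by blast+
    then show ?thesis
      by (simp add: distrib_left Bochner_Integration.integral_add integrable_gauss_mult[OF _ B e] integrable_gauss_mult[OF _ C e])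
  qed
  ultimately show ?thesis unfolding pos_type_def by auto
qed

lemma pos_type_cmult:
  assumes "pos_type \<phi>" "0 \<le> c"
  shows "pos_type (\<lambda>\<xi>. c * \<phi> \<xi>)"
proof -
  obtain B where B: "\<And>\<xi>. \<bar>\<phi> \<xi>\<bar> \<le> B" and [measurable]: "\<phi> \<in> borel_measurable borel"
    using assms(1) unfolding pos_type_def by auto
  have "\<bar>c * \<phi> \<xi>\<bar> \<le> c * B" for \<xi>
    using B[of \<xi>] assms(2) by (simp add: abs_mult mult_left_mono)
  moreover have "0 \<le> (\<integral>\<xi>. cos (x \<bullet> \<xi>) * exp (- (\<eta> * (norm \<xi>)\<^sup>2)) * (c * \<phi> \<xi>) \<partial>lborel)"
    if e: "0 < \<eta>" for \<eta> x
  proof -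
    have eq: "cos (x \<bullet> \<xi>) * exp (- (\<eta> * (norm \<xi>)\<^sup>2)) * (c * \<phi> \<xi>)
       = c * (cos (x \<bullet> \<xi>) * exp (- (\<eta> * (norm \<xi>)\<^sup>2)) * \<phi> \<xi>)" for \<xi> by simp
    have "0 \<le> (\<integral>\<xi>. cos (x \<bullet> \<xi>) * exp (- (\<eta> * (norm \<xi>)\<^sup>2)) * \<phi> \<xi> \<partial>lborel)"
      using assms e unfolding pos_type_def by blast
    then show ?thesis unfolding eq using assms(2) by (simp only: integral_mult_right_zero mult_nonneg_nonneg)
  qed
  ultimately show ?thesis unfolding pos_type_def by auto
qed

lemma pos_type_sum:
  assumes "finite I" "\<And>i. i \<in> I \<Longrightarrow> pos_type (\<phi> i)"
  shows "pos_type (\<lambda>\<xi>. \<Sum>i\<in>I. \<phi> i \<xi>)"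
  using assms
proof (induction I rule: finite_induct)
  case empty
  show ?case using pos_type_cmult[OF pos_type_one, of 0] by simp
next
  case (insert i I)
  then show ?case using pos_type_add[of "\<phi> i" "\<lambda>\<xi>. \<Sum>i\<in>I. \<phi> i \<xi>"] by simp
qed

text \<open>The test Gaussian supplies the dominating function. The origin is exempted because the
  binomial series below is summed only at arguments less than 1, which excludes \<xi> = 0.\<close>

lemma pos_type_limit:
  fixes \<phi> :: "'a::euclidean_space \<Rightarrow> real"
  assumes "\<And>k. pos_type (\<phi>' k)" and [measurable]: "\<phi> \<in> borel_measurable borel"
    and B: "\<And>\<xi>. \<bar>\<phi> \<xi>\<bar> \<le> B" "\<And>k \<xi>. \<xi> \<noteq> 0 \<Longrightarrow> \<bar>\<phi>' k \<xi>\<bar> \<le> B"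
    and lim: "\<And>\<xi>. \<xi> \<noteq> 0 \<Longrightarrow> (\<lambda>k. \<phi>' k \<xi>) \<longlonglongrightarrow> \<phi> \<xi>"
  shows "pos_type \<phi>"
proof -
  have [measurable]: "\<phi>' k \<in> borel_measurable borel" for k
    using assms(1) unfolding pos_type_def by auto
  have "0 \<le> (\<integral>\<xi>. cos (x \<bullet> \<xi>) * exp (- (\<eta> * (norm \<xi>)\<^sup>2)) * \<phi> \<xi> \<partial>lborel)" if e: "0 < \<eta>" for \<eta> x
  proof -
    let ?g = "\<lambda>\<phi> \<xi>. cos (x \<bullet> \<xi>) * exp (- (\<eta> * (norm \<xi>)\<^sup>2)) * \<phi> \<xi>"
    have ne: "AE \<xi> in lborel. \<xi> \<noteq> (0::'a)" by (rule AE_lborel_singleton)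
    have "(\<lambda>k. \<integral>\<xi>. ?g (\<phi>' k) \<xi> \<partial>lborel) \<longlonglongrightarrow> (\<integral>\<xi>. ?g \<phi> \<xi> \<partial>lborel)"
    proof (rule integral_dominated_convergence[where w="\<lambda>\<xi>. B * exp (- (\<eta> * (norm \<xi>)\<^sup>2))"])
      show "integrable lborel (\<lambda>\<xi>::'a. B * exp (- (\<eta> * (norm \<xi>)\<^sup>2)))"
        by (intro integrable_mult_right integrable_exp_norm_sq e)
      show "AE \<xi> in lborel. (\<lambda>k. ?g (\<phi>' k) \<xi>) \<longlonglongrightarrow> ?g \<phi> \<xi>"
        using ne by eventually_elim (intro tendsto_intros lim)
      show "AE \<xi> in lborel. norm (?g (\<phi>' k) \<xi>) \<le> B * exp (- (\<eta> * (norm \<xi>)\<^sup>2))" for k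
        using ne
      proof eventually_elim
        fix \<xi> :: 'a assume "\<xi> \<noteq> 0"
        then have "\<bar>cos (x \<bullet> \<xi>)\<bar> * exp (- (\<eta> * (norm \<xi>)\<^sup>2)) * \<bar>\<phi>' k \<xi>\<bar> \<le> 1 * exp (- (\<eta> * (norm \<xi>)\<^sup>2)) * B"
          using B(2)[of \<xi> k] by (intro mult_mono) auto
        then show "norm (?g (\<phi>' k) \<xi>) \<le> B * exp (- (\<eta> * (norm \<xi>)\<^sup>2))"
          by (simp add: abs_mult mult.commute)
      qed
    qed measurable
    moreover have "0 \<le> (\<integral>\<xi>. ?g (\<phi>' k) \<xi> \<partial>lborel)" for k
      using assms(1) e unfolding pos_type_def by blast
    ultimately show ?thesis by (intro LIMSEQ_le_const) auto
  qed
  then show ?thesis unfolding pos_type_def using B by auto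
qed

text \<open>The first signed coefficient is -a, and passing from index j >= 1 to j + 1 multiplies it
  by (j - a)/(j + 1), which is positive since a < 1.\<close>

lemma gchoose_sign:
  fixes a :: real assumes "0 < a" "a < 1"
  shows "(a gchoose Suc k) * (- 1) ^ Suc k \<le> 0"
proof (induction k)
  case 0 then show ?case using assms by simp
next
  case (Suc k)
  have "(a gchoose Suc (Suc k)) = (a gchoose Suc k) * (a - real (Suc k)) / real (Suc (Suc k))"
    using gbinomial_mult_1[of a "Suc k"] by (simp add: field_simps)
  moreover have "(X * (a - S) / T) * (- e) = (X * e) * ((S - a) / T)" for X S T e :: real
    by (cases "T = 0") (simp_all add: field_simps)
  ultimately have "(a gchoose Suc (Suc k)) * (- 1) ^ Suc (Suc k)
    = ((a gchoose Suc k) * (- 1) ^ Suc k) * ((real (Suc k) - a) / real (Suc (Suc k)))"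
    by (simp only: power_Suc[of _ "Suc k"] mult_minus1)
  also have "\<dots> \<le> 0"
    using Suc assms by (intro mult_nonpos_nonneg[OF _ divide_nonneg_nonneg]) auto
  finally show ?case .
qed

text \<open>For 0 < a < 1 the function 1 - (1 - z)^a is a power series in z with nonnegative
  coefficients and no constant term. At a Gaussian z its partial sums are positive combinations of
  Gaussians. The factor \<phi> is carried along so that powers can be built by repeated
  application.\<close>

lemma pos_type_bernstein:
  assumes \<phi>: "pos_type \<phi>" and a: "0 < a" "a < 1" and s: "0 < s"
  shows "pos_type (\<lambda>\<xi>. (1 - (1 - exp (- (s * (norm \<xi>)\<^sup>2))) powr a) * \<phi> \<xi>)"
proof -
  obtain B where B: "\<And>\<xi>. \<bar>\<phi> \<xi>\<bar> \<le> B" and [measurable]: "\<phi> \<in> borel_measurable borel"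
    using \<phi> unfolding pos_type_def by auto
  define c where "c k = - ((a gchoose Suc k) * (- 1) ^ Suc k)" for k
  have c: "0 \<le> c k" for k using gchoose_sign[OF a, of k] by (simp add: c_def)
  have sums: "(\<lambda>k. c k * z ^ Suc k) sums (1 - (1 - z) powr a)" if "0 \<le> z" "z < 1" for z
  proof -
    have "(\<lambda>n. (a gchoose n) * (- z) ^ n) sums (1 + - z) powr a"
      by (rule gen_binomial_real) (use that in auto)
    then have "(\<lambda>n. (a gchoose Suc n) * (- z) ^ Suc n) sums ((1 + - z) powr a - 1)"
      by (subst sums_Suc_iff) simp
    from sums_minus[OF this] show ?thesis
      by (simp add: c_def power_minus[of z] mult_ac)
  qed
  let ?P = "\<lambda>\<xi>. 1 - (1 - exp (- (s * (norm \<xi>)\<^sup>2))) powr a"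
  have P01: "0 \<le> ?P \<xi>" "?P \<xi> \<le> 1" for \<xi>
  proof -
    have "(1 - exp (- (s * (norm \<xi>)\<^sup>2))) powr a \<le> 1 powr a"
      using s a by (intro powr_mono2) auto
    then show "0 \<le> ?P \<xi>" by simp
  qed simp
  show ?thesis
  proof (rule pos_type_limit[where B=B and \<phi>'="\<lambda>K \<xi>. (\<Sum>k<K. c k * exp (- (s * (norm \<xi>)\<^sup>2)) ^ Suc k) * \<phi> \<xi>"])
    fix K
    have "pos_type (\<lambda>\<xi>. \<Sum>k<K. c k * (exp (- ((real (Suc k) * s) * (norm \<xi>)\<^sup>2)) * \<phi> \<xi>))"
      using s by (intro pos_type_sum pos_type_cmult pos_type_gauss \<phi> c) auto
    also have "(\<lambda>\<xi>. \<Sum>k<K. c k * (exp (- ((real (Suc k) * s) * (norm \<xi>)\<^sup>2)) * \<phi> \<xi>))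
       = (\<lambda>\<xi>. (\<Sum>k<K. c k * exp (- (s * (norm \<xi>)\<^sup>2)) ^ Suc k) * \<phi> \<xi>)"
      unfolding sum_distrib_right exp_of_nat_mult[symmetric] by (intro ext sum.cong refl) (simp add: mult_ac)
    finally show "pos_type \<dots>" .
  next
    show "\<bar>?P \<xi> * \<phi> \<xi>\<bar> \<le> B" for \<xi>
    proof -
      have "\<bar>?P \<xi>\<bar> * \<bar>\<phi> \<xi>\<bar> \<le> 1 * B" using P01[of \<xi>] B[of \<xi>] by (intro mult_mono) auto
      then show ?thesis by (simp only: abs_mult mult_1)
    qed
  next
    fix K \<xi> assume "\<xi> \<noteq> (0::'a)"
    then have z: "0 \<le> exp (- (s * (norm \<xi>)\<^sup>2))" "exp (- (s * (norm \<xi>)\<^sup>2)) < 1" using s by auto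
    have "(\<Sum>k<K. c k * exp (- (s * (norm \<xi>)\<^sup>2)) ^ Suc k) \<le> (\<Sum>k. c k * exp (- (s * (norm \<xi>)\<^sup>2)) ^ Suc k)"
      using c by (intro sum_le_suminf sums_summable[OF sums[OF z]] mult_nonneg_nonneg) auto
    also have "\<dots> = ?P \<xi>" using sums_unique[OF sums[OF z]] by simp
    finally have 1: "(\<Sum>k<K. c k * exp (- (s * (norm \<xi>)\<^sup>2)) ^ Suc k) \<le> 1" using P01[of \<xi>] by linarith
    have 2: "0 \<le> (\<Sum>k<K. c k * exp (- (s * (norm \<xi>)\<^sup>2)) ^ Suc k)" using c by (intro sum_nonneg) auto
    have "\<bar>(\<Sum>k<K. c k * exp (- (s * (norm \<xi>)\<^sup>2)) ^ Suc k)\<bar> * \<bar>\<phi> \<xi>\<bar> \<le> 1 * B"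
      using 1 2 B[of \<xi>] by (intro mult_mono) auto
    then show "\<bar>(\<Sum>k<K. c k * exp (- (s * (norm \<xi>)\<^sup>2)) ^ Suc k) * \<phi> \<xi>\<bar> \<le> B"
      by (simp only: abs_mult mult_1)
  next
    fix \<xi> assume "\<xi> \<noteq> (0::'a)"
    then have z: "0 \<le> exp (- (s * (norm \<xi>)\<^sup>2))" "exp (- (s * (norm \<xi>)\<^sup>2)) < 1" using s by auto
    show "(\<lambda>K. (\<Sum>k<K. c k * exp (- (s * (norm \<xi>)\<^sup>2)) ^ Suc k) * \<phi> \<xi>) \<longlonglongrightarrow> ?P \<xi> * \<phi> \<xi>"
      using sums[OF z] unfolding sums_def by (intro tendsto_intros)
  qed measurable
qed

text \<open>This takes the place of the subordination formula for stable laws: no mixing measure is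
  constructed, only a limit of powers of \<open>P\<close>.\<close>

lemma pos_type_exp_powr:
  assumes \<beta>: "0 < \<beta>" "\<beta> < 2"
  shows "pos_type (\<lambda>\<xi>::'a::euclidean_space. exp (- (norm \<xi> powr \<beta>)))"
proof -
  define a where "a = \<beta> / 2"
  have a: "0 < a" "a < 1" using \<beta> by (auto simp: a_def)
  define P where "P s \<xi> = 1 - (1 - exp (- (s * (norm \<xi>)\<^sup>2))) powr a" for s and \<xi> :: 'a
  have P01: "0 \<le> P s \<xi>" "P s \<xi> \<le> 1" if "0 < s" for s \<xi>
  proof -
    have "(1 - exp (- (s * (norm \<xi>)\<^sup>2))) powr a \<le> 1 powr a"
      using that a by (intro powr_mono2) auto
    then show "0 \<le> P s \<xi>" "P s \<xi> \<le> 1" by (simp_all add: P_def)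
  qed
  have pow: "pos_type (\<lambda>\<xi>. P s \<xi> ^ N)" if "0 < s" for s N
  proof (induction N)
    case 0 then show ?case by (simp add: pos_type_one)
  next
    case (Suc N)
    from pos_type_bernstein[OF this a that] show ?case by (simp add: P_def)
  qed
  \<comment> \<open>At this scale (1 - exp (- s l))^a behaves like l^a divided by the index, so the
    matching power of \<open>P\<close> tends to exp (- l^a), just as (1 - x/k)^k tends to exp (-
    x).\<close>
  define s where "s N = real (Suc N) powr (- (1 / a))" for N
  have s: "0 < s N" for N by (simp add: s_def)
  show ?thesis
  proof (rule pos_type_limit[where B=1 and \<phi>'="\<lambda>N \<xi>. P (s N) \<xi> ^ Suc N"])
    fix \<xi> :: 'a assume \<xi>: "\<xi> \<noteq> 0"
    define l where "l = (norm \<xi>)\<^sup>2"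
    have l: "0 < l" using \<xi> by (simp add: l_def)
    have "((\<lambda>N::nat. (1 - (1 - exp (- (real N powr (- (1 / a)) * l))) powr a) powr real N) \<longlongrightarrow> exp (- (l powr a))) sequentially"
      using a l by real_asymp
    from LIMSEQ_Suc[OF this] have "((\<lambda>N. P (s N) \<xi> powr real (Suc N)) \<longlongrightarrow> exp (- (l powr a))) sequentially"
      by (simp add: P_def s_def l_def)
    moreover have "l powr a = norm \<xi> powr \<beta>"
      using \<xi> by (simp add: l_def a_def powr_powr flip: powr_numeral)
    moreover have "P (s N) \<xi> powr real (Suc N) = P (s N) \<xi> ^ Suc N" for N
    proof -
      have "(1 - exp (- (s N * (norm \<xi>)\<^sup>2))) powr a < 1 powr a"
        using s[of N] a l by (intro powr_less_mono2) (auto simp: l_def)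
      then have "0 < P (s N) \<xi>" by (simp add: P_def)
      then show ?thesis by (rule powr_realpow)
    qed
    ultimately show "(\<lambda>N. P (s N) \<xi> ^ Suc N) \<longlonglongrightarrow> exp (- (norm \<xi> powr \<beta>))" by simp
  next
    show "\<bar>P (s k) \<xi> ^ Suc k\<bar> \<le> 1" for k \<xi>
      unfolding power_abs using P01[OF s[of k], of \<xi>] by (intro power_le_one) auto
  next
    show "pos_type (\<lambda>\<xi>. P (s k) \<xi> ^ Suc k)" for k by (rule pow[OF s])
  qed simp_all
qed

section \<open>The kernel: scaling, positivity, mass, continuity in time\<close>

text \<open>The kernel written with a cosine and Borel measure over any Euclidean space;
  \<open>frac_heat_kernel_eq_fhk\<close> identifies it with the given one at positive times.\<close>

definition fhk :: "real \<Rightarrow> real \<Rightarrow> 'a::euclidean_space \<Rightarrow> real" where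
  "fhk \<beta> t x = (\<integral>\<xi>. cos (x \<bullet> \<xi>) * exp (- (t * norm \<xi> powr \<beta>)) \<partial>lborel) / (2 * pi) ^ DIM('a)"

lemma integrable_fhk_integrand:
  fixes x :: "'a::euclidean_space"
  assumes "0 < t" "0 < \<beta>"
  shows "integrable lborel (\<lambda>\<xi>. cos (x \<bullet> \<xi>) * exp (- (t * norm \<xi> powr \<beta>)))"
  by (rule Bochner_Integration.integrable_bound[OF integrable_exp_norm_powr[OF assms]])
     (auto simp: abs_mult)

text \<open>Substituting \<xi> by t^(-1/\<beta>) \<xi> removes t from the exponent. Properties at
  general times are reduced to time 1 through this identity.\<close>

lemma fhk_scale:
  fixes x :: "'a::euclidean_space"
  assumes t: "0 < t" and \<beta>: "0 < \<beta>"
  shows "fhk \<beta> t x = t powr (- (real DIM('a) / \<beta>)) * fhk \<beta> 1 (t powr (- (1 / \<beta>)) *\<^sub>R x)"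
proof -
  define c where "c = t powr (- (1 / \<beta>))"
  have c: "c \<noteq> 0" "0 < c" using t by (auto simp: c_def)
  have cb: "t * (c * r) powr \<beta> = r powr \<beta>" if "0 \<le> r" for r
  proof -
    have "c powr \<beta> = t powr (-1)" unfolding c_def powr_powr using \<beta> by simp
    then show ?thesis using that t c by (simp add: powr_mult powr_minus)
  qed
  have "(\<integral>\<xi>. cos (x \<bullet> \<xi>) * exp (- (t * norm \<xi> powr \<beta>)) \<partial>lborel)
    = \<bar>c\<bar> ^ DIM('a) * (\<integral>\<xi>. cos (x \<bullet> (0 + c *\<^sub>R \<xi>)) * exp (- (t * norm (0 + c *\<^sub>R \<xi>) powr \<beta>)) \<partial>lborel)"
    by (rule integral_lborel_affine[OF _ c(1)]) simp
  also have "(\<lambda>\<xi>. cos (x \<bullet> (0 + c *\<^sub>R \<xi>)) * exp (- (t * norm (0 + c *\<^sub>R \<xi>) powr \<beta>)))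
     = (\<lambda>\<xi>. cos ((c *\<^sub>R x) \<bullet> \<xi>) * exp (- (1 * norm \<xi> powr \<beta>)))"
    using c by (auto simp: cb)
  also have "\<bar>c\<bar> ^ DIM('a) = t powr (- (real DIM('a) / \<beta>))"
    using t c by (simp add: c_def powr_powr flip: powr_realpow)
  finally show ?thesis unfolding fhk_def c_def by simp
qed

lemma continuous_fhk:
  assumes \<beta>: "0 < \<beta>"
  shows "continuous_on UNIV (fhk \<beta> 1 :: 'a::euclidean_space \<Rightarrow> real)"
proof -
  have "isCont (\<lambda>x::'a. \<integral>\<xi>. cos (x \<bullet> \<xi>) * exp (- (1 * norm \<xi> powr \<beta>)) \<partial>lborel) x" for x
    unfolding continuous_within tendsto_at_iff_sequentially comp_def
  proof (intro allI impI)
    fix X assume X: "X \<longlonglongrightarrow> x"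
    show "(\<lambda>i. \<integral>\<xi>. cos (X i \<bullet> \<xi>) * exp (- (1 * norm \<xi> powr \<beta>)) \<partial>lborel)
       \<longlonglongrightarrow> (\<integral>\<xi>. cos (x \<bullet> \<xi>) * exp (- (1 * norm \<xi> powr \<beta>)) \<partial>lborel)"
    proof (rule integral_dominated_convergence[where w="\<lambda>\<xi>. exp (- (1 * norm \<xi> powr \<beta>))"])
      show "integrable lborel (\<lambda>\<xi>::'a. exp (- (1 * norm \<xi> powr \<beta>)))"
        by (rule integrable_exp_norm_powr) (use \<beta> in auto)
      show "AE \<xi> in lborel. (\<lambda>i. cos (X i \<bullet> \<xi>) * exp (- (1 * norm \<xi> powr \<beta>))) \<longlonglongrightarrow> cos (x \<bullet> \<xi>) * exp (- (1 * norm \<xi> powr \<beta>))"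
        by (intro AE_I2 tendsto_intros X)
    qed (auto simp: abs_mult)
  qed
  then show ?thesis
    unfolding fhk_def by (intro continuous_at_imp_continuous_on ballI continuous_intros) auto
qed

lemma fhk_bounded:
  assumes \<beta>: "0 < \<beta>"
  obtains c where "0 < c" "\<And>x::'a::euclidean_space. \<bar>fhk \<beta> 1 x\<bar> \<le> c"
proof -
  define I where "I = (\<integral>\<xi>. exp (- (1 * norm \<xi> powr \<beta>)) \<partial>(lborel :: 'a measure))"
  have b: "\<bar>fhk \<beta> 1 x\<bar> \<le> I / (2 * pi) ^ DIM('a)" for x :: 'a
  proof -
    have "\<bar>\<integral>\<xi>. cos (x \<bullet> \<xi>) * exp (- (1 * norm \<xi> powr \<beta>)) \<partial>lborel\<bar>
       \<le> (\<integral>\<xi>. \<bar>cos (x \<bullet> \<xi>) * exp (- (1 * norm \<xi> powr \<beta>))\<bar> \<partial>lborel)" by (rule integral_abs_bound)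
    also have "\<dots> \<le> I" unfolding I_def
      by (rule integral_mono[OF integrable_abs[OF integrable_fhk_integrand] integrable_exp_norm_powr])
         (use \<beta> in \<open>auto simp: abs_mult\<close>)
    finally show ?thesis unfolding fhk_def by (simp add: divide_right_mono)
  qed
  show ?thesis by (rule that[of "\<bar>I / (2 * pi) ^ DIM('a)\<bar> + 1"]) (auto intro!: add_nonneg_pos order_trans[OF b] simp del: abs_divide)
qed

text \<open>Positive type gives the sign of the integral with an additional Gaussian factor. Letting
  its parameter tend to 0 removes the factor, since exp(-|\<xi>|^\<beta>) is itself
  integrable.\<close>

lemma fhk_nonneg:
  assumes \<beta>: "0 < \<beta>" "\<beta> < 2"
  shows "0 \<le> fhk \<beta> 1 (x::'a::euclidean_space)"
proof -
  have "(\<lambda>k::nat. \<integral>\<xi>. cos (x \<bullet> \<xi>) * exp (- (1 / real (Suc k) * (norm \<xi>)\<^sup>2)) * exp (- (norm \<xi> powr \<beta>)) \<partial>lborel)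
     \<longlonglongrightarrow> (\<integral>\<xi>. cos (x \<bullet> \<xi>) * exp (- (1 * norm \<xi> powr \<beta>)) \<partial>lborel)"
  proof (rule integral_dominated_convergence[where w="\<lambda>\<xi>. exp (- (1 * norm \<xi> powr \<beta>))"])
    show "integrable lborel (\<lambda>\<xi>::'a. exp (- (1 * norm \<xi> powr \<beta>)))"
      by (rule integrable_exp_norm_powr) (use \<beta> in auto)
    show "AE \<xi> in lborel. (\<lambda>k. cos (x \<bullet> \<xi>) * exp (- (1 / real (Suc k) * (norm \<xi>)\<^sup>2)) * exp (- (norm \<xi> powr \<beta>)))
        \<longlonglongrightarrow> cos (x \<bullet> \<xi>) * exp (- (1 * norm \<xi> powr \<beta>))"
    proof (rule AE_I2)
      fix \<xi> :: 'a
      have "(\<lambda>k. cos (x \<bullet> \<xi>) * exp (- (1 / real (Suc k) * (norm \<xi>)\<^sup>2)) * exp (- (norm \<xi> powr \<beta>)))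
        \<longlonglongrightarrow> cos (x \<bullet> \<xi>) * exp (- (0 * (norm \<xi>)\<^sup>2)) * exp (- (norm \<xi> powr \<beta>))"
        by (intro tendsto_intros LIMSEQ_Suc[OF lim_1_over_n])
      then show "(\<lambda>k. cos (x \<bullet> \<xi>) * exp (- (1 / real (Suc k) * (norm \<xi>)\<^sup>2)) * exp (- (norm \<xi> powr \<beta>)))
        \<longlonglongrightarrow> cos (x \<bullet> \<xi>) * exp (- (1 * norm \<xi> powr \<beta>))" by simp
    qed
    show "AE \<xi> in lborel. norm (cos (x \<bullet> \<xi>) * exp (- (1 / real (Suc k) * (norm \<xi>)\<^sup>2)) * exp (- (norm \<xi> powr \<beta>)))
       \<le> exp (- (1 * norm \<xi> powr \<beta>))" for k
    proof (rule AE_I2)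
      fix \<xi> :: 'a
      have "\<bar>cos (x \<bullet> \<xi>)\<bar> * exp (- (1 / real (Suc k) * (norm \<xi>)\<^sup>2)) * exp (- (norm \<xi> powr \<beta>))
        \<le> 1 * 1 * exp (- (norm \<xi> powr \<beta>))" by (intro mult_mono) auto
      then show "norm (cos (x \<bullet> \<xi>) * exp (- (1 / real (Suc k) * (norm \<xi>)\<^sup>2)) * exp (- (norm \<xi> powr \<beta>)))
       \<le> exp (- (1 * norm \<xi> powr \<beta>))" by (simp only: real_norm_def abs_mult abs_exp_cancel mult_1)
    qed
  qed measurable
  moreover have "0 \<le> (\<integral>\<xi>. cos (x \<bullet> \<xi>) * exp (- (1 / real (Suc k) * (norm \<xi>)\<^sup>2)) * exp (- (norm \<xi> powr \<beta>)) \<partial>lborel)" for k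
  proof -
    have "0 < 1 / real (Suc k)" by simp
    then show ?thesis using pos_type_exp_powr[OF \<beta>, where 'a='a] unfolding pos_type_def by blast
  qed
  ultimately have "0 \<le> (\<integral>\<xi>. cos (x \<bullet> \<xi>) * exp (- (1 * norm \<xi> powr \<beta>)) \<partial>lborel)"
    by (intro LIMSEQ_le_const) auto
  then show ?thesis unfolding fhk_def by simp
qed

lemma integrable_lborel_times:
  fixes g :: "'a::euclidean_space \<Rightarrow> real" and h :: "'b::euclidean_space \<Rightarrow> real"
  assumes "integrable lborel g" "integrable lborel h"
  shows "integrable (lborel \<Otimes>\<^sub>M lborel) (\<lambda>(x, y). g x * h y)"
  using assms by (intro lborel_pair.Fubini_integrable) (auto simp: abs_mult)

text \<open>Parseval's identity against a Gaussian, by Fubini. The parameter (r/2)^2 is the one for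
  which \<xi> = r z turns the transformed Gaussian into exp(-|z|^2), whatever r is.\<close>

lemma fhk_gauss_pairing:
  assumes \<beta>: "0 < \<beta>" and r: "0 < r"
  shows "(\<integral>x. fhk \<beta> 1 x * exp (- ((r / 2)\<^sup>2 * (norm x)\<^sup>2)) \<partial>(lborel :: 'a::euclidean_space measure))
     = (\<integral>z. exp (- ((r * norm z) powr \<beta>)) * exp (- ((norm z)\<^sup>2)) \<partial>(lborel :: 'a measure)) / sqrt pi ^ DIM('a)"
proof -
  let ?n = "DIM('a)"
  define e where "e = (r / 2)\<^sup>2"
  have e: "0 < e" using r by (simp add: e_def)
  let ?F = "\<lambda>x \<xi>::'a. cos (x \<bullet> \<xi>) * exp (- (1 * norm \<xi> powr \<beta>)) * exp (- (e * (norm x)\<^sup>2))"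
  have intF: "integrable (lborel \<Otimes>\<^sub>M lborel) (\<lambda>(x, \<xi>). ?F x \<xi>)"
  proof (rule Bochner_Integration.integrable_bound)
    show "integrable (lborel \<Otimes>\<^sub>M lborel) (\<lambda>(x::'a, \<xi>::'a). exp (- (e * (norm x)\<^sup>2)) * exp (- (1 * norm \<xi> powr \<beta>)))"
      by (intro integrable_lborel_times integrable_exp_norm_sq e integrable_exp_norm_powr \<beta>) simp
    show "(\<lambda>(x, \<xi>). ?F x \<xi>) \<in> borel_measurable (lborel \<Otimes>\<^sub>M lborel)"
      by measurable
    show "AE z in lborel \<Otimes>\<^sub>M lborel. norm (case z of (x, \<xi>) \<Rightarrow> ?F x \<xi>) \<le> norm (case z of (x::'a, \<xi>::'a) \<Rightarrow> exp (- (e * (norm x)\<^sup>2)) * exp (- (1 * norm \<xi> powr \<beta>)))"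
    proof (rule AE_I2, clarify)
      fix x \<xi> :: 'a
      have "\<bar>cos (x \<bullet> \<xi>)\<bar> * exp (- (1 * norm \<xi> powr \<beta>)) * exp (- (e * (norm x)\<^sup>2)) \<le> 1 * exp (- (1 * norm \<xi> powr \<beta>)) * exp (- (e * (norm x)\<^sup>2))"
        by (intro mult_mono) auto
      then show "norm (?F x \<xi>) \<le> norm (exp (- (e * (norm x)\<^sup>2)) * exp (- (1 * norm \<xi> powr \<beta>)))"
        by (simp add: abs_mult mult.commute)
    qed
  qed
  have "(\<integral>x. fhk \<beta> 1 x * exp (- (e * (norm x)\<^sup>2)) \<partial>(lborel :: 'a measure))
    = (\<integral>x. (\<integral>\<xi>. ?F x \<xi> \<partial>lborel) \<partial>lborel) / (2 * pi) ^ ?n"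
    unfolding fhk_def by simp
  also have "(\<integral>x. (\<integral>\<xi>. ?F x \<xi> \<partial>lborel) \<partial>lborel) = (\<integral>\<xi>. (\<integral>x. ?F x \<xi> \<partial>lborel) \<partial>lborel)"
    by (rule lborel_pair.Fubini_integral[OF intF, symmetric])
  also have "(\<lambda>\<xi>. (\<integral>x. ?F x \<xi> \<partial>lborel)) = (\<lambda>\<xi>. sqrt (pi / e) ^ ?n * (exp (- (1 * norm \<xi> powr \<beta>)) * exp (- ((norm \<xi>)\<^sup>2 / (4 * e)))))"
  proof
    fix \<xi> :: 'a
    have "(\<integral>x. ?F x \<xi> \<partial>lborel) = exp (- (1 * norm \<xi> powr \<beta>)) * (\<integral>x. cos (\<xi> \<bullet> x) * exp (- (e * (norm x)\<^sup>2)) \<partial>lborel)"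
      by (subst integral_mult_right_zero[symmetric]) (simp add: inner_commute mult_ac)
    then show "(\<integral>x. ?F x \<xi> \<partial>lborel) = sqrt (pi / e) ^ ?n * (exp (- (1 * norm \<xi> powr \<beta>)) * exp (- ((norm \<xi>)\<^sup>2 / (4 * e))))"
      by (simp only: gauss_ft[OF e] mult_ac)
  qed
  also have "(\<integral>\<xi>. sqrt (pi / e) ^ ?n * (exp (- (1 * norm \<xi> powr \<beta>)) * exp (- ((norm \<xi>)\<^sup>2 / (4 * e)))) \<partial>(lborel :: 'a measure))
     = sqrt (pi / e) ^ ?n * (\<integral>\<xi>. exp (- (1 * norm \<xi> powr \<beta>)) * exp (- ((norm \<xi>)\<^sup>2 / (4 * e))) \<partial>(lborel :: 'a measure))"
    by (rule integral_mult_right_zero)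
  also have "(\<integral>\<xi>. exp (- (1 * norm \<xi> powr \<beta>)) * exp (- ((norm \<xi>)\<^sup>2 / (4 * e))) \<partial>(lborel :: 'a measure))
     = \<bar>r\<bar> ^ ?n * (\<integral>z. exp (- (1 * norm (0 + r *\<^sub>R z) powr \<beta>)) * exp (- ((norm (0 + r *\<^sub>R z))\<^sup>2 / (4 * e))) \<partial>(lborel :: 'a measure))"
    by (rule integral_lborel_affine) (use r in auto)
  also have "(\<lambda>z::'a. exp (- (1 * norm (0 + r *\<^sub>R z) powr \<beta>)) * exp (- ((norm (0 + r *\<^sub>R z))\<^sup>2 / (4 * e))))
     = (\<lambda>z. exp (- ((r * norm z) powr \<beta>)) * exp (- ((norm z)\<^sup>2)))"
    using r by (auto simp: e_def power2_eq_square field_simps)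
  also have "sqrt (pi / e) ^ ?n * (\<bar>r\<bar> ^ ?n * (\<integral>z. exp (- ((r * norm z) powr \<beta>)) * exp (- ((norm z)\<^sup>2)) \<partial>(lborel :: 'a measure))) / (2 * pi) ^ ?n
     = (sqrt (pi / e) * r / (2 * pi)) ^ ?n * (\<integral>z. exp (- ((r * norm z) powr \<beta>)) * exp (- ((norm z)\<^sup>2)) \<partial>(lborel :: 'a measure))"
    using r by (simp add: power_mult_distrib power_divide)
  also have "sqrt (pi / e) * r / (2 * pi) = 1 / sqrt pi"
  proof -
    have "sqrt (pi / e) = sqrt pi * (2 / r)" using r by (simp add: e_def real_sqrt_divide)
    moreover have "pi = sqrt pi * sqrt pi" by simp
    ultimately show ?thesis using r by (simp add: field_simps)
  qed
  finally show ?thesis by (simp add: e_def power_divide power_one_over)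
qed

text \<open>Integrability is not visible from the oscillating integral. Nonnegativity makes the
  Gaussian-damped kernels increase as the damping vanishes, so monotone convergence yields
  integrability and mass together, the limit being computed on the Fourier side.\<close>

lemma
  assumes \<beta>: "0 < \<beta>" "\<beta> < 2"
  shows integrable_fhk_1: "integrable lborel (fhk \<beta> 1 :: 'a::euclidean_space \<Rightarrow> real)"
    and integral_fhk_1: "(\<integral>x. fhk \<beta> 1 (x :: 'a) \<partial>lborel) = 1"
proof -
  let ?n = "DIM('a)"
  note [continuous_intros] = continuous_fhk[OF \<beta>(1)]
  have [measurable]: "(fhk \<beta> 1 :: 'a \<Rightarrow> real) \<in> borel_measurable borel"
    by (rule borel_measurable_continuous_onI[OF continuous_fhk[OF \<beta>(1)]])
  define r where "r k = 1 / real (Suc k)" for k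
  have r: "0 < r k" for k by (simp add: r_def)
  have r0: "r \<longlonglongrightarrow> 0" unfolding r_def by (rule LIMSEQ_Suc[OF lim_1_over_n])
  obtain c where c: "\<And>x::'a. \<bar>fhk \<beta> 1 x\<bar> \<le> c" using fhk_bounded[OF \<beta>(1)] by blast
  let ?f = "\<lambda>k x::'a. fhk \<beta> 1 x * exp (- ((r k / 2)\<^sup>2 * (norm x)\<^sup>2))"
  have int: "integrable lborel (?f k)" for k
  proof -
    have "0 < (r k / 2)\<^sup>2" using r[of k] by simp
    from integrable_gauss_mult[of "fhk \<beta> 1" c, OF _ c this, of 0] show ?thesis by (simp add: mult.commute)
  qed
  have lim1: "(\<lambda>k. \<integral>x. ?f k x \<partial>lborel) \<longlonglongrightarrow> 1"
  proof -
    have "(\<lambda>k. \<integral>z. exp (- ((r k * norm z) powr \<beta>)) * exp (- ((norm z)\<^sup>2)) \<partial>(lborel :: 'a measure))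
       \<longlonglongrightarrow> (\<integral>z. exp (- ((norm z)\<^sup>2)) \<partial>(lborel :: 'a measure))"
    proof (rule integral_dominated_convergence[where w="\<lambda>z. exp (- ((norm z)\<^sup>2))"])
      show "integrable lborel (\<lambda>z::'a. exp (- ((norm z)\<^sup>2)))"
        using integrable_exp_norm_sq[of 1, where 'a='a] by simp
      show "AE z in lborel. (\<lambda>k. exp (- ((r k * norm z) powr \<beta>)) * exp (- ((norm (z::'a))\<^sup>2))) \<longlonglongrightarrow> exp (- ((norm z)\<^sup>2))"
      proof (rule AE_I2)
        fix z :: 'a
        have "(\<lambda>k. exp (- ((r k * norm z) powr \<beta>)) * exp (- ((norm z)\<^sup>2))) \<longlonglongrightarrow> exp (- ((0 * norm z) powr \<beta>)) * exp (- ((norm z)\<^sup>2))"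
          using \<beta> r by (intro tendsto_intros tendsto_powr' r0) (auto intro!: always_eventually simp: less_imp_le)
        then show "(\<lambda>k. exp (- ((r k * norm z) powr \<beta>)) * exp (- ((norm z)\<^sup>2))) \<longlonglongrightarrow> exp (- ((norm z)\<^sup>2))" by simp
      qed
    qed (auto intro: mult_left_le_one_le)
    moreover have "(\<integral>z. exp (- ((norm z)\<^sup>2)) \<partial>(lborel :: 'a measure)) = sqrt pi ^ ?n"
      using gauss_ft[of 1 "0::'a"] by simp
    ultimately have "(\<lambda>k. (\<integral>z. exp (- ((r k * norm z) powr \<beta>)) * exp (- ((norm z)\<^sup>2)) \<partial>(lborel :: 'a measure)) / sqrt pi ^ ?n)
       \<longlonglongrightarrow> sqrt pi ^ ?n / sqrt pi ^ ?n" by (intro tendsto_divide) auto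
    then show ?thesis by (simp add: fhk_gauss_pairing[OF \<beta>(1) r])
  qed
  have mono: "AE x in lborel. mono (\<lambda>k. ?f k x)"
  proof (intro AE_I2 monoI mult_left_mono fhk_nonneg[OF \<beta>])
    fix x :: 'a and k l :: nat assume "k \<le> l"
    then have "r l \<le> r k" by (simp add: r_def frac_le)
    then have "(r l / 2)\<^sup>2 \<le> (r k / 2)\<^sup>2" using r[of l] by (intro power_mono divide_right_mono) auto
    then show "exp (- ((r k / 2)\<^sup>2 * (norm x)\<^sup>2)) \<le> exp (- ((r l / 2)\<^sup>2 * (norm x)\<^sup>2))"
      by (simp add: mult_right_mono)
  qed
  have lim2: "AE x in lborel. (\<lambda>k. ?f k x) \<longlonglongrightarrow> fhk \<beta> 1 x"
  proof (rule AE_I2)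
    fix x :: 'a
    have "(\<lambda>k. ?f k x) \<longlonglongrightarrow> fhk \<beta> 1 x * exp (- ((0 / 2)\<^sup>2 * (norm x)\<^sup>2))"
      by (intro tendsto_intros r0) simp_all
    then show "(\<lambda>k. ?f k x) \<longlonglongrightarrow> fhk \<beta> 1 x" by simp
  qed
  show "integrable lborel (fhk \<beta> 1 :: 'a \<Rightarrow> real)" "(\<integral>x. fhk \<beta> 1 (x :: 'a) \<partial>lborel) = 1"
    by (rule integrable_monotone_convergence[OF int mono lim2 lim1] integral_monotone_convergence[OF int mono lim2 lim1]; simp)+
qed

lemma fhk_pos_time_nonneg:
  assumes "0 < \<beta>" "\<beta> < 2" "0 < t"
  shows "0 \<le> fhk \<beta> t (x::'a::euclidean_space)"
  using fhk_nonneg[OF assms(1,2)] by (subst fhk_scale[OF assms(3,1)]) (intro mult_nonneg_nonneg powr_ge_zero)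

lemma borel_measurable_fhk_1 [measurable]:
  "0 < \<beta> \<Longrightarrow> (fhk \<beta> 1 :: 'a::euclidean_space \<Rightarrow> real) \<in> borel_measurable borel"
  by (rule borel_measurable_continuous_onI[OF continuous_fhk])

lemma borel_measurable_fhk:
  "0 < \<beta> \<Longrightarrow> 0 < t \<Longrightarrow> (fhk \<beta> t :: 'a::euclidean_space \<Rightarrow> real) \<in> borel_measurable borel"
proof -
  assume a: "0 < \<beta>" "0 < t"
  note [measurable] = borel_measurable_fhk_1[OF a(1), where 'a='a]
  have "fhk \<beta> t = (\<lambda>x::'a. t powr (- (real DIM('a) / \<beta>)) * fhk \<beta> 1 (t powr (- (1 / \<beta>)) *\<^sub>R x))"
    by (rule ext) (rule fhk_scale[OF a(2,1)])
  then show ?thesis by simp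
qed

lemma powr_pow_scale:
  fixes t \<beta> :: real assumes "0 < t"
  shows "\<bar>t powr (- (1 / \<beta>))\<bar> ^ n = t powr (- (real n / \<beta>))"
  using assms by (simp add: powr_powr flip: powr_realpow)

lemma nn_integral_fhk:
  assumes \<beta>: "0 < \<beta>" "\<beta> < 2" and t: "0 < t"
  shows "(\<integral>\<^sup>+x. ennreal (fhk \<beta> t x) \<partial>(lborel :: 'a::euclidean_space measure)) = 1"
proof -
  note [measurable] = borel_measurable_fhk_1[OF \<beta>(1), where 'a='a]
  have "1 = (\<integral>\<^sup>+x. ennreal (fhk \<beta> 1 x) \<partial>(lborel :: 'a measure))"
    using nn_integral_eq_integral[OF integrable_fhk_1[OF \<beta>, where 'a='a]] fhk_nonneg[OF \<beta>, where 'a='a]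
    by (simp add: integral_fhk_1[OF \<beta>])
  also have "\<dots> = ennreal (\<bar>t powr (- (1 / \<beta>))\<bar> ^ DIM('a)) * (\<integral>\<^sup>+x. ennreal (fhk \<beta> 1 (0 + t powr (- (1 / \<beta>)) *\<^sub>R x)) \<partial>(lborel :: 'a measure))"
    by (rule nn_integral_lborel_affine) (use t in auto)
  also have "\<dots> = (\<integral>\<^sup>+x. ennreal (t powr (- (real DIM('a) / \<beta>))) * ennreal (fhk \<beta> 1 (t powr (- (1 / \<beta>)) *\<^sub>R x)) \<partial>(lborel :: 'a measure))"
    unfolding powr_pow_scale[OF t] by (subst nn_integral_cmult) auto
  also have "\<dots> = (\<integral>\<^sup>+x. ennreal (fhk \<beta> t x) \<partial>(lborel :: 'a measure))"
    by (intro nn_integral_cong) (simp add: fhk_scale[OF t \<beta>(1)] ennreal_mult')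
  finally show ?thesis by simp
qed

lemma fhk_scale2:
  fixes x :: "'a::euclidean_space"
  assumes t: "0 < t" "0 < l" and \<beta>: "0 < \<beta>"
  shows "fhk \<beta> (t * l) x = t powr (- (real DIM('a) / \<beta>)) * fhk \<beta> l (t powr (- (1 / \<beta>)) *\<^sub>R x)"
proof -
  have "0 < t * l" using t by simp
  then show ?thesis
    unfolding fhk_scale[OF \<open>0 < t * l\<close> \<beta>] fhk_scale[OF t(2) \<beta>] using t
    by (simp add: powr_mult mult_ac)
qed

text \<open>Scheffe's lemma: nonnegative densities of equal mass that converge pointwise converge in
  L^1.\<close>

lemma tendsto_fhk_L1:
  assumes \<beta>: "0 < \<beta>" "\<beta> < 2"
  shows "((\<lambda>l. \<integral>\<^sup>+x. ennreal \<bar>fhk \<beta> l x - fhk \<beta> 1 x\<bar> \<partial>(lborel :: 'a::euclidean_space measure)) \<longlongrightarrow> 0) (at 1 within {0<..})"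
  unfolding tendsto_at_iff_sequentially comp_def
proof (intro allI impI)
  fix X :: "nat \<Rightarrow> real" assume X: "\<forall>i. X i \<in> {0<..} - {1}" "X \<longlonglongrightarrow> 1"
  then have X0: "0 < X i" for i by auto
  have "(\<lambda>n. \<integral>\<^sup>+x. ennreal (norm (fhk \<beta> (X n) x - fhk \<beta> 1 x)) \<partial>(lborel :: 'a measure)) \<longlonglongrightarrow> 0"
  proof (rule Scheffe_lemma2)
    show "fhk \<beta> (X n) \<in> borel_measurable (lborel :: 'a measure)" for n
      using borel_measurable_fhk[OF \<beta>(1) X0[of n], where 'a='a] by simp
    show "integrable lborel (fhk \<beta> 1 :: 'a \<Rightarrow> real)" by (rule integrable_fhk_1[OF \<beta>])
    show "AE x in lborel. (\<lambda>n. fhk \<beta> (X n) x) \<longlonglongrightarrow> fhk \<beta> 1 (x :: 'a)"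
    proof (rule AE_I2)
      fix x :: 'a
      have c: "isCont (fhk \<beta> 1 :: 'a \<Rightarrow> real) y" for y
        using continuous_fhk[OF \<beta>(1), where 'a='a] by (simp add: continuous_on_eq_continuous_at)
      have 1: "(\<lambda>n. X n powr e) \<longlonglongrightarrow> 1" for e
        using tendsto_powr[OF X(2) tendsto_const, of e] by simp
      have "(\<lambda>n. X n powr (- (1 / \<beta>)) *\<^sub>R x) \<longlonglongrightarrow> 1 *\<^sub>R x"
        by (intro tendsto_intros 1)
      then have "(\<lambda>n. fhk \<beta> 1 (X n powr (- (1 / \<beta>)) *\<^sub>R x)) \<longlonglongrightarrow> fhk \<beta> 1 (1 *\<^sub>R x)"
        by (rule isCont_tendsto_compose[OF c])
      then have "(\<lambda>n. X n powr (- (real DIM('a) / \<beta>)) * fhk \<beta> 1 (X n powr (- (1 / \<beta>)) *\<^sub>R x)) \<longlonglongrightarrow> 1 * fhk \<beta> 1 (1 *\<^sub>R x)"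
        by (intro tendsto_mult 1)
      then show "(\<lambda>n. fhk \<beta> (X n) x) \<longlonglongrightarrow> fhk \<beta> 1 x"
        by (simp add: fhk_scale[OF X0 \<beta>(1)])
    qed
    show "(\<integral>\<^sup>+x. ennreal (norm (fhk \<beta> (X n) x)) \<partial>(lborel :: 'a measure)) \<le> (\<integral>\<^sup>+x. ennreal (norm (fhk \<beta> 1 x)) \<partial>(lborel :: 'a measure))" for n
      using fhk_pos_time_nonneg[OF \<beta>, where 'a='a] X0[of n] nn_integral_fhk[OF \<beta> X0[of n], where 'a='a] nn_integral_fhk[OF \<beta> zero_less_one, where 'a='a]
      by simp
  qed
  then show "(\<lambda>n. \<integral>\<^sup>+x. ennreal \<bar>fhk \<beta> (X n) x - fhk \<beta> 1 x\<bar> \<partial>(lborel :: 'a measure)) \<longlonglongrightarrow> 0"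
    by simp
qed

text \<open>By self-similarity the L^1 distance between the kernels at t and t' depends on t'/t
  alone, so continuity at time 1 gives one modulus for all times.\<close>

lemma fhk_L1_continuity:
  assumes \<beta>: "0 < \<beta>" "\<beta> < 2" and e: "0 < e"
  shows "\<exists>d>0. \<forall>t t'. 0 < t \<longrightarrow> 0 < t' \<longrightarrow> \<bar>t' / t - 1\<bar> < d \<longrightarrow>
    (\<integral>\<^sup>+x. ennreal \<bar>fhk \<beta> t' x - fhk \<beta> t x\<bar> \<partial>(lborel :: 'a::euclidean_space measure)) \<le> ennreal e"
proof -
  let ?om = "\<lambda>l. \<integral>\<^sup>+x. ennreal \<bar>fhk \<beta> l x - fhk \<beta> 1 x\<bar> \<partial>(lborel :: 'a measure)"
  have "\<forall>\<^sub>F l in at 1 within {0<..}. ?om l < ennreal e"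
    using e by (intro order_tendstoD(2)[OF tendsto_fhk_L1[OF \<beta>]]) simp
  then obtain d where d: "0 < d" "\<And>l. 0 < l \<Longrightarrow> l \<noteq> 1 \<Longrightarrow> dist l 1 < d \<Longrightarrow> ?om l < ennreal e"
    unfolding eventually_at by auto
  show ?thesis
  proof (intro exI[of _ d] conjI allI impI d(1))
    fix t t' :: real assume t: "0 < t" "0 < t'" and l: "\<bar>t' / t - 1\<bar> < d"
    define l where "l = t' / t"
    have l0: "0 < l" "t' = t * l" using t by (auto simp: l_def)
    have [measurable]: "(fhk \<beta> l :: 'a \<Rightarrow> real) \<in> borel_measurable borel" "(fhk \<beta> 1 :: 'a \<Rightarrow> real) \<in> borel_measurable borel"
      using \<beta> l0 by (auto intro: borel_measurable_fhk)
    have "?om l = ennreal (\<bar>t powr (- (1 / \<beta>))\<bar> ^ DIM('a)) * (\<integral>\<^sup>+x. ennreal \<bar>fhk \<beta> l (0 + t powr (- (1 / \<beta>)) *\<^sub>R x) - fhk \<beta> 1 (0 + t powr (- (1 / \<beta>)) *\<^sub>R x)\<bar> \<partial>(lborel :: 'a measure))"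
      by (rule nn_integral_lborel_affine) (use t in auto)
    also have "\<dots> = (\<integral>\<^sup>+x. ennreal (t powr (- (real DIM('a) / \<beta>))) * ennreal \<bar>fhk \<beta> l (0 + t powr (- (1 / \<beta>)) *\<^sub>R x) - fhk \<beta> 1 (0 + t powr (- (1 / \<beta>)) *\<^sub>R x)\<bar> \<partial>(lborel :: 'a measure))"
      unfolding powr_pow_scale[OF t(1)] by (subst nn_integral_cmult) auto
    also have "\<dots> = (\<integral>\<^sup>+x. ennreal \<bar>fhk \<beta> t' x - fhk \<beta> t x\<bar> \<partial>(lborel :: 'a measure))"
    proof (intro nn_integral_cong)
      fix x :: 'a
      have "fhk \<beta> t' x - fhk \<beta> t x = t powr (- (real DIM('a) / \<beta>)) * (fhk \<beta> l (t powr (- (1 / \<beta>)) *\<^sub>R x) - fhk \<beta> 1 (t powr (- (1 / \<beta>)) *\<^sub>R x))"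
        unfolding l0(2) fhk_scale2[OF t(1) l0(1) \<beta>(1)] fhk_scale[OF t(1) \<beta>(1)] by (simp add: right_diff_distrib)
      then show "ennreal (t powr (- (real DIM('a) / \<beta>))) * ennreal \<bar>fhk \<beta> l (0 + t powr (- (1 / \<beta>)) *\<^sub>R x) - fhk \<beta> 1 (0 + t powr (- (1 / \<beta>)) *\<^sub>R x)\<bar>
         = ennreal \<bar>fhk \<beta> t' x - fhk \<beta> t x\<bar>"
        by (simp add: abs_mult ennreal_mult')
    qed
    finally have "(\<integral>\<^sup>+x. ennreal \<bar>fhk \<beta> t' x - fhk \<beta> t x\<bar> \<partial>(lborel :: 'a measure)) = ?om l" ..
    also have "\<dots> \<le> ennreal e"
    proof (cases "l = 1")
      case False
      then show ?thesis using d(2)[OF l0(1) False] l by (simp add: dist_real_def l_def less_imp_le)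
    qed simp
    finally show "(\<integral>\<^sup>+x. ennreal \<bar>fhk \<beta> t' x - fhk \<beta> t x\<bar> \<partial>(lborel :: 'a measure)) \<le> ennreal e" .
  qed
qed

text \<open>After y = t^(1/\<beta>) z the kernel is fixed and the argument of \<Psi> shrinks to 0,
  so dominated convergence applies.\<close>

lemma fhk_approx_identity:
  fixes \<Psi> :: "'a::euclidean_space \<Rightarrow> real"
  assumes \<beta>: "0 < \<beta>" "\<beta> < 2" and [measurable]: "\<Psi> \<in> borel_measurable borel"
    and B: "\<And>y. \<bar>\<Psi> y\<bar> \<le> B" and cont: "isCont \<Psi> 0"
  shows "((\<lambda>t. \<integral>y. fhk \<beta> t y * \<Psi> y \<partial>lborel) \<longlongrightarrow> \<Psi> 0) (at_right 0)"
  unfolding tendsto_at_iff_sequentially comp_def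
proof (intro allI impI)
  fix X :: "nat \<Rightarrow> real" assume X: "\<forall>i. X i \<in> {0<..} - {0}" "X \<longlonglongrightarrow> 0"
  then have X0: "0 < X i" for i by auto
  note [measurable] = borel_measurable_fhk_1[OF \<beta>(1), where 'a='a]
  have eq: "(\<integral>y. fhk \<beta> (X i) y * \<Psi> y \<partial>lborel) = (\<integral>z. fhk \<beta> 1 z * \<Psi> (X i powr (1 / \<beta>) *\<^sub>R z) \<partial>lborel)" for i
  proof -
    define k where "k = X i powr (1 / \<beta>)"
    have k: "0 < k" "k \<noteq> 0" "X i powr (- (1 / \<beta>)) * k = 1" using X0[of i] by (auto simp: k_def powr_minus)
    note [measurable] = borel_measurable_fhk[OF \<beta>(1) X0[of i], where 'a='a]
    have "(\<integral>y. fhk \<beta> (X i) y * \<Psi> y \<partial>lborel) = \<bar>k\<bar> ^ DIM('a) * (\<integral>z. fhk \<beta> (X i) (0 + k *\<^sub>R z) * \<Psi> (0 + k *\<^sub>R z) \<partial>lborel)"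
      by (rule integral_lborel_affine) (use k in auto)
    also have "\<dots> = (\<integral>z. \<bar>k\<bar> ^ DIM('a) * (fhk \<beta> (X i) (0 + k *\<^sub>R z) * \<Psi> (0 + k *\<^sub>R z)) \<partial>lborel)"
      by simp
    also have "\<dots> = (\<integral>z. fhk \<beta> 1 z * \<Psi> (k *\<^sub>R z) \<partial>lborel)"
    proof (intro Bochner_Integration.integral_cong refl)
      fix z :: 'a
      have 1: "\<bar>k\<bar> ^ DIM('a) = X i powr (real DIM('a) / \<beta>)"
        using powr_pow_scale[OF X0[of i], of "- \<beta>" "DIM('a)"] by (simp add: k_def)
      have 2: "\<bar>k\<bar> ^ DIM('a) * X i powr (- (real DIM('a) / \<beta>)) = 1"
        unfolding 1 using X0[of i] by (simp add: powr_minus)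
      have 3: "fhk \<beta> (X i) (k *\<^sub>R z) = X i powr (- (real DIM('a) / \<beta>)) * fhk \<beta> 1 z"
        unfolding fhk_scale[OF X0 \<beta>(1)] by (simp add: k(3))
      show "\<bar>k\<bar> ^ DIM('a) * (fhk \<beta> (X i) (0 + k *\<^sub>R z) * \<Psi> (0 + k *\<^sub>R z)) = fhk \<beta> 1 z * \<Psi> (k *\<^sub>R z)"
        unfolding add_0_left 3 using 2 by (metis mult.assoc mult_1)
    qed
    finally show ?thesis by (simp add: k_def)
  qed
  have "(\<lambda>i. \<integral>z. fhk \<beta> 1 z * \<Psi> (X i powr (1 / \<beta>) *\<^sub>R z) \<partial>lborel) \<longlonglongrightarrow> (\<integral>z. fhk \<beta> 1 z * \<Psi> 0 \<partial>(lborel :: 'a measure))"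
  proof (rule integral_dominated_convergence[where w="\<lambda>z. fhk \<beta> 1 z * B"])
    show "integrable lborel (\<lambda>z::'a. fhk \<beta> 1 z * B)"
      by (intro integrable_mult_left integrable_fhk_1[OF \<beta>])
    show "AE z in lborel. (\<lambda>i. fhk \<beta> 1 z * \<Psi> (X i powr (1 / \<beta>) *\<^sub>R z)) \<longlonglongrightarrow> fhk \<beta> 1 z * \<Psi> 0"
    proof (rule AE_I2)
      fix z :: 'a
      have "(\<lambda>i. X i powr (1 / \<beta>)) \<longlonglongrightarrow> 0 powr (1 / \<beta>)"
        using \<beta> X0 by (intro tendsto_powr' X tendsto_const) (auto intro!: always_eventually simp: less_imp_le)
      then have "(\<lambda>i. X i powr (1 / \<beta>) *\<^sub>R z) \<longlonglongrightarrow> 0 *\<^sub>R z" by (intro tendsto_scaleR tendsto_const) simp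
      then have "(\<lambda>i. X i powr (1 / \<beta>) *\<^sub>R z) \<longlonglongrightarrow> 0" by simp
      from isCont_tendsto_compose[OF cont this]
      show "(\<lambda>i. fhk \<beta> 1 z * \<Psi> (X i powr (1 / \<beta>) *\<^sub>R z)) \<longlonglongrightarrow> fhk \<beta> 1 z * \<Psi> 0"
        by (intro tendsto_mult tendsto_const)
    qed
    show "AE z in lborel. norm (fhk \<beta> 1 z * \<Psi> (X i powr (1 / \<beta>) *\<^sub>R z)) \<le> fhk \<beta> 1 z * B" for i
      using fhk_nonneg[OF \<beta>, where 'a='a] by (intro AE_I2) (auto simp: abs_mult intro!: mult_left_mono B)
  qed measurable
  then show "(\<lambda>i. \<integral>y. fhk \<beta> (X i) y * \<Psi> y \<partial>lborel) \<longlonglongrightarrow> \<Psi> 0"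
    unfolding eq by (simp add: integral_fhk_1[OF \<beta>])
qed

lemma fhk_jointly_measurable:
  assumes \<beta>: "0 < \<beta>"
  shows "(\<lambda>(t, x::'a::euclidean_space). if 0 < t then fhk \<beta> t x else 0) \<in> borel_measurable (borel \<Otimes>\<^sub>M borel)"
proof -
  note [measurable] = borel_measurable_fhk_1[OF \<beta>, where 'a='a]
  have eq: "(\<lambda>(t, x::'a). if 0 < t then fhk \<beta> t x else 0) = (\<lambda>(t, x). if 0 < t then t powr (- (real DIM('a) / \<beta>)) * fhk \<beta> 1 (t powr (- (1 / \<beta>)) *\<^sub>R x) else 0)"
    by (intro ext, clarify, rule if_cong) (auto intro: fhk_scale[OF _ \<beta>])
  show ?thesis unfolding eq by measurable
qed

lemma frac_heat_kernel_eq_fhk: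
  fixes x :: "real ^ 'n"
  assumes t: "0 < t" and \<beta>: "0 < \<beta>"
  shows "frac_heat_kernel \<beta> t x = fhk \<beta> t x"
proof -
  let ?g = "\<lambda>\<xi>. exp (\<i> * complex_of_real (x \<bullet> \<xi>) - complex_of_real (t * norm \<xi> powr \<beta>))"
  have [measurable]: "?g \<in> borel_measurable borel" by measurable
  have re: "Re (?g \<xi>) = cos (x \<bullet> \<xi>) * exp (- (t * norm \<xi> powr \<beta>))" for \<xi>
    by (simp add: Re_exp mult.commute)
  have n: "norm (?g \<xi>) = exp (- (t * norm \<xi> powr \<beta>))" for \<xi>
    by (simp add: norm_exp_eq_Re)
  have int: "integrable lborel ?g"
    by (rule Bochner_Integration.integrable_bound[OF integrable_exp_norm_powr[OF assms]]) (auto simp: n)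
  have "(\<integral>\<xi>. ?g \<xi> \<partial>lebesgue) = (\<integral>\<xi>. ?g \<xi> \<partial>lborel)" by (rule integral_completion) simp
  then have "Re (\<integral>\<xi>. ?g \<xi> \<partial>lebesgue) = (\<integral>\<xi>. Re (?g \<xi>) \<partial>lborel)" using integral_Re[OF int] by simp
  then show ?thesis unfolding frac_heat_kernel_def fhk_def re by simp
qed

section \<open>Convolution estimates\<close>

text \<open>The weighted arithmetic-geometric mean with a third entry equal to 1, from the two-term
  inequality used twice: with the normalised weights a/s and b/s, then for v^s 1^(1-s).\<close>

lemma young_three:
  fixes x y a b :: real
  assumes "0 \<le> x" "0 \<le> y" and a: "0 < a" "0 < b" "a + b \<le> 1"
  shows "x powr a * y powr b \<le> a * x + b * y + (1 - a - b)"
proof (cases "x = 0 \<or> y = 0")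
  case True
  have "0 \<le> a * x" "0 \<le> b * y" using assms by auto
  moreover have "x powr a * y powr b = 0" using True by auto
  ultimately show ?thesis using a by linarith
next
  case False
  then have xy: "0 < x" "0 < y" using assms by auto
  define s where "s = a + b"
  define v where "v = a / s * x + b / s * y"
  have s: "0 < s" "s \<le> 1" using a by (auto simp: s_def)
  have v: "0 < v" using xy a s unfolding v_def by (intro add_pos_pos mult_pos_pos divide_pos_pos)
  have "x powr (a / s) * y powr (b / s) \<le> v"
    unfolding v_def using a s xy by (intro Youngs_inequality_0) (auto simp: s_def simp flip: add_divide_distrib)
  then have "(x powr (a / s) * y powr (b / s)) powr s \<le> v powr s"
    using s by (intro powr_mono2) auto
  also have "(x powr (a / s) * y powr (b / s)) powr s = x powr a * y powr b"
    using s by (simp add: powr_mult powr_powr)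
  also have "v powr s \<le> s * v + (1 - s)"
    using Youngs_inequality_0[of s "1 - s" v 1] s v by simp
  also have "s * v = a * x + b * y" using s by (simp add: v_def field_simps)
  finally show ?thesis by (simp add: s_def)
qed

text \<open>Hoelder's inequality for p, R and the complementary exponent against the density
  \<open>k\<close>. Only upper bounds A, q, r are given, so each factor is normalised by its bound
  before the pointwise inequality is integrated.\<close>

lemma nn_integral_holder3:
  fixes k w H :: "'b \<Rightarrow> real"
  assumes [measurable]: "k \<in> borel_measurable M" "w \<in> borel_measurable M" "H \<in> borel_measurable M"
    and nn: "\<And>x. 0 \<le> k x" "\<And>x. 0 \<le> w x" "\<And>x. 0 \<le> H x"
    and pR: "0 < p" "0 < R" "1 / p + 1 / R \<le> 1" and A: "0 < A" and r: "0 < r" and q: "0 \<le> q"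
    and Ak: "(\<integral>\<^sup>+x. ennreal (k x) \<partial>M) \<le> ennreal A"
    and qk: "(\<integral>\<^sup>+x. ennreal (k x * w x powr p) \<partial>M) \<le> ennreal q"
    and rk: "(\<integral>\<^sup>+x. ennreal (k x * H x powr R) \<partial>M) \<le> ennreal r"
  shows "(\<integral>\<^sup>+x. ennreal (k x * w x * H x) \<partial>M) \<le> ennreal (A powr (1 - 1 / p - 1 / R) * q powr (1 / p) * r powr (1 / R))"
proof (cases "q = 0")
  \<comment> \<open>A vanishing bound cannot normalise; in this case the product itself vanishes
    almost everywhere.\<close>
  case True
  then have "(\<integral>\<^sup>+x. ennreal (k x * w x powr p) \<partial>M) = 0" using qk by simp
  then have "AE x in M. ennreal (k x * w x powr p) = 0" by (subst (asm) nn_integral_0_iff_AE) auto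
  then have "AE x in M. ennreal (k x * w x * H x) = 0"
  proof eventually_elim
    case (elim x)
    have "0 \<le> k x * w x powr p" using nn(1)[of x] by simp
    moreover have "k x * w x powr p \<le> 0" using elim by (rule ennreal_eq_0_iff[THEN iffD1])
    ultimately have "k x * w x powr p = 0" by linarith
    then show ?case by auto
  qed
  then have "(\<integral>\<^sup>+x. ennreal (k x * w x * H x) \<partial>M) = 0" by (subst nn_integral_0_iff_AE) auto
  then show ?thesis by simp
next
  case False
  then have q: "0 < q" using q by simp
  define c where "c = 1 - 1 / p - 1 / R"
  define C where "C = A powr c * q powr (1 / p) * r powr (1 / R)"
  have C: "0 < C" using A q r by (simp add: C_def)
  have c: "0 \<le> c" using pR by (simp add: c_def)
  \<comment> \<open>Each coefficient is such that its term contributes the share 1/p, 1/R or c of C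
    after integration; these shares add up to 1.\<close>
  define c1 where "c1 = C / A * (1 / p * (A / q))"
  define c2 where "c2 = C / A * (1 / R * (A / r))"
  define c3 where "c3 = C / A * c"
  have cs: "0 \<le> c1" "0 \<le> c2" "0 \<le> c3"
    using C A q r pR c by (auto simp: c1_def c2_def c3_def)
  have pw: "k x * w x * H x \<le> c1 * (k x * w x powr p) + c2 * (k x * H x powr R) + c3 * k x" for x
  proof -
    have 1: "(A / q * w x powr p) powr (1 / p) = (A / q) powr (1 / p) * w x"
      using A q nn(2)[of x] pR by (subst powr_mult) (auto simp: powr_powr simp del: times_divide_eq_left)
    have 2: "(A / r * H x powr R) powr (1 / R) = (A / r) powr (1 / R) * H x"
      using A r nn(3)[of x] pR by (subst powr_mult) (auto simp: powr_powr simp del: times_divide_eq_left)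
    have 3: "C / A * ((A / q) powr (1 / p) * (A / r) powr (1 / R)) = 1"
    proof -
      have "A powr c * A powr (1 / p) * A powr (1 / R) = A"
        using A by (simp add: c_def flip: powr_add)
      then show ?thesis
        using A q r by (simp add: C_def powr_divide field_simps)
    qed
    have "w x * H x = C / A * ((A / q * w x powr p) powr (1 / p) * (A / r * H x powr R) powr (1 / R))"
      unfolding 1 2 using 3 by (metis (no_types, lifting) mult.assoc mult.commute mult_1)
    also have "\<dots> \<le> C / A * (1 / p * (A / q * w x powr p) + 1 / R * (A / r * H x powr R) + (1 - 1 / p - 1 / R))"
      using A q r C pR by (intro mult_left_mono young_three) auto
    also have "\<dots> = c1 * w x powr p + c2 * H x powr R + c3"
      by (simp add: c1_def c2_def c3_def c_def algebra_simps)
    finally have "k x * (w x * H x) \<le> k x * (c1 * w x powr p + c2 * H x powr R + c3)"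
      using nn(1) by (rule mult_left_mono)
    then show ?thesis by (simp add: algebra_simps)
  qed
  have "(\<integral>\<^sup>+x. ennreal (k x * w x * H x) \<partial>M)
    \<le> (\<integral>\<^sup>+x. ennreal c1 * ennreal (k x * w x powr p) + ennreal c2 * ennreal (k x * H x powr R) + ennreal c3 * ennreal (k x) \<partial>M)"
  proof (rule nn_integral_mono)
    fix x
    have "ennreal (k x * w x * H x) \<le> ennreal (c1 * (k x * w x powr p) + c2 * (k x * H x powr R) + c3 * k x)"
      by (rule ennreal_leI[OF pw])
    then show "ennreal (k x * w x * H x) \<le> ennreal c1 * ennreal (k x * w x powr p) + ennreal c2 * ennreal (k x * H x powr R) + ennreal c3 * ennreal (k x)"
      using cs nn[of x] by (simp add: ennreal_plus ennreal_mult)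
  qed
  also have "\<dots> = ennreal c1 * (\<integral>\<^sup>+x. ennreal (k x * w x powr p) \<partial>M) + ennreal c2 * (\<integral>\<^sup>+x. ennreal (k x * H x powr R) \<partial>M) + ennreal c3 * (\<integral>\<^sup>+x. ennreal (k x) \<partial>M)"
    by (simp add: nn_integral_add nn_integral_cmult)
  also have "\<dots> \<le> ennreal c1 * ennreal q + ennreal c2 * ennreal r + ennreal c3 * ennreal A"
    by (intro add_mono mult_left_mono Ak qk rk) auto
  also have "\<dots> = ennreal (c1 * q + c2 * r + c3 * A)"
    using cs q r A by (simp add: ennreal_plus ennreal_mult)
  also have "c1 * q + c2 * r + c3 * A = C * (1 / p + 1 / R + c)"
    using A q r by (simp add: c1_def c2_def c3_def field_simps)
  also have "\<dots> = C" by (simp add: c_def)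
  finally show ?thesis by (simp add: C_def c_def)
qed

text \<open>The preceding inequality with H = 1 and R conjugate to p, which makes the complementary
  exponent vanish.\<close>

lemma nn_integral_jensen_powr:
  fixes k w :: "'b \<Rightarrow> real"
  assumes [measurable]: "k \<in> borel_measurable M" "w \<in> borel_measurable M"
    and nn: "\<And>x. 0 \<le> k x" "\<And>x. 0 \<le> w x"
    and p: "1 < p" and A: "0 < A" and q: "0 \<le> q"
    and Ak: "(\<integral>\<^sup>+x. ennreal (k x) \<partial>M) \<le> ennreal A"
    and qk: "(\<integral>\<^sup>+x. ennreal (k x * w x powr p) \<partial>M) \<le> ennreal q"
  shows "(\<integral>\<^sup>+x. ennreal (k x * w x) \<partial>M) \<le> ennreal (A powr (1 - 1 / p) * q powr (1 / p))"
proof -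
  define R where "R = p / (p - 1)"
  have R: "0 < R" "1 / R = 1 - 1 / p" using p by (auto simp: R_def field_simps)
  have "(\<integral>\<^sup>+x. ennreal (k x * w x * 1) \<partial>M) \<le> ennreal (A powr (1 - 1 / p - 1 / R) * q powr (1 / p) * A powr (1 / R))"
    by (rule nn_integral_holder3) (use assms R in auto)
  then show ?thesis using A by (simp add: R mult.commute)
qed

text \<open>When f is not integrable the Bochner integral is 0 by convention, and the bound is
  trivial.\<close>

lemma ennreal_abs_integral_le: "ennreal \<bar>\<integral>x. f x \<partial>M\<bar> \<le> (\<integral>\<^sup>+x. ennreal \<bar>f x\<bar> \<partial>M)" for f :: "'b \<Rightarrow> real"
proof (cases "integrable M f")
  case True
  then show ?thesis using integral_norm_bound_ennreal[OF True] by simp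
next
  case False
  then show ?thesis by (simp add: not_integrable_integral_eq)
qed

lemma le_enn_powr:
  assumes "ennreal a \<le> ennreal (C * q powr (1 / p))" "0 \<le> a" "0 \<le> C" "0 \<le> q" "0 < p"
  shows "a powr p \<le> C powr p * q"
proof -
  have "a \<le> C * q powr (1 / p)" using assms by (subst (asm) ennreal_le_iff) auto
  then have "a powr p \<le> (C * q powr (1 / p)) powr p" using assms by (intro powr_mono2) auto
  then show ?thesis using assms by (simp add: powr_mult powr_powr)
qed

text \<open>In the factor with H the kernel is replaced by its supremum B; in the factor with w it
  is kept, so that q may come either from a bound on w or from its L^p norm.\<close>

lemma conv_core:
  fixes k g w H :: "'a::euclidean_space \<Rightarrow> real"
  assumes [measurable]: "k \<in> borel_measurable borel" "g \<in> borel_measurable borel" "w \<in> borel_measurable borel" "H \<in> borel_measurable borel"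
    and nn: "\<And>x. 0 \<le> k x" "\<And>x. 0 \<le> w x" "\<And>x. 0 \<le> H x"
    and pR: "0 < p" "0 < R" "1 / p + 1 / R \<le> 1" and A: "0 < A" and r: "0 < r" and B: "0 < B"
    and Ak: "(\<integral>\<^sup>+x. ennreal (k x) \<partial>lborel) \<le> ennreal A" and kB: "\<And>x. k x \<le> B"
    and rH: "(\<integral>\<^sup>+x. ennreal (H x powr R) \<partial>lborel) \<le> ennreal r"
    and g: "\<And>y. \<bar>g y\<bar> \<le> w y * H y"
    and q: "0 \<le> q" and qk: "(\<integral>\<^sup>+y. ennreal (k (x - y) * w y powr p) \<partial>lborel) \<le> ennreal q"
  shows "(\<integral>\<^sup>+y. ennreal \<bar>k (x - y) * g y\<bar> \<partial>lborel) \<le> ennreal (A powr (1 - 1 / p - 1 / R) * q powr (1 / p) * (B * r) powr (1 / R))"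
proof -
  have "(\<integral>\<^sup>+y. ennreal \<bar>k (x - y) * g y\<bar> \<partial>lborel) \<le> (\<integral>\<^sup>+y. ennreal (k (x - y) * w y * H y) \<partial>lborel)"
    using nn(1) g by (intro nn_integral_mono ennreal_leI) (auto simp: abs_mult mult.assoc intro!: mult_left_mono)
  also have "\<dots> \<le> ennreal (A powr (1 - 1 / p - 1 / R) * q powr (1 / p) * (B * r) powr (1 / R))"
  proof (rule nn_integral_holder3)
    show "(\<integral>\<^sup>+y. ennreal (k (x - y)) \<partial>lborel) \<le> ennreal A"
      using Ak by (subst nn_integral_lborel_reflect) auto
    have "(\<integral>\<^sup>+y. ennreal (k (x - y) * H y powr R) \<partial>lborel) \<le> (\<integral>\<^sup>+y. ennreal B * ennreal (H y powr R) \<partial>lborel)"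
      using nn kB B by (intro nn_integral_mono) (auto simp flip: ennreal_mult intro!: ennreal_leI mult_right_mono)
    also have "\<dots> = ennreal B * (\<integral>\<^sup>+y. ennreal (H y powr R) \<partial>lborel)" by (rule nn_integral_cmult) simp
    also have "\<dots> \<le> ennreal B * ennreal r" by (intro mult_left_mono rH) simp
    finally show "(\<integral>\<^sup>+y. ennreal (k (x - y) * H y powr R) \<partial>lborel) \<le> ennreal (B * r)"
      using B r by (simp add: ennreal_mult)
  qed (use assms in auto)
  finally show ?thesis .
qed

lemma nn_integral_conv:
  fixes k w :: "'a::euclidean_space \<Rightarrow> real"
  assumes [measurable]: "k \<in> borel_measurable borel" "w \<in> borel_measurable borel"
    and nn: "\<And>x. 0 \<le> k x" "\<And>x. 0 \<le> w x"
  shows "(\<integral>\<^sup>+x. (\<integral>\<^sup>+y. ennreal (k (x - y) * w y) \<partial>lborel) \<partial>lborel) = (\<integral>\<^sup>+x. ennreal (k x) \<partial>lborel) * (\<integral>\<^sup>+y. ennreal (w y) \<partial>lborel)"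
proof -
  have "(\<integral>\<^sup>+x. (\<integral>\<^sup>+y. ennreal (k (x - y) * w y) \<partial>lborel) \<partial>lborel) = (\<integral>\<^sup>+y. (\<integral>\<^sup>+x. ennreal (k (x - y) * w y) \<partial>lborel) \<partial>lborel)"
    by (rule lborel_pair.Fubini'[symmetric]) measurable
  also have "\<dots> = (\<integral>\<^sup>+y. (\<integral>\<^sup>+x. ennreal (k x) \<partial>lborel) * ennreal (w y) \<partial>lborel)"
    using nn by (intro nn_integral_cong) (simp add: ennreal_mult nn_integral_multc nn_integral_lborel_shift'[of "\<lambda>x. ennreal (k x)"])
  also have "\<dots> = (\<integral>\<^sup>+x. ennreal (k x) \<partial>lborel) * (\<integral>\<^sup>+y. ennreal (w y) \<partial>lborel)"
    by (rule nn_integral_cmult) simp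
  finally show ?thesis .
qed

text \<open>Young's inequality for convolutions: the pointwise bound of |v|^p by a convolution of k
  with |w|^p is integrated in x, and Fubini extracts the mass of k.\<close>

lemma nn_integral_powr_conv_le:
  fixes k v Q :: "'a::euclidean_space \<Rightarrow> real"
  assumes [measurable]: "k \<in> borel_measurable borel" "w \<in> borel_measurable borel" "v \<in> borel_measurable borel"
    and nn: "\<And>x. 0 \<le> k x" and A: "0 \<le> A" and C: "0 \<le> C" and W: "0 \<le> W" and p: "0 < p"
    and Ak: "(\<integral>\<^sup>+x. ennreal (k x) \<partial>lborel) \<le> ennreal A"
    and w: "(\<integral>\<^sup>+x. ennreal (\<bar>w x\<bar> powr p) \<partial>lborel) \<le> ennreal (W powr p)"
    and v: "\<And>x. ennreal (\<bar>v x\<bar> powr p) \<le> ennreal (C powr p) * (\<integral>\<^sup>+y. ennreal (k (x - y) * \<bar>w y\<bar> powr p) \<partial>lborel)"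
  shows "(\<integral>\<^sup>+x. ennreal (\<bar>v x\<bar> powr p) \<partial>lborel) \<le> ennreal ((C * A powr (1 / p) * W) powr p)"
proof -
  have "(\<integral>\<^sup>+x. ennreal (\<bar>v x\<bar> powr p) \<partial>lborel) \<le> (\<integral>\<^sup>+x. ennreal (C powr p) * (\<integral>\<^sup>+y. ennreal (k (x - y) * \<bar>w y\<bar> powr p) \<partial>lborel) \<partial>lborel)"
    by (intro nn_integral_mono v)
  also have "\<dots> = ennreal (C powr p) * (\<integral>\<^sup>+x. (\<integral>\<^sup>+y. ennreal (k (x - y) * \<bar>w y\<bar> powr p) \<partial>lborel) \<partial>lborel)"
    by (intro nn_integral_cmult) measurable
  also have "\<dots> = ennreal (C powr p) * ((\<integral>\<^sup>+x. ennreal (k x) \<partial>lborel) * (\<integral>\<^sup>+y. ennreal (\<bar>w y\<bar> powr p) \<partial>lborel))"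
    using nn by (subst nn_integral_conv) auto
  also have "\<dots> \<le> ennreal (C powr p) * (ennreal A * ennreal (W powr p))"
    by (intro mult_mono Ak w) auto
  also have "\<dots> = ennreal ((C * A powr (1 / p) * W) powr p)"
    using A C W p by (simp add: powr_mult powr_powr ennreal_mult mult.assoc)
  finally show ?thesis .
qed

section \<open>The Duhamel integral\<close>

text \<open>What the fixed point argument uses of the fractional kernel. Continuity is phrased
  through t'/t, as self-similarity provides it. Nonnegativity and joint measurability concern all
  real t, so an instance has to extend the kernel to t <= 0.\<close>

locale smoothing_kernel =
  fixes S :: "real \<Rightarrow> 'a::euclidean_space \<Rightarrow> real" and c \<nu> :: real
  assumes S_measurable [measurable]: "(\<lambda>(t, x). S t x) \<in> borel_measurable (borel \<Otimes>\<^sub>M borel)"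
    and S_nonneg: "\<And>t x. 0 \<le> S t x"
    and S_mass: "\<And>t. 0 < t \<Longrightarrow> (\<integral>\<^sup>+x. ennreal (S t x) \<partial>lborel) = 1"
    and S_le: "\<And>t x. 0 < t \<Longrightarrow> S t x \<le> c * t powr (- \<nu>)"
    and c_pos: "0 < c" and nu_pos: "0 < \<nu>"
    and S_L1_cont: "\<And>e. 0 < e \<Longrightarrow> \<exists>d>0. \<forall>t t'. 0 < t \<longrightarrow> 0 < t' \<longrightarrow> \<bar>t' / t - 1\<bar> < d \<longrightarrow>
          (\<integral>\<^sup>+x. ennreal \<bar>S t' x - S t x\<bar> \<partial>lborel) \<le> ennreal e"
    and S_approx: "\<And>\<Psi> B. \<Psi> \<in> borel_measurable borel \<Longrightarrow> (\<And>y. \<bar>\<Psi> y\<bar> \<le> B) \<Longrightarrow> isCont \<Psi> 0 \<Longrightarrow>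
          ((\<lambda>t. \<integral>y. S t y * \<Psi> y \<partial>lborel) \<longlongrightarrow> \<Psi> 0) (at_right 0)"
begin

lemma S_borel [measurable]: "S t \<in> borel_measurable borel"
  using measurable_compose[OF _ S_measurable, of "\<lambda>x. (t, x)" borel] by simp

lemma S_mass_reflect: "0 < t \<Longrightarrow> (\<integral>\<^sup>+y. ennreal (S t (x - y)) \<partial>lborel) = 1"
  using S_mass by (subst nn_integral_lborel_reflect[of "\<lambda>y. ennreal (S t y)"]) auto

definition heat :: "real \<Rightarrow> ('a \<Rightarrow> real) \<Rightarrow> 'a \<Rightarrow> real" where
  "heat t g x = (\<integral>y. S t (x - y) * g y \<partial>lborel)"

text \<open>The time integral is taken separately at each x; \<open>bochner_of_cont\<close> later
  identifies it with the Bochner integral in exp L^p.\<close>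

definition duhamel :: "(real \<Rightarrow> 'a \<Rightarrow> real) \<Rightarrow> real \<Rightarrow> 'a \<Rightarrow> real" where
  "duhamel g t x = (\<integral>s. indicator {0<..<t} s * heat (t - s) (g s) x \<partial>lborel)"

end

text \<open>R > \<nu> makes the time singularity integrable, 1/p + 1/R <= 1 is the room for
  Hoelder's inequality, and \<alpha> <= \<nu>/p is the hypothesis p <= n(m-1)/\<beta>.\<close>

locale smoothing = smoothing_kernel S c \<nu> for S :: "real \<Rightarrow> 'a::euclidean_space \<Rightarrow> real" and c \<nu> +
  fixes p R \<alpha> :: real
  assumes p: "1 < p" and R: "\<nu> < R" and pR: "1 / p + 1 / R \<le> 1" and al: "0 < \<alpha>" "\<alpha> \<le> \<nu> / p"
begin

definition \<delta> :: real where "\<delta> = \<nu> / R"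

lemma R_pos: "0 < R" and del: "0 < \<delta>" "\<delta> < 1" and del_R: "\<delta> * R = \<nu>"
  using R nu_pos by (auto simp: \<delta>_def)

definition tk :: "real \<Rightarrow> real \<Rightarrow> real" where
  "tk t s = (t - s) powr (- \<delta>) * (1 + s) powr (\<delta> - 1)"

definition B1 :: real where "B1 = Beta \<delta> (1 - \<delta>)"

lemma B1_pos: "0 < B1" using del by (simp add: B1_def Beta_def)

lemma tk_measurable [measurable]: "(\<lambda>x. tk t x) \<in> borel_measurable borel"
  unfolding tk_def by measurable

lemma tk_nonneg: "0 \<le> tk t s" by (simp add: tk_def)

lemma tk_pos: "0 < s \<Longrightarrow> s < t \<Longrightarrow> 0 < tk t s" by (simp add: tk_def)

text \<open>As \<delta> < 1, the factor (1+s)^(\<delta>-1) is at most s^(\<delta>-1). The exponents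
  then sum to -1, so s = t z removes t and leaves the Beta integral.\<close>

lemma tk_integral:
  assumes t: "0 < t"
  shows "(\<integral>\<^sup>+s. ennreal (indicator {0<..<t} s * tk t s) \<partial>lborel) \<le> ennreal B1"
proof -
  let ?f = "\<lambda>s. ennreal (indicator {0<..<t} s * ((t - s) powr (- \<delta>) * s powr (\<delta> - 1)))"
  have "(\<integral>\<^sup>+s. ennreal (indicator {0<..<t} s * tk t s) \<partial>lborel) \<le> (\<integral>\<^sup>+s. ?f s \<partial>lborel)"
    using del by (intro nn_integral_mono ennreal_leI)
      (auto simp: tk_def indicator_def intro!: mult_left_mono powr_mono2')
  also have "\<dots> = ennreal \<bar>t\<bar> * (\<integral>\<^sup>+z. ?f (0 + t * z) \<partial>lborel)"
    by (rule nn_integral_real_affine) (use t in auto)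
  also have "\<dots> = (\<integral>\<^sup>+z. ennreal \<bar>t\<bar> * ?f (0 + t * z) \<partial>lborel)"
    by (subst nn_integral_cmult) auto
  also have "\<dots> \<le> (\<integral>\<^sup>+z. ennreal (z powr (\<delta> - 1) * (1 - z) powr ((1 - \<delta>) - 1)) * indicator {0..1} z \<partial>lborel)"
  proof (rule nn_integral_mono)
    fix z :: real
    show "ennreal \<bar>t\<bar> * ?f (0 + t * z) \<le> ennreal (z powr (\<delta> - 1) * (1 - z) powr ((1 - \<delta>) - 1)) * indicator {0..1} z"
    proof (cases "0 < z \<and> z < 1")
      case True
      have 1: "t - t * z = t * (1 - z)" by (simp add: algebra_simps)
      have "t * ((t - t * z) powr (- \<delta>) * (t * z) powr (\<delta> - 1)) = z powr (\<delta> - 1) * (1 - z) powr (- \<delta>)"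
      proof -
        have "(t * (1 - z)) powr (- \<delta>) = t powr (- \<delta>) * (1 - z) powr (- \<delta>)"
          "(t * z) powr (\<delta> - 1) = t powr (\<delta> - 1) * z powr (\<delta> - 1)"
          using t True by (auto simp: powr_mult)
        moreover have "t * (t powr (- \<delta>) * t powr (\<delta> - 1)) = 1"
        proof -
          have "t powr 1 * t powr (- \<delta>) * t powr (\<delta> - 1) = 1"
            using t by (simp only: powr_add[symmetric]) simp
          then show ?thesis using t by (simp only: powr_one[OF less_imp_le[OF t]] mult.assoc)
        qed
        ultimately show ?thesis unfolding 1 by (simp add: mult_ac)
      qed
      then show ?thesis using True t by (simp flip: ennreal_mult')
    next
      case False
      then have "t * z \<notin> {0<..<t}" using t by (auto simp: zero_less_mult_iff)
      then show ?thesis by simp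
    qed
  qed
  also have "\<dots> = ennreal B1" unfolding B1_def
    by (rule nn_integral_has_integral_lebesgue'[OF _ has_integral_Beta_real]) (use del in auto)
  finally show ?thesis .
qed

end

section \<open>Bounds in the intersection of L^infinity and L^p\<close>

text \<open>A ball with two separate radii, because only the supremum decays in time. A relation
  instead of a norm makes finiteness part of every statement, and the supremum is over all points,
  not up to null sets.\<close>

definition Lb :: "real \<Rightarrow> real \<Rightarrow> real \<Rightarrow> ('a::euclidean_space \<Rightarrow> real) \<Rightarrow> bool" where
  "Lb p V W v \<longleftrightarrow> v \<in> borel_measurable borel \<and> (\<forall>x. \<bar>v x\<bar> \<le> V) \<and>
     (\<integral>\<^sup>+x. ennreal (\<bar>v x\<bar> powr p) \<partial>lborel) \<le> ennreal (W powr p)"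

lemma LbD:
  assumes "Lb p V W v"
  shows "v \<in> borel_measurable borel" "\<bar>v x\<bar> \<le> V" "(\<integral>\<^sup>+x. ennreal (\<bar>v x\<bar> powr p) \<partial>lborel) \<le> ennreal (W powr p)" "0 \<le> V"
  using assms abs_ge_zero[of "v undefined"] order_trans unfolding Lb_def by blast+

lemma Lb_mono:
  assumes "Lb p V W v" "V \<le> V'" "0 \<le> W" "W \<le> W'" "0 \<le> p"
  shows "Lb p V' W' v"
  unfolding Lb_def
proof (intro conjI allI)
  show "(\<integral>\<^sup>+x. ennreal (\<bar>v x\<bar> powr p) \<partial>lborel) \<le> ennreal (W' powr p)"
    using LbD(3)[OF assms(1)] assms by (elim order_trans) (auto intro!: ennreal_leI powr_mono2)
  show "\<bar>v x\<bar> \<le> V'" for x using LbD(2)[OF assms(1), of x] assms(2) by linarith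
qed (rule LbD[OF assms(1)])

lemma Lb_abs: "Lb p V W (\<lambda>x. \<bar>v x\<bar>)" if "Lb p V W v"
  using that unfolding Lb_def by auto

lemma Lb_uminus: "Lb p V W (\<lambda>x. - v x)" if "Lb p V W v"
  using that unfolding Lb_def by auto

lemma powr_add_le:
  fixes a b p :: real
  assumes "0 \<le> a" "0 \<le> b" "1 \<le> p"
  shows "(a + b) powr p \<le> 2 powr p * (a powr p + b powr p)"
proof -
  have "(a + b) powr p \<le> (2 * max a b) powr p" using assms by (intro powr_mono2) auto
  also have "\<dots> = 2 powr p * max a b powr p" using assms by (simp add: powr_mult)
  also have "max a b powr p \<le> a powr p + b powr p" by (auto simp: max_def)
  finally show ?thesis by simp
qed

text \<open>The crude constant comes from (a + b)^p <= 2^p (a^p + b^p) and 2 <= 2^p. The contraction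
  factor 1/8 is later chosen to beat it.\<close>

lemma Lb_add:
  assumes v: "Lb p V W v" "Lb p V' W' v'" and W: "0 \<le> W" "0 \<le> W'" and p: "1 \<le> p"
  shows "Lb p (4 * (V + V')) (4 * (W + W')) (\<lambda>x. v x + v' x)"
  unfolding Lb_def
proof (intro conjI allI)
  note [measurable] = LbD(1)[OF v(1)] LbD(1)[OF v(2)]
  show "(\<lambda>x. v x + v' x) \<in> borel_measurable borel" by measurable
  show "\<bar>v x + v' x\<bar> \<le> 4 * (V + V')" for x
    using LbD(2)[OF v(1), of x] LbD(2)[OF v(2), of x] LbD(4)[OF v(1)] LbD(4)[OF v(2)] abs_triangle_ineq[of "v x" "v' x"] by argo
  have "(\<integral>\<^sup>+x. ennreal (\<bar>v x + v' x\<bar> powr p) \<partial>lborel)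
      \<le> (\<integral>\<^sup>+x. ennreal (2 powr p) * (ennreal (\<bar>v x\<bar> powr p) + ennreal (\<bar>v' x\<bar> powr p)) \<partial>lborel)"
  proof (rule nn_integral_mono)
    fix x
    have "\<bar>v x + v' x\<bar> powr p \<le> (\<bar>v x\<bar> + \<bar>v' x\<bar>) powr p" using p by (intro powr_mono2) auto
    also have "\<dots> \<le> 2 powr p * (\<bar>v x\<bar> powr p + \<bar>v' x\<bar> powr p)" using p by (intro powr_add_le) auto
    finally have "ennreal (\<bar>v x + v' x\<bar> powr p) \<le> ennreal (2 powr p * (\<bar>v x\<bar> powr p + \<bar>v' x\<bar> powr p))" by (rule ennreal_leI)
    then show "ennreal (\<bar>v x + v' x\<bar> powr p) \<le> ennreal (2 powr p) * (ennreal (\<bar>v x\<bar> powr p) + ennreal (\<bar>v' x\<bar> powr p))"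
      by (simp add: ennreal_mult)
  qed
  also have "\<dots> = ennreal (2 powr p) * ((\<integral>\<^sup>+x. ennreal (\<bar>v x\<bar> powr p) \<partial>lborel) + (\<integral>\<^sup>+x. ennreal (\<bar>v' x\<bar> powr p) \<partial>lborel))"
    by (simp add: nn_integral_cmult nn_integral_add)
  also have "\<dots> \<le> ennreal (2 powr p) * (ennreal (W powr p) + ennreal (W' powr p))"
    by (intro mult_left_mono add_mono LbD(3)[OF v(1)] LbD(3)[OF v(2)]) auto
  also have "\<dots> = ennreal (2 powr p * (W powr p + W' powr p))" by (simp add: ennreal_mult)
  also have "\<dots> \<le> ennreal ((4 * (W + W')) powr p)"
  proof (rule ennreal_leI)
    have "2 powr 1 \<le> 2 powr p" using p by (intro powr_mono) auto
    then have 2: "2 \<le> 2 powr p" by simp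
    have "W powr p + W' powr p \<le> (W + W') powr p + (W + W') powr p"
      using W p by (intro add_mono powr_mono2) auto
    also have "\<dots> \<le> 2 powr p * (W + W') powr p" using mult_right_mono[OF 2, of "(W + W') powr p"] by simp
    finally have "2 powr p * (W powr p + W' powr p) \<le> 2 powr p * (2 powr p * (W + W') powr p)" by simp
    also have "\<dots> = (4 * (W + W')) powr p"
    proof -
      have "(4 * (W + W')) powr p = (2 * 2) powr p * (W + W') powr p" using W by (subst powr_mult[symmetric]) auto
      also have "(2 * 2 :: real) powr p = 2 powr p * 2 powr p" by (rule powr_mult)
      finally show ?thesis by simp
    qed
    finally show "2 powr p * (W powr p + W' powr p) \<le> (4 * (W + W')) powr p" .
  qed
  finally show "(\<integral>\<^sup>+x. ennreal (\<bar>v x + v' x\<bar> powr p) \<partial>lborel) \<le> ennreal ((4 * (W + W')) powr p)" .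
qed

lemma Lb_diff:
  assumes v: "Lb p V W v" "Lb p V' W' v'" and W: "0 \<le> W" "0 \<le> W'" and p: "1 \<le> p"
  shows "Lb p (4 * (V + V')) (4 * (W + W')) (\<lambda>x. v x - v' x)"
  using Lb_add[OF v(1) Lb_uminus[OF v(2)] W p] by simp

text \<open>Minkowski's inequality for a time integral whose slices are bounded in proportion to N.
  Jensen with weight N, applied to |h|/N, bounds the p-th power of the integral by \<Lambda>^(p-1)
  times the integral of N^(1-p) |h|^p; Fubini then reduces to the slices. The division by N is why N
  is positive on I.\<close>

lemma Lb_minkowski:
  fixes h :: "real \<Rightarrow> 'a::euclidean_space \<Rightarrow> real" and N :: "real \<Rightarrow> real"
  assumes p: "1 < p" and [measurable]: "(\<lambda>(s, x). h s x) \<in> borel_measurable (borel \<Otimes>\<^sub>M borel)" "N \<in> borel_measurable borel" "I \<in> sets borel"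
    and N: "\<And>s. s \<in> I \<Longrightarrow> 0 < N s" and NL: "(\<integral>\<^sup>+s. ennreal (indicator I s * N s) \<partial>lborel) \<le> ennreal \<Lambda>" and L: "0 < \<Lambda>"
    and VW: "0 \<le> V" "0 \<le> W"
    and h: "\<And>s. s \<in> I \<Longrightarrow> Lb p (N s * V) (N s * W) (h s)"
  shows "Lb p (\<Lambda> * V) (\<Lambda> * W) (\<lambda>x. \<integral>s. indicator I s * h s x \<partial>lborel)"
    and "integrable lborel (\<lambda>s. indicator I s * h s x)"
proof -
  have sup: "(\<integral>\<^sup>+s. ennreal \<bar>indicator I s * h s x\<bar> \<partial>lborel) \<le> ennreal (\<Lambda> * V)" for x
  proof -
    have "(\<integral>\<^sup>+s. ennreal \<bar>indicator I s * h s x\<bar> \<partial>lborel) \<le> (\<integral>\<^sup>+s. ennreal (indicator I s * N s) * ennreal V \<partial>lborel)"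
    proof (rule nn_integral_mono)
      fix s show "ennreal \<bar>indicator I s * h s x\<bar> \<le> ennreal (indicator I s * N s) * ennreal V"
        using LbD(2)[OF h[of s], of x] N[of s] VW by (cases "s \<in> I") (auto simp flip: ennreal_mult intro!: ennreal_leI)
    qed
    also have "\<dots> = (\<integral>\<^sup>+s. ennreal (indicator I s * N s) \<partial>lborel) * ennreal V" by (rule nn_integral_multc) measurable
    also have "\<dots> \<le> ennreal \<Lambda> * ennreal V" by (intro mult_right_mono NL) simp
    finally show ?thesis using L VW by (simp add: ennreal_mult)
  qed
  have int: "integrable lborel (\<lambda>s. indicator I s * h s x)" for x
    unfolding integrable_iff_bounded using sup[of x] by (auto intro: le_less_trans)
  then show "integrable lborel (\<lambda>s. indicator I s * h s x)" .
  let ?v = "\<lambda>x. \<integral>s. indicator I s * h s x \<partial>lborel"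
  have vsup: "\<bar>?v x\<bar> \<le> \<Lambda> * V" for x
    using order_trans[OF ennreal_abs_integral_le sup, of x] L VW by (subst (asm) ennreal_le_iff) auto
  have pw: "ennreal (\<bar>?v x\<bar> powr p) \<le> ennreal (\<Lambda> powr (p - 1)) * (\<integral>\<^sup>+s. ennreal (indicator I s * N s powr (1 - p) * \<bar>h s x\<bar> powr p) \<partial>lborel)" for x
  proof -
    define k where "k s = indicator I s * N s" for s
    define w where "w s = indicator I s * (\<bar>h s x\<bar> / N s)" for s
    have [measurable]: "k \<in> borel_measurable lborel" "w \<in> borel_measurable lborel" unfolding k_def w_def by measurable
    have kw: "0 \<le> k s" "0 \<le> w s" for s using N[of s] by (cases "s \<in> I"; simp add: k_def w_def)+
    have e1: "k s * w s = \<bar>indicator I s * h s x\<bar>" for s using N[of s] by (cases "s \<in> I") (auto simp: k_def w_def)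
    have e2: "k s * w s powr p = indicator I s * N s powr (1 - p) * \<bar>h s x\<bar> powr p" for s
    proof (cases "s \<in> I")
      case True
      have "N s powr (1 - p) = N s / N s powr p" using N[OF True] by (simp add: powr_diff)
      then show ?thesis using N[OF True] True by (simp add: k_def w_def powr_divide)
    qed (simp add: k_def)
    show ?thesis
    proof (cases "(\<integral>\<^sup>+s. ennreal (k s * w s powr p) \<partial>lborel) = \<infinity>")
      case True
      then show ?thesis using L by (simp add: e2 ennreal_mult_top)
    next
      case False
      define q where "q = enn2real (\<integral>\<^sup>+s. ennreal (k s * w s powr p) \<partial>lborel)"
      have q: "ennreal q = (\<integral>\<^sup>+s. ennreal (k s * w s powr p) \<partial>lborel)" "0 \<le> q"
        using False by (auto simp: q_def ennreal_enn2real_if)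
      have "(\<integral>\<^sup>+s. ennreal (k s * w s) \<partial>lborel) \<le> ennreal (\<Lambda> powr (1 - 1 / p) * q powr (1 / p))"
        by (rule nn_integral_jensen_powr) (use kw p L q NL in \<open>auto simp: k_def\<close>)
      with ennreal_abs_integral_le[of lborel "\<lambda>s. indicator I s * h s x"]
      have "ennreal \<bar>?v x\<bar> \<le> ennreal (\<Lambda> powr (1 - 1 / p) * q powr (1 / p))" unfolding e1 by (rule order_trans)
      from le_enn_powr[OF this] have "\<bar>?v x\<bar> powr p \<le> (\<Lambda> powr (1 - 1 / p)) powr p * q" using q p by simp
      also have "(\<Lambda> powr (1 - 1 / p)) powr p = \<Lambda> powr (p - 1)" using p by (simp add: powr_powr left_diff_distrib)
      finally have "ennreal (\<bar>?v x\<bar> powr p) \<le> ennreal (\<Lambda> powr (p - 1) * q)" by (rule ennreal_leI)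
      then show ?thesis using q by (simp add: ennreal_mult e2)
    qed
  qed
  show "Lb p (\<Lambda> * V) (\<Lambda> * W) ?v"
    unfolding Lb_def
  proof (intro conjI allI vsup)
    show "?v \<in> borel_measurable borel" by measurable
    have "(\<integral>\<^sup>+s. (\<integral>\<^sup>+x. ennreal (indicator I s * N s powr (1 - p) * \<bar>h s x\<bar> powr p) \<partial>(lborel :: 'a measure)) \<partial>lborel) \<le> (\<integral>\<^sup>+s. ennreal (indicator I s * N s) * ennreal (W powr p) \<partial>lborel)"
    proof (rule nn_integral_mono)
      fix s
      show "(\<integral>\<^sup>+x. ennreal (indicator I s * N s powr (1 - p) * \<bar>h s x\<bar> powr p) \<partial>lborel) \<le> ennreal (indicator I s * N s) * ennreal (W powr p)"
      proof (cases "s \<in> I")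
        case True
        note Ns = N[OF True]
        note [measurable] = LbD(1)[OF h[OF True]]
        have "(\<integral>\<^sup>+x. ennreal (indicator I s * N s powr (1 - p) * \<bar>h s x\<bar> powr p) \<partial>lborel)
          = (\<integral>\<^sup>+x. ennreal (N s powr (1 - p)) * ennreal (\<bar>h s x\<bar> powr p) \<partial>lborel)"
          using True by (simp add: ennreal_mult)
        also have "\<dots> = ennreal (N s powr (1 - p)) * (\<integral>\<^sup>+x. ennreal (\<bar>h s x\<bar> powr p) \<partial>lborel)" by (rule nn_integral_cmult) measurable
        also have "\<dots> \<le> ennreal (N s powr (1 - p)) * ennreal ((N s * W) powr p)"
          by (intro mult_left_mono LbD(3)[OF h[OF True]]) simp
        also have "\<dots> = ennreal (N s powr (1 - p) * N s powr p * W powr p)"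
          using Ns VW by (simp add: powr_mult ennreal_mult mult.assoc)
        also have "N s powr (1 - p) * N s powr p = N s" using Ns by (simp flip: powr_add)
        finally show ?thesis using True Ns by (simp add: ennreal_mult)
      qed simp
    qed
    also have "\<dots> = (\<integral>\<^sup>+s. ennreal (indicator I s * N s) \<partial>lborel) * ennreal (W powr p)" by (rule nn_integral_multc) measurable
    also have "\<dots> \<le> ennreal \<Lambda> * ennreal (W powr p)" by (intro mult_right_mono NL) auto
    finally have inner: "(\<integral>\<^sup>+s. (\<integral>\<^sup>+x. ennreal (indicator I s * N s powr (1 - p) * \<bar>h s x\<bar> powr p) \<partial>(lborel :: 'a measure)) \<partial>lborel) \<le> ennreal \<Lambda> * ennreal (W powr p)" .
    have "(\<integral>\<^sup>+x. ennreal (\<bar>?v x\<bar> powr p) \<partial>lborel)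
      \<le> (\<integral>\<^sup>+x. ennreal (\<Lambda> powr (p - 1)) * (\<integral>\<^sup>+s. ennreal (indicator I s * N s powr (1 - p) * \<bar>h s x\<bar> powr p) \<partial>lborel) \<partial>lborel)"
      by (intro nn_integral_mono pw)
    also have "\<dots> = ennreal (\<Lambda> powr (p - 1)) * (\<integral>\<^sup>+x. (\<integral>\<^sup>+s. ennreal (indicator I s * N s powr (1 - p) * \<bar>h s x\<bar> powr p) \<partial>lborel) \<partial>lborel)"
      by (rule nn_integral_cmult) measurable
    also have "(\<integral>\<^sup>+x. (\<integral>\<^sup>+s. ennreal (indicator I s * N s powr (1 - p) * \<bar>h s x\<bar> powr p) \<partial>lborel) \<partial>(lborel :: 'a measure))
       = (\<integral>\<^sup>+s. (\<integral>\<^sup>+x. ennreal (indicator I s * N s powr (1 - p) * \<bar>h s x\<bar> powr p) \<partial>(lborel :: 'a measure)) \<partial>lborel)"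
      by (rule lborel_pair.Fubini') measurable
    also have "ennreal (\<Lambda> powr (p - 1)) * \<dots> \<le> ennreal (\<Lambda> powr (p - 1)) * (ennreal \<Lambda> * ennreal (W powr p))"
      by (intro mult_left_mono inner) auto
    also have "\<dots> = ennreal (\<Lambda> powr (p - 1) * \<Lambda> * W powr p)" using L by (simp add: ennreal_mult mult.assoc)
    also have "\<Lambda> powr (p - 1) * \<Lambda> * W powr p = (\<Lambda> * W) powr p" using L VW by (simp add: powr_mult powr_diff)
    finally show "(\<integral>\<^sup>+x. ennreal (\<bar>?v x\<bar> powr p) \<partial>lborel) \<le> ennreal ((\<Lambda> * W) powr p)" .
  qed
qed

text \<open>The kernel may change sign, so that differences of heat kernels are covered. The
  hypothesis on V only concerns the convolution of |k| with w^p; a supremum bound on w and an L^p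
  bound on w each supply such a V.\<close>

lemma conv_Lb:
  fixes k g w H :: "'a::euclidean_space \<Rightarrow> real"
  assumes [measurable]: "k \<in> borel_measurable borel" "g \<in> borel_measurable borel" "w \<in> borel_measurable borel" "H \<in> borel_measurable borel"
    and nn: "\<And>x. 0 \<le> w x" "\<And>x. 0 \<le> H x"
    and pR: "0 < p" "0 < R" "1 / p + 1 / R \<le> 1" and A: "0 < A" and r: "0 < r" and B: "0 < B"
    and Ak: "(\<integral>\<^sup>+x. ennreal \<bar>k x\<bar> \<partial>lborel) \<le> ennreal A" and kB: "\<And>x. \<bar>k x\<bar> \<le> B"
    and rH: "(\<integral>\<^sup>+x. ennreal (H x powr R) \<partial>lborel) \<le> ennreal r"
    and g: "\<And>y. \<bar>g y\<bar> \<le> w y * H y" and VW: "0 \<le> V" "0 \<le> W"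
    and V: "\<And>x. (\<integral>\<^sup>+y. ennreal (\<bar>k (x - y)\<bar> * w y powr p) \<partial>lborel) \<le> ennreal (A * V powr p)"
    and W: "(\<integral>\<^sup>+y. ennreal (w y powr p) \<partial>lborel) \<le> ennreal (W powr p)"
  shows "integrable lborel (\<lambda>y. k (x - y) * g y)"
    and "Lb p (A powr (1 - 1 / R) * (B * r) powr (1 / R) * V) (A powr (1 - 1 / R) * (B * r) powr (1 / R) * W) (\<lambda>x. \<integral>y. k (x - y) * g y \<partial>lborel)"
proof -
  let ?C = "A powr (1 - 1 / p - 1 / R) * (B * r) powr (1 / R)"
  have core: "(\<integral>\<^sup>+y. ennreal \<bar>k (x - y) * g y\<bar> \<partial>lborel) \<le> ennreal (?C * q powr (1 / p))"
    if q: "0 \<le> q" "(\<integral>\<^sup>+y. ennreal (\<bar>k (x - y)\<bar> * w y powr p) \<partial>lborel) \<le> ennreal q" for x q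
    using conv_core[of "\<lambda>x. \<bar>k x\<bar>" g w H p R A r B q x] nn pR A r B Ak kB rH g q by (simp add: abs_mult mult_ac)
  have C: "0 \<le> ?C" by simp
  have AC: "?C * A powr (1 / p) = A powr (1 - 1 / R) * (B * r) powr (1 / R)"
  proof -
    have "A powr (1 - 1 / R) = A powr (1 - 1 / p - 1 / R) * A powr (1 / p)" by (simp flip: powr_add)
    then show ?thesis by (simp only: mult_ac)
  qed
  have sup: "(\<integral>\<^sup>+y. ennreal \<bar>k (x - y) * g y\<bar> \<partial>lborel) \<le> ennreal (A powr (1 - 1 / R) * (B * r) powr (1 / R) * V)" for x
  proof -
    have "?C * (A * V powr p) powr (1 / p) = A powr (1 - 1 / R) * (B * r) powr (1 / R) * V"
    proof -
      have "(A * V powr p) powr (1 / p) = A powr (1 / p) * V" using A VW pR by (simp add: powr_mult powr_powr)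
      then show ?thesis by (simp only: AC[symmetric] mult.assoc)
    qed
    moreover have "0 \<le> A * V powr p" using A by simp
    ultimately show ?thesis using core[OF _ V, of x] by metis
  qed
  show "integrable lborel (\<lambda>y. k (x - y) * g y)"
    unfolding integrable_iff_bounded using sup[of x] by (auto intro: le_less_trans)
  let ?v = "\<lambda>x. \<integral>y. k (x - y) * g y \<partial>lborel"
  show "Lb p (A powr (1 - 1 / R) * (B * r) powr (1 / R) * V) (A powr (1 - 1 / R) * (B * r) powr (1 / R) * W) ?v"
    unfolding Lb_def
  proof (intro conjI allI)
    show [measurable]: "?v \<in> borel_measurable borel" by measurable
    show "\<bar>?v x\<bar> \<le> A powr (1 - 1 / R) * (B * r) powr (1 / R) * V" for x
      using order_trans[OF ennreal_abs_integral_le sup, of x] VW by (subst (asm) ennreal_le_iff) auto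
    have "(\<integral>\<^sup>+x. ennreal (\<bar>?v x\<bar> powr p) \<partial>lborel) \<le> ennreal ((?C * A powr (1 / p) * W) powr p)"
    proof (rule nn_integral_powr_conv_le[where k="\<lambda>x. \<bar>k x\<bar>" and w=w])
      fix x
      define q where "q = enn2real (\<integral>\<^sup>+y. ennreal (\<bar>k (x - y)\<bar> * w y powr p) \<partial>lborel)"
      have q: "ennreal q = (\<integral>\<^sup>+y. ennreal (\<bar>k (x - y)\<bar> * w y powr p) \<partial>lborel)" "0 \<le> q"
        using V[of x] by (auto simp: q_def ennreal_enn2real_if top_unique)
      have "ennreal \<bar>?v x\<bar> \<le> ennreal (?C * q powr (1 / p))"
        by (rule order_trans[OF ennreal_abs_integral_le core]) (simp_all add: q)
      from le_enn_powr[OF this _ C q(2) pR(1)] have "\<bar>?v x\<bar> powr p \<le> ?C powr p * q" by simp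
      then have "ennreal (\<bar>?v x\<bar> powr p) \<le> ennreal (?C powr p * q)" by (rule ennreal_leI)
      also have "\<dots> = ennreal (?C powr p) * ennreal q" by (rule ennreal_mult) (use q in auto)
      finally show "ennreal (\<bar>?v x\<bar> powr p) \<le> ennreal (?C powr p) * (\<integral>\<^sup>+y. ennreal (\<bar>k (x - y)\<bar> * \<bar>w y\<bar> powr p) \<partial>lborel)"
        unfolding q(1) using nn by simp
    qed (use A C VW pR Ak W nn in auto)
    then show "(\<integral>\<^sup>+x. ennreal (\<bar>?v x\<bar> powr p) \<partial>lborel) \<le> ennreal ((A powr (1 - 1 / R) * (B * r) powr (1 / R) * W) powr p)"
      unfolding AC .
  qed
qed

text \<open>The analogue without the factor H: the mass A carries the L^p norm, and interpolation
  between A and B gives the supremum.\<close>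

lemma conv_Lb0:
  fixes k g :: "'a::euclidean_space \<Rightarrow> real"
  assumes [measurable]: "k \<in> borel_measurable borel" "g \<in> borel_measurable borel"
    and p: "1 < p" and A: "0 < A" and B: "0 < B"
    and Ak: "(\<integral>\<^sup>+x. ennreal \<bar>k x\<bar> \<partial>lborel) \<le> ennreal A" and kB: "\<And>x. \<bar>k x\<bar> \<le> B"
    and W: "(\<integral>\<^sup>+y. ennreal (\<bar>g y\<bar> powr p) \<partial>lborel) \<le> ennreal (W powr p)" "0 \<le> W"
  shows "integrable lborel (\<lambda>y. k (x - y) * g y)"
    and "Lb p (A powr (1 - 1 / p) * B powr (1 / p) * W) (A * W) (\<lambda>x. \<integral>y. k (x - y) * g y \<partial>lborel)"
proof -
  have core: "(\<integral>\<^sup>+y. ennreal \<bar>k (x - y) * g y\<bar> \<partial>lborel) \<le> ennreal (A powr (1 - 1 / p) * q powr (1 / p))"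
    if q: "0 \<le> q" "(\<integral>\<^sup>+y. ennreal (\<bar>k (x - y)\<bar> * \<bar>g y\<bar> powr p) \<partial>lborel) \<le> ennreal q" for x q
    unfolding abs_mult
  proof (rule nn_integral_jensen_powr)
    show "(\<integral>\<^sup>+y. ennreal \<bar>k (x - y)\<bar> \<partial>lborel) \<le> ennreal A"
      using Ak by (subst nn_integral_lborel_reflect[of "\<lambda>y. ennreal \<bar>k y\<bar>"]) auto
  qed (use p A q in auto)
  have qB: "(\<integral>\<^sup>+y. ennreal (\<bar>k (x - y)\<bar> * \<bar>g y\<bar> powr p) \<partial>lborel) \<le> ennreal (B * W powr p)" for x
  proof -
    have "(\<integral>\<^sup>+y. ennreal (\<bar>k (x - y)\<bar> * \<bar>g y\<bar> powr p) \<partial>lborel) \<le> (\<integral>\<^sup>+y. ennreal B * ennreal (\<bar>g y\<bar> powr p) \<partial>lborel)"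
      using kB B by (intro nn_integral_mono) (auto simp flip: ennreal_mult intro!: ennreal_leI mult_right_mono)
    also have "\<dots> = ennreal B * (\<integral>\<^sup>+y. ennreal (\<bar>g y\<bar> powr p) \<partial>lborel)" by (rule nn_integral_cmult) measurable
    also have "\<dots> \<le> ennreal B * ennreal (W powr p)" by (intro mult_left_mono W) simp
    finally show ?thesis using B by (simp add: ennreal_mult)
  qed
  have sup: "(\<integral>\<^sup>+y. ennreal \<bar>k (x - y) * g y\<bar> \<partial>lborel) \<le> ennreal (A powr (1 - 1 / p) * B powr (1 / p) * W)" for x
    using core[OF _ qB, of x] B W p by (simp add: powr_mult powr_powr mult.assoc)
  show "integrable lborel (\<lambda>y. k (x - y) * g y)"
    unfolding integrable_iff_bounded using sup[of x] by (auto intro: le_less_trans)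
  let ?v = "\<lambda>x. \<integral>y. k (x - y) * g y \<partial>lborel"
  show "Lb p (A powr (1 - 1 / p) * B powr (1 / p) * W) (A * W) ?v"
    unfolding Lb_def
  proof (intro conjI allI)
    show [measurable]: "?v \<in> borel_measurable borel" by measurable
    show "\<bar>?v x\<bar> \<le> A powr (1 - 1 / p) * B powr (1 / p) * W" for x
      using order_trans[OF ennreal_abs_integral_le sup, of x] W by (subst (asm) ennreal_le_iff) auto
    have "(\<integral>\<^sup>+x. ennreal (\<bar>?v x\<bar> powr p) \<partial>lborel) \<le> ennreal ((A powr (1 - 1 / p) * A powr (1 / p) * W) powr p)"
    proof (rule nn_integral_powr_conv_le[where k="\<lambda>x. \<bar>k x\<bar>" and w=g])
      fix x
      define q where "q = enn2real (\<integral>\<^sup>+y. ennreal (\<bar>k (x - y)\<bar> * \<bar>g y\<bar> powr p) \<partial>lborel)"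
      have q: "ennreal q = (\<integral>\<^sup>+y. ennreal (\<bar>k (x - y)\<bar> * \<bar>g y\<bar> powr p) \<partial>lborel)" "0 \<le> q"
        using qB[of x] by (auto simp: q_def ennreal_enn2real_if top_unique)
      have "ennreal \<bar>?v x\<bar> \<le> ennreal (A powr (1 - 1 / p) * q powr (1 / p))"
        by (rule order_trans[OF ennreal_abs_integral_le core]) (simp_all add: q)
      from le_enn_powr[OF this _ _ q(2)] have "\<bar>?v x\<bar> powr p \<le> (A powr (1 - 1 / p)) powr p * q" using p by simp
      then have "ennreal (\<bar>?v x\<bar> powr p) \<le> ennreal ((A powr (1 - 1 / p)) powr p * q)" by (rule ennreal_leI)
      also have "\<dots> = ennreal ((A powr (1 - 1 / p)) powr p) * ennreal q" by (rule ennreal_mult) (use q in auto)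
      finally show "ennreal (\<bar>?v x\<bar> powr p) \<le> ennreal ((A powr (1 - 1 / p)) powr p) * (\<integral>\<^sup>+y. ennreal (\<bar>k (x - y)\<bar> * \<bar>g y\<bar> powr p) \<partial>lborel)"
        unfolding q(1) .
    qed (use A p Ak W in auto)
    also have "A powr (1 - 1 / p) * A powr (1 / p) = A" using A by (simp flip: powr_add)
    finally show "(\<integral>\<^sup>+x. ennreal (\<bar>?v x\<bar> powr p) \<partial>lborel) \<le> ennreal ((A * W) powr p)" .
  qed
qed

section \<open>Factorised sources and the Duhamel bound\<close>

context smoothing
begin

text \<open>Only the inequality with w H is recorded, so f(u) and f(u) - f(v) can use unrelated
  choices of w and H.\<close>

definition fac :: "real \<Rightarrow> real \<Rightarrow> real \<Rightarrow> ('a \<Rightarrow> real) \<Rightarrow> bool" where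
  "fac h V W g \<longleftrightarrow> g \<in> borel_measurable borel \<and> (\<exists>w H. w \<in> borel_measurable borel \<and> H \<in> borel_measurable borel \<and>
     (\<forall>y. 0 \<le> w y) \<and> (\<forall>y. 0 \<le> H y) \<and> (\<forall>y. \<bar>g y\<bar> \<le> w y * H y) \<and> Lb p V W w \<and>
     (\<integral>\<^sup>+y. ennreal (H y powr R) \<partial>lborel) \<le> ennreal (h powr R))"

lemma fac_mono:
  assumes "fac h V W g" "0 \<le> h" "h \<le> h'" "V \<le> V'" "0 \<le> W" "W \<le> W'"
  shows "fac h' V' W' g"
proof -
  obtain w H where *: "w \<in> borel_measurable borel" "H \<in> borel_measurable borel" "\<forall>y. 0 \<le> w y" "\<forall>y. 0 \<le> H y"
    "\<forall>y. \<bar>g y\<bar> \<le> w y * H y" "Lb p V W w" "(\<integral>\<^sup>+y. ennreal (H y powr R) \<partial>lborel) \<le> ennreal (h powr R)"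
    using assms(1) unfolding fac_def by blast
  have "Lb p V' W' w" using Lb_mono[OF *(6)] assms p by auto
  moreover have "(\<integral>\<^sup>+y. ennreal (H y powr R) \<partial>lborel) \<le> ennreal (h' powr R)"
    using *(7) by (rule order_trans) (use assms R_pos in \<open>auto intro!: ennreal_leI powr_mono2\<close>)
  ultimately show ?thesis using * assms(1) unfolding fac_def by blast
qed

text \<open>Two supremum bounds for one convolution: the kernel either averages w, keeping V, or
  smooths it from L^p, producing (B/A)^(1/p) W. The Duhamel estimate takes the first for recent
  sources and the second for old ones.\<close>

lemma fac_conv:
  assumes f: "fac h V W g" and h: "0 < h" and VW: "0 \<le> V" "0 \<le> W"
    and [measurable]: "k \<in> borel_measurable borel" and A: "0 < A" and B: "0 < B"
    and Ak: "(\<integral>\<^sup>+x. ennreal \<bar>k x\<bar> \<partial>lborel) \<le> ennreal A" and kB: "\<And>x. \<bar>k x\<bar> \<le> B"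
  shows "integrable lborel (\<lambda>y. k (x - y) * g y)"
    and "Lb p (A powr (1 - 1 / R) * B powr (1 / R) * h * V) (A powr (1 - 1 / R) * B powr (1 / R) * h * W) (\<lambda>x. \<integral>y. k (x - y) * g y \<partial>lborel)"
    and "Lb p (A powr (1 - 1 / R) * B powr (1 / R) * h * ((B / A) powr (1 / p) * W)) (A powr (1 - 1 / R) * B powr (1 / R) * h * W) (\<lambda>x. \<integral>y. k (x - y) * g y \<partial>lborel)"
proof -
  obtain w H where wH: "w \<in> borel_measurable borel" "H \<in> borel_measurable borel" "\<And>y. 0 \<le> w y" "\<And>y. 0 \<le> H y"
    "\<And>y. \<bar>g y\<bar> \<le> w y * H y" "Lb p V W w" "(\<integral>\<^sup>+y. ennreal (H y powr R) \<partial>lborel) \<le> ennreal (h powr R)"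
    and g: "g \<in> borel_measurable borel"
    using f unfolding fac_def by blast
  note [measurable] = wH(1)
  have w: "(\<integral>\<^sup>+y. ennreal (w y powr p) \<partial>lborel) \<le> ennreal (W powr p)"
    using LbD(3)[OF wH(6)] wH(3) by simp
  have "(\<integral>\<^sup>+y. ennreal (\<bar>k (x - y)\<bar> * w y powr p) \<partial>lborel) \<le> ennreal (A * V powr p)" for x
  proof -
    have "(\<integral>\<^sup>+y. ennreal (\<bar>k (x - y)\<bar> * w y powr p) \<partial>lborel) \<le> (\<integral>\<^sup>+y. ennreal \<bar>k (x - y)\<bar> * ennreal (V powr p) \<partial>lborel)"
      using LbD(2)[OF wH(6)] wH(3) p
      by (intro nn_integral_mono) (auto simp flip: ennreal_mult intro!: ennreal_leI mult_left_mono powr_mono2)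
    also have "\<dots> = (\<integral>\<^sup>+y. ennreal \<bar>k (x - y)\<bar> \<partial>lborel) * ennreal (V powr p)" by (rule nn_integral_multc) measurable
    also have "\<dots> \<le> ennreal A * ennreal (V powr p)"
      using Ak by (intro mult_right_mono) (subst nn_integral_lborel_reflect[of "\<lambda>y. ennreal \<bar>k y\<bar>"], auto)
    finally show ?thesis using A by (simp add: ennreal_mult)
  qed
  note 1 = conv_Lb[OF _ g wH(1) wH(2) wH(3) wH(4) _ R_pos pR A _ B Ak kB wH(7) wH(5) VW this w, simplified]
  have e: "(B * h powr R) powr (1 / R) = B powr (1 / R) * h" using B h R_pos by (simp add: powr_mult powr_powr)
  show "integrable lborel (\<lambda>y. k (x - y) * g y)" using 1(1) p h by simp
  show "Lb p (A powr (1 - 1 / R) * B powr (1 / R) * h * V) (A powr (1 - 1 / R) * B powr (1 / R) * h * W) (\<lambda>x. \<integral>y. k (x - y) * g y \<partial>lborel)"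
    using 1(2) p h unfolding e by (simp add: mult.assoc)
  have V': "0 \<le> (B / A) powr (1 / p) * W" using VW by simp
  have "(\<integral>\<^sup>+y. ennreal (\<bar>k (x - y)\<bar> * w y powr p) \<partial>lborel) \<le> ennreal (A * ((B / A) powr (1 / p) * W) powr p)" for x
  proof -
    have "(\<integral>\<^sup>+y. ennreal (\<bar>k (x - y)\<bar> * w y powr p) \<partial>lborel) \<le> (\<integral>\<^sup>+y. ennreal B * ennreal (w y powr p) \<partial>lborel)"
      using kB B by (intro nn_integral_mono) (auto simp flip: ennreal_mult intro!: ennreal_leI mult_right_mono)
    also have "\<dots> = ennreal B * (\<integral>\<^sup>+y. ennreal (w y powr p) \<partial>lborel)" by (rule nn_integral_cmult) measurable
    also have "\<dots> \<le> ennreal B * ennreal (W powr p)" by (intro mult_left_mono w) simp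
    also have "\<dots> = ennreal (A * ((B / A) powr (1 / p) * W) powr p)"
      using A B VW p by (simp add: ennreal_mult[symmetric] powr_mult powr_powr)
    finally show ?thesis .
  qed
  note 2 = conv_Lb[OF _ g wH(1) wH(2) wH(3) wH(4) _ R_pos pR A _ B Ak kB wH(7) wH(5) V' VW(2) this w, simplified]
  show "Lb p (A powr (1 - 1 / R) * B powr (1 / R) * h * ((B / A) powr (1 / p) * W)) (A powr (1 - 1 / R) * B powr (1 / R) * h * W) (\<lambda>x. \<integral>y. k (x - y) * g y \<partial>lborel)"
    using 2(2) p h unfolding e by (simp add: mult.assoc)
qed

lemma S_powr: "(c * t powr (- \<nu>)) powr (1 / R) = c powr (1 / R) * t powr (- \<delta>)"
  using c_pos by (simp add: powr_mult powr_powr \<delta>_def)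

lemma heat_fac:
  assumes f: "fac h V W g" and h: "0 < h" and VW: "0 \<le> V" "0 \<le> W" and t: "0 < t"
  shows "integrable lborel (\<lambda>y. S t (x - y) * g y)"
    and "Lb p (c powr (1 / R) * t powr (- \<delta>) * h * V) (c powr (1 / R) * t powr (- \<delta>) * h * W) (heat t g)"
    and "Lb p (c powr (1 / R) * t powr (- \<delta>) * h * ((c * t powr (- \<nu>)) powr (1 / p) * W)) (c powr (1 / R) * t powr (- \<delta>) * h * W) (heat t g)"
proof -
  have B: "0 < c * t powr (- \<nu>)" using c_pos t by simp
  have k: "(\<integral>\<^sup>+x. ennreal \<bar>S t x\<bar> \<partial>lborel) \<le> ennreal 1" "\<bar>S t x\<bar> \<le> c * t powr (- \<nu>)" for x
    using S_mass[OF t] S_nonneg S_le[OF t] by auto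
  note * = fac_conv[OF f h VW S_borel zero_less_one B k]
  show "integrable lborel (\<lambda>y. S t (x - y) * g y)" by (rule *(1))
  show "Lb p (c powr (1 / R) * t powr (- \<delta>) * h * V) (c powr (1 / R) * t powr (- \<delta>) * h * W) (heat t g)"
    using *(2) by (simp add: S_powr heat_def[abs_def])
  show "Lb p (c powr (1 / R) * t powr (- \<delta>) * h * ((c * t powr (- \<nu>)) powr (1 / p) * W)) (c powr (1 / R) * t powr (- \<delta>) * h * W) (heat t g)"
    using *(3) by (simp add: S_powr heat_def[abs_def])
qed

lemma heat_measurable:
  assumes [measurable]: "(\<lambda>(s, y). g s y) \<in> borel_measurable (borel \<Otimes>\<^sub>M borel)"
  shows "(\<lambda>(s, x). heat (t - s) (g s) x) \<in> borel_measurable (borel \<Otimes>\<^sub>M borel)"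
  unfolding heat_def by measurable

lemma duhamel_measurable:
  assumes [measurable]: "(\<lambda>(s, y). g s y) \<in> borel_measurable (borel \<Otimes>\<^sub>M borel)"
  shows "(\<lambda>(t, x). duhamel g t x) \<in> borel_measurable (borel \<Otimes>\<^sub>M borel)"
proof -
  have [measurable]: "(\<lambda>z. S (fst (fst z) - snd (fst z)) (snd z)) \<in> borel_measurable ((borel \<Otimes>\<^sub>M borel) \<Otimes>\<^sub>M borel)"
    by measurable
  have [measurable]: "(\<lambda>z. S (fst (fst (fst z)) - snd (fst z)) (snd (fst (fst z)) - snd z) * g (snd (fst z)) (snd z))
      \<in> borel_measurable (((borel \<Otimes>\<^sub>M borel) \<Otimes>\<^sub>M lborel) \<Otimes>\<^sub>M lborel)"
    by measurable
  have "(\<lambda>z. \<integral>s. (if 0 < s \<and> s < fst z then \<integral>y. S (fst z - s) (snd z - y) * g s y \<partial>lborel else 0) \<partial>lborel) \<in> borel_measurable (borel \<Otimes>\<^sub>M borel)"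
    by measurable
  also have "(\<lambda>z. \<integral>s. (if 0 < s \<and> s < fst z then \<integral>y. S (fst z - s) (snd z - y) * g s y \<partial>lborel else 0) \<partial>lborel) = (\<lambda>(t, x). duhamel g t x)"
    unfolding duhamel_def heat_def
    by (auto intro!: ext Bochner_Integration.integral_cong simp: indicator_def)
  finally show ?thesis .
qed

text \<open>The two terms serve the two cases of \<open>duhamel_bound\<close>: the power of 2 for
  recent sources or short times, the other for the distant past.\<close>

definition C4 :: real where "C4 = 2 powr \<alpha> + (c * 4 powr \<nu>) powr (1 / p)"
definition KD :: real where "KD = B1 * c powr (1 / R) * C4"

lemma C4_ge: "1 \<le> C4" and KD_pos: "0 < KD"
proof -
  have "2 powr 0 \<le> 2 powr \<alpha>" using al by (intro powr_mono) auto
  then show 1: "1 \<le> C4" unfolding C4_def by (simp add: add_increasing2)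
  show "0 < KD" using 1 B1_pos c_pos by (simp add: KD_def)
qed

lemma duhamel_bound:
  assumes [measurable]: "(\<lambda>(s, y). g s y) \<in> borel_measurable (borel \<Otimes>\<^sub>M borel)"
    and \<eta>: "0 < \<eta>" and W: "0 \<le> W"
    and f: "\<And>s. 0 < s \<Longrightarrow> fac (\<eta> * (1 + s) powr (\<delta> - 1)) (W * (1 + s) powr (- \<alpha>)) W (g s)"
    and t: "0 < t"
  shows "Lb p (KD * \<eta> * W * (1 + t) powr (- \<alpha>)) (KD * \<eta> * W) (duhamel g t)"
    and "integrable lborel (\<lambda>s. indicator {0<..<t} s * heat (t - s) (g s) x)"
proof -
  define N where "N s = c powr (1 / R) * \<eta> * tk t s" for s
  define V where "V = C4 * W * (1 + t) powr (- \<alpha>)"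
  have V0: "0 \<le> V" using C4_ge W by (simp add: V_def)
  have [measurable]: "N \<in> borel_measurable borel" unfolding N_def by measurable
  have h: "Lb p (N s * V) (N s * W) (heat (t - s) (g s))" if "s \<in> {0<..<t}" for s
  proof -
    have s: "0 < s" "0 < t - s" using that by auto
    have Ns: "0 < N s" using tk_pos[of s t] s \<eta> c_pos by (simp add: N_def)
    have N: "N s = c powr (1 / R) * (t - s) powr (- \<delta>) * (\<eta> * (1 + s) powr (\<delta> - 1))"
      by (simp add: N_def tk_def)
    have f': "0 < \<eta> * (1 + s) powr (\<delta> - 1)" "0 \<le> W * (1 + s) powr (- \<alpha>)" using \<eta> W s by auto
    note L = heat_fac[OF f[OF s(1)] f'(1) f'(2) W s(2), folded N]
    \<comment> \<open>Supremum decay must be transferred from s to t. If t/2 <= s or t <= 1, then 1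
      + s >= (1 + t)/2 and the weights are comparable. Otherwise t - s >= (1 + t)/4, and smoothing
      at the rate \<nu>/p >= \<alpha> creates the decay.\<close>
    have key: "W * (1 + s) powr (- \<alpha>) \<le> V \<or> (c * (t - s) powr (- \<nu>)) powr (1 / p) * W \<le> V"
    proof (cases "t / 2 \<le> s \<or> t \<le> 1")
      case True
      then have "(1 + t) / 2 \<le> 1 + s" using s by auto
      then have "(1 + s) powr (- \<alpha>) \<le> ((1 + t) / 2) powr (- \<alpha>)" using al t s by (intro powr_mono2') auto
      also have "\<dots> = 2 powr \<alpha> * (1 + t) powr (- \<alpha>)" using t by (simp add: powr_divide powr_minus field_simps)
      also have "\<dots> \<le> C4 * (1 + t) powr (- \<alpha>)" by (intro mult_right_mono) (simp_all add: C4_def)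
      finally have "W * (1 + s) powr (- \<alpha>) \<le> W * (C4 * (1 + t) powr (- \<alpha>))" using W by (rule mult_left_mono)
      then show ?thesis by (simp add: V_def mult_ac)
    next
      case False
      then have ts: "(1 + t) / 4 \<le> t - s" using s by auto
      have "(c * (t - s) powr (- \<nu>)) powr (1 / p) \<le> (c * ((1 + t) / 4) powr (- \<nu>)) powr (1 / p)"
        using c_pos p nu_pos t ts by (intro powr_mono2 mult_left_mono powr_mono2') auto
      also have "\<dots> = (c * 4 powr \<nu>) powr (1 / p) * (1 + t) powr (- (\<nu> / p))"
        using t c_pos p by (simp add: powr_divide powr_mult powr_powr powr_minus field_simps)
      also have "\<dots> \<le> (c * 4 powr \<nu>) powr (1 / p) * (1 + t) powr (- \<alpha>)"
        using al t by (intro mult_left_mono powr_mono) auto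
      also have "\<dots> \<le> C4 * (1 + t) powr (- \<alpha>)" by (intro mult_right_mono) (simp_all add: C4_def)
      finally have "(c * (t - s) powr (- \<nu>)) powr (1 / p) * W \<le> C4 * (1 + t) powr (- \<alpha>) * W" using W by (rule mult_right_mono)
      then show ?thesis by (simp add: V_def mult_ac)
    qed
    then show ?thesis
    proof
      assume "W * (1 + s) powr (- \<alpha>) \<le> V"
      then show ?thesis using Ns W p by (intro Lb_mono[OF L(2)]) (auto intro: mult_left_mono)
    next
      assume "(c * (t - s) powr (- \<nu>)) powr (1 / p) * W \<le> V"
      then show ?thesis using Ns W p by (intro Lb_mono[OF L(3)]) (auto intro: mult_left_mono)
    qed
  qed
  have NL: "(\<integral>\<^sup>+s. ennreal (indicator {0<..<t} s * N s) \<partial>lborel) \<le> ennreal (B1 * c powr (1 / R) * \<eta>)"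
  proof -
    have "(\<integral>\<^sup>+s. ennreal (indicator {0<..<t} s * N s) \<partial>lborel) = (\<integral>\<^sup>+s. ennreal (c powr (1 / R) * \<eta>) * ennreal (indicator {0<..<t} s * tk t s) \<partial>lborel)"
      using \<eta> tk_nonneg by (intro nn_integral_cong) (simp add: N_def ennreal_mult[symmetric] mult_ac)
    also have "\<dots> = ennreal (c powr (1 / R) * \<eta>) * (\<integral>\<^sup>+s. ennreal (indicator {0<..<t} s * tk t s) \<partial>lborel)"
      by (rule nn_integral_cmult) measurable
    also have "\<dots> \<le> ennreal (c powr (1 / R) * \<eta>) * ennreal B1"
      by (intro mult_left_mono tk_integral t) simp
    finally show ?thesis using \<eta> B1_pos by (simp add: ennreal_mult[symmetric] mult_ac)
  qed
  note [measurable] = heat_measurable[OF assms(1)]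
  have L: "0 < B1 * c powr (1 / R) * \<eta>" using B1_pos c_pos \<eta> by simp
  note M = Lb_minkowski[OF p heat_measurable[OF assms(1), of t] _ _ _ NL L V0 W h]
  have N0: "0 < N s" if "s \<in> {0<..<t}" for s
    using that tk_pos[of s t] \<eta> c_pos by (auto simp: N_def)
  show "integrable lborel (\<lambda>s. indicator {0<..<t} s * heat (t - s) (g s) x)"
    by (rule M(2)) (auto intro: N0)
  have "Lb p (B1 * c powr (1 / R) * \<eta> * V) (B1 * c powr (1 / R) * \<eta> * W) (duhamel g t)"
    unfolding duhamel_def[abs_def] by (rule M(1)) (auto intro: N0)
  then show "Lb p (KD * \<eta> * W * (1 + t) powr (- \<alpha>)) (KD * \<eta> * W) (duhamel g t)"
  proof (rule Lb_mono)
    show "B1 * c powr (1 / R) * \<eta> * V \<le> KD * \<eta> * W * (1 + t) powr (- \<alpha>)"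
      by (simp add: KD_def V_def mult_ac)
    have "B1 * c powr (1 / R) * \<eta> * W * 1 \<le> B1 * c powr (1 / R) * \<eta> * W * C4"
      using L W C4_ge by (intro mult_left_mono) auto
    then show "B1 * c powr (1 / R) * \<eta> * W \<le> KD * \<eta> * W"
      by (simp add: KD_def mult_ac)
  qed (use L W p in auto)
qed

lemma pk_integral:
  assumes a: "a \<le> t"
  shows "(\<integral>\<^sup>+s. ennreal (indicator {a<..<t} s * (t - s) powr (- \<delta>)) \<partial>lborel) \<le> ennreal ((t - a) powr (1 - \<delta>) / (1 - \<delta>))"
proof -
  have "(\<integral>\<^sup>+s. ennreal (indicator {a<..<t} s * (t - s) powr (- \<delta>)) \<partial>lborel)
      = ennreal \<bar>- 1\<bar> * (\<integral>\<^sup>+z. ennreal (indicator {a<..<t} (t + - 1 * z) * (t - (t + - 1 * z)) powr (- \<delta>)) \<partial>lborel)"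
    by (rule nn_integral_real_affine) auto
  also have "\<dots> \<le> (\<integral>\<^sup>+z. ennreal (z powr (- \<delta>)) * indicator {0..t - a} z \<partial>lborel)"
    by (auto intro!: nn_integral_mono simp: indicator_def)
  also have "\<dots> = ennreal ((t - a) powr (- \<delta> + 1) / (- \<delta> + 1))"
    by (rule nn_integral_has_integral_lebesgue'[OF _ has_integral_powr_from_0]) (use del a in auto)
  finally show ?thesis by simp
qed

text \<open>With source bounds uniform in s only the singularity is left, and its integral over (0,
  t) is of order t^(1-\<delta>). This makes the correction vanish as t tends to 0.\<close>

lemma duhamel_short_time:
  assumes [measurable]: "(\<lambda>(s, y). g s y) \<in> borel_measurable (borel \<Otimes>\<^sub>M borel)"
    and \<eta>: "0 < \<eta>" and W: "0 \<le> W" and f: "\<And>s. 0 < s \<Longrightarrow> fac \<eta> W W (g s)" and t: "0 < t"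
  defines "E \<equiv> c powr (1 / R) * \<eta> / (1 - \<delta>) * t powr (1 - \<delta>) * W"
  shows "Lb p E E (duhamel g t)"
proof -
  define N where "N s = c powr (1 / R) * \<eta> * (t - s) powr (- \<delta>)" for s
  define L where "L = c powr (1 / R) * \<eta> * ((t - 0) powr (1 - \<delta>) / (1 - \<delta>))"
  have L: "0 < L" using c_pos \<eta> t del by (simp add: L_def)
  have "(\<integral>\<^sup>+s. ennreal (indicator {0<..<t} s * N s) \<partial>lborel) = (\<integral>\<^sup>+s. ennreal (c powr (1 / R) * \<eta>) * ennreal (indicator {0<..<t} s * (t - s) powr (- \<delta>)) \<partial>lborel)"
    using \<eta> by (intro nn_integral_cong) (simp add: N_def ennreal_mult[symmetric] mult_ac)
  also have "\<dots> = ennreal (c powr (1 / R) * \<eta>) * (\<integral>\<^sup>+s. ennreal (indicator {0<..<t} s * (t - s) powr (- \<delta>)) \<partial>lborel)"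
    by (rule nn_integral_cmult) measurable
  also have "\<dots> \<le> ennreal (c powr (1 / R) * \<eta>) * ennreal ((t - 0) powr (1 - \<delta>) / (1 - \<delta>))"
    using t by (intro mult_left_mono pk_integral) auto
  finally have NL: "(\<integral>\<^sup>+s. ennreal (indicator {0<..<t} s * N s) \<partial>lborel) \<le> ennreal L"
    using \<eta> del unfolding L_def by (subst ennreal_mult) auto
  have "Lb p (L * W) (L * W) (duhamel g t)"
    unfolding duhamel_def[abs_def]
  proof (rule Lb_minkowski[OF p heat_measurable[OF assms(1), of t] _ _ _ NL L W W])
    show "N \<in> borel_measurable borel" unfolding N_def by measurable
    show "0 < N s" if "s \<in> {0<..<t}" for s using that c_pos \<eta> by (auto simp: N_def)
    show "Lb p (N s * W) (N s * W) (heat (t - s) (g s))" if "s \<in> {0<..<t}" for s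
      using heat_fac(2)[OF f \<eta> W W, of s "t - s"] that by (simp add: N_def mult_ac)
  qed simp
  then show ?thesis by (simp add: L_def E_def mult_ac)
qed

end

section \<open>Continuity in time\<close>

lemma powr_small_ex:
  fixes a K e :: real
  assumes "0 < a" "0 \<le> K" "0 < e"
  obtains A where "0 < A" "A \<le> 1" "A powr a * K \<le> e"
proof
  \<comment> \<open>Dividing by K + 1 also covers K = 0.\<close>
  let ?A = "min 1 ((e / (K + 1)) powr (1 / a))"
  show "0 < ?A" "?A \<le> 1" using assms by auto
  have "?A powr a \<le> ((e / (K + 1)) powr (1 / a)) powr a" using assms by (intro powr_mono2) auto
  also have "\<dots> = e / (K + 1)" using assms by (simp add: powr_powr)
  finally have "?A powr a * K \<le> e / (K + 1) * K" using assms by (intro mult_right_mono) auto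
  also have "\<dots> \<le> e" using assms by (simp add: field_simps)
  finally show "?A powr a * K \<le> e" .
qed

text \<open>Norm continuity in L^infinity and L^p at once; by \<open>Lb_expL\<close> small equal
  radii mean a small Luxemburg norm.\<close>

definition Lb_cont :: "real \<Rightarrow> real set \<Rightarrow> (real \<Rightarrow> 'a::euclidean_space \<Rightarrow> real) \<Rightarrow> bool" where
  "Lb_cont p I G \<longleftrightarrow> (\<forall>t\<in>I. \<forall>e>0. \<exists>d>0. \<forall>s\<in>I. \<bar>s - t\<bar> < d \<longrightarrow> Lb p e e (\<lambda>x. G s x - G t x))"

lemma Lb_cont_add:
  assumes "Lb_cont p I G" "Lb_cont p I F" "1 \<le> p"
  shows "Lb_cont p I (\<lambda>t x. G t x + F t x)"
  unfolding Lb_cont_def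
proof (intro ballI allI impI)
  fix t and e :: real assume t: "t \<in> I" and e: "0 < e"
  \<comment> \<open>\<open>Lb_add\<close> multiplies the sum of the radii by 4, and 4 (e/8 + e/8) =
    e.\<close>
  then have e8: "0 < e / 8" by simp
  obtain d where d: "0 < d" "\<And>s. s \<in> I \<Longrightarrow> \<bar>s - t\<bar> < d \<Longrightarrow> Lb p (e / 8) (e / 8) (\<lambda>x. G s x - G t x)"
    using assms(1) t e8 unfolding Lb_cont_def by meson
  obtain d' where d': "0 < d'" "\<And>s. s \<in> I \<Longrightarrow> \<bar>s - t\<bar> < d' \<Longrightarrow> Lb p (e / 8) (e / 8) (\<lambda>x. F s x - F t x)"
    using assms(2) t e8 unfolding Lb_cont_def by meson
  show "\<exists>d>0. \<forall>s\<in>I. \<bar>s - t\<bar> < d \<longrightarrow> Lb p e e (\<lambda>x. G s x + F s x - (G t x + F t x))"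
  proof (intro exI[of _ "min d d'"] conjI ballI impI)
    show "0 < min d d'" using d d' by simp
    fix s assume s: "s \<in> I" "\<bar>s - t\<bar> < min d d'"
    have "Lb p (4 * (e / 8 + e / 8)) (4 * (e / 8 + e / 8)) (\<lambda>x. (G s x - G t x) + (F s x - F t x))"
      using d(2)[OF s(1)] d'(2)[OF s(1)] s e assms(3) by (intro Lb_add) auto
    then show "Lb p e e (\<lambda>x. G s x + F s x - (G t x + F t x))" by (simp add: algebra_simps)
  qed
qed

context smoothing
begin

text \<open>The modulus in t'/t becomes a tolerance proportional to t, which is uniform as long as t
  stays away from 0.\<close>

lemma kernel_diff:
  assumes A: "0 < A"
  obtains r where "0 < r" "\<And>t t'. 0 < t \<Longrightarrow> 0 < t' \<Longrightarrow> \<bar>t' - t\<bar> < r * t \<Longrightarrow> (\<integral>\<^sup>+x. ennreal \<bar>S t' x - S t x\<bar> \<partial>lborel) \<le> ennreal A"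
proof -
  obtain d where d: "0 < d" "\<And>t t'. 0 < t \<Longrightarrow> 0 < t' \<Longrightarrow> \<bar>t' / t - 1\<bar> < d \<Longrightarrow> (\<integral>\<^sup>+x. ennreal \<bar>S t' x - S t x\<bar> \<partial>lborel) \<le> ennreal A"
    using S_L1_cont[OF A] by blast
  show ?thesis
  proof (rule that[OF d(1)])
    fix t t' :: real assume t: "0 < t" "0 < t'" "\<bar>t' - t\<bar> < d * t"
    have "\<bar>t' / t - 1\<bar> = \<bar>t' - t\<bar> / t" using t(1) by (simp add: field_simps abs_if)
    also have "\<dots> < d" using t by (simp add: field_simps)
    finally show "(\<integral>\<^sup>+x. ennreal \<bar>S t' x - S t x\<bar> \<partial>lborel) \<le> ennreal A" using d(2) t by blast
  qed
qed

lemma kernel_diff_bound: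
  assumes "0 < \<tau>" "\<tau> \<le> t" "\<tau> \<le> t'"
  shows "\<bar>S t' x - S t x\<bar> \<le> c * \<tau> powr (- \<nu>)"
proof -
  have "S s x \<le> c * \<tau> powr (- \<nu>)" if "\<tau> \<le> s" for s
  proof -
    have "S s x \<le> c * s powr (- \<nu>)" using S_le that assms(1) by simp
    also have "\<dots> \<le> c * \<tau> powr (- \<nu>)" using that assms(1) c_pos nu_pos by (intro mult_left_mono powr_mono2') auto
    finally show ?thesis .
  qed
  then show ?thesis using assms S_nonneg[of t x] S_nonneg[of t' x] by (smt (verit))
qed

lemma heat_Lb0:
  assumes [measurable]: "g \<in> borel_measurable borel"
    and W: "(\<integral>\<^sup>+y. ennreal (\<bar>g y\<bar> powr p) \<partial>lborel) \<le> ennreal (W powr p)" "0 \<le> W" and t: "0 < t"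
  shows "integrable lborel (\<lambda>y. S t (x - y) * g y)"
    and "Lb p ((c * t powr (- \<nu>)) powr (1 / p) * W) W (heat t g)"
proof -
  have B: "0 < c * t powr (- \<nu>)" using c_pos t by simp
  have k: "(\<integral>\<^sup>+x. ennreal \<bar>S t x\<bar> \<partial>lborel) \<le> ennreal 1" "\<bar>S t x\<bar> \<le> c * t powr (- \<nu>)" for x
    using S_mass[OF t] S_nonneg S_le[OF t] by auto
  note * = conv_Lb0[OF S_borel assms(1) p zero_less_one B k W]
  show "integrable lborel (\<lambda>y. S t (x - y) * g y)" by (rule *(1))
  show "Lb p ((c * t powr (- \<nu>)) powr (1 / p) * W) W (heat t g)"
    using *(2) by (simp add: heat_def[abs_def])
qed

text \<open>The difference of two kernels has small mass A but a supremum that is merely bounded by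
  B. Since p > 1, the factor A^(1-1/p) still makes the supremum of the convolution small.\<close>

lemma heat_Lb_cont:
  assumes [measurable]: "g \<in> borel_measurable borel"
    and W: "(\<integral>\<^sup>+y. ennreal (\<bar>g y\<bar> powr p) \<partial>lborel) \<le> ennreal (W powr p)" "0 \<le> W"
  shows "Lb_cont p {0<..} (\<lambda>t. heat t g)"
  unfolding Lb_cont_def
proof (intro ballI allI impI)
  fix t e :: real assume "t \<in> {0<..}" and e: "0 < e"
  then have t: "0 < t" by simp
  define B where "B = c * (t / 2) powr (- \<nu>)"
  have B: "0 < B" using c_pos t by (simp add: B_def)
  have p1: "0 < 1 - 1 / p" using p by simp
  obtain A1 where A1: "0 < A1" "A1 \<le> 1" "A1 powr (1 - 1 / p) * (B powr (1 / p) * W) \<le> e"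
    by (rule powr_small_ex[OF p1 _ e, of "B powr (1 / p) * W"]) (use W in auto)
  obtain A2 where A2: "0 < A2" "A2 \<le> 1" "A2 powr 1 * W \<le> e"
    by (rule powr_small_ex[OF zero_less_one W(2) e])
  define A where "A = min A1 A2"
  have A: "0 < A" using A1 A2 by (simp add: A_def)
  have AA: "A powr (1 - 1 / p) * B powr (1 / p) * W \<le> e" "A * W \<le> e"
  proof -
    have "A powr (1 - 1 / p) * (B powr (1 / p) * W) \<le> A1 powr (1 - 1 / p) * (B powr (1 / p) * W)"
      using A p1 W by (intro mult_right_mono powr_mono2) (auto simp: A_def)
    then show "A powr (1 - 1 / p) * B powr (1 / p) * W \<le> e" using A1(3) by (simp add: mult.assoc)
    have "A * W \<le> A2 * W" using W by (intro mult_right_mono) (auto simp: A_def)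
    then show "A * W \<le> e" using A2 by simp
  qed
  obtain r where r: "0 < r" "\<And>t t'. 0 < t \<Longrightarrow> 0 < t' \<Longrightarrow> \<bar>t' - t\<bar> < r * t \<Longrightarrow> (\<integral>\<^sup>+x. ennreal \<bar>S t' x - S t x\<bar> \<partial>lborel) \<le> ennreal A"
    using kernel_diff[OF A] by blast
  show "\<exists>d>0. \<forall>s\<in>{0<..}. \<bar>s - t\<bar> < d \<longrightarrow> Lb p e e (\<lambda>x. heat s g x - heat t g x)"
  proof (intro exI[of _ "min (r * t) (t / 2)"] conjI ballI impI)
    show "0 < min (r * t) (t / 2)" using r t by simp
    fix s assume "s \<in> {0<..}" and st: "\<bar>s - t\<bar> < min (r * t) (t / 2)"
    then have s: "0 < s" by simp
    have s2: "t / 2 \<le> s" using st by (simp add: abs_if split: if_splits)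
    have k: "(\<integral>\<^sup>+x. ennreal \<bar>S s x - S t x\<bar> \<partial>lborel) \<le> ennreal A" "\<bar>S s x - S t x\<bar> \<le> B" for x
      using r(2)[OF t s] st kernel_diff_bound[of "t / 2" t s] s2 t by (auto simp: B_def)
    have km: "(\<lambda>x. S s x - S t x) \<in> borel_measurable borel" by measurable
    note * = conv_Lb0(2)[OF km assms(1) p A B k W]
    have "(\<lambda>x. \<integral>y. (S s (x - y) - S t (x - y)) * g y \<partial>lborel) = (\<lambda>x. heat s g x - heat t g x)"
      using heat_Lb0(1)[OF assms(1) W s] heat_Lb0(1)[OF assms(1) W t]
      by (simp add: heat_def left_diff_distrib)
    with * have "Lb p (A powr (1 - 1 / p) * B powr (1 / p) * W) (A * W) (\<lambda>x. heat s g x - heat t g x)" by simp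
    then show "Lb p e e (\<lambda>x. heat s g x - heat t g x)"
      by (rule Lb_mono) (use AA A W p in auto)
  qed
qed

text \<open>The two integrands are singular at t1 and t2. Before T = t1 - \<epsilon> the kernel
  difference has mass at most A and supremum at most c \<epsilon>^(-\<nu>); after T the two terms
  are estimated separately, at the cost of the integrals of their singularities.\<close>

lemma duhamel_increment:
  assumes [measurable]: "(\<lambda>(s, y). g s y) \<in> borel_measurable (borel \<Otimes>\<^sub>M borel)"
    and \<eta>: "0 < \<eta>" and W: "0 < W" and f: "\<And>s. 0 < s \<Longrightarrow> fac \<eta> W W (g s)"
    and int: "\<And>t x. 0 < t \<Longrightarrow> integrable lborel (\<lambda>s. indicator {0<..<t} s * heat (t - s) (g s) x)"
    and t: "0 < \<epsilon>" "\<epsilon> < t1" "t1 < t2" and A: "0 < A"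
    and kA: "\<And>s. 0 < s \<Longrightarrow> s < t1 - \<epsilon> \<Longrightarrow> (\<integral>\<^sup>+x. ennreal \<bar>S (t2 - s) x - S (t1 - s) x\<bar> \<partial>lborel) \<le> ennreal A"
  defines "E \<equiv> (t1 * (A powr (1 - 1 / R) * (c * \<epsilon> powr (- \<nu>)) powr (1 / R) * \<eta>)
      + c powr (1 / R) * \<eta> * 8 * (((t2 - t1 + \<epsilon>) powr (1 - \<delta>) + \<epsilon> powr (1 - \<delta>)) / (1 - \<delta>))) * W"
  shows "Lb p E E (\<lambda>x. duhamel g t2 x - duhamel g t1 x)"
proof -
  define K1 where "K1 = A powr (1 - 1 / R) * (c * \<epsilon> powr (- \<nu>)) powr (1 / R) * \<eta>"
  define K2 where "K2 = c powr (1 / R) * \<eta>"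
  have K: "0 < K1" "0 < K2" using A c_pos t \<eta> by (auto simp: K1_def K2_def)
  define T where "T = t1 - \<epsilon>"
  have T: "0 < T" "T < t1" using t by (auto simp: T_def)
  define N where "N s = indicator {0<..<t1} s * K1 + K2 * 8 * (indicator {T<..<t2} s * (t2 - s) powr (- \<delta>) + indicator {T<..<t1} s * (t1 - s) powr (- \<delta>))" for s
  define h where "h s x = indicator {0<..<t2} s * heat (t2 - s) (g s) x - indicator {0<..<t1} s * heat (t1 - s) (g s) x" for s x
  have [measurable]: "N \<in> borel_measurable borel" unfolding N_def by measurable
  note [measurable] = heat_measurable[OF assms(1)]
  have hm: "(\<lambda>(s, x). h s x) \<in> borel_measurable (borel \<Otimes>\<^sub>M borel)" unfolding h_def by measurable
  have N0: "0 < N s" if "s \<in> {0<..<t2}" for s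
  proof -
    have "0 < N s" if "0 < s" "s \<le> T" using that K T by (auto simp: N_def)
    moreover have "0 < N s" if "T < s" "s < t2"
    proof -
      have "0 < K2 * 8 * ((t2 - s) powr (- \<delta>) + indicator {T<..<t1} s * (t1 - s) powr (- \<delta>))"
        using K that by (intro mult_pos_pos add_pos_nonneg) auto
      moreover have "0 \<le> indicator {0<..<t1} s * K1" using K by simp
      ultimately show ?thesis unfolding N_def using that by simp
    qed
    ultimately show ?thesis using that by force
  qed
  have hL: "Lb p (N s * W) (N s * W) (h s)" if s: "s \<in> {0<..<t2} - {T}" for s
  proof (cases "s < T")
    case True
    have ss: "0 < s" "0 < t2 - s" "0 < t1 - s" "s < t1" "s < t2" using s True T t by auto
    have B: "0 < c * \<epsilon> powr (- \<nu>)" using c_pos t by simp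
    have k: "(\<integral>\<^sup>+x. ennreal \<bar>S (t2 - s) x - S (t1 - s) x\<bar> \<partial>lborel) \<le> ennreal A" "\<bar>S (t2 - s) x - S (t1 - s) x\<bar> \<le> c * \<epsilon> powr (- \<nu>)" for x
      using kA[OF ss(1)] True kernel_diff_bound[of \<epsilon> "t1 - s" "t2 - s"] t by (auto simp: T_def)
    have km: "(\<lambda>x. S (t2 - s) x - S (t1 - s) x) \<in> borel_measurable borel" by measurable
    note * = fac_conv(2)[OF f[OF ss(1)] \<eta> less_imp_le[OF W] less_imp_le[OF W] km A B k, folded K1_def]
    have "(\<lambda>x. \<integral>y. (S (t2 - s) (x - y) - S (t1 - s) (x - y)) * g s y \<partial>lborel) = h s"
      using heat_fac(1)[OF f[OF ss(1)] \<eta> less_imp_le[OF W] less_imp_le[OF W] ss(2)] heat_fac(1)[OF f[OF ss(1)] \<eta> less_imp_le[OF W] less_imp_le[OF W] ss(3)] ss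
      by (simp add: heat_def left_diff_distrib h_def fun_eq_iff)
    with * have "Lb p (K1 * W) (K1 * W) (h s)" by simp
    moreover have "N s = K1" using True ss by (simp add: N_def)
    ultimately show ?thesis by simp
  next
    case False
    then have sT: "T < s" "s < t2" "0 < s" using s T by auto
    have L: "Lb p (K2 * \<tau> powr (- \<delta>) * W) (K2 * \<tau> powr (- \<delta>) * W) (heat \<tau> (g s))" if "0 < \<tau>" for \<tau>
      using heat_fac(2)[OF f[OF sT(3)] \<eta> less_imp_le[OF W] less_imp_le[OF W] that] by (simp add: K2_def mult_ac)
    have NK: "K2 * 8 * ((t2 - s) powr (- \<delta>) + indicator {T<..<t1} s * (t1 - s) powr (- \<delta>)) \<le> N s"
      using K sT by (simp add: N_def)
    show ?thesis
    proof (cases "s < t1")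
      case True
      have a: "Lb p (4 * (K2 * (t2 - s) powr (- \<delta>) * W + K2 * (t1 - s) powr (- \<delta>) * W)) (4 * (K2 * (t2 - s) powr (- \<delta>) * W + K2 * (t1 - s) powr (- \<delta>) * W)) (\<lambda>x. heat (t2 - s) (g s) x - heat (t1 - s) (g s) x)"
        using True sT K W p by (intro Lb_diff L) auto
      have b: "(\<lambda>x. heat (t2 - s) (g s) x - heat (t1 - s) (g s) x) = h s" using True sT by (simp add: h_def fun_eq_iff)
      have d: "4 * (K2 * (t2 - s) powr (- \<delta>) * W + K2 * (t1 - s) powr (- \<delta>) * W) \<le> N s * W"
      proof -
        have "4 * (K2 * (t2 - s) powr (- \<delta>) + K2 * (t1 - s) powr (- \<delta>)) \<le> K2 * 8 * ((t2 - s) powr (- \<delta>) + indicator {T<..<t1} s * (t1 - s) powr (- \<delta>))"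
          using True sT K by (simp add: algebra_simps)
        then have "4 * (K2 * (t2 - s) powr (- \<delta>) + K2 * (t1 - s) powr (- \<delta>)) * W \<le> N s * W" using NK W by (intro mult_right_mono) auto
        then show ?thesis by (simp add: algebra_simps)
      qed
      have e: "0 \<le> 4 * (K2 * (t2 - s) powr (- \<delta>) * W + K2 * (t1 - s) powr (- \<delta>) * W)" "0 \<le> p" using W K p by auto
      show ?thesis by (rule Lb_mono[OF a[unfolded b] d e(1) d e(2)])
    next
      case False
      have a: "Lb p (K2 * (t2 - s) powr (- \<delta>) * W) (K2 * (t2 - s) powr (- \<delta>) * W) (heat (t2 - s) (g s))"
        using sT by (intro L) auto
      have b: "heat (t2 - s) (g s) = h s" using False sT by (simp add: h_def fun_eq_iff)
      have d: "K2 * (t2 - s) powr (- \<delta>) * W \<le> N s * W"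
        using NK W K False by (intro mult_right_mono) (auto elim!: order_trans[rotated])
      have e: "0 \<le> K2 * (t2 - s) powr (- \<delta>) * W" "0 \<le> p" using W K p by auto
      show ?thesis by (rule Lb_mono[OF a[unfolded b] d e(1) d e(2)])
    qed
  qed
  \<comment> \<open>At s = T neither estimate applies: the kernel bound is for s < T, and the
    singular terms of \<open>N\<close> start after T. The point is null and is removed.\<close>
  let ?I = "{0<..<t2} - {T}"
  define LL where "LL = t1 * K1 + K2 * 8 * (((t2 - t1 + \<epsilon>) powr (1 - \<delta>) + \<epsilon> powr (1 - \<delta>)) / (1 - \<delta>))"
  have LL: "0 < LL" using t K del by (auto simp: LL_def intro!: add_pos_nonneg)
  have NL: "(\<integral>\<^sup>+s. ennreal (indicator ?I s * N s) \<partial>lborel) \<le> ennreal LL"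
  proof -
    have "(\<integral>\<^sup>+s. ennreal (indicator ?I s * N s) \<partial>lborel) \<le> (\<integral>\<^sup>+s. ennreal K1 * indicator {0<..<t1} s
       + ennreal (K2 * 8) * (ennreal (indicator {T<..<t2} s * (t2 - s) powr (- \<delta>)) + ennreal (indicator {T<..<t1} s * (t1 - s) powr (- \<delta>))) \<partial>lborel)"
    proof (rule nn_integral_mono)
      fix s
      have "indicator ?I s * N s \<le> N s"
        using K by (auto simp: indicator_def N_def)
      then have "ennreal (indicator ?I s * N s) \<le> ennreal (N s)" by (rule ennreal_leI)
      also have "\<dots> = ennreal K1 * indicator {0<..<t1} s + ennreal (K2 * 8) * (ennreal (indicator {T<..<t2} s * (t2 - s) powr (- \<delta>)) + ennreal (indicator {T<..<t1} s * (t1 - s) powr (- \<delta>)))"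
        unfolding N_def using K
        by (subst ennreal_plus) (auto simp: ennreal_mult[symmetric] ennreal_plus[symmetric] mult.commute simp del: ennreal_plus simp flip: ennreal_indicator)
      finally show "ennreal (indicator ?I s * N s) \<le> \<dots>" .
    qed
    also have "\<dots> = ennreal K1 * emeasure lborel {0<..<t1} + ennreal (K2 * 8) * ((\<integral>\<^sup>+s. ennreal (indicator {T<..<t2} s * (t2 - s) powr (- \<delta>)) \<partial>lborel) + (\<integral>\<^sup>+s. ennreal (indicator {T<..<t1} s * (t1 - s) powr (- \<delta>)) \<partial>lborel))"
      by (simp add: nn_integral_add nn_integral_cmult nn_integral_cmult_indicator)
    also have "\<dots> \<le> ennreal K1 * ennreal t1 + ennreal (K2 * 8) * (ennreal ((t2 - T) powr (1 - \<delta>) / (1 - \<delta>)) + ennreal ((t1 - T) powr (1 - \<delta>) / (1 - \<delta>)))"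
      using t T by (intro add_mono mult_left_mono pk_integral) auto
    also have "\<dots> = ennreal LL"
      using K t del by (simp add: LL_def T_def ennreal_mult[symmetric] ennreal_plus[symmetric] add_divide_distrib algebra_simps del: ennreal_plus)
    finally show ?thesis .
  qed
  have "Lb p (LL * W) (LL * W) (\<lambda>x. \<integral>s. indicator ?I s * h s x \<partial>lborel)"
    by (rule Lb_minkowski(1)[OF p hm _ _ _ NL LL less_imp_le[OF W] less_imp_le[OF W] hL]) (auto intro: N0)
  also have "(\<lambda>x. \<integral>s. indicator ?I s * h s x \<partial>lborel) = (\<lambda>x. duhamel g t2 x - duhamel g t1 x)"
  proof
    fix x
    have "(\<integral>s. indicator ?I s * h s x \<partial>lborel) = (\<integral>s. h s x \<partial>lborel)"
    proof (rule integral_cong_AE)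
      have "AE s in lborel. s \<noteq> T" by (rule AE_lborel_singleton)
      then show "AE s in lborel. indicator ?I s * h s x = h s x"
        by eventually_elim (use t in \<open>auto simp: indicator_def h_def\<close>)
    qed (use hm in measurable)
    also have "\<dots> = duhamel g t2 x - duhamel g t1 x"
      unfolding h_def duhamel_def using t by (intro Bochner_Integration.integral_diff int) auto
    finally show "(\<integral>s. indicator ?I s * h s x \<partial>lborel) = duhamel g t2 x - duhamel g t1 x" .
  qed
  finally show ?thesis by (simp add: E_def LL_def K1_def K2_def)
qed

end

context smoothing
begin

lemma R_gt_1: "1 / R < 1"
  using pR p by (smt (verit) divide_pos_pos)

lemma duhamel_Lb_cont:
  assumes g: "(\<lambda>(s, y). g s y) \<in> borel_measurable (borel \<Otimes>\<^sub>M borel)"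
    and \<eta>: "0 < \<eta>" and W: "0 < W" and f: "\<And>s. 0 < s \<Longrightarrow> fac \<eta> W W (g s)"
    and int: "\<And>t x. 0 < t \<Longrightarrow> integrable lborel (\<lambda>s. indicator {0<..<t} s * heat (t - s) (g s) x)"
  shows "Lb_cont p {0<..} (duhamel g)"
  unfolding Lb_cont_def
proof (intro ballI allI impI)
  fix t e :: real assume "t \<in> {0<..}" and e: "0 < e"
  then have t: "0 < t" by simp
  define K where "K = c powr (1 / R) * \<eta> * 8 / (1 - \<delta>) * W"
  have K: "0 < K" using c_pos \<eta> W del by (simp add: K_def)
  have d1: "0 < 1 - \<delta>" "0 < e / 2" "0 \<le> 2 * K" using del e K by auto
  obtain A0 where A0: "0 < A0" "A0 \<le> 1" "A0 powr (1 - \<delta>) * (2 * K) \<le> e / 2"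
    by (rule powr_small_ex[OF d1(1) d1(3) d1(2)])
  \<comment> \<open>The distance from the singularity is fixed first and makes the recent part at
    most e/2; A is chosen afterwards, against a constant depending on \<epsilon>.\<close>
  define \<epsilon> where "\<epsilon> = min (A0 / 2) (t / 4)"
  have \<epsilon>: "0 < \<epsilon>" "\<epsilon> \<le> t / 4" "2 * \<epsilon> \<le> A0" using A0 t by (auto simp: \<epsilon>_def)
  define K' where "K' = 2 * t * (c * \<epsilon> powr (- \<nu>)) powr (1 / R) * \<eta> * W"
  have K': "0 \<le> K'" using t \<eta> W by (simp add: K'_def)
  have r1: "0 < 1 - 1 / R" using R_gt_1 by simp
  obtain A where A: "0 < A" "A \<le> 1" "A powr (1 - 1 / R) * K' \<le> e / 2"
    by (rule powr_small_ex[OF r1 K' d1(2)])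
  obtain r where r: "0 < r" "\<And>t t'. 0 < t \<Longrightarrow> 0 < t' \<Longrightarrow> \<bar>t' - t\<bar> < r * t \<Longrightarrow> (\<integral>\<^sup>+x. ennreal \<bar>S t' x - S t x\<bar> \<partial>lborel) \<le> ennreal A"
    using kernel_diff[OF A(1)] by blast
  \<comment> \<open>For s < t1 - \<epsilon> the elapsed time t1 - s exceeds \<epsilon>, so d <= r
    \<epsilon> meets the proportional tolerance of \<open>kernel_diff\<close>.\<close>
  define d where "d = min \<epsilon> (r * \<epsilon>)"
  have d: "0 < d" "d \<le> \<epsilon>" "d \<le> r * \<epsilon>" using \<epsilon> r by (auto simp: d_def)
  have main: "Lb p e e (\<lambda>x. duhamel g t2 x - duhamel g t1 x)"
    if tt: "t1 < t2" "t2 - t1 < d" "t - \<epsilon> \<le> t1" "t1 \<le> t + \<epsilon>" for t1 t2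
  proof -
    have t1: "\<epsilon> < t1" "t1 \<le> 2 * t" using tt \<epsilon> t by linarith+
    have kA: "(\<integral>\<^sup>+x. ennreal \<bar>S (t2 - s) x - S (t1 - s) x\<bar> \<partial>lborel) \<le> ennreal A" if s: "0 < s" "s < t1 - \<epsilon>" for s
    proof (rule r(2))
      have "r * \<epsilon> \<le> r * (t1 - s)" using s r by (intro mult_left_mono) auto
      then show "\<bar>t2 - s - (t1 - s)\<bar> < r * (t1 - s)" using tt d by simp
    qed (use s tt \<epsilon> in auto)
    let ?E = "(t1 * (A powr (1 - 1 / R) * (c * \<epsilon> powr (- \<nu>)) powr (1 / R) * \<eta>)
      + c powr (1 / R) * \<eta> * 8 * (((t2 - t1 + \<epsilon>) powr (1 - \<delta>) + \<epsilon> powr (1 - \<delta>)) / (1 - \<delta>))) * W"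
    have E: "Lb p ?E ?E (\<lambda>x. duhamel g t2 x - duhamel g t1 x)"
      by (rule duhamel_increment[OF g \<eta> W f int \<epsilon>(1) t1(1) tt(1) A(1) kA])
    have "t1 * (A powr (1 - 1 / R) * (c * \<epsilon> powr (- \<nu>)) powr (1 / R) * \<eta>) * W \<le> 2 * t * (A powr (1 - 1 / R) * (c * \<epsilon> powr (- \<nu>)) powr (1 / R) * \<eta>) * W"
      using t1 \<eta> W by (intro mult_right_mono) auto
    also have "\<dots> = A powr (1 - 1 / R) * K'" by (simp add: K'_def mult_ac)
    finally have 1: "t1 * (A powr (1 - 1 / R) * (c * \<epsilon> powr (- \<nu>)) powr (1 / R) * \<eta>) * W \<le> e / 2" using A(3) by simp
    have "(t2 - t1 + \<epsilon>) powr (1 - \<delta>) \<le> A0 powr (1 - \<delta>)" "\<epsilon> powr (1 - \<delta>) \<le> A0 powr (1 - \<delta>)"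
      using tt d \<epsilon> d1 by (auto intro!: powr_mono2)
    then have "K * ((t2 - t1 + \<epsilon>) powr (1 - \<delta>) + \<epsilon> powr (1 - \<delta>)) \<le> K * (A0 powr (1 - \<delta>) + A0 powr (1 - \<delta>))"
      using K by (intro mult_left_mono add_mono) auto
    then have 2: "K * ((t2 - t1 + \<epsilon>) powr (1 - \<delta>) + \<epsilon> powr (1 - \<delta>)) \<le> e / 2"
    proof -
      assume "K * ((t2 - t1 + \<epsilon>) powr (1 - \<delta>) + \<epsilon> powr (1 - \<delta>)) \<le> K * (A0 powr (1 - \<delta>) + A0 powr (1 - \<delta>))"
      also have "K * (A0 powr (1 - \<delta>) + A0 powr (1 - \<delta>)) = A0 powr (1 - \<delta>) * (2 * K)" by (simp add: algebra_simps)
      finally show ?thesis using A0(3) by linarith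
    qed
    have "(X + Y * 8 * (Z / D)) * W = X * W + (Y * 8 / D * W) * Z" for X Y Z D W :: real
      by (simp add: distrib_right)
    then have "?E = t1 * (A powr (1 - 1 / R) * (c * \<epsilon> powr (- \<nu>)) powr (1 / R) * \<eta>) * W + K * ((t2 - t1 + \<epsilon>) powr (1 - \<delta>) + \<epsilon> powr (1 - \<delta>))"
      unfolding K_def .
    then have 3: "?E \<le> e" using 1 2 by linarith
    have "0 \<le> ?E" using LbD(4)[OF E] .
    with 3 show ?thesis using p by (intro Lb_mono[OF E]) auto
  qed
  show "\<exists>d>0. \<forall>s\<in>{0<..}. \<bar>s - t\<bar> < d \<longrightarrow> Lb p e e (\<lambda>x. duhamel g s x - duhamel g t x)"
  proof (intro exI[of _ d] conjI ballI impI d(1))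
    fix s assume s: "s \<in> {0<..}" "\<bar>s - t\<bar> < d"
    consider "s < t" | "s = t" | "t < s" by linarith
    then show "Lb p e e (\<lambda>x. duhamel g s x - duhamel g t x)"
    proof cases
      case 1
      have "Lb p e e (\<lambda>x. duhamel g t x - duhamel g s x)" by (rule main) (use 1 s d \<epsilon> in auto)
      from Lb_uminus[OF this] show ?thesis by simp
    next
      case 2 then show ?thesis using e p by (simp add: Lb_def)
    next
      case 3 show ?thesis by (rule main) (use 3 s d \<epsilon> in auto)
    qed
  qed
qed

text \<open>The increment is S(t - s') applied to g(s') - g(s), plus the kernel difference applied
  to g(s). The interval is open at t, so near each s the elapsed time stays away from 0.\<close>

lemma heat_integrand_Lb_cont:
  assumes \<eta>: "0 < \<eta>" and W: "0 \<le> W" and f: "\<And>s. 0 < s \<Longrightarrow> fac \<eta> W W (g s)"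
    and gc: "\<And>s e. 0 < s \<Longrightarrow> 0 < e \<Longrightarrow> \<exists>d>0. \<forall>s'>0. \<bar>s' - s\<bar> < d \<longrightarrow> fac \<eta> e e (\<lambda>y. g s' y - g s y)"
  shows "Lb_cont p {0<..<t} (\<lambda>s. heat (t - s) (g s))"
  unfolding Lb_cont_def
proof (intro ballI allI impI)
  fix s e :: real assume "s \<in> {0<..<t}" and e: "0 < e"
  then have s: "0 < s" "0 < t - s" by auto
  \<comment> \<open>Half the remaining time: if s' is within \<tau> of s then t - s' >= \<tau>,
    which bounds both kernels.\<close>
  define \<tau> where "\<tau> = (t - s) / 2"
  have \<tau>: "0 < \<tau>" using s by (simp add: \<tau>_def)
  define K where "K = c powr (1 / R) * \<tau> powr (- \<delta>) * \<eta>"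
  have K: "0 < K" using c_pos \<tau> \<eta> by (simp add: K_def)
  define e1 where "e1 = e / (8 * K)"
  have e1: "0 < e1" "K * e1 = e / 8" using e K by (auto simp: e1_def)
  obtain d1 where d1: "0 < d1" "\<And>s'. 0 < s' \<Longrightarrow> \<bar>s' - s\<bar> < d1 \<Longrightarrow> fac \<eta> e1 e1 (\<lambda>y. g s' y - g s y)"
    using gc[OF s(1) e1(1)] by blast
  define B where "B = c * \<tau> powr (- \<nu>)"
  have B: "0 < B" using c_pos \<tau> by (simp add: B_def)
  have r1: "0 < 1 - 1 / R" "0 \<le> B powr (1 / R) * \<eta> * W" "0 < e / 8" using R_gt_1 B \<eta> W e by auto
  obtain A where A: "0 < A" "A \<le> 1" "A powr (1 - 1 / R) * (B powr (1 / R) * \<eta> * W) \<le> e / 8"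
    by (rule powr_small_ex[OF r1])
  obtain r where r: "0 < r" "\<And>t t'. 0 < t \<Longrightarrow> 0 < t' \<Longrightarrow> \<bar>t' - t\<bar> < r * t \<Longrightarrow> (\<integral>\<^sup>+x. ennreal \<bar>S t' x - S t x\<bar> \<partial>lborel) \<le> ennreal A"
    using kernel_diff[OF A(1)] by blast
  define d where "d = min d1 (min \<tau> (r * (t - s)))"
  have d: "0 < d" "d \<le> d1" "d \<le> \<tau>" "d \<le> r * (t - s)" using d1 \<tau> r s by (auto simp: d_def)
  show "\<exists>d>0. \<forall>s'\<in>{0<..<t}. \<bar>s' - s\<bar> < d \<longrightarrow> Lb p e e (\<lambda>x. heat (t - s') (g s') x - heat (t - s) (g s) x)"
  proof (intro exI[of _ d] conjI ballI impI d(1))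
    fix s' assume "s' \<in> {0<..<t}" and ss: "\<bar>s' - s\<bar> < d"
    then have s': "0 < s'" "0 < t - s'" by auto
    have ts: "\<tau> \<le> t - s'" "\<tau> \<le> t - s" using ss d \<tau> by (auto simp: \<tau>_def abs_if split: if_splits)
    have F: "fac \<eta> e1 e1 (\<lambda>y. g s' y - g s y)" using d1(2)[OF s'(1)] ss d by simp
    note F1 = heat_fac[OF F \<eta> less_imp_le[OF e1(1)] less_imp_le[OF e1(1)] s'(2)]
    have "c powr (1 / R) * (t - s') powr (- \<delta>) * \<eta> * e1 \<le> K * e1"
      unfolding K_def using ts \<tau> del \<eta> e1 by (intro mult_right_mono mult_left_mono powr_mono2') auto
    then have 1: "Lb p (e / 8) (e / 8) (heat (t - s') (\<lambda>y. g s' y - g s y))"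
      unfolding e1(2) using \<eta> e1 p by (intro Lb_mono[OF F1(2)]) auto
    have k: "(\<integral>\<^sup>+x. ennreal \<bar>S (t - s') x - S (t - s) x\<bar> \<partial>lborel) \<le> ennreal A" "\<bar>S (t - s') x - S (t - s) x\<bar> \<le> B" for x
    proof -
      show "(\<integral>\<^sup>+x. ennreal \<bar>S (t - s') x - S (t - s) x\<bar> \<partial>lborel) \<le> ennreal A"
        using ss d by (intro r(2) s s') auto
      show "\<bar>S (t - s') x - S (t - s) x\<bar> \<le> B" unfolding B_def by (rule kernel_diff_bound[OF \<tau> ts(2) ts(1)])
    qed
    have km: "(\<lambda>x. S (t - s') x - S (t - s) x) \<in> borel_measurable borel" by measurable
    note G = fac_conv[OF f[OF s(1)] \<eta> W W km A(1) B k]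
    have 2: "Lb p (e / 8) (e / 8) (\<lambda>x. \<integral>y. (S (t - s') (x - y) - S (t - s) (x - y)) * g s y \<partial>lborel)"
      using A(3) \<eta> W p by (intro Lb_mono[OF G(2)]) (auto simp: mult_ac)
    have int1: "integrable lborel (\<lambda>y. S (t - s') (x - y) * (g s' y - g s y))" for x by (rule F1(1))
    have int2: "integrable lborel (\<lambda>y. S (t - s') (x - y) * g s' y)" "integrable lborel (\<lambda>y. S (t - s) (x - y) * g s y)" for x
      using heat_fac(1)[OF f[OF s'(1)] \<eta> W W s'(2)] heat_fac(1)[OF f[OF s(1)] \<eta> W W s(2)] by auto
    have "(\<lambda>x. heat (t - s') (\<lambda>y. g s' y - g s y) x + (\<integral>y. (S (t - s') (x - y) - S (t - s) (x - y)) * g s y \<partial>lborel))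
       = (\<lambda>x. heat (t - s') (g s') x - heat (t - s) (g s) x)"
    proof
      fix x
      have "heat (t - s') (\<lambda>y. g s' y - g s y) x + (\<integral>y. (S (t - s') (x - y) - S (t - s) (x - y)) * g s y \<partial>lborel)
        = (\<integral>y. S (t - s') (x - y) * (g s' y - g s y) + (S (t - s') (x - y) - S (t - s) (x - y)) * g s y \<partial>lborel)"
        unfolding heat_def by (rule Bochner_Integration.integral_add[symmetric, OF int1 G(1)])
      also have "\<dots> = (\<integral>y. S (t - s') (x - y) * g s' y - S (t - s) (x - y) * g s y \<partial>lborel)"
        by (intro Bochner_Integration.integral_cong refl) (simp add: algebra_simps)
      also have "\<dots> = heat (t - s') (g s') x - heat (t - s) (g s) x"
        unfolding heat_def by (rule Bochner_Integration.integral_diff[OF int2])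
      finally show "heat (t - s') (\<lambda>y. g s' y - g s y) x + (\<integral>y. (S (t - s') (x - y) - S (t - s) (x - y)) * g s y \<partial>lborel) = heat (t - s') (g s') x - heat (t - s) (g s) x" .
    qed
    then show "Lb p e e (\<lambda>x. heat (t - s') (g s') x - heat (t - s) (g s) x)"
      using Lb_add[OF 1 2] e p by simp
  qed
qed

text \<open>Jensen's inequality for the convex function exp(|.|^p) - 1 and the probability density
  S(t), then Fubini with mass one. The modular bound survives at the same level a, with no constant
  lost.\<close>

lemma heat_modular:
  assumes [measurable]: "u0 \<in> borel_measurable borel" and a: "0 < a"
    and u0: "(\<integral>\<^sup>+x. ennreal (exp ((\<bar>u0 x\<bar> / a) powr p) - 1) \<partial>lborel) \<le> 1" and t: "0 < t"
  shows "(\<integral>\<^sup>+x. ennreal (exp ((\<bar>heat t u0 x\<bar> / a) powr p) - 1) \<partial>lborel) \<le> 1"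
proof -
  define \<psi> where "\<psi> y = (\<bar>u0 y\<bar> / a) powr p" for y
  have \<psi>0: "0 \<le> \<psi> y" for y by (simp add: \<psi>_def)
  have [measurable]: "\<psi> \<in> borel_measurable borel" unfolding \<psi>_def by measurable
  have pw: "ennreal (exp ((\<bar>heat t u0 x\<bar> / a) powr p) - 1) \<le> (\<integral>\<^sup>+y. ennreal (S t (x - y) * (exp (\<psi> y) - 1)) \<partial>lborel)" for x
  proof -
    have fin: "(\<integral>\<^sup>+y. ennreal (S t (x - y) * (exp (\<psi> y) - 1)) \<partial>lborel) \<le> ennreal (c * t powr (- \<nu>))"
    proof -
      have "(\<integral>\<^sup>+y. ennreal (S t (x - y) * (exp (\<psi> y) - 1)) \<partial>lborel) \<le> (\<integral>\<^sup>+y. ennreal (c * t powr (- \<nu>)) * ennreal (exp (\<psi> y) - 1) \<partial>lborel)"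
        using S_le[OF t] \<psi>0 c_pos by (intro nn_integral_mono) (auto simp flip: ennreal_mult intro!: ennreal_leI mult_right_mono)
      also have "\<dots> = ennreal (c * t powr (- \<nu>)) * (\<integral>\<^sup>+y. ennreal (exp (\<psi> y) - 1) \<partial>lborel)" by (rule nn_integral_cmult) measurable
      also have "\<dots> \<le> ennreal (c * t powr (- \<nu>)) * 1" using u0 by (intro mult_left_mono) (auto simp: \<psi>_def)
      finally show ?thesis by simp
    qed
    have i1: "integrable lborel (\<lambda>y. S t (x - y) * (exp (\<psi> y) - 1))"
      unfolding integrable_iff_bounded using fin S_nonneg \<psi>0 by (auto intro: le_less_trans)
    have i2: "integrable lborel (\<lambda>y. S t (x - y) * \<psi> y)"
    proof (rule Bochner_Integration.integrable_bound[OF i1])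
      show "AE y in lborel. norm (S t (x - y) * \<psi> y) \<le> norm (S t (x - y) * (exp (\<psi> y) - 1))"
      proof (rule AE_I2)
        fix y
        have "\<psi> y \<le> exp (\<psi> y) - 1" using exp_ge_add_one_self[of "\<psi> y"] by linarith
        then show "norm (S t (x - y) * \<psi> y) \<le> norm (S t (x - y) * (exp (\<psi> y) - 1))"
          using S_nonneg \<psi>0[of y] by (simp add: abs_mult mult_left_mono)
      qed
    qed measurable
    have i3: "integrable lborel (\<lambda>y. S t (x - y))"
      unfolding integrable_iff_bounded using S_mass_reflect[OF t, of x] S_nonneg by simp
    have m1: "(\<integral>y. S t (x - y) \<partial>lborel) = 1"
      using nn_integral_eq_integral[OF i3] S_mass_reflect[OF t, of x] S_nonneg by simp
    \<comment> \<open>Jensen is applied in two stages through the average r of \<psi>: for the p-th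
      power, where |heat|^p / a^p <= r, and then for the exponential.\<close>
    define r where "r = (\<integral>y. S t (x - y) * \<psi> y \<partial>lborel)"
    have r0: "0 \<le> r" unfolding r_def using S_nonneg \<psi>0 by (intro Bochner_Integration.integral_nonneg) auto
    have J: "(\<integral>\<^sup>+y. ennreal (S t (x - y) * (\<bar>u0 y\<bar> / a)) \<partial>lborel) \<le> ennreal (1 powr (1 - 1 / p) * r powr (1 / p))"
    proof (rule nn_integral_jensen_powr)
      show "(\<integral>\<^sup>+y. ennreal (S t (x - y) * (\<bar>u0 y\<bar> / a) powr p) \<partial>lborel) \<le> ennreal r"
        using nn_integral_eq_integral[OF i2] S_nonneg \<psi>0 unfolding \<psi>_def r_def by simp
    qed (use S_nonneg a p r0 S_mass_reflect[OF t, of x] in auto)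
    have I: "ennreal (\<bar>heat t u0 x\<bar> / a) \<le> (\<integral>\<^sup>+y. ennreal (S t (x - y) * (\<bar>u0 y\<bar> / a)) \<partial>lborel)"
    proof -
      have "\<bar>heat t u0 x\<bar> / a = \<bar>\<integral>y. S t (x - y) * u0 y / a \<partial>lborel\<bar>" using a by (simp add: heat_def)
      moreover have "ennreal \<bar>\<integral>y. S t (x - y) * u0 y / a \<partial>lborel\<bar> \<le> (\<integral>\<^sup>+y. ennreal \<bar>S t (x - y) * u0 y / a\<bar> \<partial>lborel)"
        by (rule ennreal_abs_integral_le)
      ultimately show ?thesis using a S_nonneg by (simp add: abs_mult)
    qed
    have "ennreal (\<bar>heat t u0 x\<bar> / a) \<le> ennreal (1 * r powr (1 / p))"
      using order_trans[OF I J] unfolding powr_one_eq_one .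
    from le_enn_powr[OF this] have hr: "(\<bar>heat t u0 x\<bar> / a) powr p \<le> r" using a p r0 by simp
    \<comment> \<open>The tangent of exp at r gives exp r (1 + \<psi> - r) <= exp \<psi>; averaging
      cancels the linear term because r is the mean of \<psi>.\<close>
    have er: "exp r - 1 \<le> (\<integral>y. S t (x - y) * (exp (\<psi> y) - 1) \<partial>lborel)"
    proof -
      have "(\<integral>y. exp r * (S t (x - y) * \<psi> y) + (exp r - exp r * r - 1) * S t (x - y) \<partial>lborel) \<le> (\<integral>y. S t (x - y) * (exp (\<psi> y) - 1) \<partial>lborel)"
      proof (intro integral_mono i1 Bochner_Integration.integrable_add integrable_mult_right i2 i3)
        fix y
        have "1 + (\<psi> y - r) \<le> exp (\<psi> y - r)" by (rule exp_ge_add_one_self)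
        then have "exp r * (1 + (\<psi> y - r)) \<le> exp r * exp (\<psi> y - r)" by (intro mult_left_mono) auto
        also have "exp r * exp (\<psi> y - r) = exp (\<psi> y)" by (simp add: mult_exp_exp)
        also have "exp r * (1 + (\<psi> y - r)) = exp r * \<psi> y + (exp r - exp r * r)" by (simp only: distrib_left right_diff_distrib mult_1_right)
        finally have "exp r * \<psi> y + (exp r - exp r * r - 1) \<le> exp (\<psi> y) - 1" by linarith
        then have "S t (x - y) * (exp r * \<psi> y + (exp r - exp r * r - 1)) \<le> S t (x - y) * (exp (\<psi> y) - 1)" using S_nonneg by (rule mult_left_mono)
        then show "exp r * (S t (x - y) * \<psi> y) + (exp r - exp r * r - 1) * S t (x - y) \<le> S t (x - y) * (exp (\<psi> y) - 1)"
          by (simp add: algebra_simps)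
      qed
      moreover have "(\<integral>y. exp r * (S t (x - y) * \<psi> y) + (exp r - exp r * r - 1) * S t (x - y) \<partial>lborel) = exp r * r + (exp r - exp r * r - 1) * 1"
        using i2 i3 by (subst Bochner_Integration.integral_add) (auto simp: r_def m1)
      ultimately show ?thesis by simp
    qed
    have "exp ((\<bar>heat t u0 x\<bar> / a) powr p) - 1 \<le> (\<integral>y. S t (x - y) * (exp (\<psi> y) - 1) \<partial>lborel)"
    proof -
      have "exp ((\<bar>heat t u0 x\<bar> / a) powr p) \<le> exp r" using hr by simp
      with er show ?thesis by linarith
    qed
    then have "ennreal (exp ((\<bar>heat t u0 x\<bar> / a) powr p) - 1) \<le> ennreal (\<integral>y. S t (x - y) * (exp (\<psi> y) - 1) \<partial>lborel)" by (rule ennreal_leI)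
    then show ?thesis using nn_integral_eq_integral[OF i1] S_nonneg \<psi>0 by simp
  qed
  have "(\<integral>\<^sup>+x. ennreal (exp ((\<bar>heat t u0 x\<bar> / a) powr p) - 1) \<partial>lborel) \<le> (\<integral>\<^sup>+x. (\<integral>\<^sup>+y. ennreal (S t (x - y) * (exp (\<psi> y) - 1)) \<partial>lborel) \<partial>lborel)"
    by (intro nn_integral_mono pw)
  also have "\<dots> = (\<integral>\<^sup>+x. ennreal (S t x) \<partial>lborel) * (\<integral>\<^sup>+y. ennreal (exp (\<psi> y) - 1) \<partial>lborel)"
    using S_nonneg \<psi>0 by (intro nn_integral_conv) auto
  also have "\<dots> \<le> 1" using u0 S_mass[OF t] by (simp add: \<psi>_def)
  finally show ?thesis .
qed

end

text \<open>Fatou's lemma for the L^p bound; a closed pointwise bound passes to the limit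
  directly.\<close>

lemma Lb_limit:
  assumes v: "\<And>n. Lb p V W (v n)" and lim: "\<And>x. (\<lambda>n. v n x) \<longlonglongrightarrow> u x" and p: "0 < p"
  shows "Lb p V W u"
  unfolding Lb_def
proof (intro conjI allI)
  have [measurable]: "v n \<in> borel_measurable borel" for n by (rule LbD(1)[OF v])
  show [measurable]: "u \<in> borel_measurable borel" by (rule borel_measurable_LIMSEQ_real[OF lim]) simp
  show "\<bar>u x\<bar> \<le> V" for x
    by (rule LIMSEQ_le_const2[OF tendsto_rabs[OF lim]]) (use LbD(2)[OF v] in auto)
  have "(\<integral>\<^sup>+x. ennreal (\<bar>u x\<bar> powr p) \<partial>lborel) = (\<integral>\<^sup>+x. liminf (\<lambda>n. ennreal (\<bar>v n x\<bar> powr p)) \<partial>lborel)"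
  proof (intro nn_integral_cong)
    fix x
    have "(\<lambda>n. ennreal (\<bar>v n x\<bar> powr p)) \<longlonglongrightarrow> ennreal (\<bar>u x\<bar> powr p)"
      using p by (intro tendsto_ennrealI tendsto_powr' tendsto_rabs lim tendsto_const) auto
    from lim_imp_Liminf[OF sequentially_bot this]
    show "ennreal (\<bar>u x\<bar> powr p) = liminf (\<lambda>n. ennreal (\<bar>v n x\<bar> powr p))" ..
  qed
  also have "\<dots> \<le> liminf (\<lambda>n. \<integral>\<^sup>+x. ennreal (\<bar>v n x\<bar> powr p) \<partial>lborel)"
    by (rule nn_integral_liminf) simp
  also have "\<dots> \<le> liminf (\<lambda>n. ennreal (W powr p))"
    by (intro Liminf_mono always_eventually allI LbD(3)[OF v])
  also have "\<dots> = ennreal (W powr p)" by (simp add: Liminf_const)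
  finally show "(\<integral>\<^sup>+x. ennreal (\<bar>u x\<bar> powr p) \<partial>lborel) \<le> ennreal (W powr p)" .
qed

section \<open>Elementary inequalities for the exponential weight\<close>

lemma powr_le_exp:
  fixes x N :: real
  assumes "0 \<le> x" "0 < N"
  shows "x powr N \<le> (4 * N) powr N * exp (x / 4)"
proof -
  have "x / (4 * N) \<le> exp (x / (4 * N))" using exp_ge_add_one_self[of "x / (4 * N)"] by linarith
  then have "(x / (4 * N)) powr N \<le> exp (x / (4 * N)) powr N" using assms by (intro powr_mono2) auto
  also have "exp (x / (4 * N)) powr N = exp (x / 4)" using assms by (simp add: exp_powr_real)
  finally have "x powr N / (4 * N) powr N \<le> exp (x / 4)" using assms by (simp add: powr_divide)
  then show ?thesis using assms by (simp add: pos_divide_le_eq mult.commute)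
qed

lemma le_one_plus_powr: "y \<le> 1 + y powr p" if "0 \<le> y" "1 \<le> p" for y p :: real
proof (cases "y \<le> 1")
  case False
  then have "y powr 1 \<le> y powr p" using that by (intro powr_mono) auto
  then show ?thesis using that by simp
qed (auto intro: add_increasing2)

text \<open>A quarter of the exponent pays for the factor z. Comparing with exp z - 1 instead of exp
  z matters because the modular contains the former.\<close>

lemma mult_exp_le: "z * exp (3 * z / 4) \<le> 4 * (exp z - 1)" if "0 \<le> z" for z :: real
proof -
  have "1 + z / 4 \<le> exp (z / 4)" by (rule exp_ge_add_one_self)
  then have "exp (3 * z / 4) * (1 + z / 4) \<le> exp (3 * z / 4) * exp (z / 4)" by (intro mult_left_mono) auto
  also have "exp (3 * z / 4) * exp (z / 4) = exp z" by (simp add: mult_exp_exp)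
  finally have "exp (3 * z / 4) + exp (3 * z / 4) * z / 4 \<le> exp z" by (simp add: distrib_left)
  moreover have "1 \<le> exp (3 * z / 4)" using that by simp
  moreover have "z * exp (3 * z / 4) = 4 * (exp (3 * z / 4) * z / 4)" by simp
  ultimately show ?thesis by argo
qed

text \<open>The exponent budget for the R-th power of the weight at y = |u|/b: exp(y^p/2) comes from
  the nonlinearity, a quarter of y^p absorbs the polynomial factors, and the last quarter is spent
  in \<open>mult_exp_le\<close>. The alternatives for z are a supremum bound y <= z, and z = 1 when
  there is none.\<close>

lemma exp_weight_bound:
  fixes y p R Z :: real
  assumes y: "0 \<le> y" and p: "1 \<le> p" and RZ: "0 < R" "0 \<le> Z" and z: "y \<le> z \<or> z = 1" "0 < z"
  shows "y powr Z * ((1 + y) powr R * (y powr p * exp (y powr p / 2)))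
    \<le> z powr Z * ((4 * (Z + R)) powr (Z + R) * (exp (1 / 2) * 4)) * (exp (y powr p) - 1)"
proof -
  have "(1 + y) powr (Z + R) \<le> (4 * (Z + R)) powr (Z + R) * exp ((1 + y) / 4)"
    using y RZ by (intro powr_le_exp) auto
  also have "\<dots> \<le> (4 * (Z + R)) powr (Z + R) * exp ((2 + y powr p) / 4)"
    using le_one_plus_powr[OF y p] by (intro mult_left_mono) auto
  finally have 1: "(1 + y) powr (Z + R) \<le> (4 * (Z + R)) powr (Z + R) * exp ((2 + y powr p) / 4)" .
  have 2: "y powr Z * (1 + y) powr R \<le> z powr Z * (1 + y) powr (Z + R)"
    using z(1)
  proof
    assume "y \<le> z"
    then have "y powr Z \<le> z powr Z" using y RZ by (intro powr_mono2) auto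
    moreover have "(1 + y) powr R \<le> (1 + y) powr (Z + R)" using y RZ by (intro powr_mono) auto
    ultimately show ?thesis by (intro mult_mono) auto
  next
    assume "z = 1"
    have "y powr Z \<le> (1 + y) powr Z" using y RZ by (intro powr_mono2) auto
    then have "y powr Z * (1 + y) powr R \<le> (1 + y) powr Z * (1 + y) powr R" by (intro mult_right_mono) auto
    then show ?thesis using \<open>z = 1\<close> by (simp add: powr_add)
  qed
  have "y powr Z * ((1 + y) powr R * (y powr p * exp (y powr p / 2)))
     = (y powr Z * (1 + y) powr R) * (y powr p * exp (y powr p / 2))" by (simp only: mult.assoc)
  also have "\<dots> \<le> (z powr Z * ((4 * (Z + R)) powr (Z + R) * exp ((2 + y powr p) / 4))) * (y powr p * exp (y powr p / 2))"
    by (intro mult_right_mono order_trans[OF 2] mult_left_mono 1) auto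
  also have "\<dots> = z powr Z * ((4 * (Z + R)) powr (Z + R) * exp (1 / 2)) * (y powr p * exp (3 * (y powr p) / 4))"
  proof -
    have "exp ((2 + y powr p) / 4) * exp (y powr p / 2) = exp (1 / 2) * exp (3 * (y powr p) / 4)"
      by (simp add: mult_exp_exp field_simps)
    moreover have "a * (k * A) * (w * B) = a * (k * C) * (w * D)" if "A * B = C * D" for a k w A B C D :: real
    proof -
      have "a * (k * A) * (w * B) = a * k * w * (A * B)" by (simp only: mult_ac)
      then show ?thesis unfolding that by (simp only: mult_ac)
    qed
    ultimately show ?thesis by blast
  qed
  also have "\<dots> \<le> z powr Z * ((4 * (Z + R)) powr (Z + R) * exp (1 / 2)) * (4 * (exp (y powr p) - 1))"
    by (intro mult_left_mono mult_exp_le) auto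
  finally show ?thesis by (simp only: mult_ac)
qed

section \<open>The fixed point\<close>

locale nonlinear_heat = smoothing S c \<nu> p R \<alpha> for S :: "real \<Rightarrow> 'a::euclidean_space \<Rightarrow> real" and c \<nu> p R \<alpha> +
  fixes m C0 lam :: real and f :: "real \<Rightarrow> real"
  assumes m: "1 < m" and al_m: "\<alpha> = 1 / (m - 1)" and C0: "0 < C0" and lam: "0 < lam" and f0: "f 0 = 0"
    and f_lip: "\<And>u v. \<bar>f u - f v\<bar> \<le> C0 * \<bar>u - v\<bar> * (\<bar>u\<bar> powr (m - 1) * exp (lam * \<bar>u\<bar> powr p) + \<bar>v\<bar> powr (m - 1) * exp (lam * \<bar>v\<bar> powr p))"
begin

lemma f_borel [measurable]: "f \<in> borel_measurable borel"
proof -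
  have "isCont f x" for x
  proof -
    have "((\<lambda>u. C0 * \<bar>u - x\<bar> * (\<bar>u\<bar> powr (m - 1) * exp (lam * \<bar>u\<bar> powr p) + \<bar>x\<bar> powr (m - 1) * exp (lam * \<bar>x\<bar> powr p)))
      \<longlongrightarrow> C0 * \<bar>x - x\<bar> * (\<bar>x\<bar> powr (m - 1) * exp (lam * \<bar>x\<bar> powr p) + \<bar>x\<bar> powr (m - 1) * exp (lam * \<bar>x\<bar> powr p))) (at x)"
      using m p by (intro tendsto_intros tendsto_powr') auto
    then have 0: "((\<lambda>u. C0 * \<bar>u - x\<bar> * (\<bar>u\<bar> powr (m - 1) * exp (lam * \<bar>u\<bar> powr p) + \<bar>x\<bar> powr (m - 1) * exp (lam * \<bar>x\<bar> powr p))) \<longlongrightarrow> 0) (at x)"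
      by simp
    have "((\<lambda>u. f u - f x) \<longlongrightarrow> 0) (at x)"
      by (rule Lim_null_comparison[OF _ 0]) (use f_lip in auto)
    then show ?thesis unfolding isCont_def by (subst (asm) LIM_zero_iff)
  qed
  then show ?thesis by (intro borel_measurable_continuous_onI continuous_at_imp_continuous_on) auto
qed

text \<open>In |u|^(R(m-1)) = |u|^Z |u|^p the modular pays for |u|^p, and |u|^Z carries the time
  decay.\<close>

definition Z :: real where "Z = R * (m - 1) - p"

text \<open>Since \<alpha>(m-1) = 1 and \<alpha> p <= \<nu>, one has \<alpha> Z = R - \<alpha> p >=
  R - \<nu>. As (\<delta>-1) R = \<nu> - R, this is the decay demanded of the weight.\<close>

lemma Z_ge: "0 \<le> Z" and alZ: "R - \<nu> \<le> \<alpha> * Z"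
proof -
  have "\<alpha> * p \<le> \<nu>" using al p by (simp add: field_simps)
  moreover have "\<alpha> * (m - 1) = 1" using al_m m by simp
  moreover have "\<alpha> * Z = R * (\<alpha> * (m - 1)) - \<alpha> * p" by (simp add: Z_def algebra_simps)
  ultimately have 1: "\<alpha> * Z \<ge> R - \<nu>" by simp
  then show "R - \<nu> \<le> \<alpha> * Z" .
  have "0 \<le> \<alpha> * Z" using 1 R by linarith
  then show "0 \<le> Z" using al by (simp add: zero_le_mult_iff)
qed

text \<open>
  The factor \<open>1 + \<bar>u\<bar>/b\<close> lets \<open>\<bar>f u\<bar>\<close> be split as \<open>min \<bar>u\<bar> b\<close> times a multiple of \<open>Hf b u\<close>, the first factor
  being bounded although \<open>u\<close> is not bounded near \<open>t = 0\<close>.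
\<close>

definition Hf :: "real \<Rightarrow> real \<Rightarrow> real" where
  "Hf b u = \<bar>u\<bar> powr (m - 1) * exp (lam * \<bar>u\<bar> powr p) * (1 + \<bar>u\<bar> / b)"

lemma Hf_measurable [measurable]: "Hf b \<in> borel_measurable borel"
  unfolding Hf_def by measurable

text \<open>The constant of \<open>exp_weight_bound\<close>, times a power of 2 that allows a weight
  in 1 + s for s < 1, where no supremum bound is available.\<close>

definition C6 :: real where "C6 = 2 powr (\<alpha> * Z) * ((4 * (Z + R)) powr (Z + R) * (exp (1 / 2) * 4))"
definition C7 :: real where "C7 = C6 powr (1 / R)"

lemma C7_pos: "0 < C7"
  using Z_ge R_pos by (simp add: C7_def C6_def)

text \<open>The class of the solution at time s. The pointwise bound is imposed from s = 1 on, since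
  for unbounded data none is uniform near s = 0; there the modular has to suffice.\<close>

definition adm :: "real \<Rightarrow> real \<Rightarrow> ('a \<Rightarrow> real) \<Rightarrow> bool" where
  "adm b s u \<longleftrightarrow> u \<in> borel_measurable borel \<and> (\<integral>\<^sup>+x. ennreal (exp ((\<bar>u x\<bar> / b) powr p) - 1) \<partial>lborel) \<le> 1 \<and>
     (1 \<le> s \<longrightarrow> (\<forall>x. \<bar>u x\<bar> \<le> b * (1 + s) powr (- \<alpha>)))"

lemma adm_Hf:
  assumes u: "adm b s u" and b: "0 < b" "R * lam * b powr p \<le> 1 / 2" and s: "0 < s"
  shows "(\<integral>\<^sup>+x. ennreal (Hf b (u x) powr R) \<partial>lborel) \<le> ennreal ((C7 * b powr (m - 1) * (1 + s) powr (\<delta> - 1)) powr R)"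
proof -
  have [measurable]: "u \<in> borel_measurable borel" and mod: "(\<integral>\<^sup>+x. ennreal (exp ((\<bar>u x\<bar> / b) powr p) - 1) \<partial>lborel) \<le> 1"
    using u unfolding adm_def by auto
  define z where "z = (if 1 \<le> s then (1 + s) powr (- \<alpha>) else 1)"
  have z: "0 < z" using s by (simp add: z_def)
  define C where "C = b powr (R * (m - 1)) * (z powr Z * ((4 * (Z + R)) powr (Z + R) * (exp (1 / 2) * 4)))"
  have C: "0 \<le> C" by (simp add: C_def)
  have pw: "Hf b (u x) powr R \<le> C * (exp ((\<bar>u x\<bar> / b) powr p) - 1)" for x
  proof -
    define y where "y = \<bar>u x\<bar> / b"
    have y: "0 \<le> y" "\<bar>u x\<bar> = b * y" using b by (auto simp: y_def)
    have yz: "y \<le> z \<or> z = 1"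
    proof (cases "1 \<le> s")
      case True
      then have "\<bar>u x\<bar> \<le> b * (1 + s) powr (- \<alpha>)" using u unfolding adm_def by auto
      then have "b * y \<le> b * z" using y True by (simp add: z_def)
      then show ?thesis using b by simp
    qed (simp add: z_def)
    have "Hf b (u x) powr R = (b * y) powr ((m - 1) * R) * exp (R * lam * (b * y) powr p) * (1 + y) powr R"
      unfolding Hf_def y(2) using b y R_pos by (simp add: powr_mult powr_powr exp_powr_real mult_ac)
    also have "(b * y) powr ((m - 1) * R) = b powr (R * (m - 1)) * (y powr Z * y powr p)"
      using b y by (simp add: powr_mult Z_def mult.commute flip: powr_add)
    \<comment> \<open>This is the purpose of R lam b^p <= 1/2: half of the exponent y^p stays
      free.\<close>
    also have "exp (R * lam * (b * y) powr p) \<le> exp (y powr p / 2)"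
    proof -
      have "R * lam * b powr p * y powr p \<le> 1 / 2 * y powr p" using b by (intro mult_right_mono) auto
      then show ?thesis using b y by (simp add: powr_mult mult.assoc)
    qed
    also have "b powr (R * (m - 1)) * (y powr Z * y powr p) * exp (y powr p / 2) * (1 + y) powr R
      = b powr (R * (m - 1)) * (y powr Z * ((1 + y) powr R * (y powr p * exp (y powr p / 2))))" by (simp only: mult_ac)
    also have "\<dots> \<le> b powr (R * (m - 1)) * (z powr Z * ((4 * (Z + R)) powr (Z + R) * (exp (1 / 2) * 4)) * (exp (y powr p) - 1))"
      using y p R_pos Z_ge yz z by (intro mult_left_mono exp_weight_bound) auto
    finally show ?thesis by (simp add: C_def y_def mult.assoc mult_right_mono mult_left_mono)
  qed
  have "(\<integral>\<^sup>+x. ennreal (Hf b (u x) powr R) \<partial>lborel) \<le> (\<integral>\<^sup>+x. ennreal C * ennreal (exp ((\<bar>u x\<bar> / b) powr p) - 1) \<partial>lborel)"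
    using pw C by (intro nn_integral_mono) (auto simp flip: ennreal_mult intro!: ennreal_leI)
  also have "\<dots> = ennreal C * (\<integral>\<^sup>+x. ennreal (exp ((\<bar>u x\<bar> / b) powr p) - 1) \<partial>lborel)" by (rule nn_integral_cmult) measurable
  also have "\<dots> \<le> ennreal C * 1" by (intro mult_left_mono mod) simp
  also have "\<dots> \<le> ennreal ((C7 * b powr (m - 1) * (1 + s) powr (\<delta> - 1)) powr R)"
  proof -
    \<comment> \<open>For s < 1 one has z = 1, and 1 + s <= 2 converts this into a weight in 1 +
      s.\<close>
    have "z powr Z \<le> 2 powr (\<alpha> * Z) * (1 + s) powr (- (\<alpha> * Z))"
    proof (cases "1 \<le> s")
      case True
      have "1 * (1 + s) powr (- (\<alpha> * Z)) \<le> 2 powr (\<alpha> * Z) * (1 + s) powr (- (\<alpha> * Z))"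
        using al Z_ge by (intro mult_right_mono ge_one_powr_ge_zero) auto
      then show ?thesis using True by (simp add: z_def powr_powr)
    next
      case False
      have "2 powr (- (\<alpha> * Z)) \<le> (1 + s) powr (- (\<alpha> * Z))" using al Z_ge s False by (intro powr_mono2') auto
      then have "2 powr (\<alpha> * Z) * 2 powr (- (\<alpha> * Z)) \<le> 2 powr (\<alpha> * Z) * (1 + s) powr (- (\<alpha> * Z))" by (intro mult_left_mono) auto
      then show ?thesis using False by (simp add: z_def flip: powr_add)
    qed
    also have "\<dots> \<le> 2 powr (\<alpha> * Z) * (1 + s) powr ((\<delta> - 1) * R)"
      using s alZ by (intro mult_left_mono powr_mono) (auto simp: left_diff_distrib del_R)
    finally have "C \<le> b powr (R * (m - 1)) * (2 powr (\<alpha> * Z) * (1 + s) powr ((\<delta> - 1) * R) * ((4 * (Z + R)) powr (Z + R) * (exp (1 / 2) * 4)))"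
      unfolding C_def by (intro mult_left_mono mult_right_mono) auto
    also have "\<dots> = (C7 * b powr (m - 1) * (1 + s) powr (\<delta> - 1)) powr R"
    proof -
      have "0 \<le> C6" by (simp add: C6_def)
      then have "C7 powr R = C6" using R_pos by (simp add: C7_def powr_powr)
      moreover have "(b powr (m - 1)) powr R = b powr (R * (m - 1))" "((1 + s) powr (\<delta> - 1)) powr R = (1 + s) powr ((\<delta> - 1) * R)"
        by (simp_all add: powr_powr mult.commute)
      ultimately have "(C7 * b powr (m - 1) * (1 + s) powr (\<delta> - 1)) powr R = C6 * b powr (R * (m - 1)) * (1 + s) powr ((\<delta> - 1) * R)"
        using C7_pos by (simp add: powr_mult)
      then show ?thesis unfolding C6_def by (simp only: mult_ac)
    qed
    finally show ?thesis by (simp add: ennreal_leI)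
  qed
  finally show ?thesis .
qed

text \<open>The modular dominates the p-th power because z <= exp z - 1.\<close>

lemma adm_Lp:
  assumes u: "adm b s u" and b: "0 < b"
  shows "(\<integral>\<^sup>+x. ennreal (\<bar>u x\<bar> powr p) \<partial>lborel) \<le> ennreal (b powr p)"
proof -
  have [measurable]: "u \<in> borel_measurable borel" and mod: "(\<integral>\<^sup>+x. ennreal (exp ((\<bar>u x\<bar> / b) powr p) - 1) \<partial>lborel) \<le> 1"
    using u unfolding adm_def by auto
  have "(\<integral>\<^sup>+x. ennreal (\<bar>u x\<bar> powr p) \<partial>lborel) \<le> (\<integral>\<^sup>+x. ennreal (b powr p) * ennreal (exp ((\<bar>u x\<bar> / b) powr p) - 1) \<partial>lborel)"
  proof (rule nn_integral_mono)
    fix x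
    have "\<bar>u x\<bar> powr p = b powr p * (\<bar>u x\<bar> / b) powr p" using b by (simp flip: powr_mult)
    also have "\<dots> \<le> b powr p * (exp ((\<bar>u x\<bar> / b) powr p) - 1)"
    proof (rule mult_left_mono)
      show "(\<bar>u x\<bar> / b) powr p \<le> exp ((\<bar>u x\<bar> / b) powr p) - 1"
        using exp_ge_add_one_self[of "(\<bar>u x\<bar> / b) powr p"] by linarith
    qed simp
    finally have "ennreal (\<bar>u x\<bar> powr p) \<le> ennreal (b powr p * (exp ((\<bar>u x\<bar> / b) powr p) - 1))" by (rule ennreal_leI)
    then show "ennreal (\<bar>u x\<bar> powr p) \<le> ennreal (b powr p) * ennreal (exp ((\<bar>u x\<bar> / b) powr p) - 1)"
      by (simp add: ennreal_mult)
  qed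
  also have "\<dots> = ennreal (b powr p) * (\<integral>\<^sup>+x. ennreal (exp ((\<bar>u x\<bar> / b) powr p) - 1) \<partial>lborel)" by (rule nn_integral_cmult) measurable
  also have "\<dots> \<le> ennreal (b powr p) * 1" by (intro mult_left_mono mod) simp
  finally show ?thesis by simp
qed

lemma h_le_Hf: "0 < b \<Longrightarrow> \<bar>u\<bar> powr (m - 1) * exp (lam * \<bar>u\<bar> powr p) \<le> Hf b u"
  unfolding Hf_def by (rule order_trans[OF eq_refl[OF mult_1_right[symmetric]]]) (intro mult_left_mono, auto)

text \<open>The factors are min |u| b and C0 times \<open>Hf\<close>. The truncation obeys the
  decaying bound at all positive times: for s < 1 it is at most b, and 2^\<alpha> compensates the
  weight.\<close>

lemma adm_fac:
  assumes u: "adm b s u" and b: "0 < b" "R * lam * b powr p \<le> 1 / 2" and s: "0 < s"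
  shows "fac (C0 * C7 * b powr (m - 1) * (1 + s) powr (\<delta> - 1)) (2 powr \<alpha> * b * (1 + s) powr (- \<alpha>)) (2 powr \<alpha> * b) (\<lambda>y. f (u y))"
  unfolding fac_def
proof (intro conjI exI)
  have [measurable]: "u \<in> borel_measurable borel" using u unfolding adm_def by auto
  show "(\<lambda>y. f (u y)) \<in> borel_measurable borel" by measurable
  show "(\<lambda>y. min \<bar>u y\<bar> b) \<in> borel_measurable borel" "(\<lambda>y. C0 * Hf b (u y)) \<in> borel_measurable borel" by measurable
  show "\<forall>y. 0 \<le> min \<bar>u y\<bar> b" using b by simp
  show "\<forall>y. 0 \<le> C0 * Hf b (u y)" using b C0 by (simp add: Hf_def)
  show "\<forall>y. \<bar>f (u y)\<bar> \<le> min \<bar>u y\<bar> b * (C0 * Hf b (u y))"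
  proof
    fix y
    let ?h = "\<bar>u y\<bar> powr (m - 1) * exp (lam * \<bar>u y\<bar> powr p)"
    have "\<bar>f (u y)\<bar> \<le> C0 * \<bar>u y\<bar> * ?h" using f_lip[of "u y" 0] f0 m by simp
    also have "\<dots> = \<bar>u y\<bar> * (C0 * ?h)" by (simp only: mult_ac)
    also have "\<dots> \<le> (min \<bar>u y\<bar> b * (1 + \<bar>u y\<bar> / b)) * (C0 * ?h)"
    proof (intro mult_right_mono)
      show "\<bar>u y\<bar> \<le> min \<bar>u y\<bar> b * (1 + \<bar>u y\<bar> / b)"
        using b by (cases "\<bar>u y\<bar> \<le> b") (auto simp: min_def distrib_left)
    qed (use C0 in auto)
    also have "\<dots> = min \<bar>u y\<bar> b * (C0 * Hf b (u y))" by (simp only: Hf_def mult_ac)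
    finally show "\<bar>f (u y)\<bar> \<le> min \<bar>u y\<bar> b * (C0 * Hf b (u y))" .
  qed
  have 2: "1 \<le> 2 powr \<alpha>" using al by (intro ge_one_powr_ge_zero) auto
  show "Lb p (2 powr \<alpha> * b * (1 + s) powr (- \<alpha>)) (2 powr \<alpha> * b) (\<lambda>y. min \<bar>u y\<bar> b)"
    unfolding Lb_def
  proof (intro conjI allI)
    show "\<bar>min \<bar>u x\<bar> b\<bar> \<le> 2 powr \<alpha> * b * (1 + s) powr (- \<alpha>)" for x
    proof (cases "1 \<le> s")
      case True
      have "\<bar>u x\<bar> \<le> 1 * (b * (1 + s) powr (- \<alpha>))" using u True unfolding adm_def by auto
      also have "\<dots> \<le> 2 powr \<alpha> * (b * (1 + s) powr (- \<alpha>))" using 2 b by (intro mult_right_mono) auto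
      finally show ?thesis using b by (simp add: mult.assoc)
    next
      case False
      have "2 powr (- \<alpha>) \<le> (1 + s) powr (- \<alpha>)" using al s False by (intro powr_mono2') auto
      then have "2 powr \<alpha> * b * 2 powr (- \<alpha>) \<le> 2 powr \<alpha> * b * (1 + s) powr (- \<alpha>)" using b by (intro mult_left_mono) auto
      moreover have "2 powr \<alpha> * b * 2 powr (- \<alpha>) = b" by (simp add: powr_minus)
      moreover have "\<bar>min \<bar>u x\<bar> b\<bar> \<le> b" using b by auto
      ultimately show ?thesis by linarith
    qed
    have "(\<integral>\<^sup>+x. ennreal (\<bar>min \<bar>u x\<bar> b\<bar> powr p) \<partial>lborel) \<le> (\<integral>\<^sup>+x. ennreal (\<bar>u x\<bar> powr p) \<partial>lborel)"
      using p b by (intro nn_integral_mono ennreal_leI powr_mono2) auto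
    also have "\<dots> \<le> ennreal (b powr p)" by (rule adm_Lp[OF u b(1)])
    also have "\<dots> \<le> ennreal ((2 powr \<alpha> * b) powr p)"
      using 2 b p by (intro ennreal_leI powr_mono2) auto
    finally show "(\<integral>\<^sup>+x. ennreal (\<bar>min \<bar>u x\<bar> b\<bar> powr p) \<partial>lborel) \<le> ennreal ((2 powr \<alpha> * b) powr p)" .
  qed measurable
  have "(\<integral>\<^sup>+y. ennreal ((C0 * Hf b (u y)) powr R) \<partial>lborel) = (\<integral>\<^sup>+y. ennreal (C0 powr R) * ennreal (Hf b (u y) powr R) \<partial>lborel)"
    using C0 b by (intro nn_integral_cong) (simp add: powr_mult ennreal_mult Hf_def)
  also have "\<dots> = ennreal (C0 powr R) * (\<integral>\<^sup>+y. ennreal (Hf b (u y) powr R) \<partial>lborel)" by (rule nn_integral_cmult) measurable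
  also have "\<dots> \<le> ennreal (C0 powr R) * ennreal ((C7 * b powr (m - 1) * (1 + s) powr (\<delta> - 1)) powr R)"
    by (intro mult_left_mono adm_Hf[OF u b s]) simp
  also have "\<dots> = ennreal ((C0 * C7 * b powr (m - 1) * (1 + s) powr (\<delta> - 1)) powr R)"
    using C0 C7_pos by (simp add: ennreal_mult[symmetric] powr_mult mult.assoc)
  finally show "(\<integral>\<^sup>+y. ennreal ((C0 * Hf b (u y)) powr R) \<partial>lborel) \<le> ennreal ((C0 * C7 * b powr (m - 1) * (1 + s) powr (\<delta> - 1)) powr R)" .
qed

text \<open>Here |u - v| itself is the bounded factor: in the application u and v share the same
  heat flow, so it is a difference of corrections. The constant 4 comes from 2 * 2^R <= 4^R.\<close>

lemma fac_diff:
  assumes [measurable]: "u \<in> borel_measurable borel" "v \<in> borel_measurable borel" and b: "0 < b" and h: "0 < h"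
    and u: "(\<integral>\<^sup>+x. ennreal (Hf b (u x) powr R) \<partial>lborel) \<le> ennreal (h powr R)"
    and v: "(\<integral>\<^sup>+x. ennreal (Hf b (v x) powr R) \<partial>lborel) \<le> ennreal (h powr R)"
    and w: "Lb p V W (\<lambda>x. u x - v x)"
  shows "fac (4 * C0 * h) V W (\<lambda>y. f (u y) - f (v y))"
  unfolding fac_def
proof (intro conjI exI)
  show "(\<lambda>y. f (u y) - f (v y)) \<in> borel_measurable borel" by measurable
  show "(\<lambda>y. \<bar>u y - v y\<bar>) \<in> borel_measurable borel" "(\<lambda>y. C0 * (Hf b (u y) + Hf b (v y))) \<in> borel_measurable borel" by measurable
  have Hf0: "0 \<le> Hf b r" for r using b by (simp add: Hf_def)
  show "\<forall>y. 0 \<le> \<bar>u y - v y\<bar>" by simp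
  show "\<forall>y. 0 \<le> C0 * (Hf b (u y) + Hf b (v y))" using C0 Hf0 by simp
  show "\<forall>y. \<bar>f (u y) - f (v y)\<bar> \<le> \<bar>u y - v y\<bar> * (C0 * (Hf b (u y) + Hf b (v y)))"
  proof
    fix y
    have "\<bar>f (u y) - f (v y)\<bar> \<le> C0 * \<bar>u y - v y\<bar> * (\<bar>u y\<bar> powr (m - 1) * exp (lam * \<bar>u y\<bar> powr p) + \<bar>v y\<bar> powr (m - 1) * exp (lam * \<bar>v y\<bar> powr p))"
      by (rule f_lip)
    also have "\<dots> \<le> C0 * \<bar>u y - v y\<bar> * (Hf b (u y) + Hf b (v y))"
      using C0 by (intro mult_left_mono add_mono h_le_Hf b) auto
    finally show "\<bar>f (u y) - f (v y)\<bar> \<le> \<bar>u y - v y\<bar> * (C0 * (Hf b (u y) + Hf b (v y)))" by (simp only: mult_ac)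
  qed
  show "Lb p V W (\<lambda>y. \<bar>u y - v y\<bar>)" by (rule Lb_abs[OF w])
  have R1: "1 \<le> R" using R_gt_1 R_pos by (simp add: field_simps)
  have "(\<integral>\<^sup>+y. ennreal ((C0 * (Hf b (u y) + Hf b (v y))) powr R) \<partial>lborel)
     \<le> (\<integral>\<^sup>+y. ennreal (C0 powr R * 2 powr R) * (ennreal (Hf b (u y) powr R) + ennreal (Hf b (v y) powr R)) \<partial>lborel)"
  proof (rule nn_integral_mono)
    fix y
    have "(C0 * (Hf b (u y) + Hf b (v y))) powr R = C0 powr R * (Hf b (u y) + Hf b (v y)) powr R"
      using C0 Hf0 by (simp add: powr_mult)
    also have "\<dots> \<le> C0 powr R * (2 powr R * (Hf b (u y) powr R + Hf b (v y) powr R))"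
      using R1 Hf0 by (intro mult_left_mono powr_add_le) auto
    finally have "ennreal ((C0 * (Hf b (u y) + Hf b (v y))) powr R) \<le> ennreal (C0 powr R * 2 powr R * (Hf b (u y) powr R + Hf b (v y) powr R))"
      by (intro ennreal_leI) (simp add: mult.assoc)
    then show "ennreal ((C0 * (Hf b (u y) + Hf b (v y))) powr R) \<le> ennreal (C0 powr R * 2 powr R) * (ennreal (Hf b (u y) powr R) + ennreal (Hf b (v y) powr R))"
      by (simp add: ennreal_mult)
  qed
  also have "\<dots> = ennreal (C0 powr R * 2 powr R) * ((\<integral>\<^sup>+y. ennreal (Hf b (u y) powr R) \<partial>lborel) + (\<integral>\<^sup>+y. ennreal (Hf b (v y) powr R) \<partial>lborel))"
    by (simp add: nn_integral_cmult nn_integral_add)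
  also have "\<dots> \<le> ennreal (C0 powr R * 2 powr R) * (ennreal (h powr R) + ennreal (h powr R))"
    by (intro mult_left_mono add_mono u v) simp
  also have "\<dots> = ennreal (C0 powr R * 2 powr R * (2 * h powr R))"
    by (simp add: ennreal_mult flip: ennreal_plus)
  also have "\<dots> \<le> ennreal ((4 * C0 * h) powr R)"
  proof (rule ennreal_leI)
    have "(2::real) powr 1 \<le> 2 powr R" using R1 by (intro powr_mono) auto
    then have "C0 powr R * 2 powr R * (2 * h powr R) \<le> C0 powr R * 2 powr R * (2 powr R * h powr R)"
      by (intro mult_left_mono mult_right_mono) auto
    also have "\<dots> = ((2 * 2) * C0 * h) powr R" using C0 h by (simp only: powr_mult mult_ac)
    finally show "C0 powr R * 2 powr R * (2 * h powr R) \<le> (4 * C0 * h) powr R" by simp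
  qed
  finally show "(\<integral>\<^sup>+y. ennreal ((C0 * (Hf b (u y) + Hf b (v y))) powr R) \<partial>lborel) \<le> ennreal ((4 * C0 * h) powr R)" .
qed

end

lemma Lb_meas_joint:
  assumes "(\<lambda>(s, y). g s y) \<in> borel_measurable (borel \<Otimes>\<^sub>M borel)"
  shows "g s \<in> borel_measurable borel"
  using measurable_compose[OF _ assms, of "\<lambda>y. (s, y)" borel] by simp

section \<open>Smallness, contraction and the Picard iteration\<close>

context nonlinear_heat
begin

text \<open>The 8 leaves room for a sum in the modular; the other term bounds the heat flow
  pointwise for s >= 1.\<close>

definition K0 :: real where "K0 = 8 + c powr (1 / p) * 2 powr \<alpha>"

lemma K0_ge: "8 \<le> K0" by (simp add: K0_def)

text \<open>Each summand uses half of the modular budget: the heat flow by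
  \<open>heat_modular\<close>, the correction because both its supremum and its L^p norm are at most
  a.\<close>

lemma adm_sum:
  assumes [measurable]: "u0 \<in> borel_measurable borel" and a: "0 < a"
    and u0: "(\<integral>\<^sup>+x. ennreal (exp ((\<bar>u0 x\<bar> / a) powr p) - 1) \<partial>lborel) \<le> 1"
    and w: "Lb p (a * (1 + s) powr (- \<alpha>)) a w" and s: "0 < s"
  shows "adm (K0 * a) s (\<lambda>x. heat s u0 x + w x)"
  unfolding adm_def
proof (intro conjI impI allI)
  define b where "b = K0 * a"
  have b: "0 < b" "8 * a \<le> b" using a K0_ge by (auto simp: b_def)
  have u0p: "(\<integral>\<^sup>+x. ennreal (\<bar>u0 x\<bar> powr p) \<partial>lborel) \<le> ennreal (a powr p)"
    using adm_Lp[of a "1/2" u0] u0 a by (simp add: adm_def)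
  note hL = heat_Lb0(2)[OF assms(1) u0p less_imp_le[OF a] s]
  note [measurable] = LbD(1)[OF w] LbD(1)[OF hL]
  show "(\<lambda>x. heat s u0 x + w x) \<in> borel_measurable borel" by measurable
  have pw: "exp ((\<bar>heat s u0 x + w x\<bar> / b) powr p) - 1
     \<le> 1 / 2 * (exp ((\<bar>heat s u0 x\<bar> / a) powr p) - 1) + 1 / 2 * (1 / a powr p * \<bar>w x\<bar> powr p)" for x
  proof -
    define X where "X = (\<bar>heat s u0 x\<bar> / a) powr p"
    define Y where "Y = (\<bar>w x\<bar> / a) powr p"
    have X0: "0 \<le> X" "0 \<le> Y" by (auto simp: X_def Y_def)
    have "\<bar>w x\<bar> \<le> a * (1 + s) powr (- \<alpha>)" by (rule LbD(2)[OF w])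
    also have "\<dots> \<le> a * 1"
    proof (rule mult_left_mono)
      have "(1 + s) powr (- \<alpha>) \<le> 1 powr (- \<alpha>)" using s al by (intro powr_mono2') auto
      then show "(1 + s) powr (- \<alpha>) \<le> 1" by simp
    qed (use a in simp)
    finally have wa: "\<bar>w x\<bar> / a \<le> 1" using a by simp
    have Y1: "Y \<le> 1" unfolding Y_def using wa a p by (intro powr_le1) auto
    have quart: "(r / 4) powr p \<le> r powr p / 4" if "0 \<le> r" for r
    proof -
      have "(1 / 4) powr p \<le> (1 / 4 :: real) powr 1" using p by (intro powr_mono') auto
      then have "r powr p * (1 / 4) powr p \<le> r powr p * (1 / 4)" by (intro mult_left_mono) auto
      moreover have "(r / 4) powr p = r powr p * (1 / 4) powr p" using that by (simp add: powr_divide)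
      ultimately show ?thesis by simp
    qed
    \<comment> \<open>Passing from the sum to a maximum means that the exponential is that of one
      summand, so no product of exponentials has to be split.\<close>
    have "\<bar>heat s u0 x + w x\<bar> / b \<le> max (\<bar>heat s u0 x\<bar> / a / 4) (\<bar>w x\<bar> / a / 4)"
    proof -
      have "\<bar>heat s u0 x + w x\<bar> / b \<le> \<bar>heat s u0 x + w x\<bar> / (8 * a)" using b a by (intro divide_left_mono) auto
      also have "\<dots> \<le> (2 * max \<bar>heat s u0 x\<bar> \<bar>w x\<bar>) / (8 * a)" using a by (intro divide_right_mono) auto
      also have "\<dots> = max \<bar>heat s u0 x\<bar> \<bar>w x\<bar> / a / 4" using a by simp
      also have "\<dots> \<le> max (\<bar>heat s u0 x\<bar> / a / 4) (\<bar>w x\<bar> / a / 4)" using a by (simp add: max_def divide_right_mono)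
      finally show ?thesis .
    qed
    then have "(\<bar>heat s u0 x + w x\<bar> / b) powr p \<le> max (\<bar>heat s u0 x\<bar> / a / 4) (\<bar>w x\<bar> / a / 4) powr p"
      using b p by (intro powr_mono2) auto
    also have "\<dots> \<le> max (X / 4) (Y / 4)"
      using quart[of "\<bar>heat s u0 x\<bar> / a"] quart[of "\<bar>w x\<bar> / a"] a by (auto simp: max_def X_def Y_def)
    finally have 1: "exp ((\<bar>heat s u0 x + w x\<bar> / b) powr p) \<le> exp (X / 4) \<or> exp ((\<bar>heat s u0 x + w x\<bar> / b) powr p) \<le> exp (Y / 4)"
      unfolding exp_le_cancel_iff le_max_iff_disj .
    \<comment> \<open>With q = exp(X/2) this follows from exp(X/4) <= q and 2 (q - 1) <= q^2 -
      1.\<close>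
    have 2: "exp (X / 4) - 1 \<le> 1 / 2 * (exp X - 1)"
    proof -
      define q where "q = exp (X / 2)"
      have q: "1 \<le> q" "exp X = q * q" using X0 by (auto simp: q_def mult_exp_exp)
      have "exp (X / 4) \<le> q" using X0 by (simp add: q_def)
      moreover have "0 \<le> (q - 1) * (q - 1)" by simp
      ultimately show ?thesis using q by (simp add: algebra_simps)
    qed
    have 3: "exp (Y / 4) - 1 \<le> 1 / 2 * Y"
    proof -
      have "exp (Y / 4) \<le> 1 + Y / 4 + (Y / 4)\<^sup>2" using X0 Y1 by (intro exp_bound) auto
      moreover have "(Y / 4)\<^sup>2 \<le> Y / 4 * 1" unfolding power2_eq_square using X0 Y1 by (intro mult_left_mono) auto
      ultimately show ?thesis by linarith
    qed
    have 4: "0 \<le> 1 / 2 * (exp X - 1)" using X0 by simp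
    have "exp ((\<bar>heat s u0 x + w x\<bar> / b) powr p) - 1 \<le> 1 / 2 * (exp X - 1) + 1 / 2 * Y"
      using 1 2 3 4 X0 by argo
    moreover have "Y = 1 / a powr p * \<bar>w x\<bar> powr p" using a by (simp add: Y_def powr_divide)
    ultimately show ?thesis by (simp add: X_def)
  qed
  have "(\<integral>\<^sup>+x. ennreal (exp ((\<bar>heat s u0 x + w x\<bar> / b) powr p) - 1) \<partial>lborel)
     \<le> (\<integral>\<^sup>+x. ennreal (1 / 2) * ennreal (exp ((\<bar>heat s u0 x\<bar> / a) powr p) - 1) + ennreal (1 / 2) * (ennreal (1 / a powr p) * ennreal (\<bar>w x\<bar> powr p)) \<partial>lborel)"
    by (rule nn_integral_mono, rule order_trans[OF ennreal_leI[OF pw]])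
       (simp add: ennreal_plus ennreal_mult[symmetric] del: ennreal_half)
  also have "\<dots> = ennreal (1 / 2) * (\<integral>\<^sup>+x. ennreal (exp ((\<bar>heat s u0 x\<bar> / a) powr p) - 1) \<partial>lborel) + ennreal (1 / 2) * (ennreal (1 / a powr p) * (\<integral>\<^sup>+x. ennreal (\<bar>w x\<bar> powr p) \<partial>lborel))"
    by (simp add: nn_integral_add nn_integral_cmult)
  also have "\<dots> \<le> ennreal (1 / 2) * 1 + ennreal (1 / 2) * (ennreal (1 / a powr p) * ennreal (a powr p))"
    by (intro add_mono mult_left_mono heat_modular[OF assms(1) a u0 s] LbD(3)[OF w]) auto
  also have "\<dots> = ennreal (1 / 2 * 1 + 1 / 2 * (1 / a powr p * a powr p))"
    by (simp only: ennreal_mult[symmetric] ennreal_plus[symmetric] powr_ge_zero ennreal_1[symmetric] zero_le_divide_1_iff zero_le_one mult_nonneg_nonneg zero_le_numeral)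
  also have "\<dots> = 1" using a by simp
  finally show "(\<integral>\<^sup>+x. ennreal (exp ((\<bar>heat s u0 x + w x\<bar> / (K0 * a)) powr p) - 1) \<partial>lborel) \<le> 1" by (simp add: b_def)
  fix x assume s1: "1 \<le> s"
  have "(c * s powr (- \<nu>)) powr (1 / p) = c powr (1 / p) * s powr (- (\<nu> / p))" using c_pos p by (simp add: powr_mult powr_powr)
  also have "\<dots> \<le> c powr (1 / p) * s powr (- \<alpha>)" using s1 al by (intro mult_left_mono powr_mono) auto
  also have "\<dots> \<le> c powr (1 / p) * ((1 + s) / 2) powr (- \<alpha>)" using s1 al by (intro mult_left_mono powr_mono2') auto
  also have "((1 + s) / 2) powr (- \<alpha>) = 2 powr \<alpha> * (1 + s) powr (- \<alpha>)" using s by (simp add: powr_divide powr_minus field_simps)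
  finally have L1: "(c * s powr (- \<nu>)) powr (1 / p) \<le> c powr (1 / p) * 2 powr \<alpha> * (1 + s) powr (- \<alpha>)" by (simp add: mult.assoc)
  have "\<bar>heat s u0 x + w x\<bar> \<le> \<bar>heat s u0 x\<bar> + \<bar>w x\<bar>" by (rule abs_triangle_ineq)
  also have "\<dots> \<le> c powr (1 / p) * 2 powr \<alpha> * (1 + s) powr (- \<alpha>) * a + a * (1 + s) powr (- \<alpha>)"
    using LbD(2)[OF hL, of x] mult_right_mono[OF L1, of a] a LbD(2)[OF w, of x] by linarith
  also have "\<dots> = (c powr (1 / p) * 2 powr \<alpha> + 1) * (a * (1 + s) powr (- \<alpha>))" by (simp add: algebra_simps)
  also have "\<dots> \<le> K0 * (a * (1 + s) powr (- \<alpha>))" using a by (intro mult_right_mono) (auto simp: K0_def)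
  finally show "\<bar>heat s u0 x + w x\<bar> \<le> K0 * a * (1 + s) powr (- \<alpha>)" by (simp add: mult.assoc)
qed

text \<open>The first inequality controls the exponential in the weight. The last yields both the
  invariance of the ball and the contraction factor 1/8. Both can be met because p > 0 and m >
  1.\<close>

definition small :: "real \<Rightarrow> bool" where
  "small a \<longleftrightarrow> 0 < a \<and> R * lam * (K0 * a) powr p \<le> 1 / 2 \<and>
     KD * (4 * C0 * C7 * (K0 * a) powr (m - 1)) * (2 powr \<alpha> * K0) \<le> 1 / 8"

lemma small_ex: "\<exists>a. small a"
proof -
  have p0: "0 < p" "0 \<le> R * lam" "(0::real) < 1 / 2" using p R_pos lam by auto
  obtain A1 where A1: "0 < A1" "A1 \<le> 1" "A1 powr p * (R * lam) \<le> 1 / 2" by (rule powr_small_ex[OF p0])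
  have m0: "0 < m - 1" "0 \<le> KD * (4 * C0 * C7) * (2 powr \<alpha> * K0)" "(0::real) < 1 / 8"
    using m KD_pos C0 C7_pos K0_ge by auto
  obtain A2 where A2: "0 < A2" "A2 \<le> 1" "A2 powr (m - 1) * (KD * (4 * C0 * C7) * (2 powr \<alpha> * K0)) \<le> 1 / 8" by (rule powr_small_ex[OF m0])
  define b where "b = min A1 A2"
  have b: "0 < b" using A1 A2 by (simp add: b_def)
  have "b powr p * (R * lam) \<le> A1 powr p * (R * lam)" using b p0 by (intro mult_right_mono powr_mono2) (auto simp: b_def)
  then have 1: "R * lam * b powr p \<le> 1 / 2" using A1 by (simp add: mult_ac)
  have "b powr (m - 1) * (KD * (4 * C0 * C7) * (2 powr \<alpha> * K0)) \<le> A2 powr (m - 1) * (KD * (4 * C0 * C7) * (2 powr \<alpha> * K0))"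
    using b m0 by (intro mult_right_mono powr_mono2) (auto simp: b_def)
  then have 2: "KD * (4 * C0 * C7 * b powr (m - 1)) * (2 powr \<alpha> * K0) \<le> 1 / 8" using A2 by (simp add: mult_ac)
  have "K0 * (b / K0) = b" using K0_ge by simp
  then have "small (b / K0)" unfolding small_def using 1 2 b K0_ge by simp
  then show ?thesis ..
qed

lemma small_consequences:
  assumes "small a"
  shows "0 < a" "0 < K0 * a" "R * lam * (K0 * a) powr p \<le> 1 / 2"
    "KD * (C0 * C7 * (K0 * a) powr (m - 1)) * (2 powr \<alpha> * (K0 * a)) \<le> a"
    "KD * (4 * C0 * C7 * (K0 * a) powr (m - 1)) \<le> 1 / 8"
proof -
  show a: "0 < a" "0 < K0 * a" "R * lam * (K0 * a) powr p \<le> 1 / 2" using assms K0_ge by (auto simp: small_def)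
  define q where "q = KD * (C0 * C7 * (K0 * a) powr (m - 1))"
  have q: "0 \<le> q" using KD_pos C0 C7_pos by (simp add: q_def)
  have 2: "1 \<le> 2 powr \<alpha>" using al by (intro ge_one_powr_ge_zero) auto
  have "4 * q * (2 powr \<alpha> * K0) = KD * (4 * C0 * C7 * (K0 * a) powr (m - 1)) * (2 powr \<alpha> * K0)" by (simp add: q_def)
  with assms have s: "4 * q * (2 powr \<alpha> * K0) \<le> 1 / 8" by (simp only: small_def)
  have "q * (2 powr \<alpha> * K0) * a \<le> 1 * a" using s a q 2 K0_ge by (intro mult_right_mono) auto
  then show "KD * (C0 * C7 * (K0 * a) powr (m - 1)) * (2 powr \<alpha> * (K0 * a)) \<le> a" by (simp add: q_def mult_ac)
  have "4 * q * 1 \<le> 4 * q * (2 powr \<alpha> * K0)" using q 2 K0_ge mult_mono[of 1 "2 powr \<alpha>" 1 K0] by (intro mult_left_mono) auto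
  then show "KD * (4 * C0 * C7 * (K0 * a) powr (m - 1)) \<le> 1 / 8" using s by (simp add: q_def)
qed

definition src :: "('a \<Rightarrow> real) \<Rightarrow> (real \<Rightarrow> 'a \<Rightarrow> real) \<Rightarrow> real \<Rightarrow> 'a \<Rightarrow> real" where
  "src u0 w s y = f (heat s u0 y + w s y)"

definition ballX :: "real \<Rightarrow> (real \<Rightarrow> 'a \<Rightarrow> real) \<Rightarrow> bool" where
  "ballX a w \<longleftrightarrow> (\<lambda>(s, y). w s y) \<in> borel_measurable (borel \<Otimes>\<^sub>M borel) \<and> (\<forall>s>0. Lb p (a * (1 + s) powr (- \<alpha>)) a (w s))"

context
  fixes u0 :: "'a \<Rightarrow> real" and a :: real
  assumes u0_meas [measurable]: "u0 \<in> borel_measurable borel" and sm: "small a"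
    and u0_mod: "(\<integral>\<^sup>+x. ennreal (exp ((\<bar>u0 x\<bar> / a) powr p) - 1) \<partial>lborel) \<le> 1"
begin

lemma a_pos: "0 < a" and b_pos: "0 < K0 * a" by (rule small_consequences[OF sm])+

lemma src_adm: "ballX a w \<Longrightarrow> 0 < s \<Longrightarrow> adm (K0 * a) s (\<lambda>y. heat s u0 y + w s y)"
  unfolding ballX_def by (intro adm_sum u0_mod a_pos u0_meas) auto

lemma src_measurable:
  assumes "ballX a w"
  shows "(\<lambda>(s, y). src u0 w s y) \<in> borel_measurable (borel \<Otimes>\<^sub>M borel)"
proof -
  have [measurable]: "(\<lambda>(s, y). w s y) \<in> borel_measurable (borel \<Otimes>\<^sub>M borel)" using assms unfolding ballX_def by auto
  show ?thesis unfolding src_def heat_def by measurable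
qed

lemma src_fac:
  assumes "ballX a w" "0 < s"
  shows "fac (C0 * C7 * (K0 * a) powr (m - 1) * (1 + s) powr (\<delta> - 1)) (2 powr \<alpha> * (K0 * a) * (1 + s) powr (- \<alpha>)) (2 powr \<alpha> * (K0 * a)) (src u0 w s)"
  unfolding src_def[abs_def] using src_adm[OF assms] small_consequences[OF sm] assms(2) by (intro adm_fac) auto

lemma duhamel_src:
  assumes w: "ballX a w" and t: "0 < t"
  shows "Lb p (a * (1 + t) powr (- \<alpha>)) a (duhamel (src u0 w) t)"
    and "integrable lborel (\<lambda>s. indicator {0<..<t} s * heat (t - s) (src u0 w s) x)"
proof -
  have h: "0 < C0 * C7 * (K0 * a) powr (m - 1)" "0 \<le> 2 powr \<alpha> * (K0 * a)" using C0 C7_pos b_pos a_pos K0_ge by auto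
  note D = duhamel_bound[OF src_measurable[OF w] h src_fac[OF w] t]
  show "integrable lborel (\<lambda>s. indicator {0<..<t} s * heat (t - s) (src u0 w s) x)" by (rule D(2))
  show "Lb p (a * (1 + t) powr (- \<alpha>)) a (duhamel (src u0 w) t)"
  proof (rule Lb_mono[OF D(1)])
    show "KD * (C0 * C7 * (K0 * a) powr (m - 1)) * (2 powr \<alpha> * (K0 * a)) * (1 + t) powr (- \<alpha>) \<le> a * (1 + t) powr (- \<alpha>)"
      by (intro mult_right_mono small_consequences(4)[OF sm]) simp
    show "0 \<le> KD * (C0 * C7 * (K0 * a) powr (m - 1)) * (2 powr \<alpha> * (K0 * a))" by (rule mult_nonneg_nonneg[OF mult_nonneg_nonneg[OF less_imp_le[OF KD_pos] less_imp_le[OF h(1)]] h(2)])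
  qed (use small_consequences(4)[OF sm] p in auto)
qed

lemma ballX_duhamel: "ballX a w \<Longrightarrow> ballX a (duhamel (src u0 w))"
  unfolding ballX_def[of a "duhamel (src u0 w)"] using duhamel_measurable[OF src_measurable] duhamel_src(1) by blast

text \<open>The heat flow cancels, so w - w' is the bounded factor of the source difference. The
  size W is free, which makes the lemma applicable to every step of the iteration and to its
  limit.\<close>

lemma duhamel_src_contraction:
  assumes w: "ballX a w" "ballX a w'" and W: "0 \<le> W"
    and d: "\<And>s. 0 < s \<Longrightarrow> Lb p (W * (1 + s) powr (- \<alpha>)) W (\<lambda>x. w s x - w' s x)" and t: "0 < t"
  shows "Lb p (W / 8 * (1 + t) powr (- \<alpha>)) (W / 8) (\<lambda>x. duhamel (src u0 w) t x - duhamel (src u0 w') t x)"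
proof -
  define g where "g s y = src u0 w s y - src u0 w' s y" for s y
  define \<eta> where "\<eta> = 4 * C0 * C7 * (K0 * a) powr (m - 1)"
  have \<eta>: "0 < \<eta>" using C0 C7_pos a_pos K0_ge by (simp add: \<eta>_def)
  note [measurable] = src_measurable[OF w(1)] src_measurable[OF w(2)]
  have gm: "(\<lambda>(s, y). g s y) \<in> borel_measurable (borel \<Otimes>\<^sub>M borel)" unfolding g_def by measurable
  have gf: "fac (\<eta> * (1 + s) powr (\<delta> - 1)) (W * (1 + s) powr (- \<alpha>)) W (g s)" if s: "0 < s" for s
  proof -
    let ?h = "C7 * (K0 * a) powr (m - 1) * (1 + s) powr (\<delta> - 1)"
    have ad: "adm (K0 * a) s (\<lambda>y. heat s u0 y + w s y)" "adm (K0 * a) s (\<lambda>y. heat s u0 y + w' s y)"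
      using src_adm w s by auto
    have "fac (4 * C0 * ?h) (W * (1 + s) powr (- \<alpha>)) W (\<lambda>y. f (heat s u0 y + w s y) - f (heat s u0 y + w' s y))"
    proof (rule fac_diff[where b="K0 * a"])
      show "Lb p (W * (1 + s) powr (- \<alpha>)) W (\<lambda>x. heat s u0 x + w s x - (heat s u0 x + w' s x))" using d[OF s] by simp
      have "0 < (K0 * a) powr (m - 1)" unfolding powr_gt_zero using b_pos by linarith
      then show "0 < ?h" using C7_pos s by (intro mult_pos_pos) auto
      show "(\<integral>\<^sup>+x. ennreal (Hf (K0 * a) (heat s u0 x + w s x) powr R) \<partial>lborel) \<le> ennreal (?h powr R)"
        by (rule adm_Hf[OF ad(1) b_pos small_consequences(3)[OF sm] s])
      show "(\<integral>\<^sup>+x. ennreal (Hf (K0 * a) (heat s u0 x + w' s x) powr R) \<partial>lborel) \<le> ennreal (?h powr R)"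
        by (rule adm_Hf[OF ad(2) b_pos small_consequences(3)[OF sm] s])
      show "(\<lambda>y. heat s u0 y + w s y) \<in> borel_measurable borel" "(\<lambda>y. heat s u0 y + w' s y) \<in> borel_measurable borel"
        using ad unfolding adm_def by blast+
    qed (rule b_pos)
    then show ?thesis by (simp add: g_def[abs_def] src_def \<eta>_def mult.assoc)
  qed
  note D = duhamel_bound(1)[OF gm \<eta> W gf t]
  have eq: "duhamel g t x = duhamel (src u0 w) t x - duhamel (src u0 w') t x" for x
  proof -
    have "duhamel (src u0 w) t x - duhamel (src u0 w') t x
       = (\<integral>s. indicator {0<..<t} s * heat (t - s) (src u0 w s) x - indicator {0<..<t} s * heat (t - s) (src u0 w' s) x \<partial>lborel)"
      unfolding duhamel_def by (rule Bochner_Integration.integral_diff[symmetric, OF duhamel_src(2)[OF w(1) t] duhamel_src(2)[OF w(2) t]])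
    also have "\<dots> = duhamel g t x"
      unfolding duhamel_def
    proof (intro Bochner_Integration.integral_cong refl)
      fix s
      show "indicator {0<..<t} s * heat (t - s) (src u0 w s) x - indicator {0<..<t} s * heat (t - s) (src u0 w' s) x = indicator {0<..<t} s * heat (t - s) (g s) x"
      proof (cases "s \<in> {0<..<t}")
        case True
        then have s: "0 < s" "0 < t - s" by auto
        have i: "integrable lborel (\<lambda>y. S (t - s) (x - y) * src u0 v s y)" if "ballX a v" for v
          using a_pos b_pos K0_ge C0 C7_pos s by (intro heat_fac(1)[OF src_fac[OF that s(1)]]) auto
        have "heat (t - s) (g s) x = heat (t - s) (src u0 w s) x - heat (t - s) (src u0 w' s) x"
          using i[OF w(1)] i[OF w(2)] by (simp add: heat_def g_def right_diff_distrib)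
        then show ?thesis using True by simp
      qed simp
    qed
    finally show ?thesis ..
  qed
  have le: "KD * \<eta> * W \<le> W / 8" using mult_right_mono[OF small_consequences(5)[OF sm] W] by (simp add: \<eta>_def)
  have "Lb p (W / 8 * (1 + t) powr (- \<alpha>)) (W / 8) (duhamel g t)"
  proof (rule Lb_mono[OF D])
    show "KD * \<eta> * W * (1 + t) powr (- \<alpha>) \<le> W / 8 * (1 + t) powr (- \<alpha>)" by (intro mult_right_mono le) simp
  qed (use le KD_pos \<eta> W p in auto)
  then show ?thesis by (simp add: eq[abs_def])
qed

lemma fixed_point:
  obtains w where "ballX a w" "\<And>t x. 0 < t \<Longrightarrow> w t x = duhamel (src u0 w) t x"
proof -
  define W where "W k = ((\<lambda>w. duhamel (src u0 w)) ^^ k) (\<lambda>_ _. 0)" for k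
  have W_Suc: "W (Suc k) = duhamel (src u0 (W k))" for k by (simp add: W_def)
  have B: "ballX a (W k)" for k
  proof (induction k)
    case 0 show ?case using a_pos by (simp add: W_def ballX_def Lb_def)
  next
    case (Suc k) then show ?case by (simp add: W_Suc ballX_duhamel)
  qed
  define q where "q k = a * (1 / 8) ^ k" for k
  have q0: "0 < q k" for k using a_pos by (simp add: q_def)
  have qS: "q (Suc k) = q k / 8" for k by (simp add: q_def)
  have step: "Lb p (q k * (1 + s) powr (- \<alpha>)) (q k) (\<lambda>x. W (Suc k) s x - W k s x)" if "0 < s" for k s
    using that
  proof (induction k arbitrary: s)
    case 0
    have "Lb p (a * (1 + s) powr (- \<alpha>)) a (W (Suc 0) s)" using B[of "Suc 0"] 0 unfolding ballX_def by blast
    then show ?case by (simp add: q_def W_def[of 0])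
  next
    case (Suc k)
    show ?case using duhamel_src_contraction[OF B B less_imp_le[OF q0] Suc.IH Suc.prems] by (simp add: qS W_Suc[symmetric])
  qed
  \<comment> \<open>Splitting off the first step reproduces the constant: q (Suc k) = q k / 8, so 4
    (8 q (Suc k) + q k) = 8 q k. The factor 1/8 was chosen for this.\<close>
  have tele: "Lb p (8 * q k * (1 + s) powr (- \<alpha>)) (8 * q k) (\<lambda>x. W (k + n) s x - W k s x)" if "0 < s" for k n s
  proof (induction n arbitrary: k)
    case 0 then show ?case using q0[of k] p by (simp add: Lb_def)
  next
    case (Suc n)
    have "Lb p (4 * (8 * q (Suc k) * (1 + s) powr (- \<alpha>) + q k * (1 + s) powr (- \<alpha>))) (4 * (8 * q (Suc k) + q k)) (\<lambda>x. (W (Suc k + n) s x - W (Suc k) s x) + (W (Suc k) s x - W k s x))"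
      using q0[of k] q0[of "Suc k"] p by (intro Lb_add Suc step that) auto
    then show ?case by (simp add: qS mult.assoc)
  qed
  have qlim: "(\<lambda>k. K * q k) \<longlonglongrightarrow> 0" for K
    unfolding q_def by (intro tendsto_mult_right_zero LIMSEQ_power_zero) auto
  \<comment> \<open>The limit operator is total, so the result is jointly measurable even at
    nonpositive times, where convergence of the iterates is not claimed.\<close>
  define w where "w t x = lim (\<lambda>k. W k t x)" for t x
  have conv: "(\<lambda>k. W k s x) \<longlonglongrightarrow> w s x" if s: "0 < s" for s x
  proof -
    have "Cauchy (\<lambda>k. W k s x)"
      unfolding Cauchy_altdef
    proof (intro allI impI)
      fix e :: real assume e: "0 < e"
      have "eventually (\<lambda>k. 8 * (1 + s) powr (- \<alpha>) * q k < e) sequentially" using order_tendstoD(2)[OF qlim e] .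
      then obtain M where M: "\<And>k. M \<le> k \<Longrightarrow> 8 * (1 + s) powr (- \<alpha>) * q k < e" by (auto simp: eventually_sequentially)
      show "\<exists>M. \<forall>m\<ge>M. \<forall>n>m. dist (W m s x) (W n s x) < e"
      proof (intro exI[of _ M] allI impI)
        fix m n assume mn: "M \<le> m" "m < n"
        have "\<bar>W (m + (n - m)) s x - W m s x\<bar> \<le> 8 * q m * (1 + s) powr (- \<alpha>)" by (rule LbD(2)[OF tele[OF s]])
        then show "dist (W m s x) (W n s x) < e" using M[OF mn(1)] mn by (simp add: dist_real_def abs_minus_commute mult_ac)
      qed
    qed
    from Cauchy_convergent[OF this] show ?thesis unfolding w_def by (simp only: convergent_LIMSEQ_iff)
  qed
  have Wm: "(\<lambda>z. W k (fst z) (snd z)) \<in> borel_measurable (borel \<Otimes>\<^sub>M borel)" for k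
    using B[of k] unfolding ballX_def by (simp add: case_prod_beta')
  have wB: "ballX a w"
    unfolding ballX_def
  proof (intro conjI allI impI)
    show "(\<lambda>(s, y). w s y) \<in> borel_measurable (borel \<Otimes>\<^sub>M borel)"
      unfolding w_def case_prod_beta' using Wm by (intro borel_measurable_lim_metric)
    show "Lb p (a * (1 + s) powr (- \<alpha>)) a (w s)" if "0 < s" for s
      by (rule Lb_limit[of p _ _ "\<lambda>k. W k s"]) (use B conv[OF that] p that in \<open>auto simp: ballX_def\<close>)
  qed
  have dist: "Lb p (8 * q k * (1 + s) powr (- \<alpha>)) (8 * q k) (\<lambda>x. w s x - W k s x)" if "0 < s" for s k
  proof (rule Lb_limit[OF tele[OF that]])
    show "(\<lambda>n. W (k + n) s x - W k s x) \<longlonglongrightarrow> w s x - W k s x" for x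
      using LIMSEQ_ignore_initial_segment[OF conv[OF that], of k x] by (intro tendsto_diff tendsto_const) (simp add: add.commute)
  qed (use p in auto)
  show ?thesis
  proof (rule that[OF wB])
    fix t x assume t: "0 < (t::real)"
    have q8: "0 \<le> 8 * q k" for k using q0[of k] by simp
    have le: "norm (W (Suc k) t x - duhamel (src u0 w) t x) \<le> (1 + t) powr (- \<alpha>) * q k" for k
      using LbD(2)[OF duhamel_src_contraction[OF wB B q8 dist t], of x k] by (simp add: W_Suc abs_minus_commute mult.commute)
    have "(\<lambda>k. W (Suc k) t x - duhamel (src u0 w) t x) \<longlonglongrightarrow> 0"
      by (rule Lim_null_comparison[OF always_eventually[OF allI[OF le]] qlim])
    then have "(\<lambda>k. W (Suc k) t x) \<longlonglongrightarrow> duhamel (src u0 w) t x" by (simp add: LIM_zero_iff)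
    moreover have "(\<lambda>k. W (Suc k) t x) \<longlonglongrightarrow> w t x" by (rule LIMSEQ_Suc[OF conv[OF t]])
    ultimately show "w t x = duhamel (src u0 w) t x" by (rule LIMSEQ_unique[symmetric])
  qed
qed

end

end

section \<open>Regularity of the fixed point\<close>

context nonlinear_heat
begin

context
  fixes u0 :: "'a \<Rightarrow> real" and a :: real and w :: "real \<Rightarrow> 'a \<Rightarrow> real"
  assumes u0_meas [measurable]: "u0 \<in> borel_measurable borel" and sm: "small a"
    and u0_mod: "(\<integral>\<^sup>+x. ennreal (exp ((\<bar>u0 x\<bar> / a) powr p) - 1) \<partial>lborel) \<le> 1"
    and wX: "ballX a w" and wfix: "\<And>t x. 0 < t \<Longrightarrow> w t x = duhamel (src u0 w) t x"
begin

text \<open>Together with \<open>Ws\<close>, a time-independent bound: continuity and the limit at 0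
  are local in time and can forgo the decaying weights.\<close>

definition hs :: real where "hs = C7 * (K0 * a) powr (m - 1)"
definition Ws :: real where "Ws = 2 powr \<alpha> * (K0 * a)"

lemma hs_pos: "0 < hs"
proof -
  have "0 < (K0 * a) powr (m - 1)" unfolding powr_gt_zero using small_consequences(2)[OF sm] by linarith
  then show ?thesis unfolding hs_def using C7_pos by (intro mult_pos_pos)
qed

lemma Ws_pos: "0 < Ws"
  unfolding Ws_def by (rule mult_pos_pos[OF _ small_consequences(2)[OF sm]]) simp

lemma u0_Lp: "(\<integral>\<^sup>+x. ennreal (\<bar>u0 x\<bar> powr p) \<partial>lborel) \<le> ennreal (a powr p)"
  using adm_Lp[of a "1/2" u0] u0_mod small_consequences(1)[OF sm] by (simp add: adm_def)

lemma u_adm: "0 < s \<Longrightarrow> adm (K0 * a) s (\<lambda>y. heat s u0 y + w s y)"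
  by (rule src_adm[OF u0_meas sm u0_mod wX])

text \<open>The factor 4 makes the constant agree with that of \<open>fac_diff\<close>, so one
  \<eta> serves both the source and its increments.\<close>

lemma src_fac_unif:
  assumes s: "0 < s"
  shows "fac (4 * C0 * hs) Ws Ws (src u0 w s)"
proof (rule fac_mono[OF src_fac[OF u0_meas sm u0_mod wX s]])
  have 1: "(1 + s) powr (\<delta> - 1) \<le> 1 powr (\<delta> - 1)" using s del by (intro powr_mono2') auto
  have 2: "(1 + s) powr (- \<alpha>) \<le> 1 powr (- \<alpha>)" using s al by (intro powr_mono2') auto
  have h: "0 < C0 * hs" using C0 hs_pos by simp
  have "C0 * hs * (1 + s) powr (\<delta> - 1) \<le> C0 * hs * 1" using 1 h by (intro mult_left_mono) auto
  also have "\<dots> \<le> 4 * C0 * hs" using h by simp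
  finally show "C0 * C7 * (K0 * a) powr (m - 1) * (1 + s) powr (\<delta> - 1) \<le> 4 * C0 * hs" by (simp add: hs_def mult.assoc)
  have "Ws * (1 + s) powr (- \<alpha>) \<le> Ws * 1" using 2 Ws_pos by (intro mult_left_mono) auto
  then show "2 powr \<alpha> * (K0 * a) * (1 + s) powr (- \<alpha>) \<le> Ws" by (simp add: Ws_def)
  show "0 \<le> C0 * C7 * (K0 * a) powr (m - 1) * (1 + s) powr (\<delta> - 1)" using C0 C7_pos by simp
  show "0 \<le> 2 powr \<alpha> * (K0 * a)" "2 powr \<alpha> * (K0 * a) \<le> Ws" using Ws_pos unfolding Ws_def by linarith+
qed

lemma eta_pos: "0 < 4 * C0 * hs" using C0 hs_pos by simp

lemma src_meas: "(\<lambda>(s, y). src u0 w s y) \<in> borel_measurable (borel \<Otimes>\<^sub>M borel)"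
  by (rule src_measurable[OF u0_meas sm u0_mod wX])

lemma w_cont: "Lb_cont p {0<..} w"
proof -
  have "Lb_cont p {0<..} (duhamel (src u0 w))"
    by (rule duhamel_Lb_cont[OF src_meas eta_pos Ws_pos src_fac_unif duhamel_src(2)[OF u0_meas sm u0_mod wX]])
  then show ?thesis unfolding Lb_cont_def by (simp add: wfix)
qed

lemma u_cont: "Lb_cont p {0<..} (\<lambda>t x. heat t u0 x + w t x)"
  using heat_Lb_cont[OF u0_meas u0_Lp] w_cont small_consequences(1)[OF sm] p by (intro Lb_cont_add) auto

text \<open>Increments of the source factor through increments of u, so continuity of u passes to
  the source and then to the heat integrand.\<close>

lemma integrand_cont: "Lb_cont p {0<..<t} (\<lambda>s. heat (t - s) (src u0 w s))"
proof (rule heat_integrand_Lb_cont[OF eta_pos less_imp_le[OF Ws_pos] src_fac_unif])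
  fix s e :: real assume s: "0 < s" and e: "0 < e"
  obtain d where d: "0 < d" "\<And>s'. 0 < s' \<Longrightarrow> \<bar>s' - s\<bar> < d \<Longrightarrow> Lb p e e (\<lambda>x. heat s' u0 x + w s' x - (heat s u0 x + w s x))"
  proof -
    have "\<exists>d>0. \<forall>s'\<in>{0<..}. \<bar>s' - s\<bar> < d \<longrightarrow> Lb p e e (\<lambda>x. heat s' u0 x + w s' x - (heat s u0 x + w s x))"
      by (rule u_cont[unfolded Lb_cont_def, rule_format]) (use s e in simp_all)
    then show ?thesis using that by blast
  qed
  have Hf: "(\<integral>\<^sup>+x. ennreal (Hf (K0 * a) (heat r u0 x + w r x) powr R) \<partial>lborel) \<le> ennreal (hs powr R)" if r: "0 < r" for r
  proof -
    have "(\<integral>\<^sup>+x. ennreal (Hf (K0 * a) (heat r u0 x + w r x) powr R) \<partial>lborel) \<le> ennreal ((C7 * (K0 * a) powr (m - 1) * (1 + r) powr (\<delta> - 1)) powr R)"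
      by (rule adm_Hf[OF u_adm[OF r] small_consequences(2,3)[OF sm] r])
    also have "\<dots> \<le> ennreal (hs powr R)"
    proof (intro ennreal_leI powr_mono2)
      have 1: "(1 + r) powr (\<delta> - 1) \<le> 1 powr (\<delta> - 1)" using r del by (intro powr_mono2') auto
      have "hs * (1 + r) powr (\<delta> - 1) \<le> hs * 1" using 1 hs_pos by (intro mult_left_mono) auto
      then show "C7 * (K0 * a) powr (m - 1) * (1 + r) powr (\<delta> - 1) \<le> hs" by (simp add: hs_def)
    qed (use C7_pos R_pos in auto)
    finally show ?thesis .
  qed
  have "fac (4 * C0 * hs) e e (\<lambda>y. src u0 w s' y - src u0 w s y)" if s': "0 < s'" "\<bar>s' - s\<bar> < d" for s'
    unfolding src_def
    by (rule fac_diff[OF _ _ small_consequences(2)[OF sm] hs_pos Hf[OF s'(1)] Hf[OF s] d(2)[OF s']])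
       (use u_adm[OF s] u_adm[OF s'(1)] in \<open>auto simp: adm_def\<close>)
  then show "\<exists>d>0. \<forall>s'>0. \<bar>s' - s\<bar> < d \<longrightarrow> fac (4 * C0 * hs) e e (\<lambda>y. src u0 w s' y - src u0 w s y)"
    using d(1) by blast
qed

definition KB :: real where "KB = c powr (1 / R) * (4 * C0 * hs) * Ws"

lemma KB_pos: "0 < KB" unfolding KB_def using c_pos by (intro mult_pos_pos[OF mult_pos_pos[OF _ eta_pos] Ws_pos]) simp

lemma integrand_bound:
  assumes "0 < s" "s < t"
  shows "Lb p (KB * (t - s) powr (- \<delta>)) (KB * (t - s) powr (- \<delta>)) (heat (t - s) (src u0 w s))"
    and "integrable lborel (\<lambda>y. S (t - s) (x - y) * src u0 w s y)"
  using heat_fac(1,2)[OF src_fac_unif[OF assms(1)] eta_pos less_imp_le[OF Ws_pos] less_imp_le[OF Ws_pos], of "t - s"] assms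
  by (auto simp: KB_def mult_ac)

lemma w_short_time:
  assumes t: "0 < t"
  shows "Lb p (KB / (1 - \<delta>) * t powr (1 - \<delta>)) (KB / (1 - \<delta>) * t powr (1 - \<delta>)) (w t)"
proof -
  have 1: "duhamel (src u0 w) t = w t" by (rule ext) (simp add: wfix[OF t])
  have 2: "c powr (1 / R) * (4 * C0 * hs) / (1 - \<delta>) * t powr (1 - \<delta>) * Ws = KB / (1 - \<delta>) * t powr (1 - \<delta>)"
    by (simp add: KB_def)
  show ?thesis
    using duhamel_short_time[OF src_meas eta_pos less_imp_le[OF Ws_pos] src_fac_unif t] unfolding 1 2 .
qed

end

end

text \<open>Young's inequality between exp L^p and its predual with a free parameter: k makes the
  modular coefficient as small as desired at a logarithmic price on the other term. Smallness on the
  predual side alone then makes the pairing small.\<close>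

lemma young_orlicz:
  fixes y b p k :: real
  assumes y: "0 \<le> y" and b: "0 \<le> b" and p: "1 \<le> p" and k: "1 \<le> k"
  shows "y * b \<le> 2 / k * (exp (y powr p) - 1) + (2 * (1 + ln k / ln 2)) powr (1 / p) * (b * ln (2 + b) powr (1 / p))"
proof -
  \<comment> \<open>A threshold for y^p. Below it, y is controlled by the logarithmic weight of b;
    above it, k b <= exp(y^p / 2) and the modular takes over.\<close>
  define l where "l = 2 * ln (2 + k * b)"
  have kb: "0 \<le> k * b" using k b by simp
  have l0: "0 \<le> l" using kb unfolding l_def by simp
  have lb: "ln 2 \<le> ln (2 + b)" "0 < ln (2 + b)" using b by auto
  have le: "l \<le> 2 * (1 + ln k / ln 2) * ln (2 + b)"
  proof -
    have "2 + k * b \<le> k * (2 + b)" using k b by (simp add: algebra_simps)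
    moreover have "0 < 2 + k * b" "0 < k * (2 + b)" using kb k b by (auto intro: add_pos_nonneg)
    ultimately have "ln (2 + k * b) \<le> ln (k * (2 + b))" by (subst ln_le_cancel_iff)
    also have "\<dots> = ln k + ln (2 + b)" using k b by (subst ln_mult) auto
    also have "ln k = ln k / ln 2 * ln 2" by simp
    also have "ln k / ln 2 * ln 2 + ln (2 + b) \<le> ln k / ln 2 * ln (2 + b) + ln (2 + b)"
      using lb k by (intro add_right_mono mult_left_mono) auto
    finally have "l \<le> 2 * (ln k / ln 2 * ln (2 + b) + ln (2 + b))" unfolding l_def by (rule mult_left_mono) simp
    also have "\<dots> = 2 * (1 + ln k / ln 2) * ln (2 + b)" by (simp add: algebra_simps)
    finally show ?thesis .
  qed
  have e0: "0 \<le> exp (y powr p) - 1" by simp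
  have s0: "0 \<le> (2 * (1 + ln k / ln 2)) powr (1 / p) * (b * ln (2 + b) powr (1 / p))" using b by simp
  show ?thesis
  proof (cases "y powr p \<le> l")
    case True
    have "y = (y powr p) powr (1 / p)" using y p by (simp add: powr_powr)
    also have "\<dots> \<le> (2 * (1 + ln k / ln 2) * ln (2 + b)) powr (1 / p)"
      using True le p by (intro powr_mono2) auto
    also have "\<dots> = (2 * (1 + ln k / ln 2)) powr (1 / p) * ln (2 + b) powr (1 / p)"
      using lb k by (subst powr_mult) auto
    finally have "y * b \<le> (2 * (1 + ln k / ln 2)) powr (1 / p) * ln (2 + b) powr (1 / p) * b" using b by (rule mult_right_mono)
    moreover have "0 \<le> 2 / k * (exp (y powr p) - 1)" using k e0 by simp
    ultimately show ?thesis by (simp add: mult_ac)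
  next
    case False
    define X where "X = y powr p"
    have X: "l < X" using False by (simp add: X_def)
    have "(2 + k * b) powr 1 \<le> exp (X / 2)"
    proof -
      have "ln (2 + k * b) \<le> X / 2" using X by (simp add: l_def)
      then have "exp (ln (2 + k * b)) \<le> exp (X / 2)" by simp
      then show ?thesis using kb by simp
    qed
    then have 1: "k * b \<le> exp (X / 2)" using kb by simp
    have "1 \<le> X"
    proof -
      have "2 * ln 2 \<le> l" using kb by (simp add: l_def)
      moreover have "1 / 2 \<le> ln (2::real)" using ln2_ge_two_thirds by simp
      ultimately show ?thesis using X by linarith
    qed
    have 2: "y \<le> X"
    proof (cases "1 \<le> y")
      case True
      then have "y powr 1 \<le> y powr p" using p by (intro powr_mono) auto
      then show ?thesis using True by (simp add: X_def)
    qed (use \<open>1 \<le> X\<close> in simp)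
    have "X * exp (X / 2) \<le> 2 * (exp X - 1)"
    proof -
      define q where "q = exp (X / 2)"
      have q: "exp X = q * q" "1 + X / 2 \<le> q" using exp_ge_add_one_self[of "X / 2"] by (auto simp: q_def mult_exp_exp)
      have "X * q \<le> 2 * (q - 1) * q" using q \<open>1 \<le> X\<close> by (intro mult_right_mono) auto
      moreover have "2 * (q - 1) * q \<le> 2 * (q * q - 1)" using q \<open>1 \<le> X\<close> by (simp add: algebra_simps)
      ultimately show ?thesis unfolding q_def[symmetric] q(1) by linarith
    qed
    moreover have "y * (k * b) \<le> X * exp (X / 2)" using y 1 2 kb \<open>1 \<le> X\<close> by (intro mult_mono) auto
    ultimately have "k * (y * b) \<le> 2 * (exp X - 1)" by (simp add: mult_ac)
    then have "y * b \<le> 2 / k * (exp X - 1)" using k by (simp add: field_simps)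
    then show ?thesis using s0 by (simp add: X_def)
  qed
qed

section \<open>Bochner integrals in the exponential space\<close>

lemma borel_lebesgue: "v \<in> borel_measurable borel \<Longrightarrow> v \<in> borel_measurable (lebesgue :: 'a::euclidean_space measure)"
  by (rule measurable_completion) simp

lemma exp_modular_lborel:
  "0 < l \<Longrightarrow> exp_modular p l v = (\<integral>\<^sup>+x. ennreal (exp ((\<bar>v x\<bar> / l) powr p) - 1) \<partial>lborel)"
  unfolding exp_modular_def nn_integral_completion by (simp add: powr_divide)

text \<open>An admissible level is assumed because the infimum of the empty set is
  unspecified.\<close>

lemma expL_norm_nonneg:
  assumes "0 < l" "exp_modular p l v \<le> 1"
  shows "0 \<le> expL_norm p v"
  unfolding expL_norm_def using assms by (intro cInf_greatest) auto

lemma expL_norm_le: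
  assumes "0 < l" "exp_modular p l v \<le> 1"
  shows "expL_norm p v \<le> l"
  unfolding expL_norm_def using assms by (intro cInf_lower bdd_belowI[of _ 0]) auto

lemma expL_I:
  fixes v :: "real ^ 'n \<Rightarrow> real"
  assumes v: "v \<in> borel_measurable borel" and l: "0 < l" and p: "1 < p"
    and mod: "(\<integral>\<^sup>+x. ennreal (exp ((\<bar>v x\<bar> / l) powr p) - 1) \<partial>lborel) \<le> 1"
  shows "v \<in> expL p" and "expL_norm p v \<le> l" and "0 \<le> expL_norm p v"
proof -
  have m: "exp_modular p l v \<le> 1" using mod l by (simp add: exp_modular_lborel)
  show "expL_norm p v \<le> l" "0 \<le> expL_norm p v" by (rule expL_norm_le[OF l m] expL_norm_nonneg[OF l m])+
  have "v absolutely_integrable_on K" if "compact K" for K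
  proof -
    have Kf: "emeasure lborel K < \<infinity>" using that by (rule emeasure_compact_finite)
    have [measurable]: "K \<in> sets borel" using that by (simp add: borel_compact)
    note [measurable] = v
    have "(\<integral>\<^sup>+x. ennreal (norm (indicator K x *\<^sub>R v x)) \<partial>lborel) \<le> (\<integral>\<^sup>+x. ennreal l * (indicator K x + ennreal (exp ((\<bar>v x\<bar> / l) powr p) - 1)) \<partial>lborel)"
    proof (rule nn_integral_mono)
      fix x
      have "\<bar>v x\<bar> / l \<le> 1 + (\<bar>v x\<bar> / l) powr p" using l p by (intro le_one_plus_powr) auto
      also have "\<dots> \<le> 1 + (exp ((\<bar>v x\<bar> / l) powr p) - 1)" using exp_ge_add_one_self[of "(\<bar>v x\<bar> / l) powr p"] by linarith
      finally have "\<bar>v x\<bar> \<le> l * (1 + (exp ((\<bar>v x\<bar> / l) powr p) - 1))" using l by (simp add: field_simps)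
      then have "ennreal \<bar>v x\<bar> \<le> ennreal l * (1 + ennreal (exp ((\<bar>v x\<bar> / l) powr p) - 1))"
        using l by (simp add: ennreal_mult[symmetric] ennreal_1[symmetric] ennreal_plus[symmetric] ennreal_leI del: ennreal_1 ennreal_plus)
      then show "ennreal (norm (indicator K x *\<^sub>R v x)) \<le> ennreal l * (indicator K x + ennreal (exp ((\<bar>v x\<bar> / l) powr p) - 1))"
        by (cases "x \<in> K") auto
    qed
    also have "\<dots> = ennreal l * (emeasure lborel K + (\<integral>\<^sup>+x. ennreal (exp ((\<bar>v x\<bar> / l) powr p) - 1) \<partial>lborel))"
      by (simp add: nn_integral_cmult nn_integral_add)
    also have "\<dots> < \<infinity>" using mod Kf by (auto simp: ennreal_mult_less_top intro: le_less_trans)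
    finally have "integrable lborel (\<lambda>x. indicator K x *\<^sub>R v x)" by (simp add: integrable_iff_bounded)
    then show ?thesis unfolding set_integrable_def by (subst integrable_completion) auto
  qed
  then show "v \<in> expL p" unfolding expL_def L1_loc_def using l le_less_trans[OF m] by (auto intro!: exI[of _ l])
qed

text \<open>At level l = e W the quotient |v|/l is at most 1, where exp y - 1 <= e y; the modular is
  therefore at most e (W/l)^p = e^(1-p) <= 1.\<close>

lemma Lb_expL:
  fixes v :: "real ^ 'n \<Rightarrow> real"
  assumes v: "Lb p W W v" and W: "0 < W" and p: "1 < p"
  shows "v \<in> expL p" and "expL_norm p v \<le> exp 1 * W" and "0 \<le> expL_norm p v"
proof -
  note [measurable] = LbD(1)[OF v]
  define l where "l = exp 1 * W"
  have l: "0 < l" using W by (simp add: l_def)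
  have "(\<integral>\<^sup>+x. ennreal (exp ((\<bar>v x\<bar> / l) powr p) - 1) \<partial>lborel) \<le> (\<integral>\<^sup>+x. ennreal (exp 1 / l powr p) * ennreal (\<bar>v x\<bar> powr p) \<partial>lborel)"
  proof (rule nn_integral_mono)
    fix x
    define y where "y = (\<bar>v x\<bar> / l) powr p"
    have "\<bar>v x\<bar> \<le> W" by (rule LbD(2)[OF v])
    also have "W \<le> l" using W by (simp add: l_def)
    finally have y: "0 \<le> y" "y \<le> 1" unfolding y_def using l p by (auto intro!: powr_le1)
    have "exp y - 1 \<le> exp 1 * y"
    proof -
      have "1 - y \<le> exp (- y)" using exp_ge_add_one_self[of "- y"] by simp
      then have "exp y * (1 - y) \<le> exp y * exp (- y)" by (intro mult_left_mono) auto
      then have "exp y - 1 \<le> exp y * y" by (simp add: algebra_simps mult_exp_exp)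
      also have "\<dots> \<le> exp 1 * y" using y by (intro mult_right_mono) auto
      finally show ?thesis .
    qed
    also have "exp 1 * y = exp 1 / l powr p * \<bar>v x\<bar> powr p" using l by (simp add: y_def powr_divide)
    finally have "ennreal (exp y - 1) \<le> ennreal (exp 1 / l powr p * \<bar>v x\<bar> powr p)" by (rule ennreal_leI)
    then show "ennreal (exp ((\<bar>v x\<bar> / l) powr p) - 1) \<le> ennreal (exp 1 / l powr p) * ennreal (\<bar>v x\<bar> powr p)"
      by (simp add: y_def flip: ennreal_mult)
  qed
  also have "\<dots> = ennreal (exp 1 / l powr p) * (\<integral>\<^sup>+x. ennreal (\<bar>v x\<bar> powr p) \<partial>lborel)" by (rule nn_integral_cmult) measurable
  also have "\<dots> \<le> ennreal (exp 1 / l powr p) * ennreal (W powr p)" by (intro mult_left_mono LbD(3)[OF v]) simp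
  also have "\<dots> = ennreal (exp 1 / l powr p * W powr p)" by (rule ennreal_mult[symmetric]) auto
  also have "exp 1 / l powr p * W powr p \<le> 1"
  proof -
    have "l powr p = exp p * W powr p" using W by (simp add: l_def powr_mult exp_powr_real)
    moreover have "exp 1 \<le> exp p" using p by simp
    ultimately show ?thesis using W by (simp add: divide_le_eq_1)
  qed
  finally have mod: "(\<integral>\<^sup>+x. ennreal (exp ((\<bar>v x\<bar> / l) powr p) - 1) \<partial>lborel) \<le> 1" by (simp add: ennreal_leI)
  show "v \<in> expL p" "expL_norm p v \<le> exp 1 * W" "0 \<le> expL_norm p v" using expL_I[OF LbD(1)[OF v] l p mod] by (auto simp: l_def)
qed

lemma zero_expL: "1 < p \<Longrightarrow> (\<lambda>_. 0) \<in> (expL p :: (real ^ 'n \<Rightarrow> real) set)"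
  by (rule expL_I(1)[of _ 1]) auto

text \<open>A finite subcover of K reduces G to finitely many values. The value 0 outside K leaves G
  itself as the error there, which an integrable majorant can control.\<close>

lemma simple_approx:
  fixes G :: "real \<Rightarrow> real ^ 'n \<Rightarrow> real"
  assumes I: "I \<in> sets borel" and K: "compact K" "K \<subseteq> I" and cont: "Lb_cont p I G" and p: "1 < p"
    and GL: "\<And>t. t \<in> I \<Longrightarrow> G t \<in> expL p" and Gm: "\<And>t. t \<in> I \<Longrightarrow> G t \<in> borel_measurable borel" and e: "0 < e"
  obtains s where "expL_simple p I s" "\<And>t. t \<in> K \<Longrightarrow> Lb p e e (\<lambda>x. G t x - s t x)"
    "\<And>t. t \<notin> K \<Longrightarrow> s t = (\<lambda>_. 0)" "(\<lambda>(t, x). s t x) \<in> borel_measurable (borel \<Otimes>\<^sub>M borel)"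
proof -
  obtain d where d: "\<And>t. t \<in> I \<Longrightarrow> 0 < d t" "\<And>t s. t \<in> I \<Longrightarrow> s \<in> I \<Longrightarrow> \<bar>s - t\<bar> < d t \<Longrightarrow> Lb p e e (\<lambda>x. G s x - G t x)"
  proof -
    have "\<forall>t\<in>I. \<exists>d>0. \<forall>s\<in>I. \<bar>s - t\<bar> < d \<longrightarrow> Lb p e e (\<lambda>x. G s x - G t x)"
      using cont e unfolding Lb_cont_def by blast
    from bchoice[OF this] show ?thesis using that by blast
  qed
  have "K \<subseteq> (\<Union>t\<in>K. ball t (d t))"
  proof
    fix t assume "t \<in> K"
    moreover from this have "t \<in> ball t (d t)" using d(1) K by auto
    ultimately show "t \<in> (\<Union>t\<in>K. ball t (d t))" by (rule UN_I)
  qed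
  then obtain T where T: "T \<subseteq> K" "finite T" "K \<subseteq> (\<Union>t\<in>T. ball t (d t))"
    using compactE_image[OF K(1), of K "\<lambda>t. ball t (d t)"] by blast
  obtain ts where ts: "set ts = T" using finite_list[OF T(2)] by blast
  define n where "n = length ts"
  define P where "P t i \<longleftrightarrow> i < n \<and> \<bar>t - ts ! i\<bar> < d (ts ! i)" for t i
  \<comment> \<open>Taking the least index makes the choice of a centre Borel measurable in
    t.\<close>
  define j where "j t = (LEAST i. P t i)" for t
  have j: "j t < n" "\<bar>t - ts ! j t\<bar> < d (ts ! j t)" "ts ! j t \<in> K" if t: "t \<in> K" for t
  proof -
    obtain r where "r \<in> T" "t \<in> ball r (d r)" using T(3) t by blast
    then obtain i where "i < n" "ts ! i = r" using ts by (auto simp: in_set_conv_nth n_def)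
    then have "P t i" using \<open>t \<in> ball r (d r)\<close> by (auto simp: P_def dist_real_def abs_minus_commute)
    then have "P t (j t)" unfolding j_def by (rule LeastI)
    then show "j t < n" "\<bar>t - ts ! j t\<bar> < d (ts ! j t)" by (auto simp: P_def)
    then show "ts ! j t \<in> K" using T(1) ts by (auto simp: n_def)
  qed
  have [measurable]: "Measurable.pred borel (\<lambda>t. P t i)" for i unfolding P_def by measurable
  have jm [measurable]: "j \<in> measurable borel (count_space UNIV)" unfolding j_def by measurable
  have Km [measurable]: "K \<in> sets borel" using K(1) by (rule borel_compact)
  define s where "s t = (if t \<in> K then G (ts ! j t) else (\<lambda>_. 0))" for t
  show ?thesis
  proof (rule that[of s])
    show "s t = (\<lambda>_. 0)" if "t \<notin> K" for t using that by (simp add: s_def)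
    show "Lb p e e (\<lambda>x. G t x - s t x)" if "t \<in> K" for t
      unfolding s_def using that j[OF that] K by (auto intro!: d(2))
    have seq: "s t x = (\<Sum>i<n. if t \<in> K \<and> j t = i then G (ts ! i) x else 0)" for t x
    proof (cases "t \<in> K")
      case True
      then show ?thesis using j(1)[OF True] by (simp add: s_def if_distrib cong: if_cong)
    qed (simp add: s_def)
    have tsI: "ts ! i \<in> I" if "i < n" for i using that T(1) ts K nth_mem[of i ts] by (auto simp: n_def)
    show "(\<lambda>(t, x). s t x) \<in> borel_measurable (borel \<Otimes>\<^sub>M borel)"
      unfolding seq case_prod_beta'
    proof (intro borel_measurable_sum)
      fix i assume "i \<in> {..<n}"
      then have [measurable]: "G (ts ! i) \<in> borel_measurable borel" using Gm tsI by auto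
      have "{t \<in> space borel. t \<in> K \<and> j t = i} \<in> sets borel" by measurable
      then have [measurable]: "Measurable.pred borel (\<lambda>t. t \<in> K \<and> j t = i)" by (simp add: pred_def)
      show "(\<lambda>z. if fst z \<in> K \<and> j (fst z) = i then G (ts ! i) (snd z) else 0) \<in> borel_measurable (borel \<Otimes>\<^sub>M borel)"
        by measurable
    qed
    show "expL_simple p I s"
      unfolding expL_simple_def
    proof (intro conjI allI ballI)
      have "s ` I \<subseteq> insert (\<lambda>_. 0) ((\<lambda>i. G (ts ! i)) ` {..<n})"
        using j(1) by (auto simp: s_def)
      then show "finite (s ` I)" by (rule finite_subset) simp
      show "s t \<in> expL p" if "t \<in> I" for t
        using zero_expL[OF p] GL j(3) K by (auto simp: s_def)
      fix v
      have "{t \<in> I. s t = v} = I \<inter> ((K \<inter> j -` {i. G (ts ! i) = v}) \<union> (if v = (\<lambda>_. 0) then - K else {}))"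
        by (auto simp: s_def)
      moreover have "j -` {i. G (ts ! i) = v} \<in> sets borel"
        using measurable_sets[OF jm, of "{i. G (ts ! i) = v}"] by simp
      ultimately have "{t \<in> I. s t = v} \<in> sets borel" using I Km by (auto intro!: sets.Int sets.Un)
      then show "{t \<in> I. s t = v} \<in> sets lebesgue" by (simp add: sets_completionI_sets)
    qed
  qed
qed

text \<open>Continuity on I is not uniform, so I is exhausted by compact sets, with error 1/(k+1) on
  the k-th one.\<close>

lemma expL_measurable_of_cont:
  fixes G :: "real \<Rightarrow> real ^ 'n \<Rightarrow> real"
  assumes I: "I \<in> sets borel" and K: "\<And>k::nat. compact (K k)" "\<And>k. K k \<subseteq> I" "\<And>t. t \<in> I \<Longrightarrow> eventually (\<lambda>k. t \<in> K k) sequentially"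
    and cont: "Lb_cont p I G" and p: "1 < p"
    and GL: "\<And>t. t \<in> I \<Longrightarrow> G t \<in> expL p" and Gm: "\<And>t. t \<in> I \<Longrightarrow> G t \<in> borel_measurable borel"
  shows "expL_measurable p I G"
proof -
  have "\<exists>s. expL_simple p I s \<and> (\<forall>t\<in>K k. Lb p (1 / real (Suc k)) (1 / real (Suc k)) (\<lambda>x. G t x - s t x))" for k
  proof -
    have e: "0 < 1 / real (Suc k)" by simp
    obtain s where "expL_simple p I s" "\<And>t. t \<in> K k \<Longrightarrow> Lb p (1 / real (Suc k)) (1 / real (Suc k)) (\<lambda>x. G t x - s t x)"
      by (rule simple_approx[OF I K(1)[of k] K(2)[of k] cont p GL Gm e]) blast+
    then show ?thesis by blast
  qed
  then obtain s where s: "\<And>k. expL_simple p I (s k)" "\<And>k t. t \<in> K k \<Longrightarrow> Lb p (1 / real (Suc k)) (1 / real (Suc k)) (\<lambda>x. G t x - s k t x)"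
    by metis
  have "(\<lambda>k. expL_norm p (\<lambda>x. G t x - s k t x)) \<longlonglongrightarrow> 0" if t: "t \<in> I" for t
  proof (rule Lim_null_comparison)
    show "eventually (\<lambda>k. norm (expL_norm p (\<lambda>x. G t x - s k t x)) \<le> exp 1 * (1 / real (Suc k))) sequentially"
      using K(3)[OF t]
    proof eventually_elim
      case (elim k)
      then show ?case using Lb_expL(2,3)[OF s(2)[OF elim] _ p] by simp
    qed
    show "(\<lambda>k. exp 1 * (1 / real (Suc k))) \<longlonglongrightarrow> 0"
      by (intro tendsto_mult_right_zero LIMSEQ_Suc[OF lim_1_over_n])
  qed
  then have "AE t in lebesgue_on I. G t \<in> expL p \<and> (\<lambda>k. expL_norm p (\<lambda>x. G t x - s k t x)) \<longlonglongrightarrow> 0"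
    using GL by (intro AE_I2) (simp add: space_restrict_space)
  then show ?thesis unfolding expL_measurable_def using s(1) by blast
qed

text \<open>Connects the formal sum over values with integration in t at a fixed x, through the
  level sets, which have finite measure as the interval is bounded.\<close>

lemma expL_simple_integral_eq:
  fixes s :: "real \<Rightarrow> real ^ 'n \<Rightarrow> real"
  assumes s: "expL_simple p {a<..<b} s" and "(\<lambda>(t, x). s t x) \<in> borel_measurable (borel \<Otimes>\<^sub>M borel)"
  shows "expL_simple_integral {a<..<b} s x = (\<integral>t. indicator {a<..<b} t * s t x \<partial>lborel)"
proof -
  let ?I = "{a<..<b}"
  have fin: "finite (s ` ?I)" and sets: "\<And>v. {t \<in> ?I. s t = v} \<in> sets lebesgue" using s unfolding expL_simple_def by auto
  have lm: "{t \<in> ?I. s t = v} \<in> lmeasurable" for v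
    by (rule fmeasurableI2[OF _ _ sets, of ?I]) auto
  have eq: "indicator ?I t * s t x = (\<Sum>v\<in>s ` ?I. indicator {t \<in> ?I. s t = v} t * v x)" for t
  proof (cases "t \<in> ?I")
    case True
    have "(\<Sum>v\<in>s ` ?I. indicator {t \<in> ?I. s t = v} t * v x) = (\<Sum>v\<in>s ` ?I. if v = s t then v x else 0)"
      using True by (intro sum.cong refl) (auto simp: indicator_def)
    also have "\<dots> = s t x" using True fin by simp
    finally show ?thesis using True by simp
  next
    case False
    then have "indicator {t \<in> ?I. s t = v} t = (0 :: real)" for v by (intro indicator_simps(2)) blast
    then show ?thesis using False by simp
  qed
  have int: "integrable lebesgue (\<lambda>t. indicator {t \<in> ?I. s t = v} t * v x)" for v
  proof (intro integrable_mult_left integrable_real_indicator)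
    show "{t \<in> ?I. s t = v} \<in> sets lebesgue" by (rule fmeasurableD[OF lm])
    show "emeasure lebesgue {t \<in> ?I. s t = v} < \<infinity>" using lm[of v] unfolding fmeasurable_def by blast
  qed
  have "(\<integral>t. indicator ?I t * s t x \<partial>lborel) = (\<integral>t. indicator ?I t * s t x \<partial>lebesgue)"
  proof (rule integral_completion[symmetric])
    have "(\<lambda>t. s t x) \<in> borel_measurable borel"
      using measurable_compose[OF _ assms(2), of "\<lambda>t. (t, x)" borel] by simp
    then show "(\<lambda>t. indicator ?I t * s t x) \<in> borel_measurable lborel"
      by (intro borel_measurable_times borel_measurable_indicator) simp_all
  qed
  also have "\<dots> = (\<integral>t. (\<Sum>v\<in>s ` ?I. indicator {t \<in> ?I. s t = v} t * v x) \<partial>lebesgue)" by (intro Bochner_Integration.integral_cong refl eq)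
  also have "\<dots> = (\<Sum>v\<in>s ` ?I. \<integral>t. indicator {t \<in> ?I. s t = v} t * v x \<partial>lebesgue)"
    by (rule Bochner_Integration.integral_sum[OF int])
  also have "\<dots> = (\<Sum>v\<in>s ` ?I. measure lebesgue {t \<in> ?I. s t = v} * v x)"
  proof (intro sum.cong refl)
    fix v
    have "(\<integral>t. indicator {t \<in> ?I. s t = v} t * v x \<partial>lebesgue) = (\<integral>t. indicator {t \<in> ?I. s t = v} t \<partial>lebesgue) * v x"
      by (rule integral_mult_left_zero)
    also have "(\<integral>t. indicator {t \<in> ?I. s t = v} t \<partial>lebesgue) = measure lebesgue ({t \<in> ?I. s t = v} \<inter> space lebesgue)"
      by (rule Bochner_Integration.integral_indicator)
    also have "{t \<in> ?I. s t = v} \<inter> space lebesgue = {t \<in> ?I. s t = v}" by auto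
    finally show "(\<integral>t. indicator {t \<in> ?I. s t = v} t * v x \<partial>lebesgue) = measure lebesgue {t \<in> ?I. s t = v} * v x" .
  qed
  finally show ?thesis by (simp add: expL_simple_integral_def)
qed

text \<open>The error of a simple approximation obeys an \<open>Lb\<close> bound with a majorant N
  of small integral. The same N controls the integral of the norm of the error and, by
  \<open>Lb_minkowski\<close>, the difference of the integrals, so the pointwise and the Bochner
  integral agree.\<close>

lemma bochner_of_cont:
  fixes G :: "real \<Rightarrow> real ^ 'n \<Rightarrow> real"
  assumes t: "0 < t" and p: "1 < p" and del: "0 < \<delta>" "\<delta> < 1" and C: "0 < C"
    and Gm: "(\<lambda>(s, x). G s x) \<in> borel_measurable (borel \<Otimes>\<^sub>M borel)"
    and cont: "Lb_cont p {0<..<t} G"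
    and b: "\<And>s. 0 < s \<Longrightarrow> s < t \<Longrightarrow> Lb p (C * (t - s) powr (- \<delta>)) (C * (t - s) powr (- \<delta>)) (G s)"
    and ti: "\<And>a. a \<le> t \<Longrightarrow> (\<integral>\<^sup>+s. ennreal (indicator {a<..<t} s * (t - s) powr (- \<delta>)) \<partial>lborel) \<le> ennreal ((t - a) powr (1 - \<delta>) / (1 - \<delta>))"
    and w: "\<And>x. w x = (\<integral>s. indicator {0<..<t} s * G s x \<partial>lborel)"
    and Gi: "\<And>x. integrable lborel (\<lambda>s. indicator {0<..<t} s * G s x)"
    and wL: "w \<in> expL p"
  shows "has_expL_integral p 0 t G w"
proof -
  let ?I = "{0<..<t}"
  have G1: "G s \<in> borel_measurable borel" for s by (rule Lb_meas_joint[OF Gm])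
  have GE: "G s \<in> expL p" if "s \<in> ?I" for s
    using Lb_expL(1)[OF b _ p, of s] that C by auto
  have meas: "expL_measurable p ?I G"
  proof (rule expL_measurable_of_cont[where K="\<lambda>k. {t / (real k + 2) .. t - t / (real k + 2)}"])
    show "{t / (real k + 2)..t - t / (real k + 2)} \<subseteq> ?I" for k
    proof
      fix x assume x: "x \<in> {t / (real k + 2)..t - t / (real k + 2)}"
      have "0 < t / (real k + 2)" using t by simp
      with x show "x \<in> ?I" unfolding atLeastAtMost_iff greaterThanLessThan_iff by linarith
    qed
    fix s assume s: "s \<in> ?I"
    have l: "(\<lambda>k. t / (real k + 2)) \<longlonglongrightarrow> 0" by real_asymp
    have "eventually (\<lambda>k. t / (real k + 2) < min s (t - s)) sequentially"
      using order_tendstoD(2)[OF l, of "min s (t - s)"] s by auto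
    then show "eventually (\<lambda>k. s \<in> {t / (real k + 2)..t - t / (real k + 2)}) sequentially"
      by eventually_elim auto
  qed (use cont p GE G1 in auto)
  \<comment> \<open>Bounds the integrand near the left end, where t - s >= t/2.\<close>
  define D where "D = C * (t / 2) powr (- \<delta>)"
  have D: "0 < D" using C t by (simp add: D_def)
  have approx: "\<exists>s N. expL_simple p ?I s \<and> (\<lambda>(\<tau>, x). s \<tau> x) \<in> borel_measurable (borel \<Otimes>\<^sub>M borel) \<and> N \<in> borel_measurable borel \<and>
      (\<forall>\<tau>\<in>?I. 0 < N \<tau>) \<and> (\<forall>\<tau>\<in>?I. Lb p (N \<tau>) (N \<tau>) (\<lambda>x. G \<tau> x - s \<tau> x)) \<and>
      (\<integral>\<^sup>+\<tau>. ennreal (indicator ?I \<tau> * N \<tau>) \<partial>lborel) \<le> ennreal \<epsilon>" if e: "0 < \<epsilon>" for \<epsilon>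
  proof -
    have d1: "0 < 1 - \<delta>" "0 \<le> C / (1 - \<delta>)" "0 < \<epsilon> / 3" using del C e by auto
    obtain r1 where r1: "0 < r1" "r1 \<le> 1" "r1 powr (1 - \<delta>) * (C / (1 - \<delta>)) \<le> \<epsilon> / 3" by (rule powr_small_ex[OF d1])
    \<comment> \<open>The error is shared by three pieces: r D at the left end, C
      r^(1-\<delta>)/(1-\<delta>) at the singular end, and e1 t in the interior.\<close>
    define r where "r = min r1 (min (t / 3) (\<epsilon> / (3 * D)))"
    have r: "0 < r" "r \<le> r1" "r \<le> t / 3" "r * D \<le> \<epsilon> / 3"
    proof -
      show "0 < r" "r \<le> r1" "r \<le> t / 3" using r1 t e D by (auto simp: r_def)
      have "r * D \<le> \<epsilon> / (3 * D) * D" using D by (intro mult_right_mono) (auto simp: r_def)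
      then show "r * D \<le> \<epsilon> / 3" using D by simp
    qed
    define e1 where "e1 = \<epsilon> / (3 * t)"
    have e1: "0 < e1" "e1 * t = \<epsilon> / 3" using e t by (auto simp: e1_def)
    let ?K = "{r..t - r}"
    have KI: "?K \<subseteq> ?I" using r by auto
    obtain s where s: "expL_simple p ?I s" "\<And>\<tau>. \<tau> \<in> ?K \<Longrightarrow> Lb p e1 e1 (\<lambda>x. G \<tau> x - s \<tau> x)"
      "\<And>\<tau>. \<tau> \<notin> ?K \<Longrightarrow> s \<tau> = (\<lambda>_. 0)" "(\<lambda>(\<tau>, x). s \<tau> x) \<in> borel_measurable (borel \<Otimes>\<^sub>M borel)"
      by (rule simple_approx[OF _ compact_Icc KI cont p GE G1 e1(1)]) auto
    define N where "N \<tau> = (if \<tau> \<in> ?K then e1 else C * (t - \<tau>) powr (- \<delta>))" for \<tau>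
    have Nm [measurable]: "N \<in> borel_measurable borel" unfolding N_def by measurable
    have NL: "Lb p (N \<tau>) (N \<tau>) (\<lambda>x. G \<tau> x - s \<tau> x)" if "\<tau> \<in> ?I" for \<tau>
    proof (cases "\<tau> \<in> ?K")
      case True then show ?thesis using s(2)[OF True] by (simp add: N_def)
    next
      case False
      have Nt: "N \<tau> = C * (t - \<tau>) powr (- \<delta>)" unfolding N_def using False by (rule if_not_P)
      have "Lb p (C * (t - \<tau>) powr (- \<delta>)) (C * (t - \<tau>) powr (- \<delta>)) (G \<tau>)" using that by (intro b) auto
      then show ?thesis unfolding Nt s(3)[OF False] by simp
    qed
    have N0: "0 < N \<tau>" if "\<tau> \<in> ?I" for \<tau> using that e1 C by (auto simp: N_def)
    have "(\<integral>\<^sup>+\<tau>. ennreal (indicator ?I \<tau> * N \<tau>) \<partial>lborel)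
       \<le> (\<integral>\<^sup>+\<tau>. ennreal e1 * indicator ?I \<tau> + (ennreal D * indicator {0<..<r} \<tau> + ennreal C * ennreal (indicator {t - r<..<t} \<tau> * (t - \<tau>) powr (- \<delta>))) \<partial>lborel)"
    proof (rule nn_integral_mono)
      fix \<tau>
      show "ennreal (indicator ?I \<tau> * N \<tau>) \<le> ennreal e1 * indicator ?I \<tau> + (ennreal D * indicator {0<..<r} \<tau> + ennreal C * ennreal (indicator {t - r<..<t} \<tau> * (t - \<tau>) powr (- \<delta>)))"
      proof (cases "\<tau> \<in> ?I")
        case True
        consider "\<tau> \<in> ?K" | "\<tau> \<in> {0<..<r}" | "\<tau> \<in> {t - r<..<t}" using True by force
        then show ?thesis
        proof cases
          case 1 then show ?thesis using True by (simp add: N_def)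
        next
          case 2
          have "N \<tau> \<le> D"
            unfolding N_def D_def using 2 r t C del by (auto intro!: mult_left_mono powr_mono2')
          then have "ennreal (indicator ?I \<tau> * N \<tau>) \<le> ennreal D * indicator {0<..<r} \<tau>" using True 2 by (simp add: ennreal_leI)
          then show ?thesis by (simp add: add_increasing add_increasing2)
        next
          case 3
          then have "ennreal (indicator ?I \<tau> * N \<tau>) \<le> ennreal C * ennreal (indicator {t - r<..<t} \<tau> * (t - \<tau>) powr (- \<delta>))"
            using True C by (simp add: N_def flip: ennreal_mult)
          then show ?thesis by (simp add: add_increasing)
        qed
      qed simp
    qed
    also have "\<dots> = ennreal e1 * emeasure lborel ?I + (ennreal D * emeasure lborel {0<..<r} + ennreal C * (\<integral>\<^sup>+\<tau>. ennreal (indicator {t - r<..<t} \<tau> * (t - \<tau>) powr (- \<delta>)) \<partial>lborel))"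
      by (simp add: nn_integral_add nn_integral_cmult nn_integral_cmult_indicator)
    also have "\<dots> \<le> ennreal e1 * ennreal t + (ennreal D * ennreal r + ennreal C * ennreal ((t - (t - r)) powr (1 - \<delta>) / (1 - \<delta>)))"
      using t r by (intro add_mono mult_left_mono ti) auto
    also have "\<dots> = ennreal (e1 * t + (D * r + C * (r powr (1 - \<delta>) / (1 - \<delta>))))"
    proof -
      have nn: "0 \<le> e1" "0 \<le> t" "0 \<le> D" "0 \<le> r" "0 \<le> C" "0 \<le> r powr (1 - \<delta>) / (1 - \<delta>)" "t - (t - r) = r"
        using e1 t D r C d1 by auto
      then show ?thesis
        by (simp only: ennreal_mult[symmetric] ennreal_plus[symmetric] mult_nonneg_nonneg add_nonneg_nonneg)
    qed
    also have "\<dots> \<le> ennreal \<epsilon>"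
    proof (rule ennreal_leI)
      have "r powr (1 - \<delta>) * (C / (1 - \<delta>)) \<le> r1 powr (1 - \<delta>) * (C / (1 - \<delta>))" using r d1 by (intro mult_right_mono powr_mono2) auto
      then have "C * (r powr (1 - \<delta>) / (1 - \<delta>)) \<le> \<epsilon> / 3" using r1 by (simp add: mult.commute)
      then show "e1 * t + (D * r + C * (r powr (1 - \<delta>) / (1 - \<delta>))) \<le> \<epsilon>" using e1 r by (simp add: mult.commute)
    qed
    finally show ?thesis using s(1,4) Nm NL N0 by blast
  qed
  define \<epsilon> where "\<epsilon> k = 1 / real (Suc k)" for k
  have \<epsilon>: "0 < \<epsilon> k" for k by (simp add: \<epsilon>_def)
  have \<epsilon>0: "(\<lambda>k. exp 1 * \<epsilon> k) \<longlonglongrightarrow> 0" unfolding \<epsilon>_def by (intro tendsto_mult_right_zero LIMSEQ_Suc[OF lim_1_over_n])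
  define Q where "Q k s N \<longleftrightarrow> expL_simple p ?I s \<and> (\<lambda>(\<tau>, x). s \<tau> x) \<in> borel_measurable (borel \<Otimes>\<^sub>M borel) \<and> N \<in> borel_measurable borel \<and>
      (\<forall>\<tau>\<in>?I. 0 < N \<tau>) \<and> (\<forall>\<tau>\<in>?I. Lb p (N \<tau>) (N \<tau>) (\<lambda>x. G \<tau> x - s \<tau> x)) \<and>
      (\<integral>\<^sup>+\<tau>. ennreal (indicator ?I \<tau> * N \<tau>) \<partial>lborel) \<le> ennreal (\<epsilon> k)" for k s and N :: "real \<Rightarrow> real"
  have "\<exists>s N. Q k s N" for k unfolding Q_def by (rule approx[OF \<epsilon>])
  then obtain s N where QsN: "\<And>k. Q k (s k) (N k)" by metis
  have sN: "expL_simple p ?I (s k)" "(\<lambda>(\<tau>, x). s k \<tau> x) \<in> borel_measurable (borel \<Otimes>\<^sub>M borel)"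
    "N k \<in> borel_measurable borel" "\<tau> \<in> ?I \<Longrightarrow> 0 < N k \<tau>" "\<tau> \<in> ?I \<Longrightarrow> Lb p (N k \<tau>) (N k \<tau>) (\<lambda>x. G \<tau> x - s k \<tau> x)"
    "(\<integral>\<^sup>+\<tau>. ennreal (indicator ?I \<tau> * N k \<tau>) \<partial>lborel) \<le> ennreal (\<epsilon> k)" for k \<tau>
    using QsN[of k] unfolding Q_def by blast+
  have c1: "(\<integral>\<^sup>+\<tau>. ennreal (expL_norm p (\<lambda>x. G \<tau> x - s k \<tau> x)) \<partial>lebesgue_on ?I) \<le> ennreal (exp 1 * \<epsilon> k)" for k
  proof -
    note [measurable] = sN(3)
    have "(\<integral>\<^sup>+\<tau>. ennreal (expL_norm p (\<lambda>x. G \<tau> x - s k \<tau> x)) \<partial>lebesgue_on ?I)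
       = (\<integral>\<^sup>+\<tau>. ennreal (expL_norm p (\<lambda>x. G \<tau> x - s k \<tau> x)) * indicator ?I \<tau> \<partial>lborel)"
      by (subst nn_integral_restrict_space) (auto simp: nn_integral_completion)
    also have "\<dots> \<le> (\<integral>\<^sup>+\<tau>. ennreal (exp 1) * ennreal (indicator ?I \<tau> * N k \<tau>) \<partial>lborel)"
    proof (rule nn_integral_mono)
      fix \<tau>
      show "ennreal (expL_norm p (\<lambda>x. G \<tau> x - s k \<tau> x)) * indicator ?I \<tau> \<le> ennreal (exp 1) * ennreal (indicator ?I \<tau> * N k \<tau>)"
      proof (cases "\<tau> \<in> ?I")
        case True
        have "ennreal (expL_norm p (\<lambda>x. G \<tau> x - s k \<tau> x)) \<le> ennreal (exp 1 * N k \<tau>)"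
          by (rule ennreal_leI[OF Lb_expL(2)[OF sN(5)[OF True] sN(4)[OF True] p]])
        also have "\<dots> = ennreal (exp 1) * ennreal (N k \<tau>)" by (rule ennreal_mult') simp
        finally show ?thesis using True by simp
      qed simp
    qed
    also have "\<dots> = ennreal (exp 1) * (\<integral>\<^sup>+\<tau>. ennreal (indicator ?I \<tau> * N k \<tau>) \<partial>lborel)"
      using sN(3)[of k] by (intro nn_integral_cmult measurable_compose[OF _ measurable_ennreal] borel_measurable_times borel_measurable_indicator) simp_all
    also have "\<dots> \<le> ennreal (exp 1) * ennreal (\<epsilon> k)" by (intro mult_left_mono sN(6)) simp
    finally show ?thesis by (simp add: ennreal_mult')
  qed
  have lim1: "(\<lambda>k. \<integral>\<^sup>+\<tau>. ennreal (expL_norm p (\<lambda>x. G \<tau> x - s k \<tau> x)) \<partial>lebesgue_on ?I) \<longlonglongrightarrow> 0"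
  proof (rule tendsto_sandwich[OF _ _ tendsto_const])
    show "(\<lambda>k. ennreal (exp 1 * \<epsilon> k)) \<longlonglongrightarrow> 0" using tendsto_ennrealI[OF \<epsilon>0] by simp
  qed (auto intro: always_eventually c1)
  have c2: "Lb p (\<epsilon> k) (\<epsilon> k) (\<lambda>x. expL_simple_integral ?I (s k) x - w x)" for k
  proof -
    have hm: "(\<lambda>(\<tau>, x). G \<tau> x - s k \<tau> x) \<in> borel_measurable (borel \<Otimes>\<^sub>M borel)"
      using borel_measurable_diff[OF Gm sN(2)[of k]] by (simp add: case_prod_beta')
    have h1: "Lb p (N k \<tau> * 1) (N k \<tau> * 1) (\<lambda>x. G \<tau> x - s k \<tau> x)" if "\<tau> \<in> ?I" for \<tau> using sN(5)[OF that] by simp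
    note M = Lb_minkowski[OF p hm sN(3) _ sN(4) sN(6) \<epsilon> zero_le_one zero_le_one h1]
    have Ib: "?I \<in> sets borel" by simp
    have int_s: "integrable lborel (\<lambda>\<tau>. indicator ?I \<tau> * s k \<tau> x)" for x
    proof -
      have "integrable lborel (\<lambda>\<tau>. indicator ?I \<tau> * G \<tau> x - indicator ?I \<tau> * (G \<tau> x - s k \<tau> x))"
        by (rule Bochner_Integration.integrable_diff[OF Gi M(2)[OF Ib]])
      then show ?thesis by (simp add: algebra_simps)
    qed
    have eq: "(\<lambda>x. - (\<integral>\<tau>. indicator ?I \<tau> * (G \<tau> x - s k \<tau> x) \<partial>lborel)) = (\<lambda>x. expL_simple_integral ?I (s k) x - w x)"
    proof
      fix x
      have "(\<integral>\<tau>. indicator ?I \<tau> * (G \<tau> x - s k \<tau> x) \<partial>lborel) = (\<integral>\<tau>. indicator ?I \<tau> * G \<tau> x - indicator ?I \<tau> * s k \<tau> x \<partial>lborel)"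
        by (simp only: right_diff_distrib)
      also have "\<dots> = w x - expL_simple_integral ?I (s k) x"
        unfolding w expL_simple_integral_eq[OF sN(1,2)] by (rule Bochner_Integration.integral_diff[OF Gi int_s])
      finally show "- (\<integral>\<tau>. indicator ?I \<tau> * (G \<tau> x - s k \<tau> x) \<partial>lborel) = expL_simple_integral ?I (s k) x - w x" by simp
    qed
    show ?thesis using Lb_uminus[OF M(1)[OF Ib]] unfolding eq by simp
  qed
  have lim2: "(\<lambda>k. expL_norm p (\<lambda>x. expL_simple_integral ?I (s k) x - w x)) \<longlonglongrightarrow> 0"
  proof (rule Lim_null_comparison[OF always_eventually[OF allI] \<epsilon>0])
    show "norm (expL_norm p (\<lambda>x. expL_simple_integral ?I (s k) x - w x)) \<le> exp 1 * \<epsilon> k" for k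
      using Lb_expL(2,3)[OF c2 \<epsilon> p, of k] by simp
  qed
  show ?thesis unfolding has_expL_integral_def using meas wL sN(1) lim1 lim2 by blast
qed

section \<open>The weak-star limit\<close>

definition lnL :: "real \<Rightarrow> real \<Rightarrow> real" where
  "lnL p b = \<bar>b\<bar> * ln (2 + \<bar>b\<bar>) powr (1 / p)"

lemma lnL_borel [measurable]: "lnL p \<in> borel_measurable borel"
  unfolding lnL_def by measurable

lemma lnL_mono: "\<bar>a\<bar> \<le> \<bar>b\<bar> \<Longrightarrow> 0 < p \<Longrightarrow> lnL p a \<le> lnL p b"
  unfolding lnL_def by (intro mult_mono powr_mono2) auto

lemma lnL_cont: "0 < p \<Longrightarrow> (v \<longlongrightarrow> l) F \<Longrightarrow> ((\<lambda>x. lnL p (v x)) \<longlongrightarrow> lnL p l) F"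
  unfolding lnL_def by (intro tendsto_intros tendsto_powr') auto

lemma orlicz_pair:
  fixes v b :: "'a::euclidean_space \<Rightarrow> real"
  assumes [measurable]: "v \<in> borel_measurable borel" "b \<in> borel_measurable borel" and a: "0 < a" and p: "1 \<le> p" and k: "1 \<le> k"
    and v: "(\<integral>\<^sup>+x. ennreal (exp ((\<bar>v x\<bar> / a) powr p) - 1) \<partial>lborel) \<le> 1"
    and b: "(\<integral>\<^sup>+x. ennreal (lnL p (b x)) \<partial>lborel) \<le> ennreal e" and e: "0 \<le> e"
  shows "(\<integral>\<^sup>+x. ennreal \<bar>v x * b x\<bar> \<partial>lborel) \<le> ennreal (a * (2 / k + (2 * (1 + ln k / ln 2)) powr (1 / p) * e))"
proof -
  define C where "C = (2 * (1 + ln k / ln 2)) powr (1 / p)"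
  have C: "0 \<le> C" by (simp add: C_def)
  have "(\<integral>\<^sup>+x. ennreal \<bar>v x * b x\<bar> \<partial>lborel)
    \<le> (\<integral>\<^sup>+x. ennreal (a * (2 / k)) * ennreal (exp ((\<bar>v x\<bar> / a) powr p) - 1) + ennreal (a * C) * ennreal (lnL p (b x)) \<partial>lborel)"
  proof (rule nn_integral_mono)
    fix x
    have "\<bar>v x\<bar> / a * \<bar>b x\<bar> \<le> 2 / k * (exp ((\<bar>v x\<bar> / a) powr p) - 1) + C * lnL p (b x)"
      using young_orlicz[of "\<bar>v x\<bar> / a" "\<bar>b x\<bar>" p k] a p k by (simp add: C_def lnL_def)
    then have "a * (\<bar>v x\<bar> / a * \<bar>b x\<bar>) \<le> a * (2 / k * (exp ((\<bar>v x\<bar> / a) powr p) - 1) + C * lnL p (b x))"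
      using a by (intro mult_left_mono) auto
    moreover have "a * (\<bar>v x\<bar> / a * \<bar>b x\<bar>) = \<bar>v x * b x\<bar>" using a by (simp add: abs_mult)
    moreover have "a * (2 / k * (exp ((\<bar>v x\<bar> / a) powr p) - 1) + C * lnL p (b x)) = a * (2 / k) * (exp ((\<bar>v x\<bar> / a) powr p) - 1) + a * C * lnL p (b x)"
      by (simp only: distrib_left mult.assoc)
    ultimately have "ennreal \<bar>v x * b x\<bar> \<le> ennreal (a * (2 / k) * (exp ((\<bar>v x\<bar> / a) powr p) - 1) + a * C * lnL p (b x))" by (intro ennreal_leI) simp
    also have "\<dots> = ennreal (a * (2 / k)) * ennreal (exp ((\<bar>v x\<bar> / a) powr p) - 1) + ennreal (a * C) * ennreal (lnL p (b x))"
    proof -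
      have nn: "0 \<le> a * (2 / k)" "0 \<le> exp ((\<bar>v x\<bar> / a) powr p) - 1" "0 \<le> a * C" "0 \<le> lnL p (b x)" using a k C by (auto simp: lnL_def)
      then show ?thesis by (simp only: ennreal_mult[symmetric] ennreal_plus[symmetric] mult_nonneg_nonneg)
    qed
    finally show "ennreal \<bar>v x * b x\<bar> \<le> \<dots>" .
  qed
  also have "\<dots> = ennreal (a * (2 / k)) * (\<integral>\<^sup>+x. ennreal (exp ((\<bar>v x\<bar> / a) powr p) - 1) \<partial>lborel) + ennreal (a * C) * (\<integral>\<^sup>+x. ennreal (lnL p (b x)) \<partial>lborel)"
    by (subst nn_integral_add) (auto simp: nn_integral_cmult)
  also have "\<dots> \<le> ennreal (a * (2 / k)) * 1 + ennreal (a * C) * ennreal e"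
    by (intro add_mono mult_left_mono v b) auto
  also have "\<dots> = ennreal (a * (2 / k) + a * C * e)"
  proof -
    have nn: "0 \<le> a * (2 / k)" "0 \<le> a * C" using a k C by auto
    then show ?thesis using e by (simp only: mult_1_right ennreal_mult[symmetric] ennreal_plus[symmetric] mult_nonneg_nonneg)
  qed
  finally show ?thesis by (simp add: C_def distrib_left mult.assoc)
qed

text \<open>Truncation in value and space, then continuous functions converging almost everywhere
  and cut off to bounded support. The two errors are kept apart because \<open>lnL\<close> is not
  subadditive.\<close>

lemma lnL_approx:
  fixes \<phi> :: "'a::euclidean_space \<Rightarrow> real"
  assumes [measurable]: "\<phi> \<in> borel_measurable borel" and p: "0 < p"
    and fin: "(\<integral>\<^sup>+x. ennreal (lnL p (\<phi> x)) \<partial>lborel) < \<infinity>" and e: "0 < e"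
  obtains \<phi>' \<psi> M r where "\<phi>' \<in> borel_measurable borel" "continuous_on UNIV \<psi>" "\<And>x. \<bar>\<psi> x\<bar> \<le> M" "\<And>x. r < norm x \<Longrightarrow> \<psi> x = 0"
    "(\<integral>\<^sup>+x. ennreal (lnL p (\<phi> x - \<phi>' x)) \<partial>lborel) \<le> ennreal e" "(\<integral>\<^sup>+x. ennreal (lnL p (\<phi>' x - \<psi> x)) \<partial>lborel) \<le> ennreal e"
proof -
  define \<Phi> where "\<Phi> N x = (if \<bar>\<phi> x\<bar> \<le> real N \<and> norm x \<le> real N then \<phi> x else 0)" for N x
  have [measurable]: "\<Phi> N \<in> borel_measurable borel" for N unfolding \<Phi>_def by measurable
  have e': "0 < ennreal e" using e by simp
  have "(\<lambda>N. \<integral>\<^sup>+x. ennreal (lnL p (\<phi> x - \<Phi> N x)) \<partial>lborel) \<longlonglongrightarrow> (\<integral>\<^sup>+x. 0 \<partial>(lborel :: 'a measure))"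
  proof (rule nn_integral_dominated_convergence[where w="\<lambda>x. ennreal (lnL p (\<phi> x))"])
    show "AE x in lborel. ennreal (lnL p (\<phi> x - \<Phi> N x)) \<le> ennreal (lnL p (\<phi> x))" for N
      by (intro AE_I2 ennreal_leI lnL_mono p) (auto simp: \<Phi>_def)
    show "AE x in lborel. (\<lambda>N. ennreal (lnL p (\<phi> x - \<Phi> N x))) \<longlonglongrightarrow> 0"
    proof (rule AE_I2, rule tendsto_eventually)
      fix x
      show "eventually (\<lambda>N. ennreal (lnL p (\<phi> x - \<Phi> N x)) = 0) sequentially"
        using eventually_ge_at_top[of "nat \<lceil>max \<bar>\<phi> x\<bar> (norm x)\<rceil>"]
      proof eventually_elim
        case (elim N)
        then have "max \<bar>\<phi> x\<bar> (norm x) \<le> real N" by linarith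
        then show ?case by (simp add: \<Phi>_def lnL_def)
      qed
    qed
  qed (use fin in simp_all)
  then have "eventually (\<lambda>N. (\<integral>\<^sup>+x. ennreal (lnL p (\<phi> x - \<Phi> N x)) \<partial>lborel) < ennreal e) sequentially"
    using order_tendstoD(2)[OF _ e'] by simp
  then obtain N where N: "(\<integral>\<^sup>+x. ennreal (lnL p (\<phi> x - \<Phi> N x)) \<partial>lborel) < ennreal e" by (auto simp: eventually_sequentially)
  have "\<Phi> N measurable_on UNIV"
    by (rule lebesgue_measurable_imp_measurable_on_real) (simp_all add: borel_lebesgue)
  then obtain Z g where Z: "negligible Z" "\<And>n. continuous_on UNIV (g n)" "\<And>x. x \<notin> Z \<Longrightarrow> (\<lambda>n. g n x) \<longlonglongrightarrow> \<Phi> N x"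
    unfolding measurable_on_def by auto
  \<comment> \<open>Values are clipped to [-N, N] and the spatial cutoff is 1 on the ball of radius
    N, so neither changes the limit \<open>\<Phi> N\<close>.\<close>
  define \<psi> where "\<psi> n x = max (- real N) (min (real N) (g n x)) * max 0 (min 1 (real N + 1 - norm x))" for n x
  have \<psi>c: "continuous_on UNIV (\<psi> n)" for n
    unfolding \<psi>_def by (intro continuous_intros Z)
  then have [measurable]: "\<psi> n \<in> borel_measurable borel" for n by (rule borel_measurable_continuous_onI)
  have \<psi>b: "\<bar>\<psi> n x\<bar> \<le> real N" for n x
  proof -
    have "\<bar>max (- real N) (min (real N) (g n x))\<bar> * \<bar>max 0 (min 1 (real N + 1 - norm x))\<bar> \<le> real N * 1"
      by (intro mult_mono) auto
    then show ?thesis by (simp add: \<psi>_def abs_mult)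
  qed
  have \<psi>0: "\<psi> n x = 0" if "real N + 1 < norm x" for n x using that by (simp add: \<psi>_def)
  have \<Phi>b: "\<bar>\<Phi> N x\<bar> \<le> real N" "real N < norm x \<Longrightarrow> \<Phi> N x = 0" for x by (auto simp: \<Phi>_def)
  have "(\<lambda>n. \<integral>\<^sup>+x. ennreal (lnL p (\<Phi> N x - \<psi> n x)) \<partial>lebesgue) \<longlonglongrightarrow> (\<integral>\<^sup>+x. 0 \<partial>(lebesgue :: 'a measure))"
  proof (rule nn_integral_dominated_convergence[where w="\<lambda>x. ennreal (lnL p (2 * real N)) * indicator (cball 0 (real N + 1)) x"])
    show "(\<lambda>x. ennreal (lnL p (\<Phi> N x - \<psi> n x))) \<in> borel_measurable lebesgue" for n
      by (rule measurable_completion) simp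
    show "(\<lambda>x. ennreal (lnL p (2 * real N)) * indicator (cball 0 (real N + 1)) x) \<in> borel_measurable lebesgue"
      by (rule measurable_completion) (intro borel_measurable_times_ennreal borel_measurable_const borel_measurable_indicator, simp)
    show "AE x in lebesgue. ennreal (lnL p (\<Phi> N x - \<psi> n x)) \<le> ennreal (lnL p (2 * real N)) * indicator (cball 0 (real N + 1)) x" for n
    proof (rule AE_I2)
      fix x :: 'a
      show "ennreal (lnL p (\<Phi> N x - \<psi> n x)) \<le> ennreal (lnL p (2 * real N)) * indicator (cball 0 (real N + 1)) x"
      proof (cases "norm x \<le> real N + 1")
        case True
        have "\<bar>\<Phi> N x - \<psi> n x\<bar> \<le> \<bar>2 * real N\<bar>" using \<psi>b[of n x] \<Phi>b(1)[of x] by linarith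
        then have "lnL p (\<Phi> N x - \<psi> n x) \<le> lnL p (2 * real N)" using p by (rule lnL_mono)
        moreover have "x \<in> cball 0 (real N + 1)" using True by simp
        ultimately show ?thesis by (simp only: indicator_simps mult_1_right ennreal_leI)
      next
        case False
        then show ?thesis using \<psi>0[of x n] \<Phi>b(2)[of x] by (simp add: lnL_def)
      qed
    qed
    show "(\<integral>\<^sup>+x. ennreal (lnL p (2 * real N)) * indicator (cball 0 (real N + 1)) x \<partial>(lebesgue :: 'a measure)) < \<infinity>"
      unfolding nn_integral_completion
      using emeasure_compact_finite[OF compact_cball, of "0::'a" "real N + 1"]
      by (subst nn_integral_cmult_indicator) (auto simp: ennreal_mult_less_top)
    show "AE x in lebesgue. (\<lambda>n. ennreal (lnL p (\<Phi> N x - \<psi> n x))) \<longlonglongrightarrow> 0"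
    proof (rule AE_I'[of Z])
      show "Z \<in> null_sets lebesgue" using Z(1) by (simp add: negligible_iff_null_sets)
      show "{x \<in> space lebesgue. \<not> (\<lambda>n. ennreal (lnL p (\<Phi> N x - \<psi> n x))) \<longlonglongrightarrow> 0} \<subseteq> Z"
      proof (rule subsetI, rule ccontr)
        fix x assume x: "x \<in> {x \<in> space lebesgue. \<not> (\<lambda>n. ennreal (lnL p (\<Phi> N x - \<psi> n x))) \<longlonglongrightarrow> 0}" "x \<notin> Z"
        have "(\<lambda>n. \<psi> n x) \<longlonglongrightarrow> max (- real N) (min (real N) (\<Phi> N x)) * max 0 (min 1 (real N + 1 - norm x))"
          unfolding \<psi>_def by (intro tendsto_intros Z x)
        moreover have "max (- real N) (min (real N) (\<Phi> N x)) * max 0 (min 1 (real N + 1 - norm x)) = \<Phi> N x"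
          using \<Phi>b[of x] by (cases "norm x \<le> real N") (auto simp: max_def min_def)
        ultimately have "(\<lambda>n. \<psi> n x) \<longlonglongrightarrow> \<Phi> N x" by simp
        then have "(\<lambda>n. lnL p (\<Phi> N x - \<psi> n x)) \<longlonglongrightarrow> lnL p (\<Phi> N x - \<Phi> N x)" by (intro lnL_cont p tendsto_diff tendsto_const)
        then have "(\<lambda>n. ennreal (lnL p (\<Phi> N x - \<psi> n x))) \<longlonglongrightarrow> ennreal 0" by (intro tendsto_ennrealI) (simp add: lnL_def)
        with x show False by simp
      qed
    qed
  qed simp
  then have "eventually (\<lambda>n. (\<integral>\<^sup>+x. ennreal (lnL p (\<Phi> N x - \<psi> n x)) \<partial>lborel) < ennreal e) sequentially"
    using order_tendstoD(2)[OF _ e'] by (simp add: nn_integral_completion)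
  then obtain n where n: "(\<integral>\<^sup>+x. ennreal (lnL p (\<Phi> N x - \<psi> n x)) \<partial>lborel) < ennreal e" by (auto simp: eventually_sequentially)
  show ?thesis
    by (rule that[of "\<Phi> N" "\<psi> n" "real N" "real N + 1"]) (use \<psi>c \<psi>b \<psi>0 N n in \<open>auto intro: less_imp_le\<close>)
qed

context smoothing
begin

text \<open>By Fubini and translation the pairing is the integral of S(t) against the correlation
  \<Psi>(z) of u0 and \<psi>, a bounded function continuous at 0. The approximate identity evaluates
  it at 0.\<close>

lemma heat_pairing_continuous:
  assumes [measurable]: "u0 \<in> borel_measurable borel" and u0: "(\<integral>\<^sup>+x. ennreal (\<bar>u0 x\<bar> powr p) \<partial>lborel) < \<infinity>"
    and \<psi>: "continuous_on UNIV \<psi>" "\<And>x. \<bar>\<psi> x\<bar> \<le> M" "\<And>x. r < norm x \<Longrightarrow> \<psi> x = 0"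
  shows "((\<lambda>t. (\<integral>x. heat t u0 x * \<psi> x \<partial>lborel) - (\<integral>x. u0 x * \<psi> x \<partial>lborel)) \<longlongrightarrow> 0) (at_right 0)"
proof -
  have [measurable]: "\<psi> \<in> borel_measurable borel" by (rule borel_measurable_continuous_onI[OF \<psi>(1)])
  have M: "0 \<le> M" using \<psi>(2)[of 0] by linarith
  define Y where "Y s x = (1 + \<bar>u0 x\<bar> powr p) * indicator (cball 0 s) x" for s x
  have Yi: "integrable lborel (Y s)" for s
  proof -
    have [measurable]: "(\<lambda>x. indicator (cball 0 s) x :: real) \<in> borel_measurable (borel :: 'a measure)" by (rule borel_measurable_indicator) simp
    have "(\<integral>\<^sup>+x. ennreal (norm (Y s x)) \<partial>lborel) \<le> (\<integral>\<^sup>+x. indicator (cball 0 s) x + ennreal (\<bar>u0 x\<bar> powr p) \<partial>lborel)"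
      by (intro nn_integral_mono) (auto simp: Y_def indicator_def ennreal_plus)
    also have "\<dots> = emeasure lborel (cball (0::'a) s) + (\<integral>\<^sup>+x. ennreal (\<bar>u0 x\<bar> powr p) \<partial>lborel)"
      by (subst nn_integral_add) (auto intro!: borel_measurable_indicator)
    also have "\<dots> < \<infinity>" using u0 emeasure_compact_finite[OF compact_cball, of "0::'a" s] by simp
    finally show ?thesis unfolding Y_def by (simp add: integrable_iff_bounded)
  qed
  have u0Y: "\<bar>u0 y * \<psi> (y + z)\<bar> \<le> M * Y (r + 1) y" if z: "norm z \<le> 1" for y z
  proof (cases "norm y \<le> r + 1")
    case True
    have "\<bar>u0 y\<bar> * \<bar>\<psi> (y + z)\<bar> \<le> (1 + \<bar>u0 y\<bar> powr p) * M"
      using p M by (intro mult_mono \<psi>(2) le_one_plus_powr) auto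
    then show ?thesis using True by (simp add: Y_def abs_mult mult.commute)
  next
    case False
    have "norm y \<le> norm (y + z) + norm z" using norm_triangle_ineq4[of "y + z" z] by simp
    then have "\<psi> (y + z) = 0" using False z by (intro \<psi>(3)) linarith
    then show ?thesis using M by (simp add: Y_def)
  qed
  define \<Psi> where "\<Psi> z = (\<integral>y. u0 y * \<psi> (y + z) \<partial>lborel)" for z
  define B where "B = M * (measure lborel (cball (0::'a) r) + enn2real (\<integral>\<^sup>+x. ennreal (\<bar>u0 x\<bar> powr p) \<partial>lborel))"
  have B0: "0 \<le> B" using M by (simp add: B_def)
  have Bb: "(\<integral>\<^sup>+y. ennreal \<bar>u0 y * \<psi> (y + z)\<bar> \<partial>lborel) \<le> ennreal B" for z
  proof -
    have "(\<integral>\<^sup>+y. ennreal \<bar>u0 y * \<psi> (y + z)\<bar> \<partial>lborel) \<le> (\<integral>\<^sup>+y. ennreal M * (indicator (cball 0 r) (y + z) + ennreal (\<bar>u0 y\<bar> powr p)) \<partial>lborel)"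
    proof (rule nn_integral_mono)
      fix y
      show "ennreal \<bar>u0 y * \<psi> (y + z)\<bar> \<le> ennreal M * (indicator (cball 0 r) (y + z) + ennreal (\<bar>u0 y\<bar> powr p))"
      proof (cases "norm (y + z) \<le> r")
        case True
        have "\<bar>u0 y\<bar> * \<bar>\<psi> (y + z)\<bar> \<le> (1 + \<bar>u0 y\<bar> powr p) * M"
          using p M by (intro mult_mono \<psi>(2) le_one_plus_powr) auto
        then have "ennreal \<bar>u0 y * \<psi> (y + z)\<bar> \<le> ennreal (M * (1 + \<bar>u0 y\<bar> powr p))" by (intro ennreal_leI) (simp add: abs_mult mult.commute)
        also have "\<dots> = ennreal M * (1 + ennreal (\<bar>u0 y\<bar> powr p))" using M by (simp add: ennreal_mult ennreal_plus)
        finally show ?thesis using True by simp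
      qed (use \<psi>(3)[of "y + z"] in simp)
    qed
    also have "\<dots> = ennreal M * ((\<integral>\<^sup>+y. indicator (cball 0 r) (y + z) \<partial>lborel) + (\<integral>\<^sup>+y. ennreal (\<bar>u0 y\<bar> powr p) \<partial>lborel))"
    proof -
      have [measurable]: "(\<lambda>y. indicator (cball 0 r) (y + z) :: ennreal) \<in> borel_measurable borel"
        by (rule measurable_compose[where N=borel]) (auto intro!: borel_measurable_indicator)
      show ?thesis by (simp add: nn_integral_cmult nn_integral_add)
    qed
    also have "(\<integral>\<^sup>+y. indicator (cball 0 r) (y + z) \<partial>lborel) = emeasure lborel (cball (0::'a) r)"
      by (subst nn_integral_lborel_shift[of "indicator (cball 0 r)"]) (auto intro!: borel_measurable_indicator)
    also have "ennreal M * (emeasure lborel (cball (0::'a) r) + (\<integral>\<^sup>+y. ennreal (\<bar>u0 y\<bar> powr p) \<partial>lborel)) = ennreal B"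
      using u0 M emeasure_compact_finite[OF compact_cball, of "0::'a" r]
      by (simp add: B_def ennreal_mult ennreal_plus emeasure_eq_ennreal_measure less_top[symmetric] ennreal_enn2real)
    finally show ?thesis .
  qed
  have \<Psi>m: "\<Psi> \<in> borel_measurable borel" unfolding \<Psi>_def by measurable
  have \<Psi>b: "\<bar>\<Psi> z\<bar> \<le> B" for z
    using order_trans[OF ennreal_abs_integral_le Bb, of z] B0 unfolding \<Psi>_def by (subst (asm) ennreal_le_iff) auto
  have \<Psi>c: "isCont \<Psi> 0"
    unfolding isCont_def tendsto_at_iff_sequentially comp_def
  proof (intro allI impI)
    fix X :: "nat \<Rightarrow> 'a" assume X: "X \<longlonglongrightarrow> 0"
    \<comment> \<open>Only finitely many terms change. Now all shifts have norm at most 1, and one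
      dominating function supported in the ball of radius r + 1 serves every n.\<close>
    define X' where "X' n = (if norm (X n) \<le> 1 then X n else 0)" for n
    have ev: "eventually (\<lambda>n. X' n = X n) sequentially"
    proof -
      have "(\<lambda>n. norm (X n)) \<longlonglongrightarrow> 0" using X by (rule tendsto_norm_zero)
      then have "eventually (\<lambda>n. norm (X n) < 1) sequentially" by (rule order_tendstoD) simp
      then show ?thesis by eventually_elim (simp add: X'_def)
    qed
    then have X': "X' \<longlonglongrightarrow> 0" using X by (subst tendsto_cong)
    have "(\<lambda>n. \<Psi> (X' n)) \<longlonglongrightarrow> \<Psi> 0"
      unfolding \<Psi>_def
    proof (rule integral_dominated_convergence[where w="\<lambda>y. M * Y (r + 1) y"])
      show "AE y in lborel. (\<lambda>n. u0 y * \<psi> (y + X' n)) \<longlonglongrightarrow> u0 y * \<psi> (y + 0)"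
      proof (rule AE_I2)
        fix y
        have "isCont \<psi> (y + 0)" using \<psi>(1) by (simp add: continuous_on_eq_continuous_at)
        then show "(\<lambda>n. u0 y * \<psi> (y + X' n)) \<longlonglongrightarrow> u0 y * \<psi> (y + 0)"
          by (intro tendsto_mult tendsto_const isCont_tendsto_compose[of _ \<psi>] tendsto_add X')
      qed
      show "AE y in lborel. norm (u0 y * \<psi> (y + X' n)) \<le> M * Y (r + 1) y" for n
        by (intro AE_I2) (use u0Y[of "X' n"] in \<open>simp add: X'_def\<close>)
    qed (auto intro!: integrable_mult_right Yi)
    moreover have "eventually (\<lambda>n. \<Psi> (X' n) = \<Psi> (X n)) sequentially" using ev by eventually_elim simp
    ultimately show "(\<lambda>n. \<Psi> (X n)) \<longlonglongrightarrow> \<Psi> 0" by (subst (asm) tendsto_cong)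
  qed
  have eq: "(\<integral>x. heat t u0 x * \<psi> x \<partial>lborel) = (\<integral>z. S t z * \<Psi> z \<partial>lborel)" if t: "0 < t" for t
  proof -
    let ?F = "\<lambda>y x. S t (x - y) * u0 y * \<psi> x"
    let ?H = "\<lambda>y z. S t z * (u0 y * \<psi> (y + z))"
    have H: "integrable (lborel \<Otimes>\<^sub>M lborel) (\<lambda>(y, z). ?H y z)"
    proof -
      have "(\<integral>\<^sup>+w. ennreal (norm (case w of (y, z) \<Rightarrow> ?H y z)) \<partial>(lborel \<Otimes>\<^sub>M lborel)) = (\<integral>\<^sup>+y. (\<integral>\<^sup>+z. ennreal \<bar>?H y z\<bar> \<partial>lborel) \<partial>lborel)"
        by (subst lborel.nn_integral_fst[symmetric]) (auto simp: case_prod_beta')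
      also have "\<dots> = (\<integral>\<^sup>+z. (\<integral>\<^sup>+y. ennreal \<bar>?H y z\<bar> \<partial>lborel) \<partial>lborel)"
        by (rule lborel_pair.Fubini'[symmetric]) measurable
      also have "\<dots> \<le> (\<integral>\<^sup>+z. ennreal (S t z) * ennreal B \<partial>lborel)"
      proof (rule nn_integral_mono)
        fix z
        have "(\<integral>\<^sup>+y. ennreal \<bar>?H y z\<bar> \<partial>lborel) = (\<integral>\<^sup>+y. ennreal (S t z) * ennreal \<bar>u0 y * \<psi> (y + z)\<bar> \<partial>lborel)"
          using S_nonneg by (intro nn_integral_cong) (simp add: abs_mult ennreal_mult)
        also have "\<dots> = ennreal (S t z) * (\<integral>\<^sup>+y. ennreal \<bar>u0 y * \<psi> (y + z)\<bar> \<partial>lborel)" by (rule nn_integral_cmult) measurable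
        also have "\<dots> \<le> ennreal (S t z) * ennreal B" by (intro mult_left_mono Bb) simp
        finally show "(\<integral>\<^sup>+y. ennreal \<bar>?H y z\<bar> \<partial>lborel) \<le> ennreal (S t z) * ennreal B" .
      qed
      also have "\<dots> = ennreal B" using S_mass[OF t] by (subst nn_integral_multc) auto
      also have "\<dots> < \<infinity>" by simp
      finally show ?thesis by (simp add: integrable_iff_bounded case_prod_beta')
    qed
    have F: "integrable (lborel \<Otimes>\<^sub>M lborel) (\<lambda>(y, x). ?F y x)"
    proof -
      have "(\<integral>\<^sup>+w. ennreal (norm (case w of (y, x) \<Rightarrow> ?F y x)) \<partial>(lborel \<Otimes>\<^sub>M lborel)) = (\<integral>\<^sup>+y. (\<integral>\<^sup>+x. ennreal \<bar>?F y x\<bar> \<partial>lborel) \<partial>lborel)"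
        by (subst lborel.nn_integral_fst[symmetric]) (auto simp: case_prod_beta')
      also have "\<dots> = (\<integral>\<^sup>+y. (\<integral>\<^sup>+z. ennreal \<bar>?H y z\<bar> \<partial>lborel) \<partial>lborel)"
      proof (rule nn_integral_cong)
        fix y
        show "(\<integral>\<^sup>+x. ennreal \<bar>?F y x\<bar> \<partial>lborel) = (\<integral>\<^sup>+z. ennreal \<bar>?H y z\<bar> \<partial>lborel)"
          by (subst nn_integral_lborel_shift[symmetric, where x=y]) (auto simp: mult.assoc add.commute)
      qed
      also have "\<dots> = (\<integral>\<^sup>+w. ennreal (norm (case w of (y, z) \<Rightarrow> ?H y z)) \<partial>(lborel \<Otimes>\<^sub>M lborel))"
        by (subst lborel.nn_integral_fst[symmetric]) (auto simp: case_prod_beta')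
      also have "\<dots> < \<infinity>" using H unfolding integrable_iff_bounded by blast
      finally show ?thesis by (simp add: integrable_iff_bounded case_prod_beta')
    qed
    have "(\<integral>x. heat t u0 x * \<psi> x \<partial>lborel) = (\<integral>x. (\<integral>y. ?F y x \<partial>lborel) \<partial>lborel)"
      unfolding heat_def by (intro Bochner_Integration.integral_cong refl integral_mult_left_zero[symmetric])
    also have "\<dots> = (\<integral>y. (\<integral>x. ?F y x \<partial>lborel) \<partial>lborel)" by (rule lborel_pair.Fubini_integral[OF F])
    also have "\<dots> = (\<integral>y. (\<integral>z. ?H y z \<partial>lborel) \<partial>lborel)"
    proof (rule Bochner_Integration.integral_cong[OF refl])
      fix y
      have "(\<integral>x. ?F y x \<partial>lborel) = \<bar>1\<bar> ^ DIM('a) * (\<integral>z. ?F y (y + 1 *\<^sub>R z) \<partial>lborel)"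
        by (rule integral_lborel_affine) simp_all
      then show "(\<integral>x. ?F y x \<partial>lborel) = (\<integral>z. ?H y z \<partial>lborel)" by (simp add: mult.assoc)
    qed
    also have "\<dots> = (\<integral>z. (\<integral>y. ?H y z \<partial>lborel) \<partial>lborel)" by (rule lborel_pair.Fubini_integral[OF H, symmetric])
    also have "\<dots> = (\<integral>z. S t z * \<Psi> z \<partial>lborel)"
      unfolding \<Psi>_def by (intro Bochner_Integration.integral_cong refl integral_mult_right_zero)
    finally show ?thesis .
  qed
  have "((\<lambda>t. (\<integral>z. S t z * \<Psi> z \<partial>lborel) - \<Psi> 0) \<longlongrightarrow> \<Psi> 0 - \<Psi> 0) (at_right 0)"
    by (intro tendsto_diff tendsto_const S_approx[OF \<Psi>m \<Psi>b \<Psi>c])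
  moreover have "\<Psi> 0 = (\<integral>x. u0 x * \<psi> x \<partial>lborel)" by (simp add: \<Psi>_def)
  moreover have "eventually (\<lambda>t. (\<integral>z. S t z * \<Psi> z \<partial>lborel) - \<Psi> 0 = (\<integral>x. heat t u0 x * \<psi> x \<partial>lborel) - \<Psi> 0) (at_right 0)"
    unfolding eventually_at_filter by (intro always_eventually) (simp add: eq)
  ultimately show ?thesis by (subst (asm) tendsto_cong) simp_all
qed

end

lemma orlicz_pair_integral:
  fixes v b :: "'a::euclidean_space \<Rightarrow> real"
  assumes [measurable]: "v \<in> borel_measurable borel" "b \<in> borel_measurable borel" and a: "0 < a" and p: "1 \<le> p" and k: "1 \<le> k"
    and v: "(\<integral>\<^sup>+x. ennreal (exp ((\<bar>v x\<bar> / a) powr p) - 1) \<partial>lborel) \<le> 1"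
    and b: "(\<integral>\<^sup>+x. ennreal (lnL p (b x)) \<partial>lborel) \<le> ennreal e" and e: "0 \<le> e"
  shows "integrable lborel (\<lambda>x. v x * b x)"
    and "\<bar>\<integral>x. v x * b x \<partial>lborel\<bar> \<le> a * (2 / k + (2 * (1 + ln k / ln 2)) powr (1 / p) * e)"
proof -
  note P = orlicz_pair[OF assms]
  show "integrable lborel (\<lambda>x. v x * b x)"
    using le_less_trans[OF P] by (simp add: integrable_iff_bounded)
  have "0 \<le> a * (2 / k + (2 * (1 + ln k / ln 2)) powr (1 / p) * e)" using a k e by simp
  then show "\<bar>\<integral>x. v x * b x \<partial>lborel\<bar> \<le> a * (2 / k + (2 * (1 + ln k / ln 2)) powr (1 / p) * e)"
    using order_trans[OF ennreal_abs_integral_le P] by (subst (asm) ennreal_le_iff) auto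
qed

text \<open>The logarithmic factor is bounded below by the positive constant ln 2 raised to
  1/p.\<close>

lemma lnL_L1:
  fixes \<phi> :: "'a::euclidean_space \<Rightarrow> real"
  assumes [measurable]: "\<phi> \<in> borel_measurable borel" and p: "0 < p"
    and fin: "(\<integral>\<^sup>+x. ennreal (lnL p (\<phi> x)) \<partial>lborel) < \<infinity>"
  shows "integrable lborel \<phi>"
proof -
  define C where "C = ln 2 powr (1 / p)"
  have C: "0 < C" by (simp add: C_def)
  have "(\<integral>\<^sup>+x. ennreal (norm (\<phi> x)) \<partial>lborel) \<le> (\<integral>\<^sup>+x. ennreal (1 / C) * ennreal (lnL p (\<phi> x)) \<partial>lborel)"
  proof (rule nn_integral_mono)
    fix x
    have "C \<le> ln (2 + \<bar>\<phi> x\<bar>) powr (1 / p)" unfolding C_def using p by (intro powr_mono2) auto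
    then have "\<bar>\<phi> x\<bar> * C \<le> lnL p (\<phi> x)" unfolding lnL_def by (intro mult_left_mono) auto
    then have "\<bar>\<phi> x\<bar> \<le> 1 / C * lnL p (\<phi> x)" using C by (simp add: field_simps)
    then have "ennreal \<bar>\<phi> x\<bar> \<le> ennreal (1 / C * lnL p (\<phi> x))" by (rule ennreal_leI)
    then show "ennreal (norm (\<phi> x)) \<le> ennreal (1 / C) * ennreal (lnL p (\<phi> x))" using C by (simp flip: ennreal_mult add: lnL_def)
  qed
  also have "\<dots> = ennreal (1 / C) * (\<integral>\<^sup>+x. ennreal (lnL p (\<phi> x)) \<partial>lborel)" by (rule nn_integral_cmult) measurable
  also have "\<dots> < \<infinity>" using fin by (simp add: ennreal_mult_less_top)
  finally show ?thesis by (simp add: integrable_iff_bounded)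
qed

context smoothing
begin

lemma heat_borel: "g \<in> borel_measurable borel \<Longrightarrow> heat t g \<in> borel_measurable borel"
proof -
  assume [measurable]: "g \<in> borel_measurable borel"
  show ?thesis unfolding heat_def[abs_def] by measurable
qed

text \<open>Continuous functions of bounded support are not dense in exp L^p, so the approximation
  is made on the predual side. Its error is uniform in t because the flow keeps the modular bound at
  level a.\<close>

lemma heat_weak_star:
  assumes u0 [measurable]: "u0 \<in> borel_measurable borel" and a: "0 < a"
    and mod: "(\<integral>\<^sup>+x. ennreal (exp ((\<bar>u0 x\<bar> / a) powr p) - 1) \<partial>lborel) \<le> 1"
    and Lp: "(\<integral>\<^sup>+x. ennreal (\<bar>u0 x\<bar> powr p) \<partial>lborel) < \<infinity>"
    and \<phi> [measurable]: "\<phi> \<in> borel_measurable borel" and fin: "(\<integral>\<^sup>+x. ennreal (lnL p (\<phi> x)) \<partial>lborel) < \<infinity>"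
  shows "0 < t \<Longrightarrow> integrable lborel (\<lambda>x. heat t u0 x * \<phi> x)" and "integrable lborel (\<lambda>x. u0 x * \<phi> x)"
    and "((\<lambda>t. (\<integral>x. heat t u0 x * \<phi> x \<partial>lborel) - (\<integral>x. u0 x * \<phi> x \<partial>lborel)) \<longlongrightarrow> 0) (at_right 0)"
proof -
  have p1: "1 \<le> p" "0 < p" using p by auto
  obtain X where X: "(\<integral>\<^sup>+x. ennreal (lnL p (\<phi> x)) \<partial>lborel) = ennreal X" "0 \<le> X"
    using fin by (cases "\<integral>\<^sup>+x. ennreal (lnL p (\<phi> x)) \<partial>lborel") auto
  have I: "integrable lborel (\<lambda>x. v x * \<phi> x)"
    if "v \<in> borel_measurable borel" "(\<integral>\<^sup>+x. ennreal (exp ((\<bar>v x\<bar> / a) powr p) - 1) \<partial>lborel) \<le> 1" for v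
    by (rule orlicz_pair_integral(1)[OF that(1) \<phi> a p1(1) order_refl that(2) eq_refl[OF X(1)] X(2)])
  show "0 < t \<Longrightarrow> integrable lborel (\<lambda>x. heat t u0 x * \<phi> x)" by (rule I[OF heat_borel[OF u0] heat_modular[OF u0 a mod]])
  show "integrable lborel (\<lambda>x. u0 x * \<phi> x)" by (rule I[OF u0 mod])
  show "((\<lambda>t. (\<integral>x. heat t u0 x * \<phi> x \<partial>lborel) - (\<integral>x. u0 x * \<phi> x \<partial>lborel)) \<longlongrightarrow> 0) (at_right 0)"
  proof (rule tendstoI)
    fix e :: real assume e: "0 < e"
    \<comment> \<open>First k makes the modular term small; the constant C depends on k, so the
      approximation error e' is fixed only afterwards.\<close>
    define k where "k = max 1 (32 * a / e)"
    have k: "1 \<le> k" "a * (2 / k) \<le> e / 16"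
    proof -
      show k1: "1 \<le> k" by (simp add: k_def)
      have "32 * a / e \<le> k" by (simp add: k_def)
      then show "a * (2 / k) \<le> e / 16" using e k1 by (simp add: field_simps)
    qed
    define C where "C = (2 * (1 + ln k / ln 2)) powr (1 / p)"
    have C: "0 \<le> C" by (simp add: C_def)
    define e' where "e' = e / (16 * a * (C + 1))"
    have e': "0 < e'" "a * (C * e') \<le> e / 16"
    proof -
      show e1: "0 < e'" using e a C by (simp add: e'_def)
      have "a * (C * e') \<le> a * ((C + 1) * e')" using a C e1 by (intro mult_left_mono mult_right_mono) auto
      also have "\<dots> = e / 16" using a C by (simp add: e'_def)
      finally show "a * (C * e') \<le> e / 16" .
    qed
    obtain \<phi>' \<psi> M r where \<phi>' [measurable]: "\<phi>' \<in> borel_measurable borel" and \<psi>: "continuous_on UNIV \<psi>" "\<And>x. \<bar>\<psi> x\<bar> \<le> M" "\<And>x. r < norm x \<Longrightarrow> \<psi> x = 0"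
      and ap: "(\<integral>\<^sup>+x. ennreal (lnL p (\<phi> x - \<phi>' x)) \<partial>lborel) \<le> ennreal e'" "(\<integral>\<^sup>+x. ennreal (lnL p (\<phi>' x - \<psi> x)) \<partial>lborel) \<le> ennreal e'"
      by (rule lnL_approx[OF \<phi> p1(2) fin e'(1)]) (rule that)
    have [measurable]: "\<psi> \<in> borel_measurable borel" by (rule borel_measurable_continuous_onI[OF \<psi>(1)])
    have close: "\<bar>(\<integral>x. v x * \<phi> x \<partial>lborel) - (\<integral>x. v x * \<psi> x \<partial>lborel)\<bar> \<le> e / 4"
      if v: "v \<in> borel_measurable borel" "(\<integral>\<^sup>+x. ennreal (exp ((\<bar>v x\<bar> / a) powr p) - 1) \<partial>lborel) \<le> 1" for v
    proof -
      have d: "(\<lambda>x. \<phi> x - \<phi>' x) \<in> borel_measurable borel" "(\<lambda>x. \<phi>' x - \<psi> x) \<in> borel_measurable borel" by measurable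
      note A = orlicz_pair_integral[OF v(1) d(1) a p1(1) k(1) v(2) ap(1) less_imp_le[OF e'(1)]]
      note B = orlicz_pair_integral[OF v(1) d(2) a p1(1) k(1) v(2) ap(2) less_imp_le[OF e'(1)]]
      have le: "a * (2 / k + (2 * (1 + ln k / ln 2)) powr (1 / p) * e') \<le> e / 8"
        using k(2) e'(2) unfolding C_def[symmetric] distrib_left[of a] by linarith
      have "(\<integral>x. v x * \<psi> x \<partial>lborel) = (\<integral>x. v x * \<phi> x - v x * (\<phi> x - \<phi>' x) - v x * (\<phi>' x - \<psi> x) \<partial>lborel)"
        by (rule Bochner_Integration.integral_cong) (simp_all add: algebra_simps)
      also have "\<dots> = (\<integral>x. v x * \<phi> x \<partial>lborel) - (\<integral>x. v x * (\<phi> x - \<phi>' x) \<partial>lborel) - (\<integral>x. v x * (\<phi>' x - \<psi> x) \<partial>lborel)"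
        using I[OF v] A(1) B(1) by (simp only: Bochner_Integration.integral_diff Bochner_Integration.integrable_diff)
      finally show ?thesis using A(2) B(2) le by linarith
    qed
    have "eventually (\<lambda>t. dist ((\<integral>x. heat t u0 x * \<psi> x \<partial>lborel) - (\<integral>x. u0 x * \<psi> x \<partial>lborel)) 0 < e / 2) (at_right 0)"
      by (rule tendstoD[OF heat_pairing_continuous[OF u0 Lp \<psi>]]) (use e in simp_all)
    moreover have "eventually (\<lambda>t::real. 0 < t) (at_right 0)" by (rule eventually_at_right_less)
    ultimately show "eventually (\<lambda>t. dist ((\<integral>x. heat t u0 x * \<phi> x \<partial>lborel) - (\<integral>x. u0 x * \<phi> x \<partial>lborel)) 0 < e) (at_right 0)"
    proof eventually_elim
      case (elim t)
      from elim(1) close[OF u0 mod] close[OF heat_borel[OF u0] heat_modular[OF u0 a mod elim(2)]] show ?case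
        unfolding dist_real_def by linarith
    qed
  qed
qed

end

section \<open>Decay in L^q\<close>

text \<open>For z <= 1 the power is at most z, hence at most exp z - 1. For z > 1 the exponential
  dominates, and exp z >= 2 absorbs the subtracted 1.\<close>

lemma powr_le_exp_minus_one:
  fixes z r :: real
  assumes z: "0 \<le> z" and r: "1 \<le> r"
  shows "z powr r \<le> 2 * (4 * r) powr r * (exp z - 1)"
proof -
  have e: "z \<le> exp z - 1" using exp_ge_add_one_self[of z] by linarith
  have K: "1 \<le> (4 * r) powr r" using r by (intro ge_one_powr_ge_zero) auto
  show ?thesis
  proof (cases "z \<le> 1")
    case True
    have "z powr r \<le> z" using powr_mono'[of 1 r z] True z r by simp
    then have "z powr r \<le> 1 * (exp z - 1)" using e by simp
    also have "\<dots> \<le> 2 * (4 * r) powr r * (exp z - 1)" using z K e by (intro mult_right_mono) auto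
    finally show ?thesis .
  next
    case False
    have "z powr r \<le> (4 * r) powr r * exp (z / 4)" using z r by (intro powr_le_exp) auto
    also have "\<dots> \<le> (4 * r) powr r * (2 * (exp z - 1))"
    proof (intro mult_left_mono)
      have "exp (z / 4) \<le> exp z" using z by simp
      moreover have "2 \<le> exp z" using e False by linarith
      moreover have "x \<le> 2 * (y - 1)" if "x \<le> y" "2 \<le> y" for x y :: real
        using that by (simp add: algebra_simps)
      ultimately show "exp (z / 4) \<le> 2 * (exp z - 1)" by blast
    qed simp
    finally show ?thesis by (simp only: mult_ac)
  qed
qed

context nonlinear_heat
begin

text \<open>For t >= 1, |u|^q <= B^(q-p) |u|^p, and \<alpha>(q-p) >= \<alpha> q - \<nu> because
  \<alpha> p <= \<nu>. For t < 1 the modular bounds the integral by a constant, while the negative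
  power of t is at least 1.\<close>

lemma adm_Lq:
  assumes b: "0 < b" and q: "\<nu> / \<alpha> < q" and t: "0 < t" and u: "adm b t u"
  shows "(\<integral>\<^sup>+x. ennreal (\<bar>u x\<bar> powr q) \<partial>lborel)
    \<le> ennreal (2 * (4 * (q / p)) powr (q / p) * b powr q * t powr (- (\<alpha> * q - \<nu>)))"
proof -
  have [measurable]: "u \<in> borel_measurable borel" using u by (simp add: adm_def)
  have pa: "p * \<alpha> \<le> \<nu>" using al(2) p by (simp add: field_simps)
  have "p \<le> \<nu> / \<alpha>" using pa al(1) by (simp add: field_simps)
  then have pq: "p < q" using q by linarith
  have aq: "0 < \<alpha> * q - \<nu>" using q al(1) by (simp add: field_simps)
  define K where "K = 2 * (4 * (q / p)) powr (q / p)"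
  have qp: "1 \<le> q / p" using pq p by simp
  have K: "1 \<le> K"
  proof -
    have "1 \<le> (4 * (q / p)) powr (q / p)" using qp by (intro ge_one_powr_ge_zero) linarith+
    then show ?thesis by (simp add: K_def)
  qed
  show ?thesis
  proof (cases "1 \<le> t")
    case True
    define B where "B = b * (1 + t) powr (- \<alpha>)"
    have B: "0 < B" using b True by (simp add: B_def)
    have uB: "\<bar>u x\<bar> \<le> B" for x using u True by (simp add: adm_def B_def)
    have "(\<integral>\<^sup>+x. ennreal (\<bar>u x\<bar> powr q) \<partial>lborel) \<le> (\<integral>\<^sup>+x. ennreal (B powr (q - p)) * ennreal (\<bar>u x\<bar> powr p) \<partial>lborel)"
    proof (rule nn_integral_mono)
      fix x
      have "\<bar>u x\<bar> powr q = \<bar>u x\<bar> powr (q - p) * \<bar>u x\<bar> powr p" by (simp flip: powr_add)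
      also have "\<dots> \<le> B powr (q - p) * \<bar>u x\<bar> powr p" using uB pq by (intro mult_right_mono powr_mono2) auto
      finally show "ennreal (\<bar>u x\<bar> powr q) \<le> ennreal (B powr (q - p)) * ennreal (\<bar>u x\<bar> powr p)"
        by (simp add: ennreal_leI flip: ennreal_mult)
    qed
    also have "\<dots> = ennreal (B powr (q - p)) * (\<integral>\<^sup>+x. ennreal (\<bar>u x\<bar> powr p) \<partial>lborel)" by (rule nn_integral_cmult) measurable
    also have "\<dots> \<le> ennreal (B powr (q - p)) * ennreal (b powr p)" by (intro mult_left_mono adm_Lp[OF u b]) simp
    also have "\<dots> = ennreal (B powr (q - p) * b powr p)" by (simp add: ennreal_mult)
    also have "\<dots> \<le> ennreal (K * b powr q * t powr (- (\<alpha> * q - \<nu>)))"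
    proof (rule ennreal_leI)
      have "B powr (q - p) = b powr (q - p) * (1 + t) powr (- \<alpha> * (q - p))" using b t by (simp add: B_def powr_mult powr_powr)
      moreover have "b powr (q - p) * b powr p = b powr q" by (simp flip: powr_add)
      ultimately have "B powr (q - p) * b powr p = b powr q * (1 + t) powr (- \<alpha> * (q - p))" by (simp add: mult_ac)
      also have "\<dots> \<le> b powr q * t powr (- (\<alpha> * q - \<nu>))"
      proof (rule mult_left_mono)
        have "(1 + t) powr (- \<alpha> * (q - p)) \<le> t powr (- \<alpha> * (q - p))"
          using t al(1) pq by (intro powr_mono2') auto
        also have "t powr (- \<alpha> * (q - p)) \<le> t powr (- (\<alpha> * q - \<nu>))"
          using True pa by (intro powr_mono) (auto simp: algebra_simps)
        finally show "(1 + t) powr (- \<alpha> * (q - p)) \<le> t powr (- (\<alpha> * q - \<nu>))" .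
      qed simp
      also have "b powr q * t powr (- (\<alpha> * q - \<nu>)) \<le> K * (b powr q * t powr (- (\<alpha> * q - \<nu>)))"
        using mult_right_mono[OF K, of "b powr q * t powr (- (\<alpha> * q - \<nu>))"] by simp
      finally show "B powr (q - p) * b powr p \<le> K * b powr q * t powr (- (\<alpha> * q - \<nu>))" by (simp add: mult.assoc)
    qed
    finally show ?thesis by (simp add: K_def)
  next
    case False
    have "(\<integral>\<^sup>+x. ennreal (\<bar>u x\<bar> powr q) \<partial>lborel) \<le> (\<integral>\<^sup>+x. ennreal (K * b powr q) * ennreal (exp ((\<bar>u x\<bar> / b) powr p) - 1) \<partial>lborel)"
    proof (rule nn_integral_mono)
      fix x
      have "\<bar>u x\<bar> powr q = b powr q * (\<bar>u x\<bar> / b) powr q" using b by (simp add: powr_divide)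
      also have "(\<bar>u x\<bar> / b) powr q = ((\<bar>u x\<bar> / b) powr p) powr (q / p)" using p by (simp add: powr_powr)
      also have "\<dots> \<le> K * (exp ((\<bar>u x\<bar> / b) powr p) - 1)" unfolding K_def by (rule powr_le_exp_minus_one[OF _ qp]) simp
      finally have "\<bar>u x\<bar> powr q \<le> K * b powr q * (exp ((\<bar>u x\<bar> / b) powr p) - 1)" using b by (simp add: mult_ac)
      then have "ennreal (\<bar>u x\<bar> powr q) \<le> ennreal (K * b powr q * (exp ((\<bar>u x\<bar> / b) powr p) - 1))" by (rule ennreal_leI)
      then show "ennreal (\<bar>u x\<bar> powr q) \<le> ennreal (K * b powr q) * ennreal (exp ((\<bar>u x\<bar> / b) powr p) - 1)"
        using K by (simp flip: ennreal_mult)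
    qed
    also have "\<dots> = ennreal (K * b powr q) * (\<integral>\<^sup>+x. ennreal (exp ((\<bar>u x\<bar> / b) powr p) - 1) \<partial>lborel)" by (rule nn_integral_cmult) measurable
    also have "\<dots> \<le> ennreal (K * b powr q) * 1" using u by (intro mult_left_mono) (auto simp: adm_def)
    also have "\<dots> \<le> ennreal (K * b powr q * t powr (- (\<alpha> * q - \<nu>)))"
    proof -
      have "1 \<le> t powr (- (\<alpha> * q - \<nu>))"
        using powr_mono2'[of "- (\<alpha> * q - \<nu>)" t 1] False t aq by simp
      then have "K * b powr q * 1 \<le> K * b powr q * t powr (- (\<alpha> * q - \<nu>))" using K by (intro mult_left_mono) auto
      then show ?thesis by (simp add: ennreal_leI)
    qed
    finally show ?thesis by (simp add: K_def)
  qed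
qed

end

lemma Lq_norm_le:
  fixes v :: "real ^ 'n \<Rightarrow> real"
  assumes v [measurable]: "v \<in> borel_measurable borel" and q: "0 < q" and X: "0 \<le> X"
    and le: "(\<integral>\<^sup>+x. ennreal (\<bar>v x\<bar> powr q) \<partial>lborel) \<le> ennreal X"
  shows "v \<in> Lq_space q" and "Lq_norm q v \<le> X powr (1 / q)"
proof -
  have m: "(\<lambda>x. \<bar>v x\<bar> powr q) \<in> borel_measurable lborel" by measurable
  have i: "integrable lborel (\<lambda>x. \<bar>v x\<bar> powr q)"
    using le_less_trans[OF le] by (simp add: integrable_iff_bounded)
  then show "v \<in> Lq_space q" unfolding Lq_space_def using borel_lebesgue[OF v] by (simp add: integrable_completion[OF m])
  have "ennreal (\<integral>x. \<bar>v x\<bar> powr q \<partial>lborel) = (\<integral>\<^sup>+x. ennreal (\<bar>v x\<bar> powr q) \<partial>lborel)"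
    by (rule nn_integral_eq_integral[OF i, symmetric]) simp
  then have "(\<integral>x. \<bar>v x\<bar> powr q \<partial>lborel) \<le> X" using le ennreal_le_iff[OF X] by metis
  then show "Lq_norm q v \<le> X powr (1 / q)"
    unfolding Lq_norm_def integral_completion[OF m] using q by (intro powr_mono2) auto
qed

section \<open>Borel representatives and the Luxemburg norm\<close>

lemma L1_loc_measurable:
  fixes u :: "real ^ 'n \<Rightarrow> real"
  assumes "u \<in> L1_loc"
  shows "u \<in> borel_measurable lebesgue"
proof (rule borel_measurable_LIMSEQ_real)
  show "(\<lambda>x. indicator (cball 0 (real i)) x *\<^sub>R u x) \<in> borel_measurable lebesgue" for i
  proof -
    have "u absolutely_integrable_on cball 0 (real i)" using assms by (simp add: L1_loc_def)
    then show ?thesis unfolding set_integrable_def by (rule borel_measurable_integrable)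
  qed
  fix x
  show "(\<lambda>i. indicator (cball 0 (real i)) x *\<^sub>R u x) \<longlonglongrightarrow> u x"
  proof (rule tendsto_eventually)
    show "eventually (\<lambda>i. indicator (cball 0 (real i)) x *\<^sub>R u x = u x) sequentially"
      using eventually_ge_at_top[of "nat \<lceil>norm x\<rceil>"]
    proof eventually_elim
      case (elim i)
      then have "norm x \<le> real i" by linarith
      then show ?case by simp
    qed
  qed
qed

lemma L1_loc_borel_version:
  fixes u :: "real ^ 'n \<Rightarrow> real"
  assumes "u \<in> L1_loc"
  obtains v where "v \<in> borel_measurable borel" "AE x in lebesgue. u x = v x"
  using completion_ex_borel_measurable_real[OF L1_loc_measurable[OF assms]]
  by (auto simp: AE_completion_iff)

text \<open>An admissible level is produced first, so that the infimum is over a nonempty set;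
  strictness then gives an admissible level below a, and monotonicity carries the bound to a.
  Whether the infimum is attained does not enter.\<close>

lemma exp_modular_le_one:
  fixes u :: "real ^ 'n \<Rightarrow> real"
  assumes u: "u \<in> expL p" and p: "0 < p" and a: "expL_norm p u < a"
  shows "exp_modular p a u \<le> 1"
proof -
  have [measurable]: "u \<in> borel_measurable lebesgue" using u by (intro L1_loc_measurable) (simp add: expL_def)
  obtain l where l: "0 < l" "exp_modular p l u < \<infinity>" using u by (auto simp: expL_def)
  obtain X where X: "exp_modular p l u = ennreal X" "0 \<le> X" using l(2) by (cases "exp_modular p l u") auto
  define N where "N = Suc (nat \<lceil>X\<rceil>)"
  have N: "X \<le> real N" "0 < real N" "0 < N" unfolding N_def by linarith+
  have "exp_modular p (l * real N powr (1 / p)) u \<le> 1"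
  proof -
    have "exp_modular p (l * real N powr (1 / p)) u \<le> (\<integral>\<^sup>+x. ennreal (1 / real N) * ennreal (exp (\<bar>u x\<bar> powr p / l powr p) - 1) \<partial>lebesgue)"
      unfolding exp_modular_def
    proof (rule nn_integral_mono)
      fix x
      define z where "z = \<bar>u x\<bar> powr p / l powr p"
      have z: "0 \<le> z" by (simp add: z_def)
      have "\<bar>u x\<bar> powr p / (l * real N powr (1 / p)) powr p = z / real N"
        using l N p by (simp add: z_def powr_mult powr_powr)
      \<comment> \<open>Bernoulli's inequality for the N-th power of exp(z/N): enlarging the level
        by N^(1/p) divides the modular by at least N.\<close>
      moreover have "exp (z / real N) - 1 \<le> 1 / real N * (exp z - 1)"
      proof -
        have "1 + real N * (exp (z / real N) - 1) \<le> (1 + (exp (z / real N) - 1)) ^ N"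
          using z by (intro Bernoulli_inequality) simp
        also have "\<dots> = exp z" using N by (simp flip: exp_of_nat_mult)
        finally show ?thesis using N by (simp add: field_simps)
      qed
      ultimately have "ennreal (exp (\<bar>u x\<bar> powr p / (l * real N powr (1 / p)) powr p) - 1) \<le> ennreal (1 / real N * (exp z - 1))"
        by (simp only: ennreal_leI)
      then show "ennreal (exp (\<bar>u x\<bar> powr p / (l * real N powr (1 / p)) powr p) - 1) \<le> ennreal (1 / real N) * ennreal (exp (\<bar>u x\<bar> powr p / l powr p) - 1)"
        unfolding z_def using N by (simp flip: ennreal_mult)
    qed
    also have "\<dots> = ennreal (1 / real N) * ennreal X" using X(1) unfolding exp_modular_def by (subst nn_integral_cmult) auto
    also have "\<dots> = ennreal (1 / real N * X)" using N X by (intro ennreal_mult[symmetric]) auto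
    also have "\<dots> \<le> 1" using N by (simp add: ennreal_le_1)
    finally show ?thesis .
  qed
  then have "{l. 0 < l \<and> exp_modular p l u \<le> 1} \<noteq> {}" using l N by (auto intro!: exI[of _ "l * real N powr (1 / p)"])
  then obtain k where k: "0 < k" "exp_modular p k u \<le> 1" "k < a"
    using cInf_lessD[of "{l. 0 < l \<and> exp_modular p l u \<le> 1}" a] a unfolding expL_norm_def by auto
  have "exp_modular p a u \<le> exp_modular p k u"
    unfolding exp_modular_def using k p
    by (intro nn_integral_mono ennreal_leI diff_right_mono) (auto intro!: divide_left_mono powr_mono2)
  then show ?thesis using k(2) by simp
qed

text \<open>For transferring from \<open>heat\<close> to \<open>frac_heat\<close>, which agree only
  at positive elapsed times; all clauses look at the integrand inside the open interval
  only.\<close>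

lemma has_expL_integral_cong:
  assumes eq: "\<And>s. a < s \<Longrightarrow> s < b \<Longrightarrow> g s = h s" and g: "has_expL_integral p a b g w"
  shows "has_expL_integral p a b h w"
proof -
  have A: "(AE t in lebesgue_on {a<..<b}. P (g t) t) \<longleftrightarrow> (AE t in lebesgue_on {a<..<b}. P (h t) t)" for P
    by (rule AE_cong) (simp add: space_restrict_space eq)
  have N: "(\<integral>\<^sup>+t. F (g t) t \<partial>lebesgue_on {a<..<b}) = (\<integral>\<^sup>+t. F (h t) t \<partial>lebesgue_on {a<..<b})" for F
    by (rule nn_integral_cong) (simp add: space_restrict_space eq)
  have M: "expL_measurable p {a<..<b} h"
    using g unfolding has_expL_integral_def expL_measurable_def
    by (subst (asm) A[of "\<lambda>v t. v \<in> expL p \<and> (\<lambda>k. expL_norm p (\<lambda>x. v x - _ k t x)) \<longlonglongrightarrow> 0"]) blast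
  show ?thesis using g M unfolding has_expL_integral_def
    by (subst (asm) N[of "\<lambda>v t. ennreal (expL_norm p (\<lambda>x. v x - _ _ t x))"]) blast
qed

section \<open>The solution\<close>

locale fractional_nonlinear_heat = nonlinear_heat S c \<nu> p R \<alpha> m C0 lam f
  for S :: "real \<Rightarrow> real ^ 'n \<Rightarrow> real" and c \<nu> p R \<alpha> m C0 lam f +
  fixes \<beta> :: real
  assumes S_eq: "\<And>t x. 0 < t \<Longrightarrow> S t x = frac_heat_kernel \<beta> t x"
begin

text \<open>Data are Lebesgue measurable while the fixed point lives on Borel functions. A Borel
  version has the same convolution at every x, not just almost everywhere.\<close>

lemma frac_heat_eq:
  assumes t: "0 < t" and g: "g \<in> borel_measurable lebesgue" and h [measurable]: "h \<in> borel_measurable borel"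
    and ae: "AE x in lebesgue. g x = h x"
  shows "frac_heat \<beta> t g = heat t h"
proof
  fix x
  have m: "(\<lambda>y. S t (x - y) * h y) \<in> borel_measurable lborel" by measurable
  have k: "(\<lambda>y. S t (x - y)) \<in> borel_measurable lebesgue" by (rule borel_lebesgue) measurable
  have "frac_heat \<beta> t g x = (\<integral>y. S t (x - y) * g y \<partial>lebesgue)" by (simp add: frac_heat_def S_eq[OF t])
  also have "\<dots> = (\<integral>y. S t (x - y) * h y \<partial>lebesgue)"
  proof (rule integral_cong_AE)
    show "(\<lambda>y. S t (x - y) * g y) \<in> borel_measurable lebesgue" by (rule borel_measurable_times[OF k g])
    show "(\<lambda>y. S t (x - y) * h y) \<in> borel_measurable lebesgue" by (rule borel_measurable_times[OF k borel_lebesgue[OF h]])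
    show "AE y in lebesgue. S t (x - y) * g y = S t (x - y) * h y" using ae by eventually_elim simp
  qed
  also have "\<dots> = heat t h x" unfolding heat_def by (rule integral_completion[OF m])
  finally show "frac_heat \<beta> t g x = heat t h x" .
qed

lemma frac_heat_borel_eq: "0 < t \<Longrightarrow> h \<in> borel_measurable borel \<Longrightarrow> frac_heat \<beta> t h = heat t h"
  by (rule frac_heat_eq) (simp_all add: borel_lebesgue)

context
  fixes u0 :: "real ^ 'n \<Rightarrow> real" and a :: real and w :: "real \<Rightarrow> real ^ 'n \<Rightarrow> real" and v :: "real ^ 'n \<Rightarrow> real"
  assumes u0: "u0 \<in> L1_loc" and v: "v \<in> borel_measurable borel" and uv: "AE x in lebesgue. u0 x = v x" and sm: "small a"
    and mod: "(\<integral>\<^sup>+x. ennreal (exp ((\<bar>v x\<bar> / a) powr p) - 1) \<partial>lborel) \<le> 1"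
    and wX: "ballX a w" and wfix: "\<And>t x. 0 < t \<Longrightarrow> w t x = duhamel (src v w) t x"
begin

lemmas ctx = v sm mod wX wfix

lemma wL: "0 < t \<Longrightarrow> Lb p (a * (1 + t) powr (- \<alpha>)) a (w t)" using wX by (simp add: ballX_def)

lemma w_borel: "0 < t \<Longrightarrow> w t \<in> borel_measurable borel" by (rule LbD(1)[OF wL])

lemma w_expL: "0 < t \<Longrightarrow> w t \<in> expL p"
proof -
  assume t: "0 < t"
  have "0 < KB a / (1 - \<delta>) * t powr (1 - \<delta>)" using KB_pos[OF ctx] del t by simp
  from Lb_expL(1)[OF w_short_time[OF ctx t] this p] show ?thesis .
qed

lemma frac_u0: "0 < t \<Longrightarrow> frac_heat \<beta> t u0 = heat t v"
  by (rule frac_heat_eq[OF _ L1_loc_measurable[OF u0] v uv])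

lemma u_borel: "0 < t \<Longrightarrow> (\<lambda>x. heat t v x + w t x) \<in> borel_measurable borel"
  using u_adm[OF ctx] by (simp add: adm_def)

lemma u_expL:
  assumes "0 < t"
  shows "(\<lambda>x. heat t v x + w t x) \<in> expL p" and "expL_norm p (\<lambda>x. heat t v x + w t x) \<le> K0 * a"
proof -
  have m: "(\<integral>\<^sup>+x. ennreal (exp ((\<bar>heat t v x + w t x\<bar> / (K0 * a)) powr p) - 1) \<partial>lborel) \<le> 1"
    using u_adm[OF ctx assms] by (simp add: adm_def)
  show "(\<lambda>x. heat t v x + w t x) \<in> expL p" "expL_norm p (\<lambda>x. heat t v x + w t x) \<le> K0 * a"
    by (rule expL_I[OF u_borel[OF assms] small_consequences(2)[OF sm] p m])+
qed

lemma u_Linf: "(\<lambda>t x. heat t v x + w t x) \<in> Linf_expL p {0<..}"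
  unfolding Linf_expL_def
proof (intro CollectI conjI ballI)
  fix t :: real assume "t \<in> {0<..}"
  then show "(\<lambda>x. heat t v x + w t x) \<in> expL p" by (intro u_expL(1)) simp
next
  show "expL_measurable p {0<..} (\<lambda>t x. heat t v x + w t x)"
  proof (rule expL_measurable_of_cont[where K="\<lambda>k. {1 / (real k + 1) .. real k + 1}"])
    show "{1 / (real k + 1)..real k + 1} \<subseteq> {0<..}" for k
    proof
      fix x assume "x \<in> {1 / (real k + 1)..real k + 1}"
      moreover have "0 < 1 / (real k + 1)" by simp
      ultimately show "x \<in> {0<..}" unfolding atLeastAtMost_iff greaterThan_iff by linarith
    qed
    fix s :: real assume s: "s \<in> {0<..}"
    have "(\<lambda>k. 1 / (real k + 1)) \<longlonglongrightarrow> 0" by real_asymp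
    then have "eventually (\<lambda>k. 1 / (real k + 1) < s) sequentially" using order_tendstoD(2) s by simp
    moreover have "eventually (\<lambda>k. s \<le> real k) sequentially"
      using eventually_ge_at_top[of "nat \<lceil>s\<rceil>"] by eventually_elim linarith
    ultimately show "eventually (\<lambda>k. s \<in> {1 / (real k + 1)..real k + 1}) sequentially" by eventually_elim auto
  qed (use u_cont[OF ctx] p u_expL(1) u_borel in auto)
  show "\<exists>M. AE t in lebesgue_on {0<..}. expL_norm p (\<lambda>x. heat t v x + w t x) \<le> M"
    by (rule exI[of _ "K0 * a"], rule AE_I2) (simp add: space_restrict_space u_expL(2))
qed

lemma source_borel: "0 < s \<Longrightarrow> (\<lambda>x. f (heat s v x + w s x)) \<in> borel_measurable borel"
  using measurable_compose[OF u_borel f_borel] .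

lemma source_convolvable:
  assumes "0 < s" "s < t"
  shows "convolvable (frac_heat_kernel \<beta> (t - s)) (\<lambda>x. f (heat s v x + w s x))"
  unfolding convolvable_def
proof (rule AE_I2)
  fix x :: "real ^ 'n"
  have [measurable]: "(\<lambda>x. f (heat s v x + w s x)) \<in> borel_measurable borel" by (rule source_borel[OF assms(1)])
  have m: "(\<lambda>y. S (t - s) (x - y) * f (heat s v y + w s y)) \<in> borel_measurable lborel" by measurable
  have "integrable lborel (\<lambda>y. S (t - s) (x - y) * f (heat s v y + w s y))"
    using integrand_bound(2)[OF ctx assms] by (simp add: src_def)
  then show "integrable lebesgue (\<lambda>y. frac_heat_kernel \<beta> (t - s) (x - y) * f (heat s v y + w s y))"
    using integrable_completion[OF m] assms S_eq[of "t - s"] by simp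
qed

lemma source_integral:
  assumes t: "0 < t"
  shows "has_expL_integral p 0 t (\<lambda>s. frac_heat \<beta> (t - s) (\<lambda>x. f (heat s v x + w s x))) (w t)"
proof (rule has_expL_integral_cong)
  show "heat (t - s) (src v w s) = frac_heat \<beta> (t - s) (\<lambda>x. f (heat s v x + w s x))" if "0 < s" "s < t" for s
    using frac_heat_borel_eq[of "t - s" "src v w s"] source_borel[of s] that by (simp add: src_def[abs_def])
  show "has_expL_integral p 0 t (\<lambda>s. heat (t - s) (src v w s)) (w t)"
  proof (rule bochner_of_cont[OF t p del KB_pos[OF ctx] heat_measurable[OF src_meas[OF ctx]] integrand_cont[OF ctx]])
    show "w t x = (\<integral>s. indicator {0<..<t} s * heat (t - s) (src v w s) x \<partial>lborel)" for x
      using wfix[OF t] by (simp add: duhamel_def)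
    show "integrable lborel (\<lambda>s. indicator {0<..<t} s * heat (t - s) (src v w s) x)" for x
      by (rule duhamel_src(2)[OF v sm mod wX t])
  qed (use integrand_bound(1)[OF ctx] pk_integral w_expL[OF t] in auto)
qed

text \<open>The size of the correction for short times, in both norms; the norm limit and the
  weak-star limit are read off from it.\<close>

definition E :: "real \<Rightarrow> real" where "E t = KB a / (1 - \<delta>) * t powr (1 - \<delta>)"

lemma E_tendsto: "(E \<longlongrightarrow> 0) (at_right 0)"
proof -
  have d: "0 < 1 - \<delta>" using del by simp
  have "((\<lambda>t. t powr (1 - \<delta>)) \<longlongrightarrow> 0) (at_right 0)" using d by real_asymp
  then show ?thesis unfolding E_def[abs_def] by (rule tendsto_mult_right_zero)
qed

lemma w_E: "0 < t \<Longrightarrow> Lb p (E t) (E t) (w t)" and E_pos: "0 < t \<Longrightarrow> 0 < E t"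
  using w_short_time[OF ctx] KB_pos[OF ctx] del by (simp_all add: E_def)

text \<open>Subtracting the flow leaves exactly \<open>w t\<close>, at every point.\<close>

lemma w_norm_tendsto: "((\<lambda>t. expL_norm p (\<lambda>x. heat t v x + w t x - frac_heat \<beta> t u0 x)) \<longlongrightarrow> 0) (at_right 0)"
proof (rule Lim_null_comparison)
  show "eventually (\<lambda>t. norm (expL_norm p (\<lambda>x. heat t v x + w t x - frac_heat \<beta> t u0 x)) \<le> exp 1 * E t) (at_right 0)"
    using eventually_at_right_less
  proof eventually_elim
    case (elim t)
    have "(\<lambda>x. heat t v x + w t x - frac_heat \<beta> t u0 x) = w t" using frac_u0[OF elim] by (simp add: fun_eq_iff)
    then show ?case using Lb_expL(2,3)[OF w_E[OF elim] E_pos[OF elim] p] by simp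
  qed
  show "((\<lambda>t. exp 1 * E t) \<longlongrightarrow> 0) (at_right 0)" by (rule tendsto_mult_right_zero[OF E_tendsto])
qed

text \<open>The flow converges by \<open>heat_weak_star\<close>. The correction tends to 0
  uniformly, which is enough because \<phi> is integrable. Borel versions are used throughout and
  exchanged at the end.\<close>

lemma weak_star_limit:
  assumes \<phi>: "\<phi> \<in> L1_lnL p"
  shows "((\<lambda>t. \<integral>x. (heat t v x + w t x) * \<phi> x - u0 x * \<phi> x \<partial>lebesgue) \<longlongrightarrow> 0) (at_right 0)"
proof -
  have "\<phi> \<in> L1_loc" using \<phi> by (simp add: L1_lnL_def)
  from L1_loc_borel_version[OF this] obtain \<psi> where \<psi> [measurable]: "\<psi> \<in> borel_measurable borel" and ae: "AE x in lebesgue. \<phi> x = \<psi> x" .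
  have \<phi>m: "\<phi> \<in> borel_measurable lebesgue" by (rule L1_loc_measurable[OF \<open>\<phi> \<in> L1_loc\<close>])
  have fin: "(\<integral>\<^sup>+x. ennreal (lnL p (\<psi> x)) \<partial>lborel) < \<infinity>"
  proof -
    have "(\<integral>\<^sup>+x. ennreal (lnL p (\<psi> x)) \<partial>lborel) = (\<integral>\<^sup>+x. ennreal (lnL p (\<psi> x)) \<partial>lebesgue)" by (simp add: nn_integral_completion)
    also have "\<dots> = (\<integral>\<^sup>+x. ennreal (lnL p (\<phi> x)) \<partial>lebesgue)"
    proof (rule nn_integral_cong_AE)
      show "AE x in lebesgue. ennreal (lnL p (\<psi> x)) = ennreal (lnL p (\<phi> x))" using ae by eventually_elim simp
    qed
    also have "\<dots> < \<infinity>" using \<phi> by (simp add: L1_lnL_def lnL_def)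
    finally show ?thesis .
  qed
  have p0: "0 < p" using p by simp
  have Lp: "(\<integral>\<^sup>+x. ennreal (\<bar>v x\<bar> powr p) \<partial>lborel) < \<infinity>" using le_less_trans[OF u0_Lp[OF ctx]] by simp
  note W = heat_weak_star[OF v small_consequences(1)[OF sm] mod Lp \<psi> fin]
  have \<psi>i: "integrable lborel \<psi>" by (rule lnL_L1[OF \<psi> p0 fin])
  define I where "I = (\<integral>x. \<bar>\<psi> x\<bar> \<partial>lborel)"
  have wi: "integrable lborel (\<lambda>x. w t x * \<psi> x)" "\<bar>\<integral>x. w t x * \<psi> x \<partial>lborel\<bar> \<le> E t * I" if t: "0 < t" for t
  proof -
    note [measurable] = w_borel[OF t]
    have i: "integrable lborel (\<lambda>x. E t * \<bar>\<psi> x\<bar>)" using \<psi>i by simp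
    have le: "norm (w t x * \<psi> x) \<le> E t * \<bar>\<psi> x\<bar>" for x
      unfolding real_norm_def abs_mult by (rule mult_right_mono[OF LbD(2)[OF w_E[OF t]]]) simp
    show "integrable lborel (\<lambda>x. w t x * \<psi> x)"
      by (rule Bochner_Integration.integrable_bound[OF i]) (auto intro!: AE_I2 order_trans[OF le[unfolded real_norm_def]])
    have "norm (\<integral>x. w t x * \<psi> x \<partial>lborel) \<le> (\<integral>x. E t * \<bar>\<psi> x\<bar> \<partial>lborel)"
      by (rule Bochner_Integration.integral_norm_bound_integral[OF \<open>integrable lborel (\<lambda>x. w t x * \<psi> x)\<close> i le])
    then show "\<bar>\<integral>x. w t x * \<psi> x \<partial>lborel\<bar> \<le> E t * I" by (simp add: I_def)
  qed
  have "((\<lambda>t. \<integral>x. w t x * \<psi> x \<partial>lborel) \<longlongrightarrow> 0) (at_right 0)"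
  proof (rule Lim_null_comparison)
    show "eventually (\<lambda>t. norm (\<integral>x. w t x * \<psi> x \<partial>lborel) \<le> E t * I) (at_right 0)"
      using eventually_at_right_less by eventually_elim (use wi(2) in simp)
    show "((\<lambda>t. E t * I) \<longlongrightarrow> 0) (at_right 0)" by (rule tendsto_mult_left_zero[OF E_tendsto])
  qed
  from tendsto_add[OF W(3) this]
  have lim: "((\<lambda>t. (\<integral>x. heat t v x * \<psi> x \<partial>lborel) - (\<integral>x. v x * \<psi> x \<partial>lborel) + (\<integral>x. w t x * \<psi> x \<partial>lborel)) \<longlongrightarrow> 0) (at_right 0)" by simp
  have "(\<integral>x. heat t v x * \<psi> x \<partial>lborel) - (\<integral>x. v x * \<psi> x \<partial>lborel) + (\<integral>x. w t x * \<psi> x \<partial>lborel)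
      = (\<integral>x. (heat t v x + w t x) * \<phi> x - u0 x * \<phi> x \<partial>lebesgue)" if t: "0 < t" for t
  proof -
    note [measurable] = u_borel[OF t] v
    have m: "(\<lambda>x. (heat t v x + w t x) * \<psi> x - v x * \<psi> x) \<in> borel_measurable lborel" by measurable
    have "(\<integral>x. heat t v x * \<psi> x \<partial>lborel) - (\<integral>x. v x * \<psi> x \<partial>lborel) + (\<integral>x. w t x * \<psi> x \<partial>lborel)
        = (\<integral>x. heat t v x * \<psi> x - v x * \<psi> x + w t x * \<psi> x \<partial>lborel)"
      using W(1)[OF t] W(2) wi(1)[OF t]
      by (simp only: Bochner_Integration.integral_diff Bochner_Integration.integral_add Bochner_Integration.integrable_diff)
    also have "\<dots> = (\<integral>x. (heat t v x + w t x) * \<psi> x - v x * \<psi> x \<partial>lborel)"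
      by (rule Bochner_Integration.integral_cong) (simp_all add: algebra_simps)
    also have "\<dots> = (\<integral>x. (heat t v x + w t x) * \<psi> x - v x * \<psi> x \<partial>lebesgue)" by (rule integral_completion[OF m, symmetric])
    also have "\<dots> = (\<integral>x. (heat t v x + w t x) * \<phi> x - u0 x * \<phi> x \<partial>lebesgue)"
    proof (rule integral_cong_AE)
      show "(\<lambda>x. (heat t v x + w t x) * \<psi> x - v x * \<psi> x) \<in> borel_measurable lebesgue"
        by (rule borel_lebesgue) measurable
      show "(\<lambda>x. (heat t v x + w t x) * \<phi> x - u0 x * \<phi> x) \<in> borel_measurable lebesgue"
        by (intro borel_measurable_diff borel_measurable_times borel_lebesgue[OF u_borel[OF t]] \<phi>m L1_loc_measurable[OF u0])
      show "AE x in lebesgue. (heat t v x + w t x) * \<psi> x - v x * \<psi> x = (heat t v x + w t x) * \<phi> x - u0 x * \<phi> x"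
        using ae uv by eventually_elim simp
    qed
    finally show ?thesis .
  qed
  then have "eventually (\<lambda>t. (\<integral>x. heat t v x * \<psi> x \<partial>lborel) - (\<integral>x. v x * \<psi> x \<partial>lborel) + (\<integral>x. w t x * \<psi> x \<partial>lborel)
      = (\<integral>x. (heat t v x + w t x) * \<phi> x - u0 x * \<phi> x \<partial>lebesgue)) (at_right 0)"
    unfolding eventually_at_filter by (intro always_eventually) simp
  then show ?thesis using lim by (subst (asm) tendsto_cong)
qed

text \<open>The equation holds for every t > 0 and every x, with \<open>w t\<close> as the Bochner
  integral, so the almost-everywhere clauses follow.\<close>

lemma weak_mild: "weak_mild_solution \<beta> p f u0 \<infinity> (\<lambda>t x. heat t v x + w t x)"
  unfolding weak_mild_solution_def
proof (intro conjI ballI)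
  have I: "{t. 0 < t \<and> ereal t < \<infinity>} = {0<..}" by auto
  show "(\<lambda>t x. heat t v x + w t x) \<in> Linf_expL p {t. 0 < t \<and> ereal t < \<infinity>}" unfolding I by (rule u_Linf)
  show "AE t in lebesgue_on {t. 0 < t \<and> ereal t < \<infinity>}.
      (AE s in lebesgue_on {0<..<t}. convolvable (frac_heat_kernel \<beta> (t - s)) (\<lambda>x. f (heat s v x + w s x))) \<and>
      (\<exists>W. has_expL_integral p 0 t (\<lambda>s. frac_heat \<beta> (t - s) (\<lambda>x. f (heat s v x + w s x))) W \<and>
         (AE x in lebesgue. heat t v x + w t x = frac_heat \<beta> t u0 x + W x))"
    unfolding I
  proof (rule AE_I2)
    fix t assume "t \<in> space (lebesgue_on {0::real<..})"
    then have t: "0 < t" by (simp add: space_restrict_space)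
    have "AE s in lebesgue_on {0<..<t}. convolvable (frac_heat_kernel \<beta> (t - s)) (\<lambda>x. f (heat s v x + w s x))"
      by (rule AE_I2) (simp add: space_restrict_space source_convolvable)
    moreover have "AE x in lebesgue. heat t v x + w t x = frac_heat \<beta> t u0 x + w t x"
      by (rule AE_I2) (simp add: frac_u0[OF t])
    ultimately show "(AE s in lebesgue_on {0<..<t}. convolvable (frac_heat_kernel \<beta> (t - s)) (\<lambda>x. f (heat s v x + w s x))) \<and>
      (\<exists>W. has_expL_integral p 0 t (\<lambda>s. frac_heat \<beta> (t - s) (\<lambda>x. f (heat s v x + w s x))) W \<and>
         (AE x in lebesgue. heat t v x + w t x = frac_heat \<beta> t u0 x + W x))"
      using source_integral[OF t] by blast
  qed
qed (rule weak_star_limit)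

end

lemma solution_exists:
  assumes sm: "small a" and u0: "u0 \<in> expL p" "expL_norm p u0 < a"
  obtains u where "weak_mild_solution \<beta> p f u0 \<infinity> u"
    "((\<lambda>t. expL_norm p (\<lambda>x. u t x - frac_heat \<beta> t u0 x)) \<longlongrightarrow> 0) (at_right 0)"
    "\<And>t. 0 < t \<Longrightarrow> adm (K0 * a) t (u t)"
proof -
  have a: "0 < a" by (rule small_consequences(1)[OF sm])
  have p0: "0 < p" using p by simp
  have L: "u0 \<in> L1_loc" using u0(1) by (simp add: expL_def)
  obtain v where v: "v \<in> borel_measurable borel" and uv: "AE x in lebesgue. u0 x = v x" by (rule L1_loc_borel_version[OF L])
  have "(\<integral>\<^sup>+x. ennreal (exp ((\<bar>v x\<bar> / a) powr p) - 1) \<partial>lborel) = exp_modular p a v" by (rule exp_modular_lborel[OF a, symmetric])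
  also have "\<dots> = exp_modular p a u0" unfolding exp_modular_def
  proof (rule nn_integral_cong_AE)
    show "AE x in lebesgue. ennreal (exp (\<bar>v x\<bar> powr p / a powr p) - 1) = ennreal (exp (\<bar>u0 x\<bar> powr p / a powr p) - 1)"
      using uv by eventually_elim simp
  qed
  also have "\<dots> \<le> 1" by (rule exp_modular_le_one[OF u0(1) p0 u0(2)])
  finally have mod: "(\<integral>\<^sup>+x. ennreal (exp ((\<bar>v x\<bar> / a) powr p) - 1) \<partial>lborel) \<le> 1" .
  obtain w where wX: "ballX a w" and wfix: "\<And>t x. 0 < t \<Longrightarrow> w t x = duhamel (src v w) t x"
    by (rule fixed_point[OF v sm mod]) (rule that)
  show ?thesis
  proof (rule that)
    show "weak_mild_solution \<beta> p f u0 \<infinity> (\<lambda>t x. heat t v x + w t x)" by (rule weak_mild[OF L v uv sm mod wX wfix])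
    show "((\<lambda>t. expL_norm p (\<lambda>x. heat t v x + w t x - frac_heat \<beta> t u0 x)) \<longlongrightarrow> 0) (at_right 0)"
      by (rule w_norm_tendsto[OF L v uv sm mod wX wfix])
    show "adm (K0 * a) t (\<lambda>x. heat t v x + w t x)" if "0 < t" for t by (rule u_adm[OF v sm mod wX wfix that])
  qed
qed

text \<open>C is fixed before t and u, so one constant serves all times.\<close>

lemma decay:
  assumes a: "small a" and q: "\<nu> / \<alpha> < q"
  obtains C where "0 < C" "\<And>t u. 0 < t \<Longrightarrow> adm (K0 * a) t u \<Longrightarrow> u \<in> Lq_space q \<and> Lq_norm q u \<le> C * t powr (- (\<alpha> - \<nu> / q))"
proof -
  have b: "0 < K0 * a" by (rule small_consequences(2)[OF a])
  have q0: "0 < q" using less_trans[OF _ q] nu_pos al(1) by simp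
  define D where "D = 2 * (4 * (q / p)) powr (q / p) * (K0 * a) powr q"
  have D: "0 < D" unfolding D_def using b q0 p by (intro mult_pos_pos) auto
  show ?thesis
  proof (rule that)
    show "0 < D powr (1 / q)" using D by simp
    fix t u assume t: "0 < t" and u: "adm (K0 * a) t u"
    have um: "u \<in> borel_measurable borel" using u by (simp add: adm_def)
    define X where "X = D * t powr (- (\<alpha> * q - \<nu>))"
    have X: "0 \<le> X" using D by (simp add: X_def)
    have le: "(\<integral>\<^sup>+x. ennreal (\<bar>u x\<bar> powr q) \<partial>lborel) \<le> ennreal X"
      using adm_Lq[OF b q t u] by (simp only: X_def D_def)
    have "- (\<alpha> * q - \<nu>) * (1 / q) = - (\<alpha> - \<nu> / q)" using q0 by (simp add: field_simps)
    then have "X powr (1 / q) = D powr (1 / q) * t powr (- (\<alpha> - \<nu> / q))"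
      using D by (simp add: X_def powr_mult powr_powr)
    then show "u \<in> Lq_space q \<and> Lq_norm q u \<le> D powr (1 / q) * t powr (- (\<alpha> - \<nu> / q))"
      using Lq_norm_le[OF um q0 X le] by simp
  qed
qed

end

text \<open>In the third case \<beta> > n(p-1)/p means n/\<beta> < p/(p-1), so its lower bound on q
  exceeds that of the other two.\<close>

lemma decay_exponent_gt:
  assumes "decay_exponent n \<beta> p m q" "0 < n" "0 < \<beta>" "1 < p" "1 < m"
  shows "n * (m - 1) / \<beta> < q"
  using assms(1) unfolding decay_exponent_def
proof (elim disjE)
  assume H: "\<beta> > n * (p - 1) / p \<and> pos_part (2 - m) < n * (p - 1) / (p * \<beta>) \<and> (m - 1) * p / (p - 1) < q \<and>
        ereal q < ereal (n * (m - 1) / \<beta>) * (1 / ereal (pos_part (2 - m)))"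
  have "n * (p - 1) < \<beta> * p" using H assms by (simp add: field_simps)
  then have "n / \<beta> < p / (p - 1)" using assms by (simp add: field_simps)
  then have "(m - 1) * (n / \<beta>) < (m - 1) * (p / (p - 1))" using assms by (intro mult_strict_left_mono) auto
  then show ?thesis using H by (simp add: mult.commute)
qed blast+

theorem theorem2:
  fixes \<beta> p m C0 lam :: real and f :: "real \<Rightarrow> real"
  assumes "0 < \<beta>" and "\<beta> < 2"
    and "1 < p" and "p \<le> real CARD('n::finite) * (m - 1) / \<beta>" and "p \<le> m"
    and "f 0 = 0" and "0 < C0" and "0 < lam"
    and "\<And>u v. \<bar>f u - f v\<bar> \<le> C0 * \<bar>u - v\<bar> *
           (\<bar>u\<bar> powr (m - 1) * exp (lam * \<bar>u\<bar> powr p)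
            + \<bar>v\<bar> powr (m - 1) * exp (lam * \<bar>v\<bar> powr p))"
  shows "\<exists>\<epsilon>>0. \<forall>u0 \<in> (expL p :: (real ^ 'n \<Rightarrow> real) set). expL_norm p u0 \<le> \<epsilon> \<longrightarrow>
    (\<exists>u. weak_mild_solution \<beta> p f u0 \<infinity> u \<and>
         ((\<lambda>t. expL_norm p (\<lambda>x. u t x - frac_heat \<beta> t u0 x)) \<longlongrightarrow> 0) (at_right 0) \<and>
         (\<forall>q \<sigma>. decay_exponent (real CARD('n)) \<beta> p m q \<longrightarrow>
            \<sigma> = 1 / (m - 1) - real CARD('n) / (\<beta> * q) \<longrightarrow>
            0 < \<sigma> \<and>
            (\<exists>C>0. \<forall>t>0. u t \<in> Lq_space q \<and> Lq_norm q (u t) \<le> C * t powr (- \<sigma>))))"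
proof -
  note \<beta> = assms(1,2)
  define n where "n = real CARD('n)"
  have n: "0 < n" by (simp add: n_def)
  have m: "1 < m" using assms(3,5) by simp
  \<comment> \<open>Extension by 0 to t <= 0, as the locale speaks about all real times.\<close>
  define S :: "real \<Rightarrow> real ^ 'n \<Rightarrow> real" where "S t x = (if 0 < t then fhk \<beta> t x else 0)" for t x
  define \<nu> where "\<nu> = n / \<beta>"
  define \<alpha> where "\<alpha> = 1 / (m - 1)"
  \<comment> \<open>Above \<nu>, for an integrable time singularity, and above the conjugate
    exponent of p, for Hoelder's inequality.\<close>
  define R where "R = max \<nu> (p / (p - 1)) + 1"
  have \<nu>: "0 < \<nu>" using n \<beta> by (simp add: \<nu>_def)
  have R: "\<nu> < R" "p / (p - 1) < R" by (auto simp: R_def)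
  have pR: "1 / p + 1 / R \<le> 1"
  proof -
    have "0 < p / (p - 1)" using assms(3) by simp
    then have "1 / R \<le> 1 / (p / (p - 1))" using R(2) by (intro divide_left_mono mult_pos_pos) auto
    also have "\<dots> = 1 - 1 / p" using assms(3) by (simp add: field_simps)
    finally show ?thesis by simp
  qed
  have al: "\<alpha> \<le> \<nu> / p" using assms(3,4) m \<beta> by (simp add: \<alpha>_def \<nu>_def n_def field_simps)
  obtain c where c: "0 < c" "\<And>x::real^'n. \<bar>fhk \<beta> 1 x\<bar> \<le> c" by (rule fhk_bounded[OF \<beta>(1)]) (rule that)
  have Sc: "S t x \<le> c * t powr (- \<nu>)" if "0 < t" for t x
  proof -
    have "S t x = t powr (- \<nu>) * fhk \<beta> 1 (t powr (- (1 / \<beta>)) *\<^sub>R x)"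
      using that fhk_scale[OF that \<beta>(1), of x] by (simp add: S_def \<nu>_def n_def)
    also have "\<dots> \<le> t powr (- \<nu>) * c" by (intro mult_left_mono order_trans[OF abs_ge_self c(2)]) simp
    finally show ?thesis by (simp add: mult.commute)
  qed
  interpret fractional_nonlinear_heat S c \<nu> p R \<alpha> m C0 lam f \<beta>
  proof
    show "(\<lambda>(t, x). S t x) \<in> borel_measurable (borel \<Otimes>\<^sub>M borel)"
      unfolding S_def by (rule fhk_jointly_measurable[OF \<beta>(1)])
    show "0 \<le> S t x" for t x using fhk_pos_time_nonneg[OF \<beta>, of t x] by (auto simp: S_def)
    show "(\<integral>\<^sup>+x. ennreal (S t x) \<partial>lborel) = 1" if "0 < t" for t using nn_integral_fhk[OF \<beta> that] that by (simp add: S_def)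
    show "\<exists>d>0. \<forall>t t'. 0 < t \<longrightarrow> 0 < t' \<longrightarrow> \<bar>t' / t - 1\<bar> < d \<longrightarrow> (\<integral>\<^sup>+x. ennreal \<bar>S t' x - S t x\<bar> \<partial>lborel) \<le> ennreal e" if "0 < e" for e
      using fhk_L1_continuity[OF \<beta> that, where 'a="real^'n"] by (simp add: S_def cong: conj_cong imp_cong)
    show "((\<lambda>t. \<integral>y. S t y * \<Psi> y \<partial>lborel) \<longlongrightarrow> \<Psi> 0) (at_right 0)"
      if "\<Psi> \<in> borel_measurable borel" "\<And>y. \<bar>\<Psi> y\<bar> \<le> B" "isCont \<Psi> 0" for \<Psi> B
    proof (rule Lim_transform_eventually[OF fhk_approx_identity[OF \<beta> that]])
      show "eventually (\<lambda>t. (\<integral>y. fhk \<beta> t y * \<Psi> y \<partial>lborel) = (\<integral>y. S t y * \<Psi> y \<partial>lborel)) (at_right 0)"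
        using eventually_at_right_less by eventually_elim (simp add: S_def)
    qed
    show "S t x = frac_heat_kernel \<beta> t x" if "0 < t" for t x
      using frac_heat_kernel_eq_fhk[OF that \<beta>(1), of x] that by (simp add: S_def)
  qed (use Sc c(1) \<nu> assms m R(1) pR al in \<open>auto simp: \<alpha>_def\<close>)
  obtain a where a: "small a" using small_ex by blast
  have a0: "0 < a" by (rule small_consequences(1)[OF a])
  show ?thesis
  proof (intro exI[of _ "a / 2"] conjI ballI impI)
    show "0 < a / 2" using a0 by simp
    fix u0 :: "real ^ 'n \<Rightarrow> real" assume u0: "u0 \<in> expL p" "expL_norm p u0 \<le> a / 2"
    \<comment> \<open>Taking a/2 as threshold supplies the strict inequality that
      \<open>exp_modular_le_one\<close> relies on.\<close>
    then have "expL_norm p u0 < a" using a0 by simp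
    then obtain u where u: "weak_mild_solution \<beta> p f u0 \<infinity> u"
      "((\<lambda>t. expL_norm p (\<lambda>x. u t x - frac_heat \<beta> t u0 x)) \<longlongrightarrow> 0) (at_right 0)"
      "\<And>t. 0 < t \<Longrightarrow> adm (K0 * a) t (u t)"
      by (rule solution_exists[OF a u0(1)]) (rule that)
    have "0 < \<sigma> \<and> (\<exists>C>0. \<forall>t>0. u t \<in> Lq_space q \<and> Lq_norm q (u t) \<le> C * t powr (- \<sigma>))"
      if q: "decay_exponent (real CARD('n)) \<beta> p m q" and \<sigma>: "\<sigma> = 1 / (m - 1) - real CARD('n) / (\<beta> * q)" for q \<sigma>
    proof
      have gt: "n * (m - 1) / \<beta> < q" by (rule decay_exponent_gt[OF q[folded n_def] n \<beta>(1) assms(3) m])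
      have "0 < n * (m - 1) / \<beta>" using n m \<beta> by simp
      with gt have q0: "0 < q" by linarith
      have \<sigma>': "\<sigma> = \<alpha> - \<nu> / q" using \<sigma> by (simp add: \<alpha>_def \<nu>_def n_def)
      show "0 < \<sigma>" using gt q0 m \<beta> by (simp add: \<sigma>' \<alpha>_def \<nu>_def field_simps)
      have "\<nu> / \<alpha> < q" using gt by (simp add: \<alpha>_def \<nu>_def)
      then obtain C where "0 < C" "\<And>t u. 0 < t \<Longrightarrow> adm (K0 * a) t u \<Longrightarrow> u \<in> Lq_space q \<and> Lq_norm q u \<le> C * t powr (- (\<alpha> - \<nu> / q))"
        by (rule decay[OF a]) (rule that)
      then show "\<exists>C>0. \<forall>t>0. u t \<in> Lq_space q \<and> Lq_norm q (u t) \<le> C * t powr (- \<sigma>)" using u(3) unfolding \<sigma>' by blast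
    qed
    with u(1,2) show "\<exists>u. weak_mild_solution \<beta> p f u0 \<infinity> u \<and>
         ((\<lambda>t. expL_norm p (\<lambda>x. u t x - frac_heat \<beta> t u0 x)) \<longlongrightarrow> 0) (at_right 0) \<and>
         (\<forall>q \<sigma>. decay_exponent (real CARD('n)) \<beta> p m q \<longrightarrow>
            \<sigma> = 1 / (m - 1) - real CARD('n) / (\<beta> * q) \<longrightarrow>
            0 < \<sigma> \<and>
            (\<exists>C>0. \<forall>t>0. u t \<in> Lq_space q \<and> Lq_norm q (u t) \<le> C * t powr (- \<sigma>)))" by blast
  qed
qed

end
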